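(* Let $d,\alpha\in\mathbb{N}$ and let $f:\mathbb{R}^d\to\mathbb{R}$ be such that its restriction to every box $[\boldsymbol a,\boldsymbol b]\subset\mathbb{R}^d$ belongs to $\mathcal{H}(K^{\mathrm{Sob},[\boldsymbol a,\boldsymbol b]}_{\alpha,d})$ and $\|f\|_{K^{\mathrm{Sob},*}_{\alpha,d}}<\infty$. For each $n$ let $\Lambda(\boldsymbol z,n)$, $\boldsymbol z=\boldsymbol z^{(n)}$, be a good $n$-point lattice rule for the unit cube $[0,1]^d$, with nodes scaled to the box as $\boldsymbol p_i^{[\boldsymbol a,\boldsymbol b]}$. (i) If additionally $f$ satisfies the exponential decay condition $$\|f\|_{\alpha,\beta,p,q}:=\sup_{\boldsymbol x\in\mathbb{R}^d,\ \boldsymbol\tau\in\{0,\ldots,\alpha-1\}^d}\left|\exp(\beta\|\boldsymbol x\|_p^q)\,f^{(\boldsymbol\tau)}(\boldsymbol x)\right|<\infty$$ for some $\beta>0$, $1\le p\le\infty$ and $1\le q<\infty$, then, choosing the box $[\boldsymbol a,\boldsymbol b]=[-a,a]^d$ with $$a=\left(\log(n^{\alpha/\beta})\right)^{1/q},$$ the total error for all $n$ large enough is bounded by $$\left|\int_{\mathbb{R}^d}f(\boldsymbol x)\,\mathrm{d}\boldsymbol x-\frac{\prod_{j=1}^d(b_j-a_j)}{n}\sum_{i=1}^n f(\boldsymbol p_i^{[\boldsymbol a,\boldsymbol b]})\right|\le C\left(\|f\|_{K^{\mathrm{Sob},*}_{\alpha,d}}+\|f\|_{\alpha,\beta,p,q}\right)\frac{(\log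 n)^{\alpha d+(\alpha+1/2)\,d/q}}{n^\alpha},$$ where the constant $C$ is independent of $n$ and $f$ but depends on $\alpha,\beta,q$ and $d$. (ii) If additionally $f$ satisfies the polynomial decay condition $$\|f\|_{\alpha,\beta,p}:=\sup_{\boldsymbol x\in\mathbb{R}^d,\ \boldsymbol\tau\in\{0,\ldots,\alpha-1\}^d}\left|\|\boldsymbol x\|_p^{\beta}\,f^{(\boldsymbol\tau)}(\boldsymbol x)\right|<\infty$$ for some $\beta>d\max\{\alpha-1,1\}$ and $1\le p\le\infty$, then, choosing the box $[\boldsymbol a,\boldsymbol b]=[-a,a]^d$ with $$a=n^{\alpha/(\beta+td/2)},\qquad t=3\text{ for }\alpha\ge2,\quad t=1\text{ for }\alpha=1,$$ the total error for all $n$ large enough is bounded by $$\left|\int_{\mathbb{R}^d}f(\boldsymbol x)\,\mathrm{d}\boldsymbol x-\frac{\prod_{j=1}^d(b_j-a_j)}{n}\sum_{i=1}^n f(\boldsymbol p_i^{[\boldsymbol a,\boldsymbol b]})\right|\le C\left(\|f\|_{K^{\mathrm{Sob},*}_{\alpha,d}}+\|f\|_{\alpha,\beta,p}\right)n^{-\alpha+\frac{\alpha(1+2\alpha)}{t+2\beta/d}}(\log n)^{\alpha d},$$ where the constant $C$ is independent of $n$ and $f$ but depends on $\alpha,\beta$ and $d$.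
   Context: Notation: $f^{(\boldsymbol\tau)}=\partial^{\tau_1+\cdots+\tau_d}f/\partial x_1^{\tau_1}\cdots\partial x_d^{\tau_d}$. A box is $[\boldsymbol a,\boldsymbol b]=\prod_{j=1}^d[a_j,b_j]$ with $-\infty<a_j<b_j<\infty$. For $\mathfrak w\subseteq\{1,\ldots,d\}$, $-\mathfrak w$ is its complement, $\boldsymbol x_{\mathfrak w}=(x_j)_{j\in\mathfrak w}$ and $[\boldsymbol a_{\mathfrak w},\boldsymbol b_{\mathfrak w}]=\prod_{j\in\mathfrak w}[a_j,b_j]$; an integral over an empty set of variables is the identity operation. Sobolev space: $\mathcal{H}(K^{\mathrm{Sob},[\boldsymbol a,\boldsymbol b]}_{\alpha,d})$ is the unanchored Sobolev space of dominating mixed smoothness $\alpha$, i.e. the $d$-fold Hilbert tensor product of the one-dimensional spaces of real functions on $[a_j,b_j]$ whose derivatives of order $0,\ldots,\alpha-1$ are absolutely continuous and whose $\alpha$-th derivative is in $L_2([a_j,b_j])$, with norm $$\|f\|_{K^{\mathrm{Sob},[\boldsymbol a,\boldsymbol b]}_{\alpha,d}}^2=\sum_{\boldsymbol\tau\in\{0,\ldots,\alpha\}^d,\ \mathfrak w:=\{j:\tau_j=\alpha\}}\int_{[\boldsymbol a_{\mathfrak w},\boldsymbol b_{\mathfrak w}]}\left(\int_{[\boldsymbol a_{-\mathfrak w},\boldsymbol b_{-\mathfrak w}]}f^{(\boldsymbol\tau)}(\boldsymbol x)\,\mathrm{d}\boldsymbol x_{-\mathfrak w}\right)^2\mathrm{d}\boldsymbol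 x_{\mathfrak w}.$$ Further, $\|f\|_{K^{\mathrm{Sob},*}_{\alpha,d}}:=\sup_{[\boldsymbol a,\boldsymbol b]\subset\mathbb{R}^d}\|f\|_{K^{\mathrm{Sob},[\boldsymbol a,\boldsymbol b]}_{\alpha,d}}$. Lattice rule: for $n\in\mathbb{N}$ and $\boldsymbol z\in\mathbb{Z}_n^d$, $\mathbb{Z}_n=\{0,\ldots,n-1\}$, the $n$-point lattice point set is $\Lambda(\boldsymbol z,n)=\{\boldsymbol p_i=(i\boldsymbol z/n)\bmod 1\}_{i=1}^n\subset[0,1]^d$ (mod 1 componentwise) and the scaled nodes are $p^{[\boldsymbol a,\boldsymbol b]}_{i,j}=(b_j-a_j)p_{i,j}+a_j$. Its dual is $\Lambda^\perp(\boldsymbol z,n)=\{\boldsymbol h\in\mathbb{Z}^d:\boldsymbol h\cdot\boldsymbol z\equiv0\pmod n\}$. Let $r_{\alpha,d}(\boldsymbol h)=\prod_{j=1}^d r_\alpha(h_j)$ with $r_\alpha(0)=1$ and $r_\alpha(h)=|2\pi h|^\alpha$ for $h\ne0$. The lattice rule is called good if $$\left(\sum_{\boldsymbol 0\ne\boldsymbol h\in\Lambda^\perp(\boldsymbol z,n)}[r_{\alpha,d}(\boldsymbol h)]^{-2}\right)^{1/2}\le C_{\alpha,d}\frac{(\log n)^{\alpha d}}{n^\alpha}$$ with a fixed constant $C_{\alpha,d}$ depending only on $\alpha$ and $d$ (such lattice rules exist for every $n\ge2$ for a suitable $C_{\alpha,d}$). *)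

theory Defs
  imports "HOL-Analysis.Analysis"
begin

section \<open>Classical mixed partial derivatives\<close>

definition partial_deriv :: "'d::finite \<Rightarrow> (real^'d \<Rightarrow> real) \<Rightarrow> real^'d \<Rightarrow> real" where
  "partial_deriv j f x = deriv (\<lambda>t. f (x + t *\<^sub>R axis j 1)) 0"

text \<open>
  The mixed partial derivative of multi-index \<open>\<tau>\<close>. The index type carries no order, so an arbitrary
  but fixed order of differentiation is chosen. Wherever this constant is used below (test functions,
  and orders \<open>\<tau> j < \<alpha>\<close> for functions of mixed smoothness \<open>\<alpha>\<close>) all the intermediate
  derivatives exist and are continuous, so that the order is irrelevant.
\<close>

definition mixed_partial :: "('d::finite \<Rightarrow> nat) \<Rightarrow> (real^'d \<Rightarrow> real) \<Rightarrow> real^'d \<Rightarrow> real" where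
  "mixed_partial \<tau> f = foldr partial_deriv (SOME js. \<forall>j. count_list js j = \<tau> j) f"


section \<open>Weak mixed derivatives in L2 of a box\<close>

definition smooth :: "(real^'d::finite \<Rightarrow> real) \<Rightarrow> bool" where
  "smooth \<phi> \<longleftrightarrow> (\<forall>js x. foldr partial_deriv js \<phi> differentiable (at x))"

definition test_functions :: "(real^'d::finite) set \<Rightarrow> (real^'d \<Rightarrow> real) set" where
  "test_functions S = {\<phi>. smooth \<phi> \<and> (\<exists>K. compact K \<and> K \<subseteq> S \<and> (\<forall>x. x \<notin> K \<longrightarrow> \<phi> x = 0))}"

definition has_weak_deriv ::
    "('d::finite \<Rightarrow> nat) \<Rightarrow> real^'d \<Rightarrow> real^'d \<Rightarrow> (real^'d \<Rightarrow> real) \<Rightarrow> (real^'d \<Rightarrow> real) \<Rightarrow> bool" where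
  "has_weak_deriv \<tau> a b f h \<longleftrightarrow>
     h \<in> borel_measurable borel \<and> set_integrable lborel (cbox a b) (\<lambda>x. (h x)\<^sup>2) \<and>
     (\<forall>\<phi>\<in>test_functions (box a b).
        (LINT x:cbox a b|lborel. f x * mixed_partial \<tau> \<phi> x) =
          (- 1) ^ (\<Sum>j\<in>UNIV. \<tau> j) * (LINT x:cbox a b|lborel. h x * \<phi> x))"

text \<open>Determined up to a null set of the box; only integrals of it are used.\<close>

definition weak_deriv ::
    "('d::finite \<Rightarrow> nat) \<Rightarrow> real^'d \<Rightarrow> real^'d \<Rightarrow> (real^'d \<Rightarrow> real) \<Rightarrow> real^'d \<Rightarrow> real" where
  "weak_deriv \<tau> a b f = (SOME h. has_weak_deriv \<tau> a b f h)"


section \<open>The unanchored Sobolev space of dominating mixed smoothness\<close>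

definition abs_continuous_on :: "real \<Rightarrow> real \<Rightarrow> (real \<Rightarrow> real) \<Rightarrow> bool" where
  "abs_continuous_on l r g \<longleftrightarrow>
     (\<forall>\<epsilon>>0. \<exists>\<delta>>0. \<forall>(m::nat) u v.
        (\<forall>i<m. l \<le> u i \<and> u i \<le> v i \<and> v i \<le> r) \<and>
        disjoint_family_on (\<lambda>i. {u i<..<v i}) {..<m} \<and>
        (\<Sum>i<m. v i - u i) < \<delta> \<longrightarrow> (\<Sum>i<m. \<bar>g (v i) - g (u i)\<bar>) < \<epsilon>)"

text \<open>\<open>D k\<close> is the derivative of order \<open>k\<close>; the one of order \<open>\<alpha>\<close> exists almost everywhere only.\<close>

definition sobolev_1d :: "nat \<Rightarrow> real \<Rightarrow> real \<Rightarrow> (real \<Rightarrow> real) set" where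
  "sobolev_1d \<alpha> l r = {g. \<exists>D :: nat \<Rightarrow> real \<Rightarrow> real.
     (\<forall>x\<in>{l..r}. D 0 x = g x) \<and>
     (\<forall>k<\<alpha>. abs_continuous_on l r (D k)) \<and>
     (\<forall>k. Suc k < \<alpha> \<longrightarrow>
        (\<forall>x\<in>{l..r}. (D k has_real_derivative D (Suc k) x) (at x within {l..r}))) \<and>
     (\<forall>k. Suc k = \<alpha> \<longrightarrow>
        (AE x\<in>{l..r} in lborel. (D k has_real_derivative D (Suc k) x) (at x within {l..r}))) \<and>
     D \<alpha> \<in> borel_measurable borel \<and> set_integrable lborel {l..r} (\<lambda>x. (D \<alpha> x)\<^sup>2)}"

definition algebraic_tensors :: "nat \<Rightarrow> real^'d::finite \<Rightarrow> real^'d \<Rightarrow> (real^'d \<Rightarrow> real) set" where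
  "algebraic_tensors \<alpha> a b = {g. \<exists>(m::nat) (u :: nat \<Rightarrow> 'd \<Rightarrow> real \<Rightarrow> real).
     (\<forall>i<m. \<forall>j. u i j \<in> sobolev_1d \<alpha> (a $ j) (b $ j)) \<and>
     g = (\<lambda>x. \<Sum>i<m. \<Prod>j\<in>UNIV. u i j (x $ j))}"

text \<open>The outer integral is over the coordinates in \<open>w\<close>, the inner one over the remaining ones.
  For an empty set of coordinates the product measure is a unit point mass.\<close>

definition sobolev_norm :: "nat \<Rightarrow> real^'d::finite \<Rightarrow> real^'d \<Rightarrow> (real^'d \<Rightarrow> real) \<Rightarrow> real" where
  "sobolev_norm \<alpha> a b f = sqrt (\<Sum>\<tau> | \<forall>j. \<tau> j \<le> \<alpha>.
     let w = {j. \<tau> j = \<alpha>} in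
       (LINT y:(\<Pi>\<^sub>E j\<in>w. {a $ j..b $ j})|(\<Pi>\<^sub>M j\<in>w. lborel).
         (LINT x:(\<Pi>\<^sub>E j\<in>- w. {a $ j..b $ j})|(\<Pi>\<^sub>M j\<in>- w. lborel).
            weak_deriv \<tau> a b f (\<chi> j. if j \<in> w then y j else x j))\<^sup>2))"

text \<open>
  The Hilbert tensor product, i.e. the completion of the algebraic tensor product in the above norm,
  which is the cross norm on elementary tensors. As point evaluations are bounded for this norm, the
  completion is realised as the space of pointwise limits of Cauchy sequences. Only the values of a
  function on the box \<open>cbox a b\<close> matter, so membership of \<open>f\<close> is membership of its restriction.
\<close>

definition sobolev_space :: "nat \<Rightarrow> real^'d::finite \<Rightarrow> real^'d \<Rightarrow> (real^'d \<Rightarrow> real) set" where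
  "sobolev_space \<alpha> a b = {f. \<exists>g :: nat \<Rightarrow> real^'d \<Rightarrow> real.
     (\<forall>k. g k \<in> algebraic_tensors \<alpha> a b) \<and>
     (\<forall>\<epsilon>>0. \<exists>M. \<forall>k\<ge>M. \<forall>l\<ge>M. sobolev_norm \<alpha> a b (\<lambda>x. g k x - g l x) < \<epsilon>) \<and>
     (\<forall>x\<in>cbox a b. (\<lambda>k. g k x) \<longlonglongrightarrow> f x)}"

definition boxes :: "((real^'d::finite) \<times> (real^'d)) set" where
  "boxes = {(a, b). \<forall>j. a $ j < b $ j}"

definition sobolev_norm_star :: "nat \<Rightarrow> (real^'d::finite \<Rightarrow> real) \<Rightarrow> ennreal" where
  "sobolev_norm_star \<alpha> f = (SUP (a, b)\<in>boxes. ennreal (sobolev_norm \<alpha> a b f))"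


section \<open>Decay conditions\<close>

definition lp_norm :: "ereal \<Rightarrow> real^'d::finite \<Rightarrow> real" where
  "lp_norm p x =
     (if p = \<infinity> then infnorm x
      else (\<Sum>j\<in>UNIV. \<bar>x $ j\<bar> powr real_of_ereal p) powr (1 / real_of_ereal p))"

definition exp_decay_norm ::
    "nat \<Rightarrow> real \<Rightarrow> ereal \<Rightarrow> real \<Rightarrow> (real^'d::finite \<Rightarrow> real) \<Rightarrow> ennreal" where
  "exp_decay_norm \<alpha> \<beta> p q f = (SUP x. SUP \<tau>\<in>{\<tau>. \<forall>j. \<tau> j < \<alpha>}.
     ennreal \<bar>exp (\<beta> * lp_norm p x powr q) * mixed_partial \<tau> f x\<bar>)"

definition poly_decay_norm ::
    "nat \<Rightarrow> real \<Rightarrow> ereal \<Rightarrow> (real^'d::finite \<Rightarrow> real) \<Rightarrow> ennreal" where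
  "poly_decay_norm \<alpha> \<beta> p f = (SUP x. SUP \<tau>\<in>{\<tau>. \<forall>j. \<tau> j < \<alpha>}.
     ennreal \<bar>lp_norm p x powr \<beta> * mixed_partial \<tau> f x\<bar>)"


section \<open>Lattice rules\<close>

definition scaled_node ::
    "int^'d::finite \<Rightarrow> nat \<Rightarrow> real^'d \<Rightarrow> real^'d \<Rightarrow> nat \<Rightarrow> real^'d" where
  "scaled_node z n a b i =
     (\<chi> j. (b $ j - a $ j) * frac (real i * real_of_int (z $ j) / real n) + a $ j)"

definition scaled_lattice_rule ::
    "int^'d::finite \<Rightarrow> nat \<Rightarrow> real^'d \<Rightarrow> real^'d \<Rightarrow> (real^'d \<Rightarrow> real) \<Rightarrow> real" where
  "scaled_lattice_rule z n a b f =
     (\<Prod>j\<in>UNIV. b $ j - a $ j) / real n * (\<Sum>i=1..n. f (scaled_node z n a b i))"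

definition generating_vectors :: "nat \<Rightarrow> (int^'d::finite) set" where
  "generating_vectors n = {z. \<forall>j. z $ j \<in> {0..<int n}}"

definition dual_lattice :: "int^'d::finite \<Rightarrow> nat \<Rightarrow> (int^'d) set" where
  "dual_lattice z n = {h. int n dvd (\<Sum>j\<in>UNIV. h $ j * z $ j)}"

definition r_weight :: "nat \<Rightarrow> int \<Rightarrow> real" where
  "r_weight \<alpha> h = (if h = 0 then 1 else \<bar>2 * pi * real_of_int h\<bar> ^ \<alpha>)"

definition r_weight_prod :: "nat \<Rightarrow> int^'d::finite \<Rightarrow> real" where
  "r_weight_prod \<alpha> h = (\<Prod>j\<in>UNIV. r_weight \<alpha> (h $ j))"

text \<open>The sum converges for every \<open>\<alpha> \<ge> 1\<close>, being dominated by the product of \<open>d\<close> convergent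
  one-dimensional sums, so the default value of \<open>infsum\<close> plays no role.\<close>

definition good_lattice_rule :: "nat \<Rightarrow> real \<Rightarrow> int^'d::finite \<Rightarrow> nat \<Rightarrow> bool" where
  "good_lattice_rule \<alpha> c z n \<longleftrightarrow>
     sqrt (\<Sum>\<^sub>\<infinity>h\<in>dual_lattice z n - {0}. 1 / (r_weight_prod \<alpha> h)\<^sup>2)
       \<le> c * ln (real n) ^ (\<alpha> * CARD('d)) / real n ^ \<alpha>"

end

theory Submission
  imports Defs
begin

text \<open>A smooth cutoff that is 1 on the cube \<open>[-a, a]^d\<close> and vanishes outside \<open>[-3a, 3a]^d\<close> splits \<open>f\<close> into
  two parts. The periodisation of the first part with period \<open>2a\<close> has the same integral over a period, and its
  lattice rule error is a sum of its Fourier coefficients over the dual lattice. By Cauchy and Schwarz, the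
  quality criterion and Bessel's inequality, applied to its mixed derivatives of order \<open>\<alpha>\<close> or 0 in each
  variable, this error is controlled by the \<open>L\<^sub>2\<close> norms of the mixed derivatives on \<open>[-3a, 3a]^d\<close>, and these
  by the Sobolev norm through a Poincare inequality whose constant depends on \<open>a\<close> only through a power. The part
  cut off and the values brought into the cube by periodising lie outside the cube and are bounded by the decay
  of \<open>f\<close>. Norm bounds are proved for finite sums of tensor products and pass to the limit, so no regularity of
  \<open>f\<close> beyond its pointwise approximation is used.\<close>

section \<open>Absolutely continuous functions\<close>

text \<open>A direct Fourier analysis of f on the cube fails because f need not match across
  opposite faces, so its coefficients would not decay like the inverse of
  \<open>r_weight_prod\<close>. A cutoff on a scale proportional to a yields a periodised function
  as smooth as f, while derivatives of the cutoff stay bounded after rescaling. Two features of the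
  definitions shape the rest. The Sobolev norm integrates out every variable whose derivative has
  order below \<alpha> before squaring, so it controls L2 norms only after a Poincare inequality.
  Its derivatives are arbitrarily chosen weak ones, which are reached only through uniqueness and
  through tensors whose derivatives are explicit. The exponent (\<alpha> + 1/2) d of a is half of 2
  \<alpha> d from the Poincare inequality plus d from the volume in Bessel's inequality. In both
  parts a is such that the contributions from outside the cube, together with their volume factors,
  stay below this main term.\<close>

lemma abs_continuous_on_subset:
  assumes "abs_continuous_on l r g" "l \<le> s" "t \<le> r"
  shows "abs_continuous_on s t g"
  unfolding abs_continuous_on_def
proof (intro allI impI)
  fix \<epsilon> :: real assume "\<epsilon> > 0"
  then obtain \<delta> where d: "\<delta> > 0" and H: "\<And>(m::nat) u v.
        (\<forall>i<m. l \<le> u i \<and> u i \<le> v i \<and> v i \<le> r) \<Longrightarrow>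
        disjoint_family_on (\<lambda>i. {u i<..<v i}) {..<m} \<Longrightarrow>
        (\<Sum>i<m. v i - u i) < \<delta> \<Longrightarrow> (\<Sum>i<m. \<bar>g (v i) - g (u i)\<bar>) < \<epsilon>"
    using assms(1) unfolding abs_continuous_on_def by meson
  show "\<exists>\<delta>>0. \<forall>(m::nat) u v. (\<forall>i<m. s \<le> u i \<and> u i \<le> v i \<and> v i \<le> t) \<and>
        disjoint_family_on (\<lambda>i. {u i<..<v i}) {..<m} \<and> (\<Sum>i<m. v i - u i) < \<delta> \<longrightarrow>
        (\<Sum>i<m. \<bar>g (v i) - g (u i)\<bar>) < \<epsilon>"
  proof (intro exI[of _ \<delta>] conjI allI impI d)
    fix m :: nat and u v :: "nat \<Rightarrow> real"
    assume A: "(\<forall>i<m. s \<le> u i \<and> u i \<le> v i \<and> v i \<le> t) \<and>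
        disjoint_family_on (\<lambda>i. {u i<..<v i}) {..<m} \<and> (\<Sum>i<m. v i - u i) < \<delta>"
    show "(\<Sum>i<m. \<bar>g (v i) - g (u i)\<bar>) < \<epsilon>"
    proof (rule H)
      show "\<forall>i<m. l \<le> u i \<and> u i \<le> v i \<and> v i \<le> r"
        using A assms(2,3) by (metis order_trans)
    qed (use A in auto)
  qed
qed

text \<open>The definition numbers its intervals by an initial segment of the naturals. The gauge
  argument below produces intervals indexed by a finite set of tagged pieces, so the condition is
  transported along an enumeration of such a set.\<close>

lemma abs_continuous_on_finite_family:
  assumes "abs_continuous_on l r g" "\<epsilon> > 0"
  obtains \<delta> where "\<delta> > 0"
    "\<And>(I :: 'i set) u v. finite I \<Longrightarrow> (\<And>i. i \<in> I \<Longrightarrow> l \<le> u i \<and> u i \<le> v i \<and> v i \<le> r) \<Longrightarrow>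
        disjoint_family_on (\<lambda>i. {u i<..<v i}) I \<Longrightarrow>
        (\<Sum>i\<in>I. v i - u i) < \<delta> \<Longrightarrow> (\<Sum>i\<in>I. \<bar>g (v i) - g (u i)\<bar>) < \<epsilon>"
proof -
  obtain \<delta> where d: "\<delta> > 0" and H: "\<And>(m::nat) u v.
        (\<forall>i<m. l \<le> u i \<and> u i \<le> v i \<and> v i \<le> r) \<Longrightarrow>
        disjoint_family_on (\<lambda>i. {u i<..<v i}) {..<m} \<Longrightarrow>
        (\<Sum>i<m. v i - u i) < \<delta> \<Longrightarrow> (\<Sum>i<m. \<bar>g (v i) - g (u i)\<bar>) < \<epsilon>"
    using assms unfolding abs_continuous_on_def by meson
  show ?thesis
  proof (rule that[OF d])
    fix I :: "'i set" and u v :: "'i \<Rightarrow> real"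
    assume fin: "finite I" and uv: "\<And>i. i \<in> I \<Longrightarrow> l \<le> u i \<and> u i \<le> v i \<and> v i \<le> r"
      and dis: "disjoint_family_on (\<lambda>i. {u i<..<v i}) I" and s: "(\<Sum>i\<in>I. v i - u i) < \<delta>"
    obtain h where h: "bij_betw h {..<card I} I"
      using ex_bij_betw_nat_finite[OF fin] by (auto simp: atLeast0LessThan)
    have hI: "h i \<in> I" if "i < card I" for i
      using h that by (auto simp: bij_betw_def)
    have "(\<Sum>i<card I. \<bar>g ((v \<circ> h) i) - g ((u \<circ> h) i)\<bar>) < \<epsilon>"
    proof (rule H)
      show "\<forall>i<card I. l \<le> (u \<circ> h) i \<and> (u \<circ> h) i \<le> (v \<circ> h) i \<and> (v \<circ> h) i \<le> r"
        using uv hI by auto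
      show "disjoint_family_on (\<lambda>i. {(u \<circ> h) i<..<(v \<circ> h) i}) {..<card I}"
        unfolding disjoint_family_on_def
      proof (intro ballI impI)
        fix i j assume ij: "i \<in> {..<card I}" "j \<in> {..<card I}" "i \<noteq> j"
        then have "h i \<noteq> h j" using h by (auto simp: bij_betw_def inj_on_def)
        then show "{(u \<circ> h) i<..<(v \<circ> h) i} \<inter> {(u \<circ> h) j<..<(v \<circ> h) j} = {}"
          using dis hI ij unfolding disjoint_family_on_def by auto
      qed
      show "(\<Sum>i<card I. (v \<circ> h) i - (u \<circ> h) i) < \<delta>"
        using s sum.reindex_bij_betw[OF h, of "\<lambda>i. v i - u i"] by simp
    qed
    then show "(\<Sum>i\<in>I. \<bar>g (v i) - g (u i)\<bar>) < \<epsilon>"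
      using sum.reindex_bij_betw[OF h, of "\<lambda>i. \<bar>g (v i) - g (u i)\<bar>"] by simp
  qed
qed

lemma abs_continuous_on_continuous:
  assumes "abs_continuous_on l r g"
  shows "continuous_on {l..r} g"
  unfolding continuous_on_iff dist_real_def
proof (intro ballI allI impI)
  fix x \<epsilon> :: real assume x: "x \<in> {l..r}" and e: "\<epsilon> > 0"
  obtain \<delta> where d: "\<delta> > 0" and H: "\<And>(I :: unit set) u v. finite I \<Longrightarrow> (\<And>i. i \<in> I \<Longrightarrow> l \<le> u i \<and> u i \<le> v i \<and> v i \<le> r) \<Longrightarrow>
        disjoint_family_on (\<lambda>i. {u i<..<v i}) I \<Longrightarrow>
        (\<Sum>i\<in>I. v i - u i) < \<delta> \<Longrightarrow> (\<Sum>i\<in>I. \<bar>g (v i) - g (u i)\<bar>) < \<epsilon>"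
    by (rule abs_continuous_on_finite_family[OF assms e]) blast
  show "\<exists>d>0. \<forall>x'\<in>{l..r}. \<bar>x' - x\<bar> < d \<longrightarrow> \<bar>g x' - g x\<bar> < \<epsilon>"
  proof (intro exI[of _ \<delta>] conjI ballI impI d)
    fix y assume y: "y \<in> {l..r}" "\<bar>y - x\<bar> < \<delta>"
    show "\<bar>g y - g x\<bar> < \<epsilon>"
      using H[of "{()}" "\<lambda>_. min x y" "\<lambda>_. max x y"] x y
      by (cases "x \<le> y") (auto simp: disjoint_family_on_def min_def max_def abs_if split: if_splits)
  qed
qed

text \<open>A common source for the closure properties below: increments of sums, products and C1
  functions are bounded by a multiple of increments of functions already known to be absolutely
  continuous.\<close>

lemma abs_continuous_on_dominated:
  assumes g: "abs_continuous_on l r g" and h: "abs_continuous_on l r h" and B: "B \<ge> 0"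
    and dom: "\<And>x y. x \<in> {l..r} \<Longrightarrow> y \<in> {l..r} \<Longrightarrow>
       \<bar>f y - f x\<bar> \<le> B * (\<bar>g y - g x\<bar> + \<bar>h y - h x\<bar>)"
  shows "abs_continuous_on l r f"
  unfolding abs_continuous_on_def
proof (intro allI impI)
  fix \<epsilon> :: real assume e: "\<epsilon> > 0"
  \<comment> \<open>\<open>B + 1\<close> instead of \<open>B\<close> keeps the quotient meaningful
    for \<open>B = 0\<close> and leaves the factor \<open>B / (B + 1) < 1\<close>, which yields the
    strict inequality at the end.\<close>
  define \<eta> where "\<eta> = \<epsilon> / (2 * (B + 1))"
  have eta: "\<eta> > 0" using e B by (simp add: \<eta>_def)
  obtain \<delta>1 where d1: "\<delta>1 > 0" and H1: "\<And>(m::nat) u v.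
        (\<forall>i<m. l \<le> u i \<and> u i \<le> v i \<and> v i \<le> r) \<Longrightarrow>
        disjoint_family_on (\<lambda>i. {u i<..<v i}) {..<m} \<Longrightarrow>
        (\<Sum>i<m. v i - u i) < \<delta>1 \<Longrightarrow> (\<Sum>i<m. \<bar>g (v i) - g (u i)\<bar>) < \<eta>"
    using g eta unfolding abs_continuous_on_def by meson
  obtain \<delta>2 where d2: "\<delta>2 > 0" and H2: "\<And>(m::nat) u v.
        (\<forall>i<m. l \<le> u i \<and> u i \<le> v i \<and> v i \<le> r) \<Longrightarrow>
        disjoint_family_on (\<lambda>i. {u i<..<v i}) {..<m} \<Longrightarrow>
        (\<Sum>i<m. v i - u i) < \<delta>2 \<Longrightarrow> (\<Sum>i<m. \<bar>h (v i) - h (u i)\<bar>) < \<eta>"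
    using h eta unfolding abs_continuous_on_def by meson
  show "\<exists>\<delta>>0. \<forall>(m::nat) u v. (\<forall>i<m. l \<le> u i \<and> u i \<le> v i \<and> v i \<le> r) \<and>
        disjoint_family_on (\<lambda>i. {u i<..<v i}) {..<m} \<and> (\<Sum>i<m. v i - u i) < \<delta> \<longrightarrow>
        (\<Sum>i<m. \<bar>f (v i) - f (u i)\<bar>) < \<epsilon>"
  proof (intro exI[of _ "min \<delta>1 \<delta>2"] conjI allI impI)
    show "min \<delta>1 \<delta>2 > 0" using d1 d2 by simp
    fix m :: nat and u v :: "nat \<Rightarrow> real"
    assume A: "(\<forall>i<m. l \<le> u i \<and> u i \<le> v i \<and> v i \<le> r) \<and>
        disjoint_family_on (\<lambda>i. {u i<..<v i}) {..<m} \<and> (\<Sum>i<m. v i - u i) < min \<delta>1 \<delta>2"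
    have "(\<Sum>i<m. \<bar>f (v i) - f (u i)\<bar>) \<le> (\<Sum>i<m. B * (\<bar>g (v i) - g (u i)\<bar> + \<bar>h (v i) - h (u i)\<bar>))"
    proof (intro sum_mono dom)
      fix i assume "i \<in> {..<m}"
      then have "l \<le> u i" "u i \<le> v i" "v i \<le> r" using A by auto
      then show "u i \<in> {l..r}" "v i \<in> {l..r}" by auto
    qed
    also have "\<dots> = B * ((\<Sum>i<m. \<bar>g (v i) - g (u i)\<bar>) + (\<Sum>i<m. \<bar>h (v i) - h (u i)\<bar>))"
      by (simp add: sum_distrib_left sum.distrib distrib_left)
    also have "\<dots> \<le> B * (\<eta> + \<eta>)"
      using A by (intro mult_left_mono[OF _ B] add_mono less_imp_le H1 H2) auto
    also have "\<dots> < \<epsilon>"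
    proof -
      have "\<eta> + \<eta> = \<epsilon> / (B + 1)" using B by (simp add: \<eta>_def divide_simps)
      then have "B * (\<eta> + \<eta>) = \<epsilon> * (B / (B + 1))" by simp
      also have "\<dots> < \<epsilon> * 1" using e B by (intro mult_strict_left_mono) auto
      finally show ?thesis by simp
    qed
    finally show "(\<Sum>i<m. \<bar>f (v i) - f (u i)\<bar>) < \<epsilon>" .
  qed
qed

section \<open>Closure properties of absolute continuity\<close>

lemma abs_continuous_on_ident: "abs_continuous_on l r (\<lambda>x. x)"
  unfolding abs_continuous_on_def
proof (intro allI impI)
  fix \<epsilon> :: real assume e: "\<epsilon> > 0"
  have "(\<Sum>i<m. \<bar>v i - u i\<bar>) < \<epsilon>"
    if "\<forall>i<m. l \<le> u i \<and> u i \<le> v i \<and> v i \<le> r" "(\<Sum>i<m. v i - u i) < \<epsilon>"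
    for m :: nat and u v :: "nat \<Rightarrow> real"
  proof -
    have "(\<Sum>i<m. \<bar>v i - u i\<bar>) = (\<Sum>i<m. v i - u i)" using that by (intro sum.cong) auto
    then show ?thesis using that by simp
  qed
  then show "\<exists>\<delta>>0. \<forall>(m::nat) u v. (\<forall>i<m. l \<le> u i \<and> u i \<le> v i \<and> v i \<le> r) \<and>
        disjoint_family_on (\<lambda>i. {u i<..<v i}) {..<m} \<and> (\<Sum>i<m. v i - u i) < \<delta> \<longrightarrow>
        (\<Sum>i<m. \<bar>v i - u i\<bar>) < \<epsilon>"
    using e by blast
qed

lemma abs_continuous_on_cong:
  assumes "abs_continuous_on l r g" "\<And>x. x \<in> {l..r} \<Longrightarrow> f x = g x"
  shows "abs_continuous_on l r f"
  by (rule abs_continuous_on_dominated[OF assms(1) assms(1), of 1]) (use assms(2) in auto)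

lemma abs_continuous_on_add:
  assumes "abs_continuous_on l r g" "abs_continuous_on l r h"
  shows "abs_continuous_on l r (\<lambda>x. g x + h x)"
  by (rule abs_continuous_on_dominated[OF assms, of 1]) auto

lemma abs_continuous_on_const: "abs_continuous_on l r (\<lambda>_. c)"
  by (rule abs_continuous_on_dominated[OF abs_continuous_on_ident abs_continuous_on_ident, of 0]) auto

lemma abs_continuous_on_sum:
  assumes "\<And>i. i \<in> I \<Longrightarrow> abs_continuous_on l r (g i)"
  shows "abs_continuous_on l r (\<lambda>x. \<Sum>i\<in>I. g i x)"
  using assms
  by (induction I rule: infinite_finite_induct)
     (auto intro: abs_continuous_on_add abs_continuous_on_const)

lemma abs_continuous_on_mult:
  assumes g: "abs_continuous_on l r g" and h: "abs_continuous_on l r h"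
  shows "abs_continuous_on l r (\<lambda>x. g x * h x)"
proof -
  have "bounded (g ` {l..r})" "bounded (h ` {l..r})"
    using abs_continuous_on_continuous[OF g] abs_continuous_on_continuous[OF h]
    by (auto intro!: compact_imp_bounded compact_continuous_image)
  then obtain B1 B2 where B1: "B1 > 0" "\<And>x. x \<in> {l..r} \<Longrightarrow> \<bar>g x\<bar> \<le> B1"
    and B2: "B2 > 0" "\<And>x. x \<in> {l..r} \<Longrightarrow> \<bar>h x\<bar> \<le> B2"
    unfolding bounded_pos by auto
  show ?thesis
  proof (rule abs_continuous_on_dominated[OF g h, of "B1 + B2"])
    fix x y assume xy: "x \<in> {l..r}" "y \<in> {l..r}"
    have "\<bar>g y * h y - g x * h x\<bar> = \<bar>(g y - g x) * h y + g x * (h y - h x)\<bar>"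
      by (simp add: algebra_simps)
    also have "\<dots> \<le> \<bar>g y - g x\<bar> * \<bar>h y\<bar> + \<bar>g x\<bar> * \<bar>h y - h x\<bar>"
      by (metis abs_mult abs_triangle_ineq)
    also have "\<dots> \<le> \<bar>g y - g x\<bar> * (B1 + B2) + (B1 + B2) * \<bar>h y - h x\<bar>"
      using B1 B2 xy by (intro add_mono mult_left_mono mult_right_mono) (auto intro: order_trans add_increasing add_increasing2)
    finally show "\<bar>g y * h y - g x * h x\<bar> \<le> (B1 + B2) * (\<bar>g y - g x\<bar> + \<bar>h y - h x\<bar>)"
      by (simp add: algebra_simps)
  qed (use B1 B2 in auto)
qed

lemma abs_continuous_on_C1:
  assumes "\<And>x. x \<in> {l..r} \<Longrightarrow> (f has_real_derivative f' x) (at x within {l..r})"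
    and "continuous_on {l..r} f'"
  shows "abs_continuous_on l r f"
proof -
  have "bounded (f' ` {l..r})"
    using assms(2) by (auto intro!: compact_imp_bounded compact_continuous_image)
  then obtain B where B: "B > 0" "\<And>x. x \<in> {l..r} \<Longrightarrow> \<bar>f' x\<bar> \<le> B"
    unfolding bounded_pos by auto
  show ?thesis
  proof (rule abs_continuous_on_dominated[OF abs_continuous_on_ident abs_continuous_on_ident, of B])
    fix x y assume "x \<in> {l..r}" "y \<in> {l..r}"
    then have "norm (f y - f x) \<le> B * norm (y - x)"
      using field_differentiable_bound[of "{l..r}" f f' B y x] assms(1) B by auto
    then show "\<bar>f y - f x\<bar> \<le> B * (\<bar>y - x\<bar> + \<bar>y - x\<bar>)"
      using B(1) by (smt (verit) mult_left_mono real_norm_def abs_ge_zero)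
  qed (use B in auto)
qed

text \<open>In the Henstock integral the exceptional null set can be given tags in an open set of small
  measure, over which an absolutely continuous function varies little.\<close>

theorem abs_continuous_on_ftc:
  fixes g g' :: "real \<Rightarrow> real"
  assumes lr: "l \<le> r" and ac: "abs_continuous_on l r g"
    and ae: "AE x\<in>{l..r} in lborel. (g has_real_derivative g' x) (at x within {l..r})"
    and int: "set_integrable lborel {l..r} g'"
  shows "(LINT x:{l..r}|lborel. g' x) = g r - g l"
proof -
  obtain N where N: "N \<in> null_sets lborel"
    and NN: "\<And>x. x \<in> space lborel - N \<Longrightarrow> x \<in> {l..r} \<longrightarrow> (g has_real_derivative g' x) (at x within {l..r})"
    by (rule AE_E3[OF ae], rule that, assumption, blast)
  have der: "(g has_real_derivative g' x) (at x within {l..r})" if "x \<in> {l..r}" "x \<notin> N" for x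
    using NN that by auto
  \<comment> \<open>The integrand is set to 0 on the exceptional null set N, so that tags in N
    contribute nothing to a Riemann sum; the increments of g over their intervals still have to be
    small. The change is undone at the end because N is negligible.\<close>
  define k where "k x = (if x \<in> N then 0 else g' x)" for x
  have "(k has_integral (g r - g l)) (cbox l r)"
    unfolding has_integral
  proof (intro allI impI)
    fix e :: real assume e: "e > 0"
    define e1 where "e1 = e / (2 * (r - l + 1))"
    have e1: "e1 > 0" using e lr by (simp add: e1_def)
    obtain \<delta> where d: "\<delta> > 0" and H: "\<And>(I :: (real \<times> real set) set) u v. finite I \<Longrightarrow> (\<And>i. i \<in> I \<Longrightarrow> l \<le> u i \<and> u i \<le> v i \<and> v i \<le> r) \<Longrightarrow>
        disjoint_family_on (\<lambda>i. {u i<..<v i}) I \<Longrightarrow>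
        (\<Sum>i\<in>I. v i - u i) < \<delta> \<Longrightarrow> (\<Sum>i\<in>I. \<bar>g (v i) - g (u i)\<bar>) < e / 2"
      by (rule abs_continuous_on_finite_family[OF ac half_gt_zero[OF e]]) blast
    have Nleb: "N \<in> null_sets lebesgue" using N by (rule null_sets_completionI)
    obtain T where T: "open T" "N \<subseteq> T" "(T - N) \<in> lmeasurable" "emeasure lebesgue (T - N) < ennreal \<delta>"
      using sets_lebesgue_outer_open[of N \<delta>] Nleb d by auto
    have T_meas: "emeasure lborel T < ennreal \<delta>"
    proof -
      have "T = (T - N) \<union> N" using T by auto
      then have "emeasure lebesgue T \<le> emeasure lebesgue (T - N) + emeasure lebesgue N"
        using T(3) Nleb by (metis emeasure_subadditive fmeasurableD null_setsD2)
      then show ?thesis using T Nleb by (simp add: null_setsD1)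
    qed
    \<comment> \<open>The gauge. At tags in N it keeps the interval inside the open set T of small
      measure; at the other tags in \<open>{l..r}\<close> it makes the linear approximation of g
      accurate up to \<open>e1\<close> times the distance.\<close>
    have ex: "\<exists>\<rho>>0. if x \<in> N then ball x \<rho> \<subseteq> T else x \<in> {l..r} \<longrightarrow>
        (\<forall>y\<in>{l..r}. \<bar>y - x\<bar> < \<rho> \<longrightarrow> \<bar>g y - g x - g' x * (y - x)\<bar> \<le> e1 * \<bar>y - x\<bar>)" for x
    proof (cases "x \<in> N")
      case True
      then show ?thesis using T(1,2) open_contains_ball by force
    next
      case F: False
      show ?thesis
      proof (cases "x \<in> {l..r}")
        case True
        have "(g has_derivative (*) (g' x)) (at x within {l..r})"
          using der[OF True F] by (simp add: has_field_derivative_def)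
        then show ?thesis using F e1 unfolding has_derivative_within_alt
          by (auto simp: ac_simps)
      qed (use F in \<open>auto intro!: exI[of _ 1]\<close>)
    qed
    then obtain \<rho> where rho: "\<And>x. \<rho> x > 0" and
      rho2: "\<And>x. if x \<in> N then ball x (\<rho> x) \<subseteq> T else x \<in> {l..r} \<longrightarrow>
        (\<forall>y\<in>{l..r}. \<bar>y - x\<bar> < \<rho> x \<longrightarrow> \<bar>g y - g x - g' x * (y - x)\<bar> \<le> e1 * \<bar>y - x\<bar>)"
      by metis
    show "\<exists>\<gamma>. gauge \<gamma> \<and> (\<forall>\<D>. \<D> tagged_division_of cbox l r \<and> \<gamma> fine \<D> \<longrightarrow>
        norm ((\<Sum>(x, ka)\<in>\<D>. measure lborel ka *\<^sub>R k x) - (g r - g l)) < e)"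
    proof (intro exI conjI allI impI)
      show "gauge (\<lambda>x. ball x (\<rho> x))" using rho by (auto simp: gauge_def)
      fix \<D> assume D: "\<D> tagged_division_of cbox l r \<and> (\<lambda>x. ball x (\<rho> x)) fine \<D>"
      then have Dt: "\<D> tagged_division_of {l..r}" and Df: "(\<lambda>x. ball x (\<rho> x)) fine \<D>" by auto
      have fin: "finite \<D>" using Dt by auto
      define u where "u p = Inf (snd p)" for p :: "real \<times> real set"
      define v where "v p = Sup (snd p)" for p :: "real \<times> real set"
      have dat: "snd p = {u p..v p} \<and> u p \<le> fst p \<and> fst p \<le> v p \<and> l \<le> u p \<and> v p \<le> r \<and> snd p \<subseteq> ball (fst p) (\<rho> (fst p))"
        if p: "p \<in> \<D>" for p
      proof -
        obtain x K where pk: "p = (x, K)" by (cases p)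
        have "x \<in> K" "K \<subseteq> {l..r}" using tagged_division_ofD(2,3)[OF Dt] p pk by auto
        moreover obtain a b where "K = cbox a b" using tagged_division_ofD(4)[OF Dt] p pk by blast
        moreover have "K \<subseteq> ball x (\<rho> x)" using Df p pk unfolding fine_def by auto
        ultimately show ?thesis by (auto simp: pk u_def v_def)
      qed
      have tele: "(\<Sum>p\<in>\<D>. g (v p) - g (u p)) = g r - g l"
        using additive_tagged_division_1[OF lr Dt, of g] unfolding u_def v_def
        by (simp add: case_prod_unfold)
      have cont: "measure lborel (snd p) = v p - u p" if "p \<in> \<D>" for p
        using dat[OF that] by (simp add: order_trans[of "u p" "fst p" "v p"])
      have "(\<Sum>p\<in>\<D>. v p - u p) = r - l"
        using additive_tagged_division_1[OF lr Dt, of "\<lambda>x. x"] unfolding u_def v_def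
        by (simp add: case_prod_unfold)
      note len = this
      define A where "A = {p \<in> \<D>. fst p \<in> N}"
      define B where "B = {p \<in> \<D>. fst p \<notin> N}"
      have AB: "\<D> = A \<union> B" "A \<inter> B = {}" "finite A" "finite B" using fin by (auto simp: A_def B_def)
      have disj: "disjoint_family_on (\<lambda>i. {u i<..<v i}) \<D>"
        unfolding disjoint_family_on_def
      proof (intro ballI impI)
        fix p q assume pq: "p \<in> \<D>" "q \<in> \<D>" "p \<noteq> q"
        have "interior (snd p) \<inter> interior (snd q) = {}"
          using tagged_division_ofD(5)[OF Dt, of "fst p" "snd p" "fst q" "snd q"] pq by auto
        then show "{u p<..<v p} \<inter> {u q<..<v q} = {}"
          using dat[OF pq(1)] dat[OF pq(2)] by (metis interior_atLeastAtMost_real)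
      qed
      \<comment> \<open>The open intervals tagged in N are disjoint and lie in T, so their total
        length is below the \<delta> of absolute continuity.\<close>
      have lenA: "(\<Sum>p\<in>A. v p - u p) < \<delta>"
      proof -
        have "(\<Sum>p\<in>A. ennreal (v p - u p)) = (\<Sum>p\<in>A. emeasure lborel {u p<..<v p})"
          using dat by (intro sum.cong) (auto simp: A_def intro!: emeasure_lborel_Ioo[symmetric] intro: order_trans)
        also have "\<dots> = emeasure lborel (\<Union>p\<in>A. {u p<..<v p})"
          using AB disj by (intro sum_emeasure) (auto intro: disjoint_family_on_mono)
        also have "\<dots> \<le> emeasure lborel T"
        proof (rule emeasure_mono)
          show "(\<Union>p\<in>A. {u p<..<v p}) \<subseteq> T"
          proof
            fix y assume "y \<in> (\<Union>p\<in>A. {u p<..<v p})"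
            then obtain p where p: "p \<in> \<D>" "fst p \<in> N" "y \<in> {u p<..<v p}" by (auto simp: A_def)
            then have "y \<in> snd p" using dat[OF p(1)] by auto
            then have "y \<in> ball (fst p) (\<rho> (fst p))" using dat[OF p(1)] by blast
            then show "y \<in> T" using rho2[of "fst p"] p(2) by auto
          qed
        qed (use T(1) in auto)
        also have "\<dots> < ennreal \<delta>" by (rule T_meas)
        finally have "(\<Sum>p\<in>A. ennreal (v p - u p)) < ennreal \<delta>" .
        moreover have "(\<Sum>p\<in>A. ennreal (v p - u p)) = ennreal (\<Sum>p\<in>A. v p - u p)"
          using dat by (intro sum_ennreal) (auto simp: A_def intro: order_trans)
        ultimately show ?thesis using d by (metis ennreal_leI not_less)
      qed
      have sA: "(\<Sum>p\<in>A. \<bar>g (v p) - g (u p)\<bar>) < e / 2"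
      proof (rule H)
        show "l \<le> u p \<and> u p \<le> v p \<and> v p \<le> r" if "p \<in> A" for p
          using dat[of p] that by (auto simp: A_def intro: order_trans)
        show "disjoint_family_on (\<lambda>i. {u i<..<v i}) A"
          using disj AB by (auto intro: disjoint_family_on_mono)
      qed (use AB lenA in auto)
      \<comment> \<open>The tag lies between the two end points, so the errors at both ends,
        measured from the tag, add up to a multiple of the length of the interval.\<close>
      have sB: "\<bar>g' (fst p) * (v p - u p) - (g (v p) - g (u p))\<bar> \<le> e1 * (v p - u p)" if "p \<in> B" for p
      proof -
        define x where "x = fst p"
        have p: "p \<in> \<D>" "x \<notin> N" using that by (auto simp: B_def x_def)
        note P = dat[OF p(1), folded x_def]
        have x: "x \<in> {l..r}" using P by auto
        have uv: "u p \<in> {l..r}" "v p \<in> {l..r}" "u p \<in> snd p" "v p \<in> snd p" using P by auto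
        then have "u p \<in> ball x (\<rho> x)" "v p \<in> ball x (\<rho> x)" using P by blast+
        then have near: "\<bar>u p - x\<bar> < \<rho> x" "\<bar>v p - x\<bar> < \<rho> x" by (auto simp: dist_real_def abs_minus_commute)
        have "\<bar>g (u p) - g x - g' x * (u p - x)\<bar> \<le> e1 * \<bar>u p - x\<bar>"
          "\<bar>g (v p) - g x - g' x * (v p - x)\<bar> \<le> e1 * \<bar>v p - x\<bar>"
          using rho2[of x] p(2) x uv near by auto
        then have "\<bar>(g (u p) - g x - g' x * (u p - x)) - (g (v p) - g x - g' x * (v p - x))\<bar>
           \<le> e1 * (x - u p) + e1 * (v p - x)"
          using P by (auto simp: abs_if split: if_splits)
        then show ?thesis unfolding x_def[symmetric] by (simp add: algebra_simps)
      qed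
      have "(\<Sum>(x, ka)\<in>\<D>. measure lborel ka *\<^sub>R k x) = (\<Sum>p\<in>\<D>. (v p - u p) * k (fst p))"
        using cont by (intro sum.cong) (auto simp: case_prod_unfold)
      also have "\<dots> = (\<Sum>p\<in>A. (v p - u p) * k (fst p)) + (\<Sum>p\<in>B. (v p - u p) * k (fst p))"
        using AB by (simp add: sum.union_disjoint)
      also have "(\<Sum>p\<in>A. (v p - u p) * k (fst p)) = 0"
        by (auto simp: A_def k_def intro!: sum.neutral)
      also have "(\<Sum>p\<in>B. (v p - u p) * k (fst p)) = (\<Sum>p\<in>B. g' (fst p) * (v p - u p))"
        by (intro sum.cong) (auto simp: B_def k_def)
      finally have s1: "(\<Sum>(x, ka)\<in>\<D>. measure lborel ka *\<^sub>R k x) = (\<Sum>p\<in>B. g' (fst p) * (v p - u p))" by simp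
      have s2: "g r - g l = (\<Sum>p\<in>A. g (v p) - g (u p)) + (\<Sum>p\<in>B. g (v p) - g (u p))"
        using AB tele by (simp add: sum.union_disjoint)
      have "norm ((\<Sum>(x, ka)\<in>\<D>. measure lborel ka *\<^sub>R k x) - (g r - g l)) =
        \<bar>(\<Sum>p\<in>B. g' (fst p) * (v p - u p) - (g (v p) - g (u p))) - (\<Sum>p\<in>A. g (v p) - g (u p))\<bar>"
        unfolding s1 s2 by (simp add: sum_subtractf)
      also have "\<dots> \<le> (\<Sum>p\<in>B. \<bar>g' (fst p) * (v p - u p) - (g (v p) - g (u p))\<bar>) + (\<Sum>p\<in>A. \<bar>g (v p) - g (u p)\<bar>)"
        by (rule order_trans[OF abs_triangle_ineq4]) (intro add_mono sum_abs)
      also have "\<dots> < (\<Sum>p\<in>B. e1 * (v p - u p)) + e / 2"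
        using sB sA by (intro add_le_less_mono sum_mono) auto
      also have "(\<Sum>p\<in>B. e1 * (v p - u p)) \<le> (\<Sum>p\<in>\<D>. e1 * (v p - u p))"
      proof (intro sum_mono2 fin)
        fix p assume "p \<in> \<D> - B"
        then have "u p \<le> v p" using dat[of p] by auto
        then show "0 \<le> e1 * (v p - u p)" using e1 by simp
      qed (use AB in auto)
      also have "\<dots> = e1 * (r - l)" using len by (simp add: sum_distrib_left[symmetric])
      also have "\<dots> \<le> e / 2" using e lr by (simp add: e1_def field_simps)
      finally show "norm ((\<Sum>(x, ka)\<in>\<D>. measure lborel ka *\<^sub>R k x) - (g r - g l)) < e" by simp
    qed
  qed
  then have k: "(k has_integral (g r - g l)) {l..r}" by simp
  have "(g' has_integral (g r - g l)) {l..r}"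
    by (rule has_integral_spike[OF _ _ k, of N])
       (use null_sets_completionI[OF N] in \<open>auto simp: k_def negligible_iff_null_sets\<close>)
  moreover have "set_integrable lebesgue {l..r} g'"
    using int by (auto simp: set_integrable_def integrable_completion)
  ultimately have "g r - g l = (LINT x:{l..r}|lebesgue. g' x)"
    using set_lebesgue_integral_eq_integral(2) integral_unique by metis
  also have "\<dots> = (LINT x:{l..r}|lborel. g' x)"
    using int by (auto simp: set_lebesgue_integral_def set_integrable_def integral_completion)
  finally show ?thesis by simp
qed

text \<open>The product of u with a C1 function is again absolutely continuous and has the displayed
  integrand as its derivative almost everywhere, so partial integration is one application of the
  fundamental theorem. The C1 factor will be, for instance, a test function on a line or a
  trigonometric function.\<close>

theorem abs_continuous_on_parts:
  fixes u u' \<psi> \<psi>' :: "real \<Rightarrow> real"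
  assumes lr: "l \<le> r" and ac: "abs_continuous_on l r u"
    and ae: "AE x\<in>{l..r} in lborel. (u has_real_derivative u' x) (at x within {l..r})"
    and int: "set_integrable lborel {l..r} u'"
    and psi: "\<And>x. x \<in> {l..r} \<Longrightarrow> (\<psi> has_real_derivative \<psi>' x) (at x within {l..r})"
    and psi': "continuous_on {l..r} \<psi>'"
  shows "set_integrable lborel {l..r} (\<lambda>x. u' x * \<psi> x + u x * \<psi>' x)" (is ?I)
    and "(LINT x:{l..r}|lborel. u' x * \<psi> x + u x * \<psi>' x) = u r * \<psi> r - u l * \<psi> l"
proof -
  have cpsi: "continuous_on {l..r} \<psi>" using psi by (rule DERIV_continuous_on)
  have cu: "continuous_on {l..r} u" using ac by (rule abs_continuous_on_continuous)
  have "bounded (\<psi> ` {l..r})" using cpsi by (auto intro!: compact_imp_bounded compact_continuous_image)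
  then obtain B where B: "\<And>x. x \<in> {l..r} \<Longrightarrow> \<bar>\<psi> x\<bar> \<le> B"
    unfolding bounded_pos by (metis image_eqI real_norm_def)
  have mpsi: "(\<lambda>x. indicator {l..r} x * \<psi> x) \<in> borel_measurable borel"
    using borel_measurable_continuous_on_indicator[OF _ cpsi] by simp
  have m': "(\<lambda>x. indicator {l..r} x * u' x) \<in> borel_measurable borel"
    using int by (auto simp: set_integrable_def)
  have e1: "(\<lambda>x. (indicator {l..r} x * u' x) * (indicator {l..r} x * \<psi> x)) = (\<lambda>x. indicator {l..r} x * (u' x * \<psi> x))"
    by (auto simp: indicator_def)
  have "integrable lborel (\<lambda>x. indicator {l..r} x * (u' x * \<psi> x))"
  proof (rule Bochner_Integration.integrable_bound)
    show "integrable lborel (\<lambda>x. B * (indicator {l..r} x * u' x))"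
      using int by (auto simp: set_integrable_def)
    show "(\<lambda>x. indicator {l..r} x * (u' x * \<psi> x)) \<in> borel_measurable lborel"
      using borel_measurable_times[OF m' mpsi] unfolding e1 by simp
    show "AE x in lborel. norm (indicator {l..r} x * (u' x * \<psi> x)) \<le> norm (B * (indicator {l..r} x * u' x))"
      using B by (auto simp: indicator_def abs_mult mult.commute intro!: mult_right_mono order_trans[OF B abs_ge_self])
  qed
  moreover have "set_integrable lborel {l..r} (\<lambda>x. u x * \<psi>' x)"
    by (intro borel_integrable_atLeastAtMost' continuous_on_mult cu psi')
  ultimately show ?I
    by (intro set_integral_add) (auto simp: set_integrable_def)
  show "(LINT x:{l..r}|lborel. u' x * \<psi> x + u x * \<psi>' x) = u r * \<psi> r - u l * \<psi> l"
  proof (rule abs_continuous_on_ftc[OF lr])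
    show "abs_continuous_on l r (\<lambda>x. u x * \<psi> x)"
      using abs_continuous_on_C1[OF psi psi'] ac by (intro abs_continuous_on_mult) auto
    show "AE x\<in>{l..r} in lborel. ((\<lambda>x. u x * \<psi> x) has_real_derivative u' x * \<psi> x + u x * \<psi>' x) (at x within {l..r})"
      using ae by eventually_elim (auto intro!: derivative_eq_intros psi)
  qed (rule \<open>?I\<close>)
qed

section \<open>Fubini's theorem in coordinates\<close>

lemma prod_Basis_vec: "(\<Prod>b\<in>(Basis::(real^'d::finite) set). f b) = (\<Prod>j\<in>UNIV. f (axis j 1))"
proof -
  have "(Basis::(real^'d) set) = range (\<lambda>j. axis j 1)" by (auto simp: Basis_vec_def)
  moreover have "inj (\<lambda>j::'d. axis j (1::real))" by (auto simp: inj_def axis_eq_axis)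
  ultimately show ?thesis by (metis (no_types, lifting) comp_apply prod.cong prod.reindex)
qed

lemma borel_measurable_vec_nth [measurable]: "(\<lambda>x::real^'d::finite. x $ j) \<in> borel_measurable borel"
  by (intro borel_measurable_continuous_onI continuous_intros)

lemma borel_measurable_vec_lambda:
  assumes "\<And>j. (\<lambda>x. f x j) \<in> borel_measurable M"
  shows "(\<lambda>x. (\<chi> j. f x j) :: real^'d::finite) \<in> borel_measurable M"
proof (subst borel_measurable_euclidean_space, rule ballI)
  fix b :: "real^'d" assume "b \<in> Basis"
  then obtain j where "b = axis j 1" by (auto simp: Basis_vec_def)
  then show "(\<lambda>x. (\<chi> j. f x j) \<bullet> b) \<in> borel_measurable M"
    using assms[of j] by (simp add: inner_axis)
qed

interpretation PL: product_sigma_finite "\<lambda>_::'d. lborel :: real measure"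
  by standard

text \<open>Identifies a pair of points of the two partial product spaces with a vector, so that the
  iterated integrals in the Sobolev norm can be compared with integrals over
  \<open>real^'d\<close>.\<close>

definition merge_vec :: "'d::finite set \<Rightarrow> ('d \<Rightarrow> real) \<Rightarrow> ('d \<Rightarrow> real) \<Rightarrow> real^'d" where
  "merge_vec w y x = (\<chi> j. if j \<in> w then y j else x j)"

lemma merge_vec_nth [simp]: "merge_vec w y x $ j = (if j \<in> w then y j else x j)"
  by (simp add: merge_vec_def)

lemma measurable_merge_vec [measurable]:
  "(\<lambda>p. merge_vec w (fst p) (snd p)) \<in>
     (PiM w (\<lambda>_. lborel)) \<Otimes>\<^sub>M (PiM (- w) (\<lambda>_. lborel)) \<rightarrow>\<^sub>M borel"
  unfolding merge_vec_def
proof (rule borel_measurable_vec_lambda)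
  fix j
  show "(\<lambda>p. if j \<in> w then fst p j else snd p j)
     \<in> borel_measurable (PiM w (\<lambda>_. lborel) \<Otimes>\<^sub>M PiM (- w) (\<lambda>_. lborel))"
  proof (cases "j \<in> w")
    case True
    have "(\<lambda>p. fst p j) \<in> (PiM w (\<lambda>_. lborel) \<Otimes>\<^sub>M PiM (- w) (\<lambda>_. lborel)) \<rightarrow>\<^sub>M lborel"
      using measurable_compose[OF measurable_fst measurable_component_singleton[OF True]] .
    then show ?thesis using True by simp
  next
    case False
    then have "j \<in> - w" by simp
    then have "(\<lambda>p. snd p j) \<in> (PiM w (\<lambda>_. lborel) \<Otimes>\<^sub>M PiM (- w) (\<lambda>_. lborel)) \<rightarrow>\<^sub>M lborel"
      by (intro measurable_compose[OF measurable_snd] measurable_component_singleton)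
    then show ?thesis using False by simp
  qed
qed

text \<open>Lebesgue measure is characterised by its values on open boxes, and the preimage of a box
  under merging is a product of two boxes. Fubini's theorem for an arbitrary splitting of the
  coordinates follows from this identity.\<close>

lemma lborel_merge_vec:
  "(lborel :: (real^'d::finite) measure) =
     distr (PiM w (\<lambda>_. lborel) \<Otimes>\<^sub>M PiM (- w) (\<lambda>_. lborel)) borel (\<lambda>p. merge_vec w (fst p) (snd p))"
proof (rule lborel_eqI)
  interpret A: finite_product_sigma_finite "\<lambda>_::'d. lborel :: real measure" w by standard simp
  interpret B: finite_product_sigma_finite "\<lambda>_::'d. lborel :: real measure" "- w" by standard simp
  fix l u :: "real^'d" assume lu: "\<And>b. b \<in> Basis \<Longrightarrow> l \<bullet> b \<le> u \<bullet> b"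
  have lu': "l $ j \<le> u $ j" for j
    using lu[of "axis j 1"] by (simp add: inner_axis axis_in_Basis_iff)
  have pre: "(\<lambda>p. merge_vec w (fst p) (snd p)) -` box l u \<inter> space (PiM w (\<lambda>_. lborel) \<Otimes>\<^sub>M PiM (- w) (\<lambda>_. lborel))
     = (\<Pi>\<^sub>E j\<in>w. {l $ j<..<u $ j}) \<times> (\<Pi>\<^sub>E j\<in>- w. {l $ j<..<u $ j})"
    by (auto simp: mem_box_cart space_pair_measure space_PiM PiE_iff split: if_splits)
  have "emeasure (distr (PiM w (\<lambda>_. lborel) \<Otimes>\<^sub>M PiM (- w) (\<lambda>_. lborel)) borel (\<lambda>p. merge_vec w (fst p) (snd p))) (box l u)
     = emeasure (PiM w (\<lambda>_. lborel)) (\<Pi>\<^sub>E j\<in>w. {l $ j<..<u $ j}) *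
       emeasure (PiM (- w) (\<lambda>_. lborel)) (\<Pi>\<^sub>E j\<in>- w. {l $ j<..<u $ j})"
    by (subst emeasure_distr[OF measurable_merge_vec], simp, unfold pre,
        rule B.emeasure_pair_measure_Times) (auto intro!: sets_PiM_I_finite)
  also have "\<dots> = (\<Prod>j\<in>w. ennreal (u $ j - l $ j)) * (\<Prod>j\<in>- w. ennreal (u $ j - l $ j))"
    using lu' by (simp add: A.measure_times B.measure_times)
  also have "\<dots> = (\<Prod>j\<in>UNIV. ennreal (u $ j - l $ j))"
    by (subst prod.union_disjoint[symmetric]) (auto simp: Compl_partition)
  also have "\<dots> = ennreal (\<Prod>b\<in>Basis. (u - l) \<bullet> b)"
    using lu' by (simp add: prod_Basis_vec inner_axis prod_ennreal)
  finally show "emeasure (distr (PiM w (\<lambda>_. lborel) \<Otimes>\<^sub>M PiM (- w) (\<lambda>_. lborel)) borel (\<lambda>p. merge_vec w (fst p) (snd p))) (box l u)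
     = (\<Prod>b\<in>Basis. (u - l) \<bullet> b)" by simp
qed simp

lemma lborel_vec: "(lborel :: (real^'d::finite) measure) = distr (PiM UNIV (\<lambda>_. lborel)) borel (\<lambda>y. \<chi> j. y j)"
proof (rule lborel_eqI)
  interpret A: finite_product_sigma_finite "\<lambda>_::'d. lborel :: real measure" UNIV by standard simp
  fix l u :: "real^'d" assume lu: "\<And>b. b \<in> Basis \<Longrightarrow> l \<bullet> b \<le> u \<bullet> b"
  have lu': "l $ j \<le> u $ j" for j
    using lu[of "axis j 1"] by (simp add: inner_axis axis_in_Basis_iff)
  have m: "(\<lambda>y. (\<chi> j. y j) :: real^'d) \<in> borel_measurable (PiM UNIV (\<lambda>_. lborel))"
    by (rule borel_measurable_vec_lambda)
       (use measurable_component_singleton[of _ UNIV "\<lambda>_. lborel :: real measure"] in auto)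
  have pre: "(\<lambda>y. (\<chi> j. y j) :: real^'d) -` box l u \<inter> space (PiM UNIV (\<lambda>_. lborel))
     = (\<Pi>\<^sub>E j\<in>UNIV. {l $ j<..<u $ j})"
    by (auto simp: mem_box_cart space_PiM PiE_iff)
  have "emeasure (distr (PiM UNIV (\<lambda>_. lborel)) borel (\<lambda>y. \<chi> j. y j)) (box l u)
     = emeasure (PiM UNIV (\<lambda>_. lborel)) (\<Pi>\<^sub>E j\<in>UNIV. {l $ j<..<u $ j})"
    by (subst emeasure_distr[OF m]) (auto simp only: pre, auto)
  also have "\<dots> = (\<Prod>j\<in>UNIV. ennreal (u $ j - l $ j))"
    using lu' by (simp add: A.measure_times)
  also have "\<dots> = ennreal (\<Prod>b\<in>Basis. (u - l) \<bullet> b)"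
    using lu' by (simp add: prod_Basis_vec inner_axis prod_ennreal)
  finally show "emeasure (distr (PiM UNIV (\<lambda>_. lborel)) borel (\<lambda>y. \<chi> j. y j)) (box l u)
     = (\<Prod>b\<in>Basis. (u - l) \<bullet> b)" by simp
qed simp

lemma
  fixes f :: "'d::finite \<Rightarrow> real \<Rightarrow> 'a::{real_normed_field,banach,second_countable_topology}"
  assumes f: "\<And>j. integrable lborel (f j)"
  shows integrable_prod_vec: "integrable lborel (\<lambda>x::real^'d. \<Prod>j\<in>UNIV. f j (x $ j))"
    and integral_prod_vec: "(LINT x|lborel. (\<Prod>j\<in>UNIV. f j (x $ j))) = (\<Prod>j\<in>UNIV. LINT t|lborel. f j t)"
proof -
  have m: "(\<lambda>y. (\<chi> j. y j) :: real^'d) \<in> borel_measurable (PiM UNIV (\<lambda>_. lborel))"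
    by (rule borel_measurable_vec_lambda)
       (use measurable_component_singleton[of _ UNIV "\<lambda>_. lborel :: real measure"] in auto)
  have fm: "f j \<in> borel_measurable borel" for j using f[of j] by auto
  have F: "(\<lambda>x::real^'d. \<Prod>j\<in>UNIV. f j (x $ j)) \<in> borel_measurable borel"
    by (intro borel_measurable_prod measurable_compose[OF borel_measurable_vec_nth fm])
  show "integrable lborel (\<lambda>x::real^'d. \<Prod>j\<in>UNIV. f j (x $ j))"
    unfolding lborel_vec using PL.product_integrable_prod[of UNIV f] f
    by (subst integrable_distr_eq[OF m F]) auto
  show "(LINT x|lborel. (\<Prod>j\<in>UNIV. f j (x $ j))) = (\<Prod>j\<in>UNIV. LINT t|lborel. f j t)"
    using PL.product_integral_prod[of UNIV f] f unfolding lborel_vec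
    by (subst integral_distr[OF m F]) auto
qed

section \<open>Integration along a single coordinate\<close>

definition upd_vec :: "real^'d::finite \<Rightarrow> 'd \<Rightarrow> real \<Rightarrow> real^'d" where
  "upd_vec x j t = (\<chi> i. if i = j then t else x $ i)"

lemma upd_vec_nth [simp]: "upd_vec x j t $ i = (if i = j then t else x $ i)"
  by (simp add: upd_vec_def)

lemma upd_vec_same [simp]: "upd_vec x j (x $ j) = x"
  by (simp add: vec_eq_iff)

lemma upd_vec_eq: "upd_vec x j t = x + (t - x $ j) *\<^sub>R axis j 1"
  by (simp add: vec_eq_iff axis_def)

lemma measurable_upd_vec:
  "(\<lambda>p. upd_vec (fst p) j (snd p)) \<in> (lborel \<Otimes>\<^sub>M lborel) \<rightarrow>\<^sub>M (borel :: (real^'d::finite) measure)"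
  unfolding upd_vec_def by (rule borel_measurable_vec_lambda) measurable

text \<open>The splitting at a singleton, with the distinguished coordinate as a real number instead
  of a function on a one-point set; this spares a conversion whenever a line is integrated
  over.\<close>

definition mk_vec :: "'d::finite \<Rightarrow> real \<Rightarrow> ('d \<Rightarrow> real) \<Rightarrow> real^'d" where
  "mk_vec j t x = (\<chi> i. if i = j then t else x i)"

lemma mk_vec_nth [simp]: "mk_vec j t x $ i = (if i = j then t else x i)"
  by (simp add: mk_vec_def)

lemma upd_vec_mk_vec [simp]: "upd_vec (mk_vec j s x) j t = mk_vec j t x"
  by (simp add: vec_eq_iff)

lemma measurable_mk_vec [measurable]:
  "(\<lambda>p. mk_vec j (fst p) (snd p)) \<in> lborel \<Otimes>\<^sub>M (PiM (- {j}) (\<lambda>_. lborel)) \<rightarrow>\<^sub>M borel"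
  unfolding mk_vec_def
proof (rule borel_measurable_vec_lambda)
  fix i
  show "(\<lambda>p. if i = j then fst p else snd p i) \<in> borel_measurable (lborel \<Otimes>\<^sub>M PiM (- {j}) (\<lambda>_. lborel))"
  proof (cases "i = j")
    case False
    then have "i \<in> - {j}" by simp
    then have "(\<lambda>p. snd p i) \<in> (lborel \<Otimes>\<^sub>M PiM (- {j}) (\<lambda>_. lborel)) \<rightarrow>\<^sub>M lborel"
      by (intro measurable_compose[OF measurable_snd] measurable_component_singleton)
    then show ?thesis using False by simp
  qed simp
qed

lemma lborel_mk_vec:
  "(lborel :: (real^'d::finite) measure) =
     distr (lborel \<Otimes>\<^sub>M PiM (- {j}) (\<lambda>_. lborel)) borel (\<lambda>p. mk_vec j (fst p) (snd p))"
proof (rule lborel_eqI)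
  interpret B: finite_product_sigma_finite "\<lambda>_::'d. lborel :: real measure" "- {j}" by standard simp
  fix l u :: "real^'d" assume lu: "\<And>b. b \<in> Basis \<Longrightarrow> l \<bullet> b \<le> u \<bullet> b"
  have lu': "l $ i \<le> u $ i" for i
    using lu[of "axis i 1"] by (simp add: inner_axis axis_in_Basis_iff)
  have pre: "(\<lambda>p. mk_vec j (fst p) (snd p)) -` box l u \<inter> space (lborel \<Otimes>\<^sub>M PiM (- {j}) (\<lambda>_. lborel))
     = {l $ j<..<u $ j} \<times> (\<Pi>\<^sub>E i\<in>- {j}. {l $ i<..<u $ i})"
  proof (intro set_eqI)
    fix p :: "real \<times> ('d \<Rightarrow> real)"
    obtain t x where p: "p = (t, x)" by (cases p)
    have "(\<forall>i. l $ i < (if i = j then t else x i) \<and> (if i = j then t else x i) < u $ i)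
       \<longleftrightarrow> (l $ j < t \<and> t < u $ j) \<and> (\<forall>i\<in>- {j}. l $ i < x i \<and> x i < u $ i)"
    proof -
      have split: "(\<forall>i. P i) \<longleftrightarrow> P j \<and> (\<forall>i\<in>- {j}. P i)" for P by blast
      show ?thesis by (subst split) simp
    qed
    then show "p \<in> (\<lambda>p. mk_vec j (fst p) (snd p)) -` box l u \<inter> space (lborel \<Otimes>\<^sub>M PiM (- {j}) (\<lambda>_. lborel))
      \<longleftrightarrow> p \<in> {l $ j<..<u $ j} \<times> (\<Pi>\<^sub>E i\<in>- {j}. {l $ i<..<u $ i})"
      unfolding p by (simp only: vimage_eq Int_iff mem_box_cart mk_vec_nth fst_conv snd_conv
        mem_Times_iff space_pair_measure space_PiM PiE_iff greaterThanLessThan_iff space_lborel space_borel UNIV_I) blast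
  qed
  have "emeasure (distr (lborel \<Otimes>\<^sub>M PiM (- {j}) (\<lambda>_. lborel)) borel (\<lambda>p. mk_vec j (fst p) (snd p))) (box l u)
     = emeasure lborel {l $ j<..<u $ j} *
       emeasure (PiM (- {j}) (\<lambda>_. lborel)) (\<Pi>\<^sub>E i\<in>- {j}. {l $ i<..<u $ i})"
    by (subst emeasure_distr[OF measurable_mk_vec], simp, unfold pre,
        rule B.emeasure_pair_measure_Times) (auto intro!: sets_PiM_I_finite)
  also have "\<dots> = ennreal (u $ j - l $ j) * (\<Prod>i\<in>- {j}. ennreal (u $ i - l $ i))"
    using lu' by (simp add: B.measure_times)
  also have "\<dots> = (\<Prod>i\<in>UNIV. ennreal (u $ i - l $ i))"
    by (subst prod.remove[of UNIV j]) (simp_all add: Compl_eq_Diff_UNIV)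
  also have "\<dots> = ennreal (\<Prod>b\<in>Basis. (u - l) \<bullet> b)"
    using lu' by (simp add: prod_Basis_vec inner_axis prod_ennreal)
  finally show "emeasure (distr (lborel \<Otimes>\<^sub>M PiM (- {j}) (\<lambda>_. lborel)) borel (\<lambda>p. mk_vec j (fst p) (snd p))) (box l u)
     = (\<Prod>b\<in>Basis. (u - l) \<bullet> b)" by simp
qed simp

lemma nn_integral_mk_vec:
  fixes H :: "real^'d::finite \<Rightarrow> ennreal"
  assumes [measurable]: "H \<in> borel_measurable borel"
  shows "(\<integral>\<^sup>+x. H x \<partial>lborel) = (\<integral>\<^sup>+x. (\<integral>\<^sup>+t. H (mk_vec j t x) \<partial>lborel) \<partial>PiM (- {j}) (\<lambda>_. lborel))"
proof -
  interpret B: finite_product_sigma_finite "\<lambda>_::'d. lborel :: real measure" "- {j}" by standard simp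
  interpret P: pair_sigma_finite "lborel :: real measure" "PiM (- {j}) (\<lambda>_. lborel :: real measure)" by standard
  have "(\<integral>\<^sup>+x. H x \<partial>lborel) = (\<integral>\<^sup>+p. H (mk_vec j (fst p) (snd p)) \<partial>(lborel \<Otimes>\<^sub>M PiM (- {j}) (\<lambda>_. lborel)))"
    by (subst lborel_mk_vec[of j]) (simp add: nn_integral_distr)
  also have "\<dots> = (\<integral>\<^sup>+x. (\<integral>\<^sup>+t. H (mk_vec j (fst (t, x)) (snd (t, x))) \<partial>lborel) \<partial>PiM (- {j}) (\<lambda>_. lborel))"
    by (subst P.nn_integral_snd[symmetric]) measurable
  finally show ?thesis by simp
qed

text \<open>The inner integral does not depend on the coordinate j of x, so the outer integration
  over that coordinate only contributes the measure of A. A bound that is constant along each line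
  is thereby converted into one for the integral over the whole box.\<close>

lemma nn_integral_resample:
  fixes H :: "real^'d::finite \<Rightarrow> ennreal"
  assumes [measurable]: "H \<in> borel_measurable borel" "A \<in> sets borel"
  shows "(\<integral>\<^sup>+x. indicator A (x $ j) * (\<integral>\<^sup>+t. H (upd_vec x j t) \<partial>lborel) \<partial>lborel)
     = emeasure lborel A * (\<integral>\<^sup>+x. H x \<partial>lborel)"
proof -
  interpret B: finite_product_sigma_finite "\<lambda>_::'d. lborel :: real measure" "- {j}" by standard simp
  interpret P: pair_sigma_finite "lborel :: real measure" "PiM (- {j}) (\<lambda>_. lborel :: real measure)" by standard
  have [measurable]: "(\<lambda>x. \<integral>\<^sup>+t. H (upd_vec x j t) \<partial>lborel) \<in> borel_measurable borel"
    using lborel.borel_measurable_nn_integral_fst[of "\<lambda>p. H (upd_vec (fst p) j (snd p))" lborel]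
      measurable_compose[OF measurable_upd_vec[of j] assms(1)] by simp
  have m1 [measurable]: "(\<lambda>x. \<integral>\<^sup>+t. H (mk_vec j t x) \<partial>lborel) \<in> borel_measurable (PiM (- {j}) (\<lambda>_. lborel))"
    using lborel.borel_measurable_nn_integral_fst[of "\<lambda>p. H (mk_vec j (snd p) (fst p))" "PiM (- {j}) (\<lambda>_. lborel)"]
      measurable_compose[OF measurable_pair_swap' measurable_compose[OF measurable_mk_vec[of j] assms(1)]]
    by (simp add: case_prod_unfold)
  have "(\<integral>\<^sup>+x. indicator A (x $ j) * (\<integral>\<^sup>+t. H (upd_vec x j t) \<partial>lborel) \<partial>lborel)
     = (\<integral>\<^sup>+x. (\<integral>\<^sup>+s. indicator A s * (\<integral>\<^sup>+t. H (mk_vec j t x) \<partial>lborel) \<partial>lborel) \<partial>PiM (- {j}) (\<lambda>_. lborel))"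
    by (subst nn_integral_mk_vec[of _ j]) simp_all
  also have "\<dots> = (\<integral>\<^sup>+x. emeasure lborel A * (\<integral>\<^sup>+t. H (mk_vec j t x) \<partial>lborel) \<partial>PiM (- {j}) (\<lambda>_. lborel))"
    by (simp add: nn_integral_multc)
  also have "\<dots> = emeasure lborel A * (\<integral>\<^sup>+x. H x \<partial>lborel)"
    by (subst nn_integral_cmult[OF m1]) (simp add: nn_integral_mk_vec[of H j])
  finally show ?thesis .
qed

text \<open>In the partial integration for tensors the boundary terms vanish on every line parallel
  to an axis; Fubini's theorem then gives the identity in all variables.\<close>

lemma integral_zero_of_coordinate:
  fixes V :: "real^'d::finite \<Rightarrow> real"
  assumes V: "integrable lborel V" and z: "\<And>x. (LINT t|lborel. V (upd_vec x j t)) = 0"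
  shows "(LINT x|lborel. V x) = 0"
proof -
  interpret B: finite_product_sigma_finite "\<lambda>_::'d. lborel :: real measure" "- {j}" by standard simp
  interpret P: pair_sigma_finite "lborel :: real measure" "PiM (- {j}) (\<lambda>_. lborel :: real measure)" by standard
  have [measurable]: "V \<in> borel_measurable borel" using V by auto
  have i: "integrable (lborel \<Otimes>\<^sub>M PiM (- {j}) (\<lambda>_. lborel)) (\<lambda>p. V (mk_vec j (fst p) (snd p)))"
    using V by (subst (asm) lborel_mk_vec[of j]) (simp add: integrable_distr_eq)
  have "(LINT x|lborel. V x) = (LINT p|(lborel \<Otimes>\<^sub>M PiM (- {j}) (\<lambda>_. lborel)). V (mk_vec j (fst p) (snd p)))"
    by (subst lborel_mk_vec[of j]) (simp add: integral_distr)
  also have "\<dots> = (LINT x|PiM (- {j}) (\<lambda>_. lborel). (LINT t|lborel. V (mk_vec j t x)))"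
    using P.integral_snd[of "\<lambda>t x. V (mk_vec j t x)"] i by (simp add: case_prod_unfold)
  also have "\<dots> = 0"
  proof -
    have "(LINT t|lborel. V (mk_vec j t x)) = 0" for x
      using z[of "mk_vec j 0 x"] by simp
    then show ?thesis by simp
  qed
  finally show ?thesis .
qed

section \<open>Partial integrals of square integrable functions\<close>

text \<open>Cauchy and Schwarz against the indicator of A. A function that is not integrable is
  covered as well, since its integral is 0 by convention.\<close>

lemma square_integral_le:
  fixes f :: "'a \<Rightarrow> real"
  assumes [measurable]: "f \<in> borel_measurable M" "A \<in> sets M" and supp: "\<And>x. x \<in> space M \<Longrightarrow> x \<notin> A \<Longrightarrow> f x = 0"
  shows "ennreal ((LINT x|M. f x)\<^sup>2) \<le> emeasure M A * (\<integral>\<^sup>+x. ennreal ((f x)\<^sup>2) \<partial>M)"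
proof (cases "integrable M f")
  case True
  have "ennreal \<bar>LINT x|M. f x\<bar> \<le> (\<integral>\<^sup>+x. ennreal \<bar>f x\<bar> \<partial>M)"
    using integral_norm_bound_ennreal[OF True] by simp
  also have "\<dots> = (\<integral>\<^sup>+x. indicator A x * ennreal \<bar>f x\<bar> \<partial>M)"
    using supp by (intro nn_integral_cong) (auto simp: indicator_def)
  finally have "(ennreal \<bar>LINT x|M. f x\<bar>)\<^sup>2 \<le> (\<integral>\<^sup>+x. indicator A x * ennreal \<bar>f x\<bar> \<partial>M)\<^sup>2"
    by (intro power_mono) auto
  also have "\<dots> \<le> (\<integral>\<^sup>+x. (indicator A x)\<^sup>2 \<partial>M) * (\<integral>\<^sup>+x. (ennreal \<bar>f x\<bar>)\<^sup>2 \<partial>M)"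
    by (rule Cauchy_Schwarz_nn_integral) measurable
  also have "(\<integral>\<^sup>+x. (indicator A x)\<^sup>2 \<partial>M) = emeasure M A"
    by (subst nn_integral_indicator[symmetric, OF assms(2)], intro nn_integral_cong) (auto simp: indicator_def)
  finally show ?thesis by (simp add: ennreal_power)
qed (simp add: not_integrable_integral_eq)

lemma integrable_of_square_integrable:
  fixes f :: "'a \<Rightarrow> real"
  assumes [measurable]: "f \<in> borel_measurable M" "A \<in> sets M" and A: "emeasure M A < \<infinity>"
    and supp: "\<And>x. x \<in> space M \<Longrightarrow> x \<notin> A \<Longrightarrow> f x = 0" and f2: "integrable M (\<lambda>x. (f x)\<^sup>2)"
  shows "integrable M f"
proof (rule Bochner_Integration.integrable_bound)
  show "integrable M (\<lambda>x. indicator A x + (f x)\<^sup>2)"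
    using f2 A by (intro Bochner_Integration.integrable_add) auto
  have "\<bar>y\<bar> \<le> 1 + y\<^sup>2" for y :: real
    using zero_le_power2[of "\<bar>y\<bar> - 1 / 2"] by (simp add: power2_diff power_divide)
  then show "AE x in M. norm (f x) \<le> norm (indicator A x + (f x)\<^sup>2)"
    using supp by (auto simp: indicator_def intro!: AE_I2)
qed measurable

definition partial_integral :: "'d::finite set \<Rightarrow> (real^'d \<Rightarrow> real) \<Rightarrow> ('d \<Rightarrow> real) \<Rightarrow> real" where
  "partial_integral w V y = (LINT x|PiM (- w) (\<lambda>_. lborel). V (merge_vec w y x))"

text \<open>The contribution of one multi-index to the squared Sobolev norm, where w is the set of
  coordinates of top order. For functions that vanish outside the box no integration domain has to
  be carried along.\<close>

definition partial_sq :: "'d::finite set \<Rightarrow> (real^'d \<Rightarrow> real) \<Rightarrow> real" where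
  "partial_sq w V = (LINT y|PiM w (\<lambda>_. lborel). (partial_integral w V y)\<^sup>2)"

text \<open>Elements of L2 of the box are represented by everywhere defined functions that vanish
  outside it, so that differences and limits stay in the class without reference to a
  domain.\<close>

locale box_L2 =
  fixes a b :: "real^'d::finite" and V :: "real^'d \<Rightarrow> real"
  assumes ab: "\<And>j. a $ j \<le> b $ j"
    and V_measurable [measurable]: "V \<in> borel_measurable borel"
    and V_supp: "\<And>x. x \<notin> cbox a b \<Longrightarrow> V x = 0"
    and V_sq: "integrable lborel (\<lambda>x. (V x)\<^sup>2)"
begin

lemma nn_integral_merge:
  fixes H :: "real^'d \<Rightarrow> ennreal"
  assumes [measurable]: "H \<in> borel_measurable borel"
  shows "(\<integral>\<^sup>+x. H x \<partial>lborel) =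
     (\<integral>\<^sup>+y. (\<integral>\<^sup>+x. H (merge_vec w y x) \<partial>PiM (- w) (\<lambda>_. lborel)) \<partial>PiM w (\<lambda>_. lborel))"
proof -
  interpret B: finite_product_sigma_finite "\<lambda>_::'d. lborel :: real measure" "- w" by standard simp
  have "(\<integral>\<^sup>+x. H x \<partial>lborel) = (\<integral>\<^sup>+p. H (merge_vec w (fst p) (snd p)) \<partial>(PiM w (\<lambda>_. lborel) \<Otimes>\<^sub>M PiM (- w) (\<lambda>_. lborel)))"
    by (subst lborel_merge_vec[of w]) (simp add: nn_integral_distr)
  also have "\<dots> = (\<integral>\<^sup>+y. (\<integral>\<^sup>+x. H (merge_vec w (fst (y, x)) (snd (y, x))) \<partial>PiM (- w) (\<lambda>_. lborel)) \<partial>PiM w (\<lambda>_. lborel))"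
    by (subst B.nn_integral_fst[symmetric]) measurable
  finally show ?thesis by simp
qed

lemma section_measurable:
  assumes y: "y \<in> space (PiM w (\<lambda>_. lborel))"
  shows "(\<lambda>x. V (merge_vec w y x)) \<in> borel_measurable (PiM (- w) (\<lambda>_. lborel))"
  using measurable_compose[OF measurable_Pair1'[OF y] measurable_compose[OF measurable_merge_vec V_measurable]]
  by simp

lemma section_supp:
  assumes "x \<in> space (PiM (- w) (\<lambda>_. lborel))" "x \<notin> (\<Pi>\<^sub>E j\<in>- w. {a $ j..b $ j})"
  shows "V (merge_vec w y x) = 0"
proof (rule V_supp)
  show "merge_vec w y x \<notin> cbox a b"
    using assms by (auto simp: mem_box_cart space_PiM PiE_iff split: if_splits)
qed

lemma box_compl_measure:
  "emeasure (PiM (- w) (\<lambda>_. lborel)) (\<Pi>\<^sub>E j\<in>- w. {a $ j..b $ j}) = ennreal (\<Prod>j\<in>- w. b $ j - a $ j)"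
  using ab by (subst PL.emeasure_PiM) (auto simp: prod_ennreal)

lemma partial_integral_sq_le:
  assumes y: "y \<in> space (PiM w (\<lambda>_. lborel))"
  shows "ennreal ((partial_integral w V y)\<^sup>2) \<le>
    ennreal (\<Prod>j\<in>- w. b $ j - a $ j) * (\<integral>\<^sup>+x. ennreal ((V (merge_vec w y x))\<^sup>2) \<partial>PiM (- w) (\<lambda>_. lborel))"
  unfolding partial_integral_def box_compl_measure[symmetric]
  by (rule square_integral_le[OF section_measurable[OF y]])
     (auto intro!: section_supp sets_PiM_I_finite)

lemma partial_integral_measurable [measurable]:
  "partial_integral w V \<in> borel_measurable (PiM w (\<lambda>_. lborel))"
proof -
  interpret B: finite_product_sigma_finite "\<lambda>_::'d. lborel :: real measure" "- w" by standard simp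
  show ?thesis unfolding partial_integral_def
    using B.borel_measurable_lebesgue_integral[of "\<lambda>y x. V (merge_vec w y x)" "PiM w (\<lambda>_. lborel)"]
      measurable_compose[OF measurable_merge_vec[of w] V_measurable]
    by (simp add: case_prod_unfold)
qed

text \<open>Differences pass through \<open>partial_integral\<close> only where the sections are
  integrable; the exceptional y form a null set and do not affect \<open>partial_sq\<close>.\<close>

lemma AE_section_integrable:
  "AE y in PiM w (\<lambda>_. lborel). integrable (PiM (- w) (\<lambda>_. lborel)) (\<lambda>x. V (merge_vec w y x))"
proof -
  interpret B: finite_product_sigma_finite "\<lambda>_::'d. lborel :: real measure" "- w" by standard simp
  have m: "(\<lambda>y. \<integral>\<^sup>+x. ennreal ((V (merge_vec w y x))\<^sup>2) \<partial>PiM (- w) (\<lambda>_. lborel)) \<in> borel_measurable (PiM w (\<lambda>_. lborel))"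
    using B.borel_measurable_nn_integral_fst[of "\<lambda>p. ennreal ((V (merge_vec w (fst p) (snd p)))\<^sup>2)" "PiM w (\<lambda>_. lborel)"]
      measurable_compose[OF measurable_merge_vec[of w] V_measurable] by simp
  have "(\<integral>\<^sup>+x. ennreal ((V x)\<^sup>2) \<partial>lborel) < \<infinity>"
    using V_sq by (auto simp: integrable_iff_bounded)
  then have "(\<integral>\<^sup>+y. (\<integral>\<^sup>+x. ennreal ((V (merge_vec w y x))\<^sup>2) \<partial>PiM (- w) (\<lambda>_. lborel)) \<partial>PiM w (\<lambda>_. lborel)) \<noteq> \<infinity>"
    by (subst (asm) nn_integral_merge[where w = w]) auto
  then have "AE y in PiM w (\<lambda>_. lborel). (\<integral>\<^sup>+x. ennreal ((V (merge_vec w y x))\<^sup>2) \<partial>PiM (- w) (\<lambda>_. lborel)) \<noteq> \<infinity>"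
    by (rule nn_integral_PInf_AE[OF m])
  then show ?thesis
  proof (rule AE_mp, intro AE_I2 impI)
    fix y assume y: "y \<in> space (PiM w (\<lambda>_. lborel))"
      and fin: "(\<integral>\<^sup>+x. ennreal ((V (merge_vec w y x))\<^sup>2) \<partial>PiM (- w) (\<lambda>_. lborel)) \<noteq> \<infinity>"
    note [measurable] = section_measurable[OF y]
    show "integrable (PiM (- w) (\<lambda>_. lborel)) (\<lambda>x. V (merge_vec w y x))"
    proof (rule integrable_of_square_integrable[where A = "\<Pi>\<^sub>E j\<in>- w. {a $ j..b $ j}"])
      show "integrable (PiM (- w) (\<lambda>_. lborel)) (\<lambda>x. (V (merge_vec w y x))\<^sup>2)"
        using fin by (intro integrableI_bounded) (auto simp: less_top)
    qed (auto simp: box_compl_measure intro!: section_supp sets_PiM_I_finite)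
  qed
qed

text \<open>Integrating out the coordinates outside w costs at most their volume in the squared
  norm, by Cauchy and Schwarz on each section. Hence the terms of the Sobolev norm depend
  continuously on the derivative in L2.\<close>

lemma partial_sq_bound:
  shows "integrable (PiM w (\<lambda>_. lborel)) (\<lambda>y. (partial_integral w V y)\<^sup>2)"
    and "partial_sq w V \<le> (\<Prod>j\<in>- w. b $ j - a $ j) * (LINT x|lborel. (V x)\<^sup>2)"
proof -
  interpret B: finite_product_sigma_finite "\<lambda>_::'d. lborel :: real measure" "- w" by standard simp
  let ?v = "\<Prod>j\<in>- w. b $ j - a $ j"
  have v: "?v \<ge> 0" using ab by (intro prod_nonneg) auto
  have m: "(\<lambda>y. \<integral>\<^sup>+x. ennreal ((V (merge_vec w y x))\<^sup>2) \<partial>PiM (- w) (\<lambda>_. lborel)) \<in> borel_measurable (PiM w (\<lambda>_. lborel))"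
    using B.borel_measurable_nn_integral_fst[of "\<lambda>p. ennreal ((V (merge_vec w (fst p) (snd p)))\<^sup>2)" "PiM w (\<lambda>_. lborel)"]
      measurable_compose[OF measurable_merge_vec[of w] V_measurable] by simp
  have "(\<integral>\<^sup>+y. ennreal ((partial_integral w V y)\<^sup>2) \<partial>PiM w (\<lambda>_. lborel))
     \<le> (\<integral>\<^sup>+y. ennreal ?v * (\<integral>\<^sup>+x. ennreal ((V (merge_vec w y x))\<^sup>2) \<partial>PiM (- w) (\<lambda>_. lborel)) \<partial>PiM w (\<lambda>_. lborel))"
    by (intro nn_integral_mono partial_integral_sq_le)
  also have "\<dots> = ennreal ?v * (\<integral>\<^sup>+x. ennreal ((V x)\<^sup>2) \<partial>lborel)"
    by (subst nn_integral_cmult[OF m]) (subst nn_integral_merge[where w = w], auto)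
  also have "(\<integral>\<^sup>+x. ennreal ((V x)\<^sup>2) \<partial>lborel) = ennreal (LINT x|lborel. (V x)\<^sup>2)"
    using V_sq by (intro nn_integral_eq_integral) auto
  finally have le: "(\<integral>\<^sup>+y. ennreal ((partial_integral w V y)\<^sup>2) \<partial>PiM w (\<lambda>_. lborel)) \<le> ennreal (?v * (LINT x|lborel. (V x)\<^sup>2))"
    using v by (simp add: ennreal_mult')
  then show i: "integrable (PiM w (\<lambda>_. lborel)) (\<lambda>y. (partial_integral w V y)\<^sup>2)"
    by (intro integrableI_bounded) (auto simp: less_top[symmetric] top_unique)
  have "ennreal (partial_sq w V) \<le> ennreal (?v * (LINT x|lborel. (V x)\<^sup>2))"
    unfolding partial_sq_def using le nn_integral_eq_integral[OF i] by simp
  then show "partial_sq w V \<le> ?v * (LINT x|lborel. (V x)\<^sup>2)"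
    using v by (subst (asm) ennreal_le_iff) auto
qed

end

lemma box_L2_diff:
  assumes "box_L2 a b V1" "box_L2 a b V2"
  shows "box_L2 a b (\<lambda>x. V1 x - V2 x)"
proof -
  interpret V1: box_L2 a b V1 by fact
  interpret V2: box_L2 a b V2 by fact
  show ?thesis
  proof
    show "integrable lborel (\<lambda>x. (V1 x - V2 x)\<^sup>2)"
    proof (rule Bochner_Integration.integrable_bound)
      show "integrable lborel (\<lambda>x. 2 * (V1 x)\<^sup>2 + 2 * (V2 x)\<^sup>2)"
        using V1.V_sq V2.V_sq by auto
      have "(x - y)\<^sup>2 \<le> 2 * x\<^sup>2 + 2 * y\<^sup>2" for x y :: real
        using zero_le_power2[of "x + y"] by (simp add: power2_eq_square algebra_simps)
      then show "AE x in lborel. norm ((V1 x - V2 x)\<^sup>2) \<le> norm (2 * (V1 x)\<^sup>2 + 2 * (V2 x)\<^sup>2)"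
        by (intro AE_I2) simp
    qed measurable
  qed (use V1.ab V1.V_supp V2.V_supp in auto)
qed

text \<open>The inequality (p + q)^2 \<le> 2 p^2 + 2 q^2 takes the place of Minkowski's inequality;
  factors of 2 are absorbed into the final constant.\<close>

lemma partial_sq_diff_le:
  assumes "box_L2 a b V1" "box_L2 a b V2"
  shows "partial_sq w V1 \<le> 2 * partial_sq w V2 + 2 * partial_sq w (\<lambda>x. V1 x - V2 x)"
proof -
  interpret V1: box_L2 a b V1 by fact
  interpret V2: box_L2 a b V2 by fact
  interpret D: box_L2 a b "\<lambda>x. V1 x - V2 x" by (rule box_L2_diff) fact+
  have "partial_sq w V1 \<le> (LINT y|PiM w (\<lambda>_. lborel). 2 * (partial_integral w V2 y)\<^sup>2 +
      2 * (partial_integral w (\<lambda>x. V1 x - V2 x) y)\<^sup>2)"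
    unfolding partial_sq_def
  proof (rule integral_mono_AE)
    have sq: "p\<^sup>2 \<le> 2 * q\<^sup>2 + 2 * (p - q)\<^sup>2" for p q :: real
      using zero_le_power2[of "p - 2 * q"] by (simp add: power2_eq_square algebra_simps)
    show "AE y in PiM w (\<lambda>_. lborel). (partial_integral w V1 y)\<^sup>2 \<le> 2 * (partial_integral w V2 y)\<^sup>2 +
      2 * (partial_integral w (\<lambda>x. V1 x - V2 x) y)\<^sup>2"
      using V1.AE_section_integrable[of w] V2.AE_section_integrable[of w]
      by eventually_elim (use sq in \<open>simp add: partial_integral_def\<close>)
  qed (use V1.partial_sq_bound(1) V2.partial_sq_bound(1) D.partial_sq_bound(1) in auto)
  also have "\<dots> = 2 * partial_sq w V2 + 2 * partial_sq w (\<lambda>x. V1 x - V2 x)"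
    unfolding partial_sq_def using V2.partial_sq_bound(1) D.partial_sq_bound(1) by simp
  finally show ?thesis .
qed

section \<open>Smooth bump functions\<close>

text \<open>A smooth function is carried together with a named derivative of each order, so that
  iterated partial derivatives of products become products of named derivatives.\<close>

definition smooth_seq :: "(nat \<Rightarrow> real \<Rightarrow> real) \<Rightarrow> bool" where
  "smooth_seq D \<longleftrightarrow> (\<forall>k x. (D k has_real_derivative D (Suc k) x) (at x))"

lemma smooth_seqD: "smooth_seq D \<Longrightarrow> (D k has_real_derivative D (Suc k) x) (at x)"
  by (simp add: smooth_seq_def)

lemma smooth_seq_continuous: "smooth_seq D \<Longrightarrow> continuous_on S (D k)"
  by (meson DERIV_continuous_on has_field_derivative_at_within smooth_seqD)

lemma smooth_seq_scale:
  assumes "smooth_seq D"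
  shows "smooth_seq (\<lambda>k x. s ^ k * D k (s * x + t))"
  unfolding smooth_seq_def
proof (intro allI)
  fix k x
  have "((\<lambda>x. D k (s * x + t)) has_real_derivative D (Suc k) (s * x + t) * s) (at x)"
    by (rule DERIV_chain2[OF smooth_seqD[OF assms]]) (auto intro!: derivative_eq_intros)
  then show "((\<lambda>x. s ^ k * D k (s * x + t)) has_real_derivative s ^ Suc k * D (Suc k) (s * x + t)) (at x)"
    by (auto intro!: derivative_eq_intros)
qed

text \<open>Used at the two end points of the bump: a quadratic bound is all that is kept of the
  exponential decay there, and it suffices for the derivative to exist and vanish.\<close>

lemma has_real_derivative_zero_of_quadratic:
  fixes f :: "real \<Rightarrow> real"
  assumes f: "f x0 = 0" and b: "\<And>x. \<bar>f x\<bar> \<le> K * (x - x0)\<^sup>2"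
  shows "(f has_real_derivative 0) (at x0)"
  unfolding has_field_derivative_iff
proof (rule Lim_null_comparison)
  show "\<forall>\<^sub>F x in at x0. norm ((f x - f x0) / (x - x0)) \<le> K * \<bar>x - x0\<bar>"
    unfolding eventually_at_filter
  proof (intro always_eventually allI impI)
    fix x assume "x \<noteq> x0"
    then show "norm ((f x - f x0) / (x - x0)) \<le> K * \<bar>x - x0\<bar>"
    proof -
      have "norm ((f x - f x0) / (x - x0)) = \<bar>f x\<bar> / \<bar>x - x0\<bar>" by (simp add: f)
      also have "\<dots> \<le> (K * (x - x0)\<^sup>2) / \<bar>x - x0\<bar>" by (intro divide_right_mono b) simp
      also have "(x - x0)\<^sup>2 = \<bar>x - x0\<bar> * \<bar>x - x0\<bar>" by (simp add: power2_eq_square)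
      also have "K * (\<bar>x - x0\<bar> * \<bar>x - x0\<bar>) / \<bar>x - x0\<bar> = K * \<bar>x - x0\<bar>"
      proof -
        have "K * (d * d) / d = K * d" if "d \<noteq> 0" for d using that by simp
        then show ?thesis using \<open>x \<noteq> x0\<close> by (metis abs_eq_0 right_minus_eq)
      qed
      finally show ?thesis .
    qed
  qed
  show "((\<lambda>x. K * \<bar>x - x0\<bar>) \<longlongrightarrow> 0) (at x0)"
    by (auto intro!: tendsto_eq_intros)
qed

text \<open>With y = x (1 - x) this is p(x) exp (- c / y) y^(-k) on the open unit interval. The
  family is closed under differentiation, and the logarithm makes the power part of the exponent,
  for real k.\<close>

definition bump_term :: "real \<Rightarrow> real poly \<Rightarrow> real \<Rightarrow> real \<Rightarrow> real" where
  "bump_term c p k x =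
     (if 0 < x \<and> x < 1 then poly p x * exp (- c / (x * (1 - x)) - k * ln (x * (1 - x))) else 0)"

lemma bump_term_bound:
  assumes c: "c > 0" and k: "k \<ge> 0"
  obtains K where "\<And>x. \<bar>bump_term c p k x\<bar> \<le> K * x\<^sup>2" "\<And>x. \<bar>bump_term c p k x\<bar> \<le> K * (x - 1)\<^sup>2"
proof -
  have "bounded (poly p ` {0..1})"
    by (intro compact_imp_bounded compact_continuous_image continuous_intros) auto
  then obtain B where B: "B > 0" "\<And>x. x \<in> {0..1} \<Longrightarrow> \<bar>poly p x\<bar> \<le> B"
    unfolding bounded_pos by auto
  \<comment> \<open>K is the maximum of exp (- c / y) y^(-(k + 2)) over y > 0, attained at y = c /
    (k + 2). The inequality ln s \<le> s - 1 at s = c / ((k + 2) y) proves the bound; the two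
    additional powers of y give the quadratic decay at both ends.\<close>
  define K where "K = exp ((k + 2) * (ln ((k + 2) / c) - 1))"
  have main: "\<bar>bump_term c p k x\<bar> \<le> B * K * (x * (1 - x))\<^sup>2" if x: "0 < x" "x < 1" for x
  proof -
    define y where "y = x * (1 - x)"
    have y: "y > 0" using x by (simp add: y_def)
    have "ln ((1 / y) / ((k + 2) / c)) \<le> (1 / y) / ((k + 2) / c) - 1"
      using y c k by (intro ln_le_minus_one) auto
    moreover have "ln ((1 / y) / ((k + 2) / c)) = - ln y - ln ((k + 2) / c)"
      using y c k by (simp add: ln_div ln_mult)
    ultimately have "(k + 2) * (- ln y) \<le> (k + 2) * ((1 / y) / ((k + 2) / c) - 1 + ln ((k + 2) / c))"
      using k by (intro mult_left_mono) auto
    also have "\<dots> = c / y + (k + 2) * (ln ((k + 2) / c) - 1)"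
    proof -
      have "(1 / y) / ((k + 2) / c) = (c / y) / (k + 2)" by simp
      moreover have "(k + 2) * ((c / y) / (k + 2)) = c / y" using k by simp
      ultimately show ?thesis by (simp add: distrib_left right_diff_distrib del: times_divide_eq_right)
    qed
    finally have "- c / y - k * ln y \<le> (k + 2) * (ln ((k + 2) / c) - 1) + 2 * ln y"
      by (simp add: algebra_simps)
    then have "exp (- c / y - k * ln y) \<le> exp ((k + 2) * (ln ((k + 2) / c) - 1) + 2 * ln y)" by simp
    also have "\<dots> = K * y\<^sup>2"
    proof -
      have "exp (2 * ln y) = y\<^sup>2" using y by (simp only: mult_2 exp_add power2_eq_square exp_ln)
      then show ?thesis by (simp only: K_def exp_add)
    qed
    finally have "exp (- c / y - k * ln y) \<le> K * y\<^sup>2" .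
    then have "\<bar>poly p x\<bar> * exp (- c / y - k * ln y) \<le> B * (K * y\<^sup>2)"
      using B x by (intro mult_mono) auto
    then show ?thesis using x by (simp add: bump_term_def y_def[symmetric] abs_mult)
  qed
  show ?thesis
  proof (rule that[of "B * K"])
    fix x
    have BK: "B * K \<ge> 0" using B by (simp add: K_def)
    show "\<bar>bump_term c p k x\<bar> \<le> B * K * x\<^sup>2"
    proof (cases "0 < x \<and> x < 1")
      case True
      then have "(x * (1 - x))\<^sup>2 \<le> x\<^sup>2" by (intro power_mono) (auto simp: mult_left_le)
      then show ?thesis using main[of x] True BK by (meson mult_left_mono order_trans)
    qed (use BK in \<open>auto simp: bump_term_def\<close>)
    show "\<bar>bump_term c p k x\<bar> \<le> B * K * (x - 1)\<^sup>2"
    proof (cases "0 < x \<and> x < 1")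
      case True
      then have "(x * (1 - x))\<^sup>2 \<le> (1 - x)\<^sup>2" by (intro power_mono) (auto simp: mult_left_le_one_le)
      then show ?thesis using main[of x] True BK
        by (metis mult_left_mono order_trans power2_commute)
    qed (use BK in \<open>auto simp: bump_term_def\<close>)
  qed
qed

text \<open>The polynomial after one differentiation: the derivative of p exp (- c / Y) Y^(-k) is
  (p' Y^2 - k p Y' Y + c p Y') exp (- c / Y) Y^(-(k + 2)), where Y is x (1 - x). The exponent
  therefore grows by 2 at each step.\<close>

definition bump_step :: "real \<Rightarrow> real \<Rightarrow> real poly \<Rightarrow> real poly" where
  "bump_step c k p = (let Y = [:0, 1, -1:]; Y' = [:1, -2:] in
     pderiv p * Y * Y - smult k (p * Y' * Y) + smult c (p * Y'))"

lemma bump_term_deriv: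
  assumes c: "c > 0" and k: "k \<ge> 0"
  shows "(bump_term c p k has_real_derivative bump_term c (bump_step c k p) (k + 2) x) (at x)"
proof -
  obtain K where K: "\<And>x. \<bar>bump_term c p k x\<bar> \<le> K * x\<^sup>2" "\<And>x. \<bar>bump_term c p k x\<bar> \<le> K * (x - 1)\<^sup>2"
    using bump_term_bound[OF assms] by metis
  consider "x < 0" | "x > 1" | "x = 0" | "x = 1" | "0 < x" "x < 1" by linarith
  then show ?thesis
  proof cases
    case 1
    have "((\<lambda>_. 0) has_real_derivative 0) (at x)" by simp
    then have "(bump_term c p k has_real_derivative 0) (at x)"
      by (rule has_field_derivative_transform_within_open[of _ _ _ "{..<0}"]) (use 1 in \<open>auto simp: bump_term_def\<close>)
    then show ?thesis using 1 by (simp add: bump_term_def)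
  next
    case 2
    have "((\<lambda>_. 0) has_real_derivative 0) (at x)" by simp
    then have "(bump_term c p k has_real_derivative 0) (at x)"
      by (rule has_field_derivative_transform_within_open[of _ _ _ "{1<..}"]) (use 2 in \<open>auto simp: bump_term_def\<close>)
    then show ?thesis using 2 by (simp add: bump_term_def)
  next
    case 3
    have "(bump_term c p k has_real_derivative 0) (at 0)"
      by (rule has_real_derivative_zero_of_quadratic[of _ _ K]) (use K in \<open>auto simp: bump_term_def\<close>)
    then show ?thesis using 3 by (simp add: bump_term_def)
  next
    case 4
    have "(bump_term c p k has_real_derivative 0) (at 1)"
      by (rule has_real_derivative_zero_of_quadratic[of _ _ K]) (use K in \<open>auto simp: bump_term_def\<close>)
    then show ?thesis using 4 by (simp add: bump_term_def)
  next
    case 5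
    define y where "y = x * (1 - x)"
    have y: "y > 0" using 5 by (simp add: y_def)
    let ?f = "\<lambda>x. poly p x * exp (- c / (x * (1 - x)) - k * ln (x * (1 - x)))"
    let ?E = "exp (- c / y - k * ln y)"
    have "(?f has_real_derivative (poly (pderiv p) x * ?E + poly p x * (?E * (c * (1 - 2 * x) / y\<^sup>2 - k * ((1 - 2 * x) / y))))) (at x)"
    proof -
      have Y: "((\<lambda>x. x * (1 - x)) has_real_derivative (1 - 2 * x)) (at x)"
        by (auto intro!: derivative_eq_intros)
      have "((\<lambda>z. - c / z - k * ln z) has_real_derivative (c / y\<^sup>2 - k / y)) (at (x * (1 - x)))"
        using y unfolding y_def[symmetric]
        by (auto intro!: derivative_eq_intros simp: power2_eq_square divide_inverse)
      from DERIV_chain2[OF this Y]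
      have "((\<lambda>x. exp (- c / (x * (1 - x)) - k * ln (x * (1 - x)))) has_real_derivative
          ?E * ((c / y\<^sup>2 - k / y) * (1 - 2 * x))) (at x)"
        using DERIV_chain2[OF DERIV_exp] by (simp add: y_def)
      then have der: "(?f has_real_derivative (poly (pderiv p) x * ?E + ?E * ((c / y\<^sup>2 - k / y) * (1 - 2 * x)) * poly p x)) (at x)"
        using DERIV_mult[OF poly_DERIV] by (simp add: y_def)
      moreover have "(c / y\<^sup>2 - k / y) * (1 - 2 * x) = c * (1 - 2 * x) / y\<^sup>2 - k * ((1 - 2 * x) / y)"
        by (simp add: left_diff_distrib)
      ultimately have "?E * ((c / y\<^sup>2 - k / y) * (1 - 2 * x)) * poly p x
          = poly p x * (?E * (c * (1 - 2 * x) / y\<^sup>2 - k * ((1 - 2 * x) / y)))"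
        by (simp only: mult.commute)
      with der show ?thesis by (simp only:)
    qed
    also have "(poly (pderiv p) x * ?E + poly p x * (?E * (c * (1 - 2 * x) / y\<^sup>2 - k * ((1 - 2 * x) / y))))
       = (poly (pderiv p) x * y * y - k * (poly p x * (1 - 2 * x) * y) + c * (poly p x * (1 - 2 * x))) * (?E / y\<^sup>2)"
      using y by (simp add: field_simps power2_eq_square)
    also have "?E / y\<^sup>2 = exp (- c / y - (k + 2) * ln y)"
    proof -
      have "y\<^sup>2 = exp (2 * ln y)" by (simp only: mult_2 exp_add power2_eq_square exp_ln[OF y])
      then have "?E / y\<^sup>2 = exp ((- c / y - k * ln y) - 2 * ln y)" by (simp only: exp_diff)
      then show ?thesis by (simp add: algebra_simps)
    qed
    also have "poly (pderiv p) x * y * y - k * (poly p x * (1 - 2 * x) * y) + c * (poly p x * (1 - 2 * x))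
       = poly (bump_step c k p) x"
      by (simp add: bump_step_def Let_def y_def algebra_simps)
    finally have "(?f has_real_derivative bump_term c (bump_step c k p) (k + 2) x) (at x)"
      using 5 by (simp add: bump_term_def y_def)
    then show ?thesis
      by (rule has_field_derivative_transform_within_open[of _ _ _ "{0<..<1}"]) (use 5 in \<open>auto simp: bump_term_def\<close>)
  qed
qed

primrec bump_poly :: "real \<Rightarrow> nat \<Rightarrow> real poly" where
  "bump_poly c 0 = 1"
| "bump_poly c (Suc k) = bump_step c (2 * real k) (bump_poly c k)"

definition bump :: "real \<Rightarrow> nat \<Rightarrow> real \<Rightarrow> real" where
  "bump c k = bump_term c (bump_poly c k) (2 * real k)"

lemma smooth_seq_bump: "c > 0 \<Longrightarrow> smooth_seq (bump c)"
  unfolding smooth_seq_def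
proof (intro allI)
  fix k x assume "c > 0"
  then show "(bump c k has_real_derivative bump c (Suc k) x) (at x)"
    using bump_term_deriv[of c "2 * real k" "bump_poly c k" x] by (simp add: bump_def algebra_simps)
qed

lemma bump_0: "bump c 0 x = (if 0 < x \<and> x < 1 then exp (- c / (x * (1 - x))) else 0)"
  by (simp add: bump_def bump_term_def)

section \<open>Product test functions\<close>

lemma differentiable_prod_seq:
  assumes "\<And>j. smooth_seq (\<Psi> j)"
  shows "(\<lambda>x::real^'d::finite. \<Prod>j\<in>I. \<Psi> j (k j) (x $ j)) differentiable (at x)"
proof -
  have "(\<lambda>x::real^'d. \<Psi> j (k j) (x $ j)) differentiable (at x)" for j
  proof (rule differentiable_compose[where f = "\<Psi> j (k j)" and g = "\<lambda>x. x $ j"])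
    show "\<Psi> j (k j) differentiable at (x $ j)"
      using smooth_seqD[OF assms] by (auto simp: real_differentiable_def)
    show "(\<lambda>x::real^'d. x $ j) differentiable at x"
      by (intro bounded_linear_imp_differentiable bounded_linear_vec_nth)
  qed
  then show ?thesis
    by (induction I rule: infinite_finite_induct) auto
qed

lemma partial_deriv_prod:
  fixes \<Psi> :: "'d::finite \<Rightarrow> nat \<Rightarrow> real \<Rightarrow> real"
  assumes "\<And>j. smooth_seq (\<Psi> j)"
  shows "partial_deriv j (\<lambda>x. \<Prod>i\<in>UNIV. \<Psi> i (k i) (x $ i)) = (\<lambda>x. \<Prod>i\<in>UNIV. \<Psi> i ((k(j := Suc (k j))) i) (x $ i))"
proof
  fix x :: "real^'d"
  have "((\<lambda>t. \<Psi> j (k j) (x $ j + t)) has_real_derivative \<Psi> j (Suc (k j)) (x $ j) * 1) (at 0)"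
    using smooth_seqD[OF assms, of j "k j" "x $ j + 0"]
    by (intro DERIV_chain2[of "\<Psi> j (k j)"]) (auto intro!: derivative_eq_intros)
  then have "((\<lambda>t. \<Psi> j (k j) (x $ j + t) * (\<Prod>i\<in>UNIV - {j}. \<Psi> i (k i) (x $ i))) has_real_derivative
       \<Psi> j (Suc (k j)) (x $ j) * (\<Prod>i\<in>UNIV - {j}. \<Psi> i (k i) (x $ i))) (at 0)"
    by (auto intro!: derivative_eq_intros)
  moreover have "(\<lambda>t. \<Prod>i\<in>UNIV. \<Psi> i (k i) ((x + t *\<^sub>R axis j 1) $ i))
     = (\<lambda>t. \<Psi> j (k j) (x $ j + t) * (\<Prod>i\<in>UNIV - {j}. \<Psi> i (k i) (x $ i)))"
  proof
    fix t
    show "(\<Prod>i\<in>UNIV. \<Psi> i (k i) ((x + t *\<^sub>R axis j 1) $ i)) = \<Psi> j (k j) (x $ j + t) * (\<Prod>i\<in>UNIV - {j}. \<Psi> i (k i) (x $ i))"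
      by (subst prod.remove[of UNIV j]) (auto simp: axis_def intro!: prod.cong)
  qed
  moreover have "(\<Prod>i\<in>UNIV. \<Psi> i ((k(j := Suc (k j))) i) (x $ i)) = \<Psi> j (Suc (k j)) (x $ j) * (\<Prod>i\<in>UNIV - {j}. \<Psi> i (k i) (x $ i))"
    by (subst prod.remove[of UNIV j]) (auto intro!: prod.cong)
  ultimately show "partial_deriv j (\<lambda>x. \<Prod>i\<in>UNIV. \<Psi> i (k i) (x $ i)) x = (\<Prod>i\<in>UNIV. \<Psi> i ((k(j := Suc (k j))) i) (x $ i))"
    by (simp add: partial_deriv_def DERIV_imp_deriv)
qed

text \<open>Each partial derivative raises the order of one factor, so all iterated partial
  derivatives are products of the same shape and hence differentiable.\<close>

lemma smooth_prod:
  fixes \<Psi> :: "'d::finite \<Rightarrow> nat \<Rightarrow> real \<Rightarrow> real"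
  assumes "\<And>j. smooth_seq (\<Psi> j)"
  shows "smooth (\<lambda>x. \<Prod>i\<in>UNIV. \<Psi> i 0 (x $ i))"
proof -
  have "\<exists>k. foldr partial_deriv js (\<lambda>x. \<Prod>i\<in>UNIV. \<Psi> i 0 (x $ i)) = (\<lambda>x. \<Prod>i\<in>UNIV. \<Psi> i (k i) (x $ i))" for js
  proof (induction js)
    case (Cons j js)
    then obtain k where "foldr partial_deriv js (\<lambda>x. \<Prod>i\<in>UNIV. \<Psi> i 0 (x $ i)) = (\<lambda>x. \<Prod>i\<in>UNIV. \<Psi> i (k i) (x $ i))"
      by blast
    then have "foldr partial_deriv (j # js) (\<lambda>x. \<Prod>i\<in>UNIV. \<Psi> i 0 (x $ i))
      = (\<lambda>x. \<Prod>i\<in>UNIV. \<Psi> i ((k(j := Suc (k j))) i) (x $ i))"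
      by (simp only: foldr_Cons comp_apply partial_deriv_prod[OF assms])
    then show ?case by blast
  qed auto
  note ex = this
  show ?thesis unfolding smooth_def
  proof (intro allI)
    fix js x
    obtain k where "foldr partial_deriv js (\<lambda>x. \<Prod>i\<in>UNIV. \<Psi> i 0 (x $ i)) = (\<lambda>x. \<Prod>i\<in>UNIV. \<Psi> i (k i) (x $ i))"
      using ex by blast
    then show "foldr partial_deriv js (\<lambda>x. \<Prod>i\<in>UNIV. \<Psi> i 0 (x $ i)) differentiable at x"
      using differentiable_prod_seq[of \<Psi>, OF assms] by simp
  qed
qed

text \<open>The box is shrunk by s on every side to obtain compact support inside the open box. The
  margin s and the constant 1 / (m + 1) in the exponent tend to 0, which drives the bump to the
  indicator of the box; the denominator m + 3 ensures 2 s < u - l already for m = 0.\<close>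

definition box_bump :: "real^'d::finite \<Rightarrow> real^'d \<Rightarrow> nat \<Rightarrow> real^'d \<Rightarrow> real" where
  "box_bump l u m x = (\<Prod>j\<in>UNIV. let s = (u $ j - l $ j) / real (m + 3) in
     bump (1 / real (Suc m)) 0 ((x $ j - (l $ j + s)) / (u $ j - l $ j - 2 * s)))"

lemma box_bump_test:
  fixes l u :: "real^'d::finite"
  assumes lu: "\<And>j. l $ j < u $ j" and sub: "box l u \<subseteq> S"
  shows "box_bump l u m \<in> test_functions S"
proof -
  define s where "s j = (u $ j - l $ j) / real (m + 3)" for j
  define c where "c = 1 / real (Suc m)"
  define \<sigma> where "\<sigma> j = 1 / (u $ j - l $ j - 2 * s j)" for j
  have s: "s j > 0" "2 * s j < u $ j - l $ j" for j
    using lu[of j] mult_strict_left_mono[OF lu[of j], of "1 + real m"]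
    by (auto simp: s_def field_simps)
  have eq: "box_bump l u m = (\<lambda>x. \<Prod>j\<in>UNIV. (\<lambda>k x. \<sigma> j ^ k * bump c k (\<sigma> j * x + (- (l $ j + s j) * \<sigma> j))) 0 (x $ j))"
  proof
    fix x :: "real^'d"
    have "(y - (l $ j + s j)) / (u $ j - l $ j - 2 * s j) = \<sigma> j * y + (- (l $ j + s j) * \<sigma> j)" for y j
    proof -
      have "\<sigma> j * y + (- (l $ j + s j) * \<sigma> j) = (y - (l $ j + s j)) * \<sigma> j" by (simp add: algebra_simps)
      then show ?thesis by (simp add: \<sigma>_def)
    qed
    then show "box_bump l u m x = (\<Prod>j\<in>UNIV. (\<lambda>k x. \<sigma> j ^ k * bump c k (\<sigma> j * x + (- (l $ j + s j) * \<sigma> j))) 0 (x $ j))"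
      unfolding box_bump_def Let_def s_def[symmetric] c_def[symmetric] by simp
  qed
  have "smooth (box_bump l u m)"
    unfolding eq by (intro smooth_prod smooth_seq_scale smooth_seq_bump) (simp add: c_def)
  moreover have "compact (cbox (\<chi> j. l $ j + s j) (\<chi> j. u $ j - s j))" by (rule compact_cbox)
  moreover have "cbox (\<chi> j. l $ j + s j) (\<chi> j. u $ j - s j) \<subseteq> S"
    using s(1) by (intro order_trans[OF _ sub]) (auto simp: mem_box_cart, (smt (verit))+)
  moreover have "box_bump l u m x = 0" if "x \<notin> cbox (\<chi> j. l $ j + s j) (\<chi> j. u $ j - s j)" for x
  proof -
    have "\<exists>j. \<not> (l $ j + s j \<le> x $ j \<and> x $ j \<le> u $ j - s j)"
      using that by (simp add: mem_box_cart)
    then obtain j where j: "x $ j < l $ j + s j \<or> x $ j > u $ j - s j"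
      by (auto simp: not_le)
    then have "(x $ j - (l $ j + s j)) / (u $ j - l $ j - 2 * s j) < 0 \<or> (x $ j - (l $ j + s j)) / (u $ j - l $ j - 2 * s j) > 1"
      using s(2)[of j] by (auto simp: field_simps)
    then have "bump c 0 ((x $ j - (l $ j + s j)) / (u $ j - l $ j - 2 * s j)) = 0"
      by (auto simp: bump_0)
    then show ?thesis
      unfolding box_bump_def Let_def s_def[symmetric] c_def[symmetric]
      by (subst prod_zero_iff) auto
  qed
  ultimately show ?thesis unfolding test_functions_def by blast
qed

lemma bump_0_bounds: "c \<ge> 0 \<Longrightarrow> 0 \<le> bump c 0 t" "c \<ge> 0 \<Longrightarrow> bump c 0 t \<le> 1"
  by (auto simp: bump_0)

lemma box_bump_bounds: "0 \<le> box_bump l u m x" "box_bump l u m x \<le> 1"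
  unfolding box_bump_def Let_def by (auto intro!: prod_nonneg prod_le_1 bump_0_bounds)

lemma box_bump_tendsto:
  fixes l u :: "real^'d::finite"
  assumes lu: "\<And>j. l $ j < u $ j"
  shows "(\<lambda>m. box_bump l u m x) \<longlonglongrightarrow> indicator (box l u) x"
proof (cases "x \<in> box l u")
  case False
  have "box_bump l u m x = 0" for m
  proof -
    define s where "s j = (u $ j - l $ j) / real (m + 3)" for j
    have s: "s j > 0" "2 * s j < u $ j - l $ j" for j
      using lu[of j] mult_strict_left_mono[OF lu[of j], of "1 + real m"]
      by (auto simp: s_def field_simps)
    obtain j where j: "x $ j \<le> l $ j \<or> x $ j \<ge> u $ j"
      using False by (auto simp: mem_box_cart not_less)
    then have "(x $ j - (l $ j + s j)) / (u $ j - l $ j - 2 * s j) < 0 \<or> (x $ j - (l $ j + s j)) / (u $ j - l $ j - 2 * s j) > 1"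
      using s(1)[of j] s(2)[of j] by (auto simp: field_simps)
    then have "bump (1 / real (Suc m)) 0 ((x $ j - (l $ j + s j)) / (u $ j - l $ j - 2 * s j)) = 0"
      by (auto simp: bump_0)
    then show ?thesis
      unfolding box_bump_def Let_def s_def[symmetric]
      by (subst prod_zero_iff) auto
  qed
  then show ?thesis using False by simp
next
  case True
  then have x: "l $ j < x $ j" "x $ j < u $ j" for j by (auto simp: mem_box_cart)
  have "(\<lambda>m. let s = (u $ j - l $ j) / real (m + 3) in
     bump (1 / real (Suc m)) 0 ((x $ j - (l $ j + s)) / (u $ j - l $ j - 2 * s))) \<longlonglongrightarrow> 1" for j
  proof -
    define p where "p m = (x $ j - (l $ j + (u $ j - l $ j) / real (m + 3))) / (u $ j - l $ j - 2 * ((u $ j - l $ j) / real (m + 3)))" for m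
    define P where "P = (x $ j - l $ j) / (u $ j - l $ j)"
    have P: "0 < P" "P < 1" using x[of j] lu[of j] by (auto simp: P_def field_simps)
    have z: "(\<lambda>m. (u $ j - l $ j) / real (m + 3)) \<longlonglongrightarrow> 0"
      using LIMSEQ_ignore_initial_segment[OF lim_const_over_n[of "u $ j - l $ j"], of 3] .
    have "p \<longlonglongrightarrow> (x $ j - (l $ j + 0)) / (u $ j - l $ j - 2 * 0)"
      unfolding p_def using lu[of j] by (intro tendsto_intros z) auto
    then have pP: "p \<longlonglongrightarrow> P" by (simp add: P_def)
    have ev: "\<forall>\<^sub>F m in sequentially. 0 < p m \<and> p m < 1"
      using order_tendstoD[OF pP] P by (auto intro: eventually_conj)
    have "(\<lambda>m. exp (- (1 / real (Suc m)) / (p m * (1 - p m)))) \<longlonglongrightarrow> exp (- 0 / (P * (1 - P)))"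
      using P lim_1_over_n[THEN LIMSEQ_Suc] by (intro tendsto_intros pP) auto
    then have "(\<lambda>m. exp (- (1 / real (Suc m)) / (p m * (1 - p m)))) \<longlonglongrightarrow> 1" by simp
    moreover have "\<forall>\<^sub>F m in sequentially. exp (- (1 / real (Suc m)) / (p m * (1 - p m))) = bump (1 / real (Suc m)) 0 (p m)"
      using ev by eventually_elim (simp add: bump_0)
    ultimately have "(\<lambda>m. bump (1 / real (Suc m)) 0 (p m)) \<longlonglongrightarrow> 1"
      by (rule Lim_transform_eventually)
    then show ?thesis by (simp add: p_def Let_def)
  qed
  then have "(\<lambda>m. box_bump l u m x) \<longlonglongrightarrow> (\<Prod>j\<in>(UNIV::'d set). 1)"
    unfolding box_bump_def by (intro tendsto_prod)
  then show ?thesis using True by simp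
qed

section \<open>Uniqueness of weak derivatives\<close>

lemma AE_not_frontier_cbox: "AE x in lborel. x \<in> cbox a b \<longrightarrow> x \<in> box a b"
proof -
  have "cbox a b - box a b \<in> null_sets lebesgue"
    using negligible_frontier_interval negligible_iff_null_sets by blast
  then obtain N where "N \<in> null_sets lborel" "cbox a b - box a b \<subseteq> N"
    unfolding null_sets_completion_iff2 by blast
  then show ?thesis by (intro AE_I'[of N]) auto
qed

text \<open>The fundamental lemma of the calculus of variations. Bumps converge boundedly to
  indicators of open boxes, so V has integral 0 over every box inside the interior. Open boxes form
  an intersection stable generator of the Borel sets, which extends this to all Borel sets and
  forces V to vanish almost everywhere.\<close>

lemma AE_zero_of_test_functions:
  fixes V :: "real^'d::finite \<Rightarrow> real"
  assumes V: "integrable lborel V" and supp: "\<And>x. x \<notin> cbox a b \<Longrightarrow> V x = 0"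
    and ort: "\<And>\<phi>. \<phi> \<in> test_functions (box a b) \<Longrightarrow> (LINT x|lborel. V x * \<phi> x) = 0"
  shows "AE x in lborel. V x = 0"
proof -
  have [measurable]: "V \<in> borel_measurable borel" using V by auto
  have box0: "(LINT x:(box l u \<inter> box a b)|lborel. V x) = 0" for l u :: "real^'d"
  proof (cases "box l u \<inter> box a b = {}")
    case False
    define l' u' where "l' = (\<chi> j. max (l $ j) (a $ j))" and "u' = (\<chi> j. min (u $ j) (b $ j))"
    have eq: "box l u \<inter> box a b = box l' u'"
      by (auto simp: l'_def u'_def mem_box_cart)
    then have lu: "l' $ j < u' $ j" for j
    proof -
      obtain x where "x \<in> box l' u'" using False eq by auto
      then have "l' $ j < x $ j" "x $ j < u' $ j" by (auto simp: mem_box_cart)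
      then show ?thesis by simp
    qed
    have "(\<lambda>m. LINT x|lborel. V x * box_bump l' u' m x) \<longlonglongrightarrow> (LINT x|lborel. V x * indicator (box l' u') x)"
    proof (rule integral_dominated_convergence[where w = "\<lambda>x. \<bar>V x\<bar>"])
      show "integrable lborel (\<lambda>x. \<bar>V x\<bar>)" using V by auto
      show "(\<lambda>x. V x * box_bump l' u' m x) \<in> borel_measurable lborel" for m
      proof -
        have "box_bump l' u' m \<in> test_functions (box l' u')" by (rule box_bump_test[OF lu]) auto
        then have "\<forall>x. foldr partial_deriv [] (box_bump l' u' m) differentiable at x"
          unfolding test_functions_def smooth_def by blast
        then have "continuous_on UNIV (box_bump l' u' m)"
          by (simp add: continuous_at_imp_continuous_on differentiable_imp_continuous_within)
        then have [measurable]: "box_bump l' u' m \<in> borel_measurable borel"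
          by (rule borel_measurable_continuous_onI)
        show ?thesis by measurable
      qed
      show "AE x in lborel. (\<lambda>m. V x * box_bump l' u' m x) \<longlonglongrightarrow> V x * indicator (box l' u') x"
        by (intro AE_I2 tendsto_intros box_bump_tendsto lu)
      show "AE x in lborel. norm (V x * box_bump l' u' m x) \<le> \<bar>V x\<bar>" for m
        using box_bump_bounds[of l' u' m] by (intro AE_I2) (auto simp: abs_mult intro!: mult_left_le)
    qed measurable
    moreover have "(LINT x|lborel. V x * box_bump l' u' m x) = 0" for m
      by (intro ort box_bump_test[OF lu]) (auto simp flip: eq)
    ultimately have "(LINT x|lborel. V x * indicator (box l' u') x) = 0"
      by (simp add: LIMSEQ_const_iff)
    then show ?thesis unfolding eq by (simp add: set_lebesgue_integral_def mult.commute)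
  qed (simp add: set_lebesgue_integral_def)
  define W where "W x = indicator (box a b) x * V x" for x
  have W: "integrable lborel W" unfolding W_def
    using integrable_mult_indicator[OF _ V, of "box a b"] by simp
  have "(LINT x:A|lborel. W x) = 0" if A: "A \<in> sets borel" for A
  proof -
    let ?G = "range (\<lambda>(l, u). box l u :: (real^'d) set)"
    have all0: "(LINT x|lborel. W x) = 0"
      using box0[of a b] by (simp add: W_def[abs_def] set_lebesgue_integral_def)
    have Wi: "set_integrable lborel B W" if "B \<in> sets borel" for B
      unfolding set_integrable_def using integrable_mult_indicator[OF _ W, of B] that by simp
    have st: "Int_stable ?G" by (auto simp: Int_stable_def box_Int_box)
    have bs: "sets (borel :: (real^'d) measure) = sigma_sets UNIV ?G"
      by (simp add: borel_eq_box)
    have "?G \<subseteq> Pow UNIV" by simp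
    moreover have "A \<in> sigma_sets UNIV ?G" using A bs by simp
    ultimately show ?thesis
    proof (induction rule: sigma_sets_induct_disjoint[OF st, consumes 2, case_names basic empty compl union])
      case (basic B)
      then obtain l u where B: "B = box l u" by auto
      have "(\<lambda>x. indicator B x *\<^sub>R W x) = (\<lambda>x. indicator (box l u \<inter> box a b) x *\<^sub>R V x)"
        by (auto simp: W_def B indicator_def)
      then show ?case using box0[of l u] by (simp add: set_lebesgue_integral_def)
    next
      case (compl B)
      have "(\<lambda>x. indicator (UNIV - B) x *\<^sub>R W x) = (\<lambda>x. W x - indicator B x *\<^sub>R W x)"
        by (auto simp: indicator_def)
      then have "(LINT x:UNIV - B|lborel. W x) = (LINT x|lborel. W x) - (LINT x:B|lborel. W x)"
        using W Wi[of B] compl(1) bs unfolding set_lebesgue_integral_def set_integrable_def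
        by (simp add: Bochner_Integration.integral_diff)
      then show ?case using compl(2) all0 by simp
    next
      case (union B)
      have "(LINT x:(\<Union>i. B i)|lborel. W x) = (\<Sum>i. (LINT x:(B i)|lborel. W x))"
      proof (intro lebesgue_integral_countable_add Wi)
        show B: "B i \<in> sets lborel" for i using union(2) bs by auto
        show "(\<Union>i. B i) \<in> sets borel" using B by (intro sets.countable_UN) auto
      qed (use union(1) in \<open>auto simp: disjoint_family_on_def\<close>)
      then show ?case using union by simp
    qed (auto simp: set_lebesgue_integral_def)
  qed
  then have "AE x in lborel. W x = 0"
    using density_unique_real[OF W, of "\<lambda>_. 0"] by (auto simp: set_lebesgue_integral_def)
  then show ?thesis using AE_not_frontier_cbox[of a b]
    by eventually_elim (use supp in \<open>auto simp: W_def indicator_def split: if_splits\<close>)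
qed

section \<open>Completeness of the square integrable functions on a box\<close>

text \<open>The theorem of Riesz and Fischer for functions supported in the box: a rapidly
  converging subsequence has absolutely summable increments almost everywhere, and Fatou's lemma
  carries the Cauchy estimate over to the limit for the whole sequence.\<close>

lemma box_L2_complete:
  assumes H: "\<And>k. box_L2 a b (H k)"
    and cauchy: "\<And>\<epsilon>. \<epsilon> > 0 \<Longrightarrow> \<exists>N. \<forall>k\<ge>N. \<forall>l\<ge>N. (LINT x|lborel. (H k x - H l x)\<^sup>2) < \<epsilon>"
  obtains W where "box_L2 a b W" "(\<lambda>k. LINT x|lborel. (H k x - W x)\<^sup>2) \<longlonglongrightarrow> 0"
proof -
  interpret H: box_L2 a b "H k" for k by (rule H)
  interpret D: box_L2 a b "\<lambda>x. H k x - H l x" for k l by (rule box_L2_diff[OF H H])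
  define v where "v = emeasure lborel (cbox a b)"
  have v: "v < \<infinity>" unfolding v_def by (intro emeasure_bounded_finite bounded_cbox)
  have "\<exists>N. \<forall>k\<ge>N. \<forall>l\<ge>N. (LINT x|lborel. (H k x - H l x)\<^sup>2) < (1/4) ^ n" for n
    by (rule cauchy) simp
  then obtain N where N: "\<And>n k l. k \<ge> N n \<Longrightarrow> l \<ge> N n \<Longrightarrow> (LINT x|lborel. (H k x - H l x)\<^sup>2) < (1/4) ^ n"
    by metis
  \<comment> \<open>The partial sums make \<open>r n\<close> and \<open>r (Suc n)\<close> both at
    least \<open>N n\<close>, so that consecutive terms are close; the summand n makes r exceed any
    given index, as the use of Fatou's lemma requires.\<close>
  define r where "r n = (\<Sum>i\<le>n. N i) + n" for n
  have r1: "r n \<ge> N n" for n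
    unfolding r_def by (rule order_trans[of _ "\<Sum>i\<le>n. N i"]) (auto intro!: member_le_sum)
  have r2: "r (Suc n) \<ge> N n" for n
  proof -
    have "N n \<le> (\<Sum>i\<le>Suc n. N i)" by (rule member_le_sum) auto
    then show ?thesis unfolding r_def by linarith
  qed
  have r3: "r n \<ge> n" for n by (simp add: r_def)
  define \<Delta> where "\<Delta> n x = H (r (Suc n)) x - H (r n) x" for n x
  have nn_eq: "(\<integral>\<^sup>+x. ennreal ((H k x - H l x)\<^sup>2) \<partial>lborel) = ennreal (LINT x|lborel. (H k x - H l x)\<^sup>2)" for k l
    using D.V_sq by (intro nn_integral_eq_integral) auto
  have bound: "(\<integral>\<^sup>+x. ennreal \<bar>\<Delta> n x\<bar> \<partial>lborel) \<le> ennreal ((1/2)^n) * (v + 1)" for n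
  proof -
    \<comment> \<open>This weighted form of |y| \<le> 1 + y^2 balances the volume against the
      squared norm: a squared L2 norm below 4^(-n) becomes an L1 norm of order 2^(-n).\<close>
    have am: "\<bar>y\<bar> \<le> (1/2)^n * 1 + 2^n * y\<^sup>2" for y :: real
    proof -
      have "0 \<le> (2^n * \<bar>y\<bar> - 1/2)\<^sup>2" by simp
      then have "2^n * \<bar>y\<bar> \<le> 1 + 2^n * (2^n * y\<^sup>2)"
        by (simp add: power2_diff power_mult_distrib) (simp add: power2_eq_square mult.assoc power_divide)
      then have "(1/2)^n * (2^n * \<bar>y\<bar>) \<le> (1/2)^n * (1 + 2^n * (2^n * y\<^sup>2))"
        by (intro mult_left_mono) auto
      also have "(1/2)^n * (2^n * \<bar>y\<bar>) = \<bar>y\<bar>" by (simp add: power_divide)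
      also have "(1/2)^n * (1 + 2^n * (2^n * y\<^sup>2)) = (1/2)^n * 1 + 2^n * y\<^sup>2"
        by (simp add: distrib_left power_divide)
      finally show ?thesis .
    qed
    have "(\<integral>\<^sup>+x. ennreal \<bar>\<Delta> n x\<bar> \<partial>lborel)
      \<le> (\<integral>\<^sup>+x. ennreal ((1/2)^n) * indicator (cbox a b) x + ennreal (2^n) * ennreal ((H (r (Suc n)) x - H (r n) x)\<^sup>2) \<partial>lborel)"
    proof (rule nn_integral_mono)
      fix x
      show "ennreal \<bar>\<Delta> n x\<bar> \<le> ennreal ((1/2)^n) * indicator (cbox a b) x + ennreal (2^n) * ennreal ((H (r (Suc n)) x - H (r n) x)\<^sup>2)"
      proof (cases "x \<in> cbox a b")
        case True
        have "ennreal \<bar>\<Delta> n x\<bar> \<le> ennreal ((1/2)^n * 1 + 2^n * (\<Delta> n x)\<^sup>2)" by (intro ennreal_leI am)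
        then show ?thesis using True by (simp add: \<Delta>_def ennreal_plus ennreal_mult')
      qed (simp add: \<Delta>_def H.V_supp)
    qed
    also have "\<dots> = ennreal ((1/2)^n) * v + ennreal (2^n) * ennreal (LINT x|lborel. (H (r (Suc n)) x - H (r n) x)\<^sup>2)"
      by (simp add: nn_integral_add nn_integral_cmult nn_eq v_def)
    also have "\<dots> \<le> ennreal ((1/2)^n) * v + ennreal (2^n) * ennreal ((1/4)^n)"
      using N[OF r2[of n] r1[of n]] by (intro add_mono mult_left_mono ennreal_leI) auto
    also have "ennreal (2^n) * ennreal ((1/4)^n) = ennreal ((1/2)^n)"
      by (simp add: ennreal_mult'[symmetric] power_mult_distrib[symmetric])
    finally show ?thesis by (simp add: distrib_left)
  qed
  have "(\<integral>\<^sup>+x. (\<Sum>n. ennreal \<bar>\<Delta> n x\<bar>) \<partial>lborel) = (\<Sum>n. \<integral>\<^sup>+x. ennreal \<bar>\<Delta> n x\<bar> \<partial>lborel)"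
    unfolding \<Delta>_def by (rule nn_integral_suminf) measurable
  also have "\<dots> \<le> (\<Sum>n. ennreal ((1/2)^n) * (v + 1))"
    by (intro suminf_le bound) auto
  also have "\<dots> = (\<Sum>n. ennreal ((1/2)^n)) * (v + 1)" by (rule ennreal_suminf_multc)
  also have "(\<Sum>n. ennreal ((1/2)^n)) = ennreal (\<Sum>n. (1/2)^n)"
    by (intro suminf_ennreal2) (auto intro!: summable_geometric)
  also have "\<dots> * (v + 1) < \<infinity>" using v by (simp add: ennreal_mult_less_top less_top)
  finally have "AE x in lborel. (\<Sum>n. ennreal \<bar>\<Delta> n x\<bar>) \<noteq> \<infinity>"
    by (intro nn_integral_PInf_AE) (auto simp: \<Delta>_def)
  then have conv: "AE x in lborel. convergent (\<lambda>n. H (r n) x)"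
  proof eventually_elim
    case (elim x)
    then have "summable (\<lambda>n. \<bar>\<Delta> n x\<bar>)" by (intro summable_suminf_not_top) auto
    then have "summable (\<lambda>n. \<Delta> n x)" by (rule summable_rabs_cancel)
    then have "convergent (\<lambda>n. H (r n) x - H (r 0) x)"
      unfolding summable_iff_convergent \<Delta>_def by (simp add: sum_lessThan_telescope[of "\<lambda>n. H (r n) x"])
    then show ?case by (simp add: convergent_diff_const_right_iff)
  qed
  define W where "W x = lim (\<lambda>n. H (r n) x)" for x
  have [measurable]: "W \<in> borel_measurable borel" unfolding W_def by measurable
  have lim: "AE x in lborel. (\<lambda>n. H (r n) x) \<longlonglongrightarrow> W x"
    using conv by eventually_elim (simp add: W_def convergent_LIMSEQ_iff)
  have W_supp: "W x = 0" if "x \<notin> cbox a b" for x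
    using that by (simp add: W_def H.V_supp)
  have fatou: "(\<integral>\<^sup>+x. ennreal ((H k x - W x)\<^sup>2) \<partial>lborel) \<le> ennreal \<epsilon>"
    if K: "\<forall>k\<ge>K. \<forall>l\<ge>K. (LINT x|lborel. (H k x - H l x)\<^sup>2) < \<epsilon>" "k \<ge> K" for K k \<epsilon>
  proof -
    have "(\<integral>\<^sup>+x. ennreal ((H k x - W x)\<^sup>2) \<partial>lborel)
      = (\<integral>\<^sup>+x. liminf (\<lambda>n. ennreal ((H k x - H (r n) x)\<^sup>2)) \<partial>lborel)"
    proof (rule nn_integral_cong_AE)
      show "AE x in lborel. ennreal ((H k x - W x)\<^sup>2) = liminf (\<lambda>n. ennreal ((H k x - H (r n) x)\<^sup>2))"
        using lim
      proof eventually_elim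
        case (elim x)
        have "(\<lambda>n. ennreal ((H k x - H (r n) x)\<^sup>2)) \<longlonglongrightarrow> ennreal ((H k x - W x)\<^sup>2)"
          by (intro tendsto_ennrealI tendsto_intros elim)
        then show ?case by (rule lim_imp_Liminf[OF trivial_limit_sequentially, symmetric])
      qed
    qed
    also have "\<dots> \<le> liminf (\<lambda>n. \<integral>\<^sup>+x. ennreal ((H k x - H (r n) x)\<^sup>2) \<partial>lborel)"
      by (rule nn_integral_liminf) measurable
    also have "\<dots> \<le> ennreal \<epsilon>"
    proof (rule Liminf_le)
      show "\<forall>\<^sub>F n in sequentially. (\<integral>\<^sup>+x. ennreal ((H k x - H (r n) x)\<^sup>2) \<partial>lborel) \<le> ennreal \<epsilon>"
        using eventually_ge_at_top[of K]
      proof eventually_elim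
        case (elim n)
        then have "r n \<ge> K" using r3[of n] by linarith
        then show ?case using K by (simp add: nn_eq less_imp_le ennreal_leI)
      qed
    qed simp
    finally show ?thesis .
  qed
  have sqi: "integrable lborel (\<lambda>x. (H k x - W x)\<^sup>2)" if K: "\<forall>k\<ge>K. \<forall>l\<ge>K. (LINT x|lborel. (H k x - H l x)\<^sup>2) < \<epsilon>" "k \<ge> K" for K k \<epsilon>
    using fatou[OF K] by (intro integrableI_bounded) (auto simp: less_top[symmetric] top_unique)
  obtain K1 where K1: "\<forall>k\<ge>K1. \<forall>l\<ge>K1. (LINT x|lborel. (H k x - H l x)\<^sup>2) < 1"
    using cauchy[of 1] by auto
  interpret B: box_L2 a b "\<lambda>x. H K1 x - W x"
    by standard (use H.ab H.V_supp W_supp sqi[OF K1] in auto)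
  have "box_L2 a b (\<lambda>x. H K1 x - (H K1 x - W x))"
    by (rule box_L2_diff[OF H B.box_L2_axioms])
  then have W: "box_L2 a b W" by simp
  have "(\<lambda>k. LINT x|lborel. (H k x - W x)\<^sup>2) \<longlonglongrightarrow> 0"
    unfolding LIMSEQ_iff
  proof (intro allI impI)
    fix e :: real assume e: "e > 0"
    then obtain K where K: "\<forall>k\<ge>K. \<forall>l\<ge>K. (LINT x|lborel. (H k x - H l x)\<^sup>2) < e / 2"
      using cauchy[of "e / 2"] by auto
    have "norm ((LINT x|lborel. (H k x - W x)\<^sup>2) - 0) < e" if k: "k \<ge> K" for k
    proof -
      have "ennreal (LINT x|lborel. (H k x - W x)\<^sup>2) \<le> ennreal (e / 2)"
        using fatou[OF K k] nn_integral_eq_integral[OF sqi[OF K k]] by simp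
      then show ?thesis using e by (simp add: ennreal_le_iff integral_nonneg_AE)
    qed
    then show "\<exists>no. \<forall>n\<ge>no. norm ((LINT x|lborel. (H n x - W x)\<^sup>2) - 0) < e" by blast
  qed
  with W show ?thesis by (rule that)
qed

section \<open>Tensors of one-dimensional Sobolev functions\<close>

definition L2_on :: "real \<Rightarrow> real \<Rightarrow> (real \<Rightarrow> real) \<Rightarrow> bool" where
  "L2_on l r f \<longleftrightarrow> f \<in> borel_measurable borel \<and> (\<forall>x. x \<notin> {l..r} \<longrightarrow> f x = 0) \<and>
     integrable lborel (\<lambda>x. (f x)\<^sup>2)"

lemma L2_on_integrable: "L2_on l r f \<Longrightarrow> integrable lborel f"
  by (rule integrable_of_square_integrable[where A = "{l..r}", OF _ _ emeasure_bounded_finite])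
     (auto simp: L2_on_def)

text \<open>Asking for the derivative only almost everywhere lets one notion cover the classical
  derivatives below order \<alpha> and the last one, which exists almost everywhere only. The
  extension by 0 is harmless because derivatives are taken within the interval.\<close>

definition weak_pair :: "real \<Rightarrow> real \<Rightarrow> (real \<Rightarrow> real) \<Rightarrow> (real \<Rightarrow> real) \<Rightarrow> bool" where
  "weak_pair l r u u' \<longleftrightarrow> L2_on l r u \<and> L2_on l r u' \<and> abs_continuous_on l r u \<and>
     (AE x\<in>{l..r} in lborel. (u has_real_derivative u' x) (at x within {l..r}))"

definition sobolev_chain :: "nat \<Rightarrow> real \<Rightarrow> real \<Rightarrow> (nat \<Rightarrow> real \<Rightarrow> real) \<Rightarrow> bool" where
  "sobolev_chain \<alpha> l r D \<longleftrightarrow> (\<forall>k\<le>\<alpha>. L2_on l r (D k)) \<and> (\<forall>k<\<alpha>. weak_pair l r (D k) (D (Suc k)))"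

lemma sobolev_1d_chain:
  assumes "u \<in> sobolev_1d \<alpha> l r"
  obtains D where "sobolev_chain \<alpha> l r D" "0 < \<alpha> \<Longrightarrow> (\<And>x. x \<in> {l..r} \<Longrightarrow> D 0 x = u x)"
proof -
  obtain D where D0: "\<forall>x\<in>{l..r}. D 0 x = u x" and ac: "\<And>k. k < \<alpha> \<Longrightarrow> abs_continuous_on l r (D k)"
    and d1: "\<And>k x. Suc k < \<alpha> \<Longrightarrow> x \<in> {l..r} \<Longrightarrow> (D k has_real_derivative D (Suc k) x) (at x within {l..r})"
    and d2: "\<And>k. Suc k = \<alpha> \<Longrightarrow> AE x\<in>{l..r} in lborel. (D k has_real_derivative D (Suc k) x) (at x within {l..r})"
    and m: "D \<alpha> \<in> borel_measurable borel" and sq: "set_integrable lborel {l..r} (\<lambda>x. (D \<alpha> x)\<^sup>2)"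
    using assms unfolding sobolev_1d_def by blast
  define E where "E k x = indicator {l..r} x * D k x" for k x
  have EL2: "L2_on l r (E k)" if "k \<le> \<alpha>" for k
  proof -
    have eq: "(\<lambda>x. (E k x)\<^sup>2) = (\<lambda>x. indicator {l..r} x *\<^sub>R (D k x)\<^sup>2)"
      by (auto simp: E_def indicator_def)
    have "E k \<in> borel_measurable borel \<and> integrable lborel (\<lambda>x. (E k x)\<^sup>2)"
    proof (cases "k = \<alpha>")
      case True
      then show ?thesis using m sq unfolding eq by (auto simp: E_def[abs_def] set_integrable_def)
    next
      case False
      then have c: "continuous_on {l..r} (D k)" using ac that by (intro abs_continuous_on_continuous) auto
      have "E k \<in> borel_measurable borel"
        using borel_measurable_continuous_on_indicator[OF _ c] by (simp add: E_def[abs_def])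
      moreover have "set_integrable lborel {l..r} (\<lambda>x. (D k x)\<^sup>2)"
        by (intro borel_integrable_atLeastAtMost' continuous_intros c)
      ultimately show ?thesis unfolding eq by (simp add: set_integrable_def)
    qed
    then show ?thesis by (simp add: L2_on_def E_def)
  qed
  have E_eq: "E k x = D k x" if "x \<in> {l..r}" for k x using that by (simp add: E_def)
  have tr: "(E k has_real_derivative E (Suc k) x) (at x within {l..r})"
    if "(D k has_real_derivative D (Suc k) x) (at x within {l..r})" "x \<in> {l..r}" for k x
    using has_field_derivative_transform_within[OF that(1) zero_less_one that(2), of "E k"] E_eq that(2) by simp
  have "weak_pair l r (E k) (E (Suc k))" if k: "k < \<alpha>" for k
    unfolding weak_pair_def
  proof (intro conjI EL2)
    show "abs_continuous_on l r (E k)"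
      by (rule abs_continuous_on_cong[OF ac[OF k]]) (simp add: E_eq)
    show "AE x\<in>{l..r} in lborel. (E k has_real_derivative E (Suc k) x) (at x within {l..r})"
    proof (cases "Suc k = \<alpha>")
      case True
      show ?thesis using d2[OF True] by eventually_elim (use tr in blast)
    next
      case False
      then have "Suc k < \<alpha>" using k by simp
      then show ?thesis using d1 tr by (intro AE_I2) blast
    qed
  qed (use k in auto)
  then have "sobolev_chain \<alpha> l r E" using EL2 by (simp add: sobolev_chain_def)
  then show ?thesis using that D0 E_eq by metis
qed

text \<open>In \<open>D i j k\<close> the indices are the summand, the variable and the order of the
  derivative. Thus \<open>tens m D \<tau>\<close> plays the part of the mixed derivative of order
  \<tau> of \<open>tens m D (\<lambda>_. 0)\<close>, read off without differentiating in several
  variables.\<close>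

definition tens :: "nat \<Rightarrow> (nat \<Rightarrow> 'd::finite \<Rightarrow> nat \<Rightarrow> real \<Rightarrow> real) \<Rightarrow> ('d \<Rightarrow> nat) \<Rightarrow> real^'d \<Rightarrow> real" where
  "tens m D \<tau> x = (\<Sum>i<m. \<Prod>j\<in>UNIV. D i j (\<tau> j) (x $ j))"

lemma box_L2_zero: "(\<And>j. a $ j \<le> b $ j) \<Longrightarrow> box_L2 a b (\<lambda>_. 0)"
  by standard auto

lemma box_L2_add: "box_L2 a b V1 \<Longrightarrow> box_L2 a b V2 \<Longrightarrow> box_L2 a b (\<lambda>x. V1 x + V2 x)"
  using box_L2_diff[OF _ box_L2_diff[OF box_L2_zero], of a b V1 V2] box_L2.ab by force

lemma box_L2_sum:
  "(\<And>j. a $ j \<le> b $ j) \<Longrightarrow> (\<And>i. i \<in> I \<Longrightarrow> box_L2 a b (V i)) \<Longrightarrow> box_L2 a b (\<lambda>x. \<Sum>i\<in>I. V i x)"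
  by (induction I rule: infinite_finite_induct) (auto intro: box_L2_zero box_L2_add)

lemma box_L2_integrable:
  assumes "box_L2 a b V" shows "integrable lborel V"
proof -
  interpret box_L2 a b V by fact
  show ?thesis
    by (rule integrable_of_square_integrable[where A = "cbox a b", OF _ _ emeasure_bounded_finite])
       (use V_supp V_sq in auto)
qed

lemma box_L2_prod:
  fixes f :: "'d::finite \<Rightarrow> real \<Rightarrow> real" and a b :: "real^'d"
  assumes ab: "\<And>j. a $ j \<le> b $ j" and f: "\<And>j. L2_on (a $ j) (b $ j) (f j)"
  shows "box_L2 a b (\<lambda>x. \<Prod>j\<in>UNIV. f j (x $ j))"
proof
  have [measurable]: "f j \<in> borel_measurable borel" for j using f by (simp add: L2_on_def)
  show "(\<lambda>x. \<Prod>j\<in>UNIV. f j (x $ j)) \<in> borel_measurable borel"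
    by (intro borel_measurable_prod) measurable
  show "(\<Prod>j\<in>UNIV. f j (x $ j)) = 0" if x: "x \<notin> cbox a b" for x
  proof -
    have "\<exists>j. \<not> (a $ j \<le> x $ j \<and> x $ j \<le> b $ j)"
      using x by (simp add: mem_box_cart)
    then obtain j where "x $ j \<notin> {a $ j..b $ j}" by auto
    then have "f j (x $ j) = 0" using f[of j] by (simp add: L2_on_def)
    then show ?thesis by (subst prod_zero_iff) auto
  qed
  have "integrable lborel (\<lambda>x::real^'d. \<Prod>j\<in>UNIV. (\<lambda>t. (f j t)\<^sup>2) (x $ j))"
    using f by (intro integrable_prod_vec) (simp add: L2_on_def)
  then show "integrable lborel (\<lambda>x::real^'d. (\<Prod>j\<in>UNIV. f j (x $ j))\<^sup>2)"
    by (simp add: prod_power_distrib)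
qed (use ab in auto)

lemma box_L2_tens:
  fixes a b :: "real^'d::finite"
  assumes "\<And>j. a $ j \<le> b $ j" and "\<And>i j. i < m \<Longrightarrow> L2_on (a $ j) (b $ j) (D i j (\<tau> j))"
  shows "box_L2 a b (tens m D \<tau>)"
  unfolding tens_def[abs_def] using assms by (intro box_L2_sum box_L2_prod) auto

text \<open>On a line parallel to an axis a tensor is a linear combination of its factors in that
  variable. The coefficients do not involve the order in variable j, so the tensor, its derivative
  and its mean in that variable share them.\<close>

lemma tens_upd:
  "tens m D \<tau> (upd_vec x j t) = (\<Sum>i<m. (\<Prod>k\<in>UNIV - {j}. D i k (\<tau> k) (x $ k)) * D i j (\<tau> j) t)"
  unfolding tens_def
proof (intro sum.cong refl)
  fix i
  show "(\<Prod>k\<in>UNIV. D i k (\<tau> k) (upd_vec x j t $ k)) = (\<Prod>k\<in>UNIV - {j}. D i k (\<tau> k) (x $ k)) * D i j (\<tau> j) t"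
    by (subst prod.remove[of UNIV j]) (auto simp: mult.commute intro!: arg_cong2[where f = "(*)"] prod.cong)
qed

lemma tens_upd_upd:
  "tens m D (\<tau>(j := k)) (upd_vec x j t) = (\<Sum>i<m. (\<Prod>k\<in>UNIV - {j}. D i k (\<tau> k) (x $ k)) * D i j k t)"
  unfolding tens_upd by (intro sum.cong refl arg_cong2[where f = "(*)"] prod.cong) auto

subsection \<open>Test functions\<close>

text \<open>Unlike in \<open>test_functions\<close> the set that contains the support is named,
  since it stays the same while derivatives are taken.\<close>

definition test_on :: "(real^'d::finite) set \<Rightarrow> (real^'d \<Rightarrow> real) \<Rightarrow> bool" where
  "test_on K \<psi> \<longleftrightarrow> smooth \<psi> \<and> (\<forall>x. x \<notin> K \<longrightarrow> \<psi> x = 0)"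

lemma test_on_partial_deriv:
  assumes "test_on K \<psi>" "compact K"
  shows "test_on K (partial_deriv j \<psi>)"
  unfolding test_on_def
proof (intro conjI allI impI)
  show "smooth (partial_deriv j \<psi>)"
    unfolding smooth_def
  proof (intro allI)
    fix js x
    have "foldr partial_deriv (js @ [j]) \<psi> differentiable (at x)"
      using assms(1) unfolding test_on_def smooth_def by blast
    then show "foldr partial_deriv js (partial_deriv j \<psi>) differentiable (at x)" by simp
  qed
  fix x assume x: "x \<notin> K"
  have "closed K" using assms(2) by (rule compact_imp_closed)
  have "isCont (\<lambda>t. x + t *\<^sub>R axis j 1) 0" by (intro continuous_intros)
  then have "((\<lambda>t. x + t *\<^sub>R axis j 1) \<longlongrightarrow> x + 0 *\<^sub>R axis j 1) (nhds 0)"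
    unfolding isCont_def by (subst (asm) tendsto_at_iff_tendsto_nhds)
  then have "\<forall>\<^sub>F t in nhds 0. x + t *\<^sub>R axis j 1 \<in> - K"
    using \<open>closed K\<close> x by (intro topological_tendstoD) auto
  then have "\<forall>\<^sub>F t in nhds 0. \<psi> (x + t *\<^sub>R axis j 1) = 0"
    by eventually_elim (use assms(1) in \<open>auto simp: test_on_def\<close>)
  then have "deriv (\<lambda>t. \<psi> (x + t *\<^sub>R axis j 1)) 0 = deriv (\<lambda>t. 0) 0"
    by (intro deriv_cong_ev) auto
  then show "partial_deriv j \<psi> x = 0" by (simp add: partial_deriv_def)
qed

lemma test_on_foldr:
  assumes "test_on K \<psi>" "compact K"
  shows "test_on K (foldr partial_deriv js \<psi>)"
  by (induction js) (auto intro: test_on_partial_deriv assms)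

lemma test_on_differentiable: "test_on K \<psi> \<Longrightarrow> \<psi> differentiable (at x)"
  unfolding test_on_def smooth_def by (metis foldr_Nil id_apply)

lemma test_on_continuous: "test_on K \<psi> \<Longrightarrow> continuous_on S \<psi>"
  by (meson continuous_at_imp_continuous_on differentiable_imp_continuous_within test_on_differentiable)

lemma test_on_bounded:
  assumes "test_on K \<psi>" "compact K"
  obtains B where "B > 0" "\<And>x. \<bar>\<psi> x\<bar> \<le> B"
proof -
  have "bounded (\<psi> ` K)"
    using test_on_continuous[OF assms(1)] assms(2) by (intro compact_imp_bounded compact_continuous_image)
  then obtain B where B: "B > 0" "\<And>x. x \<in> K \<Longrightarrow> \<bar>\<psi> x\<bar> \<le> B"
    unfolding bounded_pos by auto
  have "\<bar>\<psi> x\<bar> \<le> B" for x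
    using B assms(1) by (cases "x \<in> K") (auto simp: test_on_def)
  then show ?thesis using that B(1) by blast
qed

lemma test_on_line:
  assumes "test_on K \<psi>"
  shows "((\<lambda>t. \<psi> (upd_vec x j t)) has_real_derivative partial_deriv j \<psi> (upd_vec x j t)) (at t)"
proof -
  define y where "y = upd_vec x j t"
  have "(\<lambda>s. \<psi> (y + s *\<^sub>R axis j 1)) differentiable (at 0)"
    by (rule differentiable_compose[where f = \<psi>])
       (auto intro!: test_on_differentiable[OF assms] bounded_linear_imp_differentiable derivative_intros)
  then have d: "((\<lambda>s. \<psi> (y + s *\<^sub>R axis j 1)) has_real_derivative partial_deriv j \<psi> y) (at (t - t))"
    unfolding partial_deriv_def by (simp add: DERIV_deriv_iff_real_differentiable)
  have "((\<lambda>s. \<psi> (y + (s - t) *\<^sub>R axis j 1)) has_real_derivative partial_deriv j \<psi> y * 1) (at t)"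
    by (rule DERIV_chain2[where f = "\<lambda>s. \<psi> (y + s *\<^sub>R axis j 1)" and g = "\<lambda>s. s - t", OF d]) (auto intro!: derivative_eq_intros)
  moreover have "y + (s - t) *\<^sub>R axis j 1 = upd_vec x j s" for s
    by (simp add: y_def vec_eq_iff axis_def)
  ultimately show ?thesis by (simp add: y_def)
qed

lemma L2_times_test_integrable:
  assumes V: "box_L2 a b V" and "test_on K \<psi>" "compact K"
  shows "integrable lborel (\<lambda>x. V x * \<psi> x)"
proof -
  obtain B where B: "B > 0" "\<And>x. \<bar>\<psi> x\<bar> \<le> B" using test_on_bounded assms(2,3) by metis
  have [measurable]: "\<psi> \<in> borel_measurable borel"
    by (intro borel_measurable_continuous_onI test_on_continuous[OF assms(2)])
  have [measurable]: "V \<in> borel_measurable borel" using V by (rule box_L2.V_measurable)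
  show ?thesis
  proof (rule Bochner_Integration.integrable_bound)
    show "integrable lborel (\<lambda>x. B * V x)" using box_L2_integrable[OF V] by simp
    show "AE x in lborel. norm (V x * \<psi> x) \<le> norm (B * V x)"
      using B by (intro AE_I2) (simp add: abs_mult mult.commute[of B] mult_left_mono)
  qed measurable
qed

subsection \<open>Weak derivatives of tensors\<close>

lemma line_integral_zero:
  assumes wp: "weak_pair l r u u'" and lr: "l \<le> r"
    and psi: "\<And>t. (\<psi> has_real_derivative \<psi>' t) (at t)" and c: "continuous_on UNIV \<psi>'"
    and ends: "\<psi> l = 0" "\<psi> r = 0"
  shows "integrable lborel (\<lambda>t. u' t * \<psi> t + u t * \<psi>' t)"
    and "(LINT t|lborel. u' t * \<psi> t + u t * \<psi>' t) = 0"
proof -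
  have int: "set_integrable lborel {l..r} u'"
    unfolding set_integrable_def
    by (rule integrable_mult_indicator) (use L2_on_integrable[of l r u'] wp in \<open>auto simp: weak_pair_def\<close>)
  have eq: "(\<lambda>t. u' t * \<psi> t + u t * \<psi>' t) = (\<lambda>t. indicator {l..r} t *\<^sub>R (u' t * \<psi> t + u t * \<psi>' t))"
  proof
    fix t
    show "u' t * \<psi> t + u t * \<psi>' t = indicator {l..r} t *\<^sub>R (u' t * \<psi> t + u t * \<psi>' t)"
      using wp by (cases "t \<in> {l..r}") (simp_all add: weak_pair_def L2_on_def)
  qed
  have "(\<psi> has_real_derivative \<psi>' t) (at t within {l..r})" for t
    using psi by (rule has_field_derivative_at_within)
  note parts = abs_continuous_on_parts[OF lr _ _ int this continuous_on_subset[OF c subset_UNIV], of u]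
  show "integrable lborel (\<lambda>t. u' t * \<psi> t + u t * \<psi>' t)"
    using parts(1) wp by (subst eq) (simp add: set_integrable_def weak_pair_def)
  show "(LINT t|lborel. u' t * \<psi> t + u t * \<psi>' t) = 0"
    using parts(2) wp ends by (subst eq) (simp add: set_lebesgue_integral_def weak_pair_def)
qed

text \<open>One partial derivative moves from the test function to the tensor. Along each line in
  direction j the boundary terms vanish, because the end points of the line lie outside the open box
  that contains the support.\<close>

lemma tens_parts:
  fixes a b :: "real^'d::finite"
  assumes ab: "\<And>j. a $ j \<le> b $ j"
    and wp: "\<And>i. i < m \<Longrightarrow> weak_pair (a $ j) (b $ j) (D i j (\<tau> j)) (D i j (Suc (\<tau> j)))"
    and L2: "\<And>i k. i < m \<Longrightarrow> L2_on (a $ k) (b $ k) (D i k (\<tau> k))"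
    and K: "test_on K \<psi>" "compact K" "K \<subseteq> box a b"
  shows "(LINT x|lborel. tens m D \<tau> x * partial_deriv j \<psi> x) = - (LINT x|lborel. tens m D (\<tau>(j := Suc (\<tau> j))) x * \<psi> x)"
proof -
  let ?\<tau> = "\<tau>(j := Suc (\<tau> j))"
  have T: "box_L2 a b (tens m D \<tau>)" by (rule box_L2_tens[of a b m D \<tau>, OF ab L2])
  have T': "box_L2 a b (tens m D ?\<tau>)"
    by (rule box_L2_tens[OF ab]) (use wp L2 in \<open>auto simp: weak_pair_def\<close>)
  note K' = test_on_partial_deriv[OF K(1,2), of j]
  have i1: "integrable lborel (\<lambda>x. tens m D ?\<tau> x * \<psi> x)" by (rule L2_times_test_integrable[OF T' K(1,2)])
  have i2: "integrable lborel (\<lambda>x. tens m D \<tau> x * partial_deriv j \<psi> x)" by (rule L2_times_test_integrable[OF T K' K(2)])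
  have "(LINT x|lborel. tens m D ?\<tau> x * \<psi> x + tens m D \<tau> x * partial_deriv j \<psi> x) = 0"
  proof (rule integral_zero_of_coordinate[where j = j])
    fix x :: "real^'d"
    define c where "c i = (\<Prod>k\<in>UNIV - {j}. D i k (\<tau> k) (x $ k))" for i
    define p where "p t = \<psi> (upd_vec x j t)" for t
    define p' where "p' t = partial_deriv j \<psi> (upd_vec x j t)" for t
    have p: "(p has_real_derivative p' t) (at t)" for t
      using test_on_line[OF K(1)] by (simp add: p_def[abs_def] p'_def)
    have p'c: "continuous_on UNIV p'"
      unfolding p'_def upd_vec_eq
      by (rule continuous_on_compose2[OF test_on_continuous[OF K', of UNIV]]) (auto intro!: continuous_intros)
    have ends: "p (a $ j) = 0" "p (b $ j) = 0"
    proof -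
      have "upd_vec x j (a $ j) \<notin> box a b" "upd_vec x j (b $ j) \<notin> box a b"
        by (auto simp: mem_box_cart intro!: exI[of _ j])
      then show "p (a $ j) = 0" "p (b $ j) = 0" using K(1,3) by (auto simp: p_def test_on_def)
    qed
    have "(\<lambda>t. tens m D ?\<tau> (upd_vec x j t) * \<psi> (upd_vec x j t) + tens m D \<tau> (upd_vec x j t) * partial_deriv j \<psi> (upd_vec x j t))
      = (\<lambda>t. \<Sum>i<m. c i * (D i j (Suc (\<tau> j)) t * p t + D i j (\<tau> j) t * p' t))"
      unfolding tens_upd_upd unfolding tens_upd p_def[symmetric] p'_def[symmetric] c_def[symmetric]
      by (simp add: sum_distrib_left sum_distrib_right sum.distrib algebra_simps)
    then have "(LINT t|lborel. tens m D ?\<tau> (upd_vec x j t) * \<psi> (upd_vec x j t) + tens m D \<tau> (upd_vec x j t) * partial_deriv j \<psi> (upd_vec x j t))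
      = (LINT t|lborel. (\<Sum>i<m. c i * (D i j (Suc (\<tau> j)) t * p t + D i j (\<tau> j) t * p' t)))" by simp
    also have "\<dots> = (\<Sum>i<m. c i * (LINT t|lborel. D i j (Suc (\<tau> j)) t * p t + D i j (\<tau> j) t * p' t))"
      using line_integral_zero(1)[OF wp ab p p'c ends] by (subst Bochner_Integration.integral_sum) auto
    also have "\<dots> = 0"
      using line_integral_zero(2)[OF wp ab p p'c ends] by simp
    finally show "(LINT t|lborel. tens m D ?\<tau> (upd_vec x j t) * \<psi> (upd_vec x j t) + tens m D \<tau> (upd_vec x j t) * partial_deriv j \<psi> (upd_vec x j t)) = 0" .
  qed (use i1 i2 in auto)
  then show ?thesis using i1 i2 by simp
qed

lemma tens_foldr_parts:
  fixes a b :: "real^'d::finite"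
  assumes ab: "\<And>j. a $ j \<le> b $ j"
    and D: "\<And>i j. i < m \<Longrightarrow> sobolev_chain \<alpha> (a $ j) (b $ j) (D i j)"
    and K: "test_on K \<psi>" "compact K" "K \<subseteq> box a b"
  shows "(\<And>j. \<tau> j + count_list js j \<le> \<alpha>) \<Longrightarrow>
    (LINT x|lborel. tens m D \<tau> x * foldr partial_deriv js \<psi> x) =
    (- 1) ^ length js * (LINT x|lborel. tens m D (\<lambda>j. \<tau> j + count_list js j) x * \<psi> x)"
proof (induction js arbitrary: \<tau>)
  case (Cons j js)
  let ?\<tau> = "\<tau>(j := Suc (\<tau> j))"
  have le: "\<tau> k \<le> \<alpha>" "\<tau> j < \<alpha>" for k
    using Cons.prems[of k] Cons.prems[of j] by auto
  have "(LINT x|lborel. tens m D \<tau> x * partial_deriv j (foldr partial_deriv js \<psi>) x)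
    = - (LINT x|lborel. tens m D ?\<tau> x * foldr partial_deriv js \<psi> x)"
    by (rule tens_parts[OF ab _ _ test_on_foldr[OF K(1,2)] K(2,3)]) (use D le in \<open>auto simp: sobolev_chain_def\<close>)
  also have "(LINT x|lborel. tens m D ?\<tau> x * foldr partial_deriv js \<psi> x) =
    (- 1) ^ length js * (LINT x|lborel. tens m D (\<lambda>k. ?\<tau> k + count_list js k) x * \<psi> x)"
  proof (rule Cons.IH)
    fix k show "?\<tau> k + count_list js k \<le> \<alpha>" using Cons.prems[of k] by (auto split: if_splits)
  qed
  also have "(\<lambda>k. ?\<tau> k + count_list js k) = (\<lambda>k. \<tau> k + count_list (j # js) k)" by auto
  finally show ?case by simp
qed simp

lemma ex_count_list: "\<exists>js. \<forall>j::'d::finite. count_list js j = \<tau> j"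
proof -
  obtain xs :: "'d list" where xs: "set xs = UNIV" "distinct xs"
    using finite_distinct_list[of "UNIV :: 'd set"] by auto
  have rep: "count_list (replicate n x) y = (if x = y then n else 0)" for n and x y :: 'd
    by (induction n) auto
  have "distinct ys \<Longrightarrow> count_list (concat (map (\<lambda>j. replicate (\<tau> j) j) ys)) j = (if j \<in> set ys then \<tau> j else 0)" for ys j
    by (induction ys) (auto simp: rep)
  then show ?thesis using xs by (metis UNIV_I)
qed

text \<open>\<open>mixed_partial\<close> differentiates in an unspecified order; the arguments below
  use only how often each variable occurs in the chosen list and how long the list is.\<close>

lemma mixed_partial_list:
  fixes \<tau> :: "'d::finite \<Rightarrow> nat"
  obtains js where "\<And>j. count_list js j = \<tau> j" "length js = (\<Sum>j\<in>UNIV. \<tau> j)"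
    "\<And>\<phi>. mixed_partial \<tau> \<phi> = foldr partial_deriv js \<phi>"
proof -
  define js where "js = (SOME js. \<forall>j. count_list js j = \<tau> j)"
  have js: "count_list js j = \<tau> j" for j
    using someI_ex[OF ex_count_list[of \<tau>]] by (simp add: js_def)
  have "length js = (\<Sum>j\<in>UNIV. \<tau> j)"
    using sum_count_set[of js UNIV] js by simp
  then show ?thesis using js by (intro that[of js]) (simp_all add: mixed_partial_def js_def)
qed

lemma mixed_partial_zero [simp]: "mixed_partial (\<lambda>_. 0) f = f"
proof -
  obtain js where "\<And>j. count_list js j = 0" "length js = (\<Sum>j\<in>(UNIV::'a set). 0)"
    "\<And>\<phi>. mixed_partial (\<lambda>_::'a. 0) \<phi> = foldr partial_deriv js \<phi>"
    using mixed_partial_list[of "\<lambda>_::'a. 0"] by blast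
  then show ?thesis by simp
qed

lemma test_functions_test_on:
  "\<phi> \<in> test_functions S \<longleftrightarrow> (\<exists>K. compact K \<and> K \<subseteq> S \<and> test_on K \<phi>)"
  by (auto simp: test_functions_def test_on_def)

lemma has_weak_deriv_tens:
  fixes a b :: "real^'d::finite"
  assumes ab: "\<And>j. a $ j \<le> b $ j"
    and D: "\<And>i j. i < m \<Longrightarrow> sobolev_chain \<alpha> (a $ j) (b $ j) (D i j)"
    and g: "\<And>x. x \<in> cbox a b \<Longrightarrow> g x = tens m D (\<lambda>_. 0) x" and \<tau>: "\<And>j. \<tau> j \<le> \<alpha>"
  shows "has_weak_deriv \<tau> a b g (tens m D \<tau>)"
  unfolding has_weak_deriv_def
proof (intro conjI ballI)
  interpret T: box_L2 a b "tens m D \<tau>"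
    by (rule box_L2_tens[OF ab]) (use D \<tau> in \<open>auto simp: sobolev_chain_def\<close>)
  interpret T0: box_L2 a b "tens m D (\<lambda>_. 0)"
    by (rule box_L2_tens[OF ab]) (use D \<tau> in \<open>auto simp: sobolev_chain_def\<close>)
  show "tens m D \<tau> \<in> borel_measurable borel" by (rule T.V_measurable)
  show "set_integrable lborel (cbox a b) (\<lambda>x. (tens m D \<tau> x)\<^sup>2)"
    unfolding set_integrable_def using T.V_sq by (intro integrable_mult_indicator) auto
  fix \<phi> assume "\<phi> \<in> test_functions (box a b)"
  then obtain K where K: "test_on K \<phi>" "compact K" "K \<subseteq> box a b"
    by (auto simp: test_functions_test_on)
  obtain js where js: "\<And>j. count_list js j = \<tau> j" "length js = (\<Sum>j\<in>UNIV. \<tau> j)"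
    "mixed_partial \<tau> \<phi> = foldr partial_deriv js \<phi>"
    using mixed_partial_list[of \<tau>] by metis
  have "(LINT x:cbox a b|lborel. g x * mixed_partial \<tau> \<phi> x) = (LINT x|lborel. tens m D (\<lambda>_. 0) x * foldr partial_deriv js \<phi> x)"
    unfolding set_lebesgue_integral_def js(3)
    by (intro Bochner_Integration.integral_cong) (auto simp: indicator_def g T0.V_supp)
  also have "\<dots> = (- 1) ^ length js * (LINT x|lborel. tens m D (\<lambda>j. 0 + count_list js j) x * \<phi> x)"
    by (rule tens_foldr_parts[OF ab D K]) (use js \<tau> in auto)
  also have "(\<lambda>j. 0 + count_list js j) = \<tau>" using js by auto
  also have "(LINT x|lborel. tens m D \<tau> x * \<phi> x) = (LINT x:cbox a b|lborel. tens m D \<tau> x * \<phi> x)"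
    unfolding set_lebesgue_integral_def
    by (intro Bochner_Integration.integral_cong) (auto simp: indicator_def T.V_supp)
  finally show "(LINT x:cbox a b|lborel. g x * mixed_partial \<tau> \<phi> x) =
      (- 1) ^ (\<Sum>j\<in>UNIV. \<tau> j) * (LINT x:cbox a b|lborel. tens m D \<tau> x * \<phi> x)"
    using js by simp
qed

subsection \<open>The terms of the Sobolev norm\<close>

lemma has_weak_deriv_box_L2:
  assumes "\<And>j. a $ j \<le> b $ j" "has_weak_deriv \<tau> a b f h"
  shows "box_L2 a b (\<lambda>x. indicator (cbox a b) x * h x)"
proof
  have eq: "(\<lambda>x. (indicator (cbox a b) x * h x)\<^sup>2) = (\<lambda>x. indicator (cbox a b) x *\<^sub>R (h x)\<^sup>2)"
    by (auto simp: indicator_def)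
  show "integrable lborel (\<lambda>x. (indicator (cbox a b) x * h x)\<^sup>2)"
    unfolding eq using assms(2) by (simp add: has_weak_deriv_def set_integrable_def)
qed (use assms in \<open>auto simp: has_weak_deriv_def\<close>)

text \<open>\<open>weak_deriv\<close> is an arbitrary choice among all weak derivatives. Uniqueness
  up to null sets allows any explicit weak derivative to stand in for it in the Sobolev
  norm.\<close>

lemma has_weak_deriv_unique:
  assumes ab: "\<And>j. a $ j \<le> b $ j" and h: "has_weak_deriv \<tau> a b f h1" "has_weak_deriv \<tau> a b f h2"
  shows "AE x in lborel. indicator (cbox a b) x * h1 x = indicator (cbox a b) x * h2 x"
proof -
  note L = has_weak_deriv_box_L2[OF ab h(1)] has_weak_deriv_box_L2[OF ab h(2)]
  note L' = box_L2_diff[OF L]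
  have "AE x in lborel. indicator (cbox a b) x * h1 x - indicator (cbox a b) x * h2 x = 0"
  proof (rule AE_zero_of_test_functions[where a = a and b = b])
    fix \<phi> assume phi: "\<phi> \<in> test_functions (box a b)"
    then obtain K where K: "test_on K \<phi>" "compact K" "K \<subseteq> box a b"
      by (auto simp: test_functions_test_on)
    have "(- 1) ^ (\<Sum>j\<in>UNIV. \<tau> j) * (LINT x:cbox a b|lborel. h1 x * \<phi> x) = (- 1) ^ (\<Sum>j\<in>UNIV. \<tau> j) * (LINT x:cbox a b|lborel. h2 x * \<phi> x)"
      using h phi unfolding has_weak_deriv_def by (metis (no_types, lifting))
    then have "(LINT x:cbox a b|lborel. h1 x * \<phi> x) = (LINT x:cbox a b|lborel. h2 x * \<phi> x)"
      by simp
    then show "(LINT x|lborel. (indicator (cbox a b) x * h1 x - indicator (cbox a b) x * h2 x) * \<phi> x) = 0"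
      using L2_times_test_integrable[OF L(1) K(1,2)] L2_times_test_integrable[OF L(2) K(1,2)]
      by (simp add: left_diff_distrib set_lebesgue_integral_def mult.assoc)
  qed (use box_L2_integrable[OF L'] in auto)
  then show ?thesis by eventually_elim simp
qed

definition sobolev_term :: "real^'d::finite \<Rightarrow> real^'d \<Rightarrow> 'd set \<Rightarrow> (real^'d \<Rightarrow> real) \<Rightarrow> real" where
  "sobolev_term a b w V =
     (LINT y:(\<Pi>\<^sub>E j\<in>w. {a $ j..b $ j})|(\<Pi>\<^sub>M j\<in>w. lborel).
         (LINT x:(\<Pi>\<^sub>E j\<in>- w. {a $ j..b $ j})|(\<Pi>\<^sub>M j\<in>- w. lborel).
            V (\<chi> j. if j \<in> w then y j else x j))\<^sup>2)"

lemma sobolev_norm_eq: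
  "sobolev_norm \<alpha> a b f = sqrt (\<Sum>\<tau> | \<forall>j. \<tau> j \<le> \<alpha>. sobolev_term a b {j. \<tau> j = \<alpha>} (weak_deriv \<tau> a b f))"
  unfolding sobolev_norm_def sobolev_term_def Let_def ..

lemma sobolev_term_eq: "sobolev_term a b w V = partial_sq w (\<lambda>x. indicator (cbox a b) x * V x)"
  unfolding sobolev_term_def partial_sq_def set_lebesgue_integral_def
proof (intro Bochner_Integration.integral_cong refl)
  fix y :: "'a \<Rightarrow> real" assume y: "y \<in> space (\<Pi>\<^sub>M j\<in>w. lborel)"
  have "partial_integral w (\<lambda>x. indicator (cbox a b) x * V x) y =
     (LINT x|PiM (- w) (\<lambda>_. lborel). indicator (\<Pi>\<^sub>E j\<in>w. {a $ j..b $ j}) y *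
         (indicator (\<Pi>\<^sub>E j\<in>- w. {a $ j..b $ j}) x *\<^sub>R V (\<chi> j. if j \<in> w then y j else x j)))"
    unfolding partial_integral_def
  proof (intro Bochner_Integration.integral_cong refl)
    fix x :: "'a \<Rightarrow> real" assume x: "x \<in> space (\<Pi>\<^sub>M j\<in>- w. lborel)"
    have "merge_vec w y x \<in> cbox a b \<longleftrightarrow> y \<in> (\<Pi>\<^sub>E j\<in>w. {a $ j..b $ j}) \<and> x \<in> (\<Pi>\<^sub>E j\<in>- w. {a $ j..b $ j})"
      using x y by (auto simp: mem_box_cart space_PiM PiE_iff split: if_splits)
    then show "indicator (cbox a b) (merge_vec w y x) * V (merge_vec w y x) = indicator (\<Pi>\<^sub>E j\<in>w. {a $ j..b $ j}) y *
         (indicator (\<Pi>\<^sub>E j\<in>- w. {a $ j..b $ j}) x *\<^sub>R V (\<chi> j. if j \<in> w then y j else x j))"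
      by (simp add: indicator_def merge_vec_def)
  qed
  also have "\<dots> = indicator (\<Pi>\<^sub>E j\<in>w. {a $ j..b $ j}) y *
     (LINT x|PiM (- w) (\<lambda>_. lborel). (indicator (\<Pi>\<^sub>E j\<in>- w. {a $ j..b $ j}) x *\<^sub>R V (\<chi> j. if j \<in> w then y j else x j)))"
    by simp
  finally show "indicator (\<Pi>\<^sub>E j\<in>w. {a $ j..b $ j}) y *\<^sub>R
     (LINT x|PiM (- w) (\<lambda>_. lborel). indicator (\<Pi>\<^sub>E j\<in>- w. {a $ j..b $ j}) x *\<^sub>R V (\<chi> j. if j \<in> w then y j else x j))\<^sup>2
     = (partial_integral w (\<lambda>x. indicator (cbox a b) x * V x) y)\<^sup>2"
    by (simp add: indicator_def)
qed

lemma sobolev_term_nonneg: "sobolev_term a b w V \<ge> 0"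
  unfolding sobolev_term_eq partial_sq_def by simp

lemma finite_multi_index: "finite {\<tau> :: 'd::finite \<Rightarrow> nat. \<forall>j. \<tau> j \<le> \<alpha>}"
proof -
  have "{\<tau> :: 'd \<Rightarrow> nat. \<forall>j. \<tau> j \<le> \<alpha>} = (\<Pi>\<^sub>E j\<in>UNIV. {..\<alpha>})" by (auto simp: PiE_iff)
  then show ?thesis by (simp add: finite_PiE)
qed

lemma sobolev_norm_sq:
  "(sobolev_norm \<alpha> a b f)\<^sup>2 = (\<Sum>\<tau> | \<forall>j. \<tau> j \<le> \<alpha>. sobolev_term a b {j. \<tau> j = \<alpha>} (weak_deriv \<tau> a b f))"
  unfolding sobolev_norm_eq by (simp add: sum_nonneg sobolev_term_nonneg)

lemma partial_sq_eq_0: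
  assumes "box_L2 a b V" "AE x in lborel. V x = 0"
  shows "partial_sq w V \<le> 0"
proof -
  have "(LINT x|lborel. (V x)\<^sup>2) = 0"
    using assms(2) by (intro integral_eq_zero_AE) auto
  then show ?thesis using box_L2.partial_sq_bound(2)[OF assms(1), of w] by simp
qed

text \<open>W and the chosen weak derivative agree almost everywhere on the box, hence their
  difference has \<open>partial_sq\<close> equal to 0; the factors 2 come from
  \<open>partial_sq_diff_le\<close>.\<close>

lemma partial_sq_weak_deriv:
  assumes ab: "\<And>j. a $ j \<le> b $ j" and h: "has_weak_deriv \<tau> a b f W" and W: "box_L2 a b W"
  shows "partial_sq w W \<le> 2 * sobolev_term a b w (weak_deriv \<tau> a b f)"
    and "sobolev_term a b w (weak_deriv \<tau> a b f) \<le> 2 * partial_sq w W"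
proof -
  have h': "has_weak_deriv \<tau> a b f (weak_deriv \<tau> a b f)"
    unfolding weak_deriv_def by (rule someI[of "has_weak_deriv \<tau> a b f", OF h])
  define V where "V x = indicator (cbox a b) x * weak_deriv \<tau> a b f x" for x
  have V: "box_L2 a b V" using has_weak_deriv_box_L2[OF ab h'] by (simp add: V_def[abs_def])
  have W_eq: "(\<lambda>x. indicator (cbox a b) x * W x) = W"
  proof
    fix x show "indicator (cbox a b) x * W x = W x"
      using box_L2.V_supp[OF W, of x] by (cases "x \<in> cbox a b") simp_all
  qed
  have ae: "AE x in lborel. W x = V x"
    using has_weak_deriv_unique[OF ab h h'] by (simp add: V_def fun_cong[OF W_eq])
  have st: "sobolev_term a b w (weak_deriv \<tau> a b f) = partial_sq w V"
    by (simp add: sobolev_term_eq V_def[abs_def])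
  have "partial_sq w (\<lambda>x. W x - V x) \<le> 0"
    by (rule partial_sq_eq_0[OF box_L2_diff[OF W V]]) (use ae in auto)
  then show "partial_sq w W \<le> 2 * sobolev_term a b w (weak_deriv \<tau> a b f)"
    using partial_sq_diff_le[OF W V, of w] st by linarith
  have "partial_sq w (\<lambda>x. V x - W x) \<le> 0"
    by (rule partial_sq_eq_0[OF box_L2_diff[OF V W]]) (use ae in auto)
  then show "sobolev_term a b w (weak_deriv \<tau> a b f) \<le> 2 * partial_sq w W"
    using partial_sq_diff_le[OF V W, of w] st by linarith
qed

lemma partial_sq_le_sobolev_norm:
  assumes "\<And>j. a $ j \<le> b $ j" and "has_weak_deriv \<tau> a b f W" and "box_L2 a b W" "\<forall>j. \<tau> j \<le> \<alpha>"
  shows "partial_sq {j. \<tau> j = \<alpha>} W \<le> 2 * (sobolev_norm \<alpha> a b f)\<^sup>2"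
proof -
  have "sobolev_term a b {j. \<tau> j = \<alpha>} (weak_deriv \<tau> a b f) \<le> (sobolev_norm \<alpha> a b f)\<^sup>2"
    unfolding sobolev_norm_sq using assms(4)
    by (intro member_le_sum[of \<tau> _ "\<lambda>\<tau>. sobolev_term a b {j. \<tau> j = \<alpha>} (weak_deriv \<tau> a b f)"])
       (auto intro: sobolev_term_nonneg finite_multi_index)
  then show ?thesis using partial_sq_weak_deriv(1)[OF assms(1,2,3), of "{j. \<tau> j = \<alpha>}"] by linarith
qed

section \<open>A Poincare inequality for tensors\<close>

lemma weak_pair_ftc:
  assumes wp: "weak_pair l r u u'" and st: "l \<le> s" "s \<le> t" "t \<le> r"
  shows "(LINT y:{s..t}|lborel. u' y) = u t - u s"
proof (rule abs_continuous_on_ftc[OF st(2)])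
  show "abs_continuous_on s t u"
    by (rule abs_continuous_on_subset[of l r]) (use wp st in \<open>auto simp: weak_pair_def\<close>)
  have "AE x\<in>{l..r} in lborel. (u has_real_derivative u' x) (at x within {l..r})"
    using wp by (simp add: weak_pair_def)
  then show "AE x\<in>{s..t} in lborel. (u has_real_derivative u' x) (at x within {s..t})"
    by eventually_elim (use st in \<open>auto intro: has_field_derivative_subset\<close>)
  have "integrable lborel u'" using wp by (auto simp: weak_pair_def intro: L2_on_integrable)
  then show "set_integrable lborel {s..t} u'"
    unfolding set_integrable_def by (intro integrable_mult_indicator) auto
qed

lemma mult_left_mono_indicator:
  fixes c d :: real
  assumes "s \<in> A \<Longrightarrow> c \<le> d"
  shows "indicator A s * c \<le> indicator A s * d"
  using assms by (auto simp: indicator_def)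

lemma L2_on_const:
  assumes "l \<le> r"
  shows "L2_on l r (\<lambda>t. indicator {l..r} t * c)"
proof -
  have "(\<lambda>t. (indicator {l..r} t * c)\<^sup>2) = (\<lambda>t. indicator {l..r} t * c\<^sup>2)"
    by (auto simp: indicator_def)
  moreover have "integrable lborel (\<lambda>t. indicator {l..r} t * c\<^sup>2)"
    using assms by (intro integrable_mult_left impI integrable_real_indicator) auto
  ultimately have "integrable lborel (\<lambda>t. (indicator {l..r} t * c)\<^sup>2)" by simp
  then show ?thesis by (auto simp: L2_on_def)
qed

text \<open>Any two values of u differ by at most the L1 norm of u', so the same holds for a value
  and the mean; Cauchy and Schwarz turn that norm into the L2 norm at the cost of the length. The
  bound is pointwise, which suits an argument line by line.\<close>

lemma poincare_1d:
  assumes wp: "weak_pair l r u u'" and lr: "l < r" and t: "t \<in> {l..r}"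
  shows "(u t - (1 / (r - l)) * (LINT s|lborel. u s))\<^sup>2 \<le> (r - l) * (LINT s|lborel. (u' s)\<^sup>2)"
proof -
  have L2: "L2_on l r u" "L2_on l r u'" using wp by (auto simp: weak_pair_def)
  have i: "integrable lborel u" "integrable lborel u'" using L2 by (auto intro: L2_on_integrable)
  define A where "A = (LINT s|lborel. \<bar>u' s\<bar>)"
  have dif: "\<bar>u y - u x\<bar> \<le> A" if "l \<le> x" "x \<le> y" "y \<le> r" for x y
  proof -
    have "\<bar>u y - u x\<bar> = \<bar>LINT z|lborel. indicator {x..y} z * u' z\<bar>"
      using weak_pair_ftc[OF wp that] by (simp add: set_lebesgue_integral_def)
    also have "\<dots> \<le> (LINT z|lborel. \<bar>indicator {x..y} z * u' z\<bar>)" by (rule integral_abs_bound)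
    also have "\<dots> \<le> A"
      unfolding A_def
      by (rule integral_mono)
         (use i integrable_mult_indicator[of "{x..y}" lborel u'] in \<open>auto simp: indicator_def\<close>)
    finally show ?thesis .
  qed
  have bd: "u t - A \<le> u s" "u s \<le> u t + A" if "s \<in> {l..r}" for s
    using dif[of s t] dif[of t s] that t by (auto simp: abs_if split: if_splits; linarith)+
  have u_eq: "(LINT s|lborel. u s) = (LINT s|lborel. indicator {l..r} s * u s)"
    using L2(1) by (intro Bochner_Integration.integral_cong) (auto simp: L2_on_def indicator_def)
  have const: "(LINT s|lborel. indicator {l..r} s * c) = (r - l) * c" for c :: real
    using lr by simp
  have i1: "integrable lborel (\<lambda>s. indicator {l..r} s * c)" for c :: real
    using lr by simp
  have i2: "integrable lborel (\<lambda>s. indicator {l..r} s * u s)"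
    using integrable_mult_indicator[of "{l..r}" lborel u] i by simp
  have "(r - l) * (u t - A) \<le> (LINT s|lborel. u s)"
    unfolding u_eq const[symmetric]
    by (rule integral_mono[OF i1 i2 mult_left_mono_indicator]) (use bd in auto)
  moreover have "(LINT s|lborel. u s) \<le> (r - l) * (u t + A)"
    unfolding u_eq const[symmetric]
    by (rule integral_mono[OF i2 i1 mult_left_mono_indicator]) (use bd in auto)
  ultimately have "\<bar>u t - (1 / (r - l)) * (LINT s|lborel. u s)\<bar> \<le> A"
    using lr by (simp add: abs_le_iff field_simps)
  moreover have "A \<ge> 0" by (simp add: A_def)
  ultimately have "(u t - (1 / (r - l)) * (LINT s|lborel. u s))\<^sup>2 \<le> A\<^sup>2"
    by (metis abs_le_square_iff abs_of_nonneg)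
  also have "ennreal (A\<^sup>2) \<le> emeasure lborel {l..r} * (\<integral>\<^sup>+s. ennreal (\<bar>u' s\<bar>\<^sup>2) \<partial>lborel)"
    unfolding A_def by (rule square_integral_le) (use L2 in \<open>auto simp: L2_on_def\<close>)
  then have "ennreal (A\<^sup>2) \<le> ennreal ((r - l) * (LINT s|lborel. (u' s)\<^sup>2))"
    using L2(2) lr by (subst (asm) nn_integral_eq_integral) (auto simp: L2_on_def ennreal_mult')
  then have "A\<^sup>2 \<le> (r - l) * (LINT s|lborel. (u' s)\<^sup>2)"
    using lr by (subst (asm) ennreal_le_iff) auto
  finally show ?thesis .
qed

lemma L2_on_sum:
  assumes "\<And>i. i < (m::nat) \<Longrightarrow> L2_on l r (u i)"
  shows "L2_on l r (\<lambda>t. \<Sum>i<m. c i * u i t)"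
  using assms
proof (induction m)
  case (Suc m)
  let ?v = "\<lambda>t. \<Sum>i<m. c i * u i t"
  have v: "L2_on l r ?v" and w: "L2_on l r (u m)" using Suc by auto
  have [measurable]: "?v \<in> borel_measurable borel" "u m \<in> borel_measurable borel"
    using v w by (auto simp: L2_on_def)
  have "integrable lborel (\<lambda>t. (?v t + c m * u m t)\<^sup>2)"
  proof (rule Bochner_Integration.integrable_bound)
    show "integrable lborel (\<lambda>t. 2 * (?v t)\<^sup>2 + 2 * ((c m)\<^sup>2 * (u m t)\<^sup>2))"
      using v w by (auto simp: L2_on_def)
    have "(x + y)\<^sup>2 \<le> 2 * x\<^sup>2 + 2 * y\<^sup>2" for x y :: real
      using zero_le_power2[of "x - y"] by (simp add: power2_eq_square algebra_simps)
    from this[of "?v t" "c m * u m t" for t]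
    show "AE t in lborel. norm ((?v t + c m * u m t)\<^sup>2) \<le> norm (2 * (?v t)\<^sup>2 + 2 * ((c m)\<^sup>2 * (u m t)\<^sup>2))"
      by (intro AE_I2) (simp add: power_mult_distrib)
  qed measurable
  then show ?case using v w by (auto simp: L2_on_def)
qed (auto simp: L2_on_def)

lemma weak_pair_sum:
  assumes wp: "\<And>i. i < (m::nat) \<Longrightarrow> weak_pair l r (u i) (u' i)"
  shows "weak_pair l r (\<lambda>t. \<Sum>i<m. c i * u i t) (\<lambda>t. \<Sum>i<m. c i * u' i t)"
  unfolding weak_pair_def
proof (intro conjI L2_on_sum)
  show "abs_continuous_on l r (\<lambda>t. \<Sum>i<m. c i * u i t)"
    using wp by (intro abs_continuous_on_sum abs_continuous_on_mult abs_continuous_on_const) (auto simp: weak_pair_def)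
  have "AE x in lborel. \<forall>i\<in>{..<m}. x \<in> {l..r} \<longrightarrow> (u i has_real_derivative u' i x) (at x within {l..r})"
    using wp by (subst AE_ball_countable) (auto simp: weak_pair_def)
  then show "AE x\<in>{l..r} in lborel. ((\<lambda>t. \<Sum>i<m. c i * u i t) has_real_derivative (\<Sum>i<m. c i * u' i x)) (at x within {l..r})"
    by eventually_elim (auto intro!: DERIV_sum DERIV_cmult)
qed (use wp in \<open>auto simp: weak_pair_def\<close>)

text \<open>The one-dimensional inequality on all lines in direction j. Index \<open>k0\<close>
  stands for the mean in that variable and \<open>k1\<close> for the derivative. One factor \<l> is
  the length in the pointwise estimate, the other comes from integrating the constant bound over the
  line.\<close>

lemma poincare_tens_step:
  fixes a b :: "real^'d::finite"
  assumes ab: "\<And>j. a $ j \<le> b $ j" and l: "b $ j - a $ j = \<l>" "\<l> > 0"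
    and L2: "\<And>i k. i < m \<Longrightarrow> L2_on (a $ k) (b $ k) (D i k (\<tau> k))"
    and wp: "\<And>i. i < m \<Longrightarrow> weak_pair (a $ j) (b $ j) (D i j (\<tau> j)) (D i j k1)"
    and mean: "\<And>i. i < m \<Longrightarrow> D i j k0 = (\<lambda>t. indicator {a $ j..b $ j} t * ((1 / \<l>) * (LINT s|lborel. D i j (\<tau> j) s)))"
  shows "(LINT x|lborel. (tens m D \<tau> x)\<^sup>2) \<le>
     2 * (LINT x|lborel. (tens m D (\<tau>(j := k0)) x)\<^sup>2) + 2 * (\<l>\<^sup>2 * (LINT x|lborel. (tens m D (\<tau>(j := k1)) x)\<^sup>2))"
proof -
  let ?U = "tens m D \<tau>" and ?A = "tens m D (\<tau>(j := k0))" and ?B = "tens m D (\<tau>(j := k1))"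
  have L0: "L2_on (a $ j) (b $ j) (D i j k0)" if "i < m" for i
    unfolding mean[OF that] by (rule L2_on_const[OF ab])
  have T: "box_L2 a b ?U" by (rule box_L2_tens[of a b m D \<tau>, OF ab L2])
  have T0: "box_L2 a b ?A"
  proof (rule box_L2_tens)
    show "L2_on (a $ k) (b $ k) (D i k ((\<tau>(j := k0)) k))" if "i < m" for i k
      using L0[OF that] L2[OF that, of k] by auto
  qed (rule ab)
  have T1: "box_L2 a b ?B"
  proof (rule box_L2_tens)
    show "L2_on (a $ k) (b $ k) (D i k ((\<tau>(j := k1)) k))" if "i < m" for i k
      using wp[OF that] L2[OF that, of k] by (auto simp: weak_pair_def)
  qed (rule ab)
  interpret T: box_L2 a b ?U by fact
  interpret T0: box_L2 a b ?A by fact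
  interpret T1: box_L2 a b ?B by fact
  interpret Df: box_L2 a b "\<lambda>x. ?U x - ?A x" by (rule box_L2_diff[OF T T0])
  have pt: "ennreal ((?U x - ?A x)\<^sup>2) \<le> ennreal \<l> * (indicator {a $ j..b $ j} (x $ j) * (\<integral>\<^sup>+t. ennreal ((?B (upd_vec x j t))\<^sup>2) \<partial>lborel))" for x
  proof (cases "x \<in> cbox a b")
    case True
    then have xj: "x $ j \<in> {a $ j..b $ j}" by (simp add: mem_box_cart)
    define c where "c i = (\<Prod>k\<in>UNIV - {j}. D i k (\<tau> k) (x $ k))" for i
    define u where "u t = (\<Sum>i<m. c i * D i j (\<tau> j) t)" for t
    define u' where "u' t = (\<Sum>i<m. c i * D i j k1 t)" for t
    have wpu: "weak_pair (a $ j) (b $ j) u u'"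
      unfolding u_def[abs_def] u'_def[abs_def] by (rule weak_pair_sum[OF wp])
    have "?U x = u (x $ j)"
      using tens_upd[of m D \<tau> x j "x $ j"] by (simp add: u_def c_def)
    moreover have "?A x = (1 / (b $ j - a $ j)) * (LINT s|lborel. u s)"
    proof -
      have "(LINT s|lborel. u s) = (\<Sum>i<m. c i * (LINT s|lborel. D i j (\<tau> j) s))"
        unfolding u_def using L2_on_integrable[OF L2] by (subst Bochner_Integration.integral_sum) auto
      moreover have "?A x = (\<Sum>i<m. c i * D i j k0 (x $ j))"
        using tens_upd_upd[of m D \<tau> j k0 x "x $ j"] by (simp add: c_def)
      ultimately show ?thesis using xj mean l by (simp add: sum_distrib_left sum_divide_distrib)
    qed
    ultimately have pu: "(?U x - ?A x)\<^sup>2 \<le> \<l> * (LINT s|lborel. (u' s)\<^sup>2)"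
      using poincare_1d[OF wpu _ xj] l by simp
    have u'_eq: "u' = (\<lambda>t. ?B (upd_vec x j t))"
      by (simp add: tens_upd_upd u'_def c_def fun_eq_iff)
    have "ennreal ((?U x - ?A x)\<^sup>2) \<le> ennreal \<l> * ennreal (LINT s|lborel. (?B (upd_vec x j s))\<^sup>2)"
      using l pu u'_eq by (simp add: ennreal_mult'[symmetric] ennreal_leI)
    also have "ennreal (LINT s|lborel. (?B (upd_vec x j s))\<^sup>2) = (\<integral>\<^sup>+t. ennreal ((?B (upd_vec x j t))\<^sup>2) \<partial>lborel)"
      using wpu u'_eq by (intro nn_integral_eq_integral[symmetric]) (auto simp: weak_pair_def L2_on_def)
    finally show ?thesis using xj by (simp add: fun_upd_def)
  qed (simp add: T.V_supp T0.V_supp)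
  have m1: "(\<lambda>x. \<integral>\<^sup>+t. ennreal ((?B (upd_vec x j t))\<^sup>2) \<partial>lborel) \<in> borel_measurable borel"
    using lborel.borel_measurable_nn_integral_fst[of "\<lambda>p. ennreal ((?B (upd_vec (fst p) j (snd p)))\<^sup>2)" lborel]
      measurable_compose[OF measurable_upd_vec[of j] T1.V_measurable] by simp
  have "ennreal (LINT x|lborel. (?U x - ?A x)\<^sup>2) = (\<integral>\<^sup>+x. ennreal ((?U x - ?A x)\<^sup>2) \<partial>lborel)"
    using Df.V_sq by (intro nn_integral_eq_integral[symmetric]) auto
  also have "\<dots> \<le> (\<integral>\<^sup>+x. ennreal \<l> * (indicator {a $ j..b $ j} (x $ j) * (\<integral>\<^sup>+t. ennreal ((?B (upd_vec x j t))\<^sup>2) \<partial>lborel)) \<partial>lborel)"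
    by (intro nn_integral_mono pt)
  also have "\<dots> = ennreal \<l> * (emeasure lborel {a $ j..b $ j} * (\<integral>\<^sup>+x. ennreal ((?B x)\<^sup>2) \<partial>lborel))"
    using m1 by (subst nn_integral_cmult) (auto simp: nn_integral_resample[of "\<lambda>x. ennreal ((?B x)\<^sup>2)"])
  also have "(\<integral>\<^sup>+x. ennreal ((?B x)\<^sup>2) \<partial>lborel) = ennreal (LINT x|lborel. (?B x)\<^sup>2)"
    using T1.V_sq by (intro nn_integral_eq_integral) auto
  also have "ennreal \<l> * (emeasure lborel {a $ j..b $ j} * \<dots>) = ennreal (\<l>\<^sup>2 * (LINT x|lborel. (?B x)\<^sup>2))"
    using l ab[of j] by (simp add: ennreal_mult' power2_eq_square mult.assoc)
  finally have key: "(LINT x|lborel. (?U x - ?A x)\<^sup>2) \<le> \<l>\<^sup>2 * (LINT x|lborel. (?B x)\<^sup>2)"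
    by (subst (asm) ennreal_le_iff) auto
  have "(LINT x|lborel. (?U x)\<^sup>2) \<le> (LINT x|lborel. 2 * (?A x)\<^sup>2 + 2 * (?U x - ?A x)\<^sup>2)"
  proof (rule integral_mono)
    have sq: "p\<^sup>2 \<le> 2 * q\<^sup>2 + 2 * (p - q)\<^sup>2" for p q :: real
      using zero_le_power2[of "p - 2 * q"] by (simp add: power2_eq_square algebra_simps)
    then show "(?U x)\<^sup>2 \<le> 2 * (?A x)\<^sup>2 + 2 * (?U x - ?A x)\<^sup>2" for x .
  qed (use T.V_sq T0.V_sq Df.V_sq in auto)
  also have "\<dots> = 2 * (LINT x|lborel. (?A x)\<^sup>2) + 2 * (LINT x|lborel. (?U x - ?A x)\<^sup>2)"
    using T0.V_sq Df.V_sq by simp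
  finally show ?thesis using key by linarith
qed

text \<open>The indices beyond \<open>\<alpha>\<close> stand for means of the derivatives of order below \<open>\<alpha>\<close>.\<close>

definition mean_ext :: "nat \<Rightarrow> real^'d::finite \<Rightarrow> real^'d \<Rightarrow> real \<Rightarrow> (nat \<Rightarrow> 'd \<Rightarrow> nat \<Rightarrow> real \<Rightarrow> real) \<Rightarrow> nat \<Rightarrow> 'd \<Rightarrow> nat \<Rightarrow> real \<Rightarrow> real" where
  "mean_ext \<alpha> a b \<l> D i j k =
     (if k \<le> \<alpha> then D i j k
      else (\<lambda>t. indicator {a $ j..b $ j} t * ((1 / \<l>) * (LINT s|lborel. D i j (k - \<alpha> - 1) s))))"

locale tensor_chain =
  fixes a b :: "real^'d::finite" and \<l> :: real and \<alpha> m :: nat and D :: "nat \<Rightarrow> 'd \<Rightarrow> nat \<Rightarrow> real \<Rightarrow> real"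
  assumes side: "\<And>j. b $ j - a $ j = \<l>" and l1: "\<l> \<ge> 1" and al: "\<alpha> \<ge> 1"
    and chain: "\<And>i j. i < m \<Longrightarrow> sobolev_chain \<alpha> (a $ j) (b $ j) (D i j)"
begin

lemma ab: "a $ j \<le> b $ j"
  using side[of j] l1 by simp

abbreviation "E \<equiv> mean_ext \<alpha> a b \<l> D"

text \<open>Weights that make the Poincare step independent of scale: each derivative counts \<l>^2,
  and the mean of a derivative of order k, stored at index k + \<alpha> + 1, has the weight of order
  k.\<close>

definition wt :: "nat \<Rightarrow> real" where
  "wt k = (if k \<le> \<alpha> then \<l> ^ (2 * k) else \<l> ^ (2 * (k - \<alpha> - 1)))"

definition energy :: "('d \<Rightarrow> nat) \<Rightarrow> real" where
  "energy \<tau> = (\<Prod>j\<in>UNIV. wt (\<tau> j)) * (LINT x|lborel. (tens m E \<tau> x)\<^sup>2)"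

lemma energy_nonneg: "energy \<tau> \<ge> 0"
  unfolding energy_def using l1 by (intro mult_nonneg_nonneg prod_nonneg) (auto simp: wt_def)

lemma L2_E:
  assumes "i < m" shows "L2_on (a $ j) (b $ j) (E i j k)"
proof (cases "k \<le> \<alpha>")
  case True
  then show ?thesis using chain[OF assms, of j] by (simp add: sobolev_chain_def mean_ext_def)
next
  case False
  then show ?thesis unfolding mean_ext_def by (simp only: if_False L2_on_const[OF ab])
qed

lemma energy_step:
  assumes j: "\<tau> j < \<alpha>"
  shows "energy \<tau> \<le> 2 * energy (\<tau>(j := \<tau> j + \<alpha> + 1)) + 2 * energy (\<tau>(j := Suc (\<tau> j)))"
proof -
  define P where "P = (\<Prod>k\<in>UNIV - {j}. wt (\<tau> k))"
  have P: "P \<ge> 0" unfolding P_def using l1 by (intro prod_nonneg) (auto simp: wt_def)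
  have pr: "(\<Prod>k\<in>UNIV. wt ((\<tau>(j := n)) k)) = wt n * P" for n
    unfolding P_def by (subst prod.remove[of UNIV j]) (auto intro!: prod.cong)
  have pr0: "(\<Prod>k\<in>UNIV. wt (\<tau> k)) = wt (\<tau> j) * P" using pr[of "\<tau> j"] by simp
  have w: "wt (\<tau> j + \<alpha> + 1) = wt (\<tau> j)" "wt (Suc (\<tau> j)) = wt (\<tau> j) * \<l>\<^sup>2"
    using j by (auto simp: wt_def power2_eq_square)
  have w0: "wt (\<tau> j) \<ge> 0" using l1 by (auto simp: wt_def)
  have "(LINT x|lborel. (tens m E \<tau> x)\<^sup>2) \<le>
     2 * (LINT x|lborel. (tens m E (\<tau>(j := \<tau> j + \<alpha> + 1)) x)\<^sup>2) + 2 * (\<l>\<^sup>2 * (LINT x|lborel. (tens m E (\<tau>(j := Suc (\<tau> j))) x)\<^sup>2))"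
  proof (rule poincare_tens_step[OF ab side])
    fix i assume "i < m"
    then show "weak_pair (a $ j) (b $ j) (E i j (\<tau> j)) (E i j (Suc (\<tau> j)))"
      using chain[of i j] j by (simp add: mean_ext_def sobolev_chain_def)
    show "E i j (\<tau> j + \<alpha> + 1) = (\<lambda>t. indicator {a $ j..b $ j} t * (1 / \<l> * (LINT s|lborel. E i j (\<tau> j) s)))"
      using j by (simp add: mean_ext_def)
  qed (use l1 L2_E in auto)
  then have "(wt (\<tau> j) * P) * (LINT x|lborel. (tens m E \<tau> x)\<^sup>2) \<le> (wt (\<tau> j) * P) *
     (2 * (LINT x|lborel. (tens m E (\<tau>(j := \<tau> j + \<alpha> + 1)) x)\<^sup>2) + 2 * (\<l>\<^sup>2 * (LINT x|lborel. (tens m E (\<tau>(j := Suc (\<tau> j))) x)\<^sup>2)))"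
    using P w0 by (intro mult_left_mono) auto
  then show ?thesis
    unfolding energy_def pr pr0 w by (simp add: algebra_simps)
qed

text \<open>In every variable a terminal index asks either for the derivative of order \<alpha> or,
  at \<alpha> + 1 to 2 \<alpha>, for the mean of a derivative of lower order. These combinations
  correspond to the terms of the Sobolev norm, so the iteration stops there.\<close>

definition terminal :: "('d \<Rightarrow> nat) set" where
  "terminal = {\<tau>. \<forall>j. \<alpha> \<le> \<tau> j \<and> \<tau> j \<le> 2 * \<alpha>}"

lemma terminal_eq: "terminal = (\<Pi>\<^sub>E j\<in>UNIV. {\<alpha>..2 * \<alpha>})"
  by (auto simp: terminal_def PiE_iff)

lemma finite_terminal: "finite terminal" and card_terminal: "card terminal = (\<alpha> + 1) ^ CARD('d)"
  unfolding terminal_eq by (auto simp: finite_PiE card_PiE)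

text \<open>Induction on the total number of missing orders. A step in variable j either passes to
  the mean, which removes all missing orders of that variable, or raises its derivative by one. Two
  branches with a factor 2 each give 4 per missing order.\<close>

lemma energy_le_terminal:
  "(\<And>j. \<tau> j \<le> 2 * \<alpha>) \<Longrightarrow> energy \<tau> \<le> 4 ^ (\<Sum>j\<in>UNIV. \<alpha> - \<tau> j) * (\<Sum>\<tau>\<in>terminal. energy \<tau>)"
proof (induction "\<Sum>j\<in>UNIV. \<alpha> - \<tau> j" arbitrary: \<tau> rule: less_induct)
  case less
  define S where "S = (\<Sum>\<tau>\<in>terminal. energy \<tau>)"
  have S: "S \<ge> 0" unfolding S_def by (intro sum_nonneg energy_nonneg)
  let ?n = "\<Sum>j\<in>UNIV. \<alpha> - \<tau> j"
  show ?case
  proof (cases "\<tau> \<in> terminal")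
    case True
    then have "energy \<tau> \<le> 1 * S"
      unfolding S_def mult_1 by (intro member_le_sum) (auto simp: energy_nonneg finite_terminal)
    also have "\<dots> \<le> 4 ^ ?n * S" using S by (intro mult_right_mono) auto
    finally show ?thesis by (simp add: S_def)
  next
    case False
    then obtain j where j: "\<tau> j < \<alpha>" using less.prems by (auto simp: terminal_def not_le)
    let ?v = "\<tau>(j := \<tau> j + \<alpha> + 1)" and ?w = "\<tau>(j := Suc (\<tau> j))"
    have split: "(\<Sum>k\<in>UNIV. \<alpha> - (\<tau>(j := n)) k) = (\<alpha> - n) + (\<Sum>k\<in>UNIV - {j}. \<alpha> - \<tau> k)" for n
      by (subst sum.remove[of UNIV j]) (auto intro!: sum.cong)
    have s: "?n = (\<alpha> - \<tau> j) + (\<Sum>k\<in>UNIV - {j}. \<alpha> - \<tau> k)"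
      using split[of "\<tau> j"] by simp
    have lt: "(\<Sum>k\<in>UNIV. \<alpha> - ?v k) < ?n" "(\<Sum>k\<in>UNIV. \<alpha> - ?w k) < ?n"
      unfolding split s using j by auto
    have pw: "(4::real) ^ k * S \<le> 4 ^ (?n - 1) * S" if "k < ?n" for k
      using that S by (intro mult_right_mono power_increasing) auto
    have "energy ?v \<le> 4 ^ (\<Sum>k\<in>UNIV. \<alpha> - ?v k) * S"
      unfolding S_def by (rule less.hyps[OF lt(1)]) (use less.prems j in auto)
    moreover have "energy ?w \<le> 4 ^ (\<Sum>k\<in>UNIV. \<alpha> - ?w k) * S"
      unfolding S_def by (rule less.hyps[OF lt(2)]) (use less.prems j in auto)
    ultimately have "energy \<tau> \<le> 4 * (4 ^ (?n - 1) * S)"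
      using energy_step[of \<tau> j, OF j] pw[OF lt(1)] pw[OF lt(2)] by linarith
    also have "\<dots> = 4 ^ Suc (?n - 1) * S" by simp
    also have "Suc (?n - 1) = ?n" using lt(1) by simp
    finally show ?thesis by (simp add: S_def)
  qed
qed

text \<open>Let r be the number of variables outside w. A tensor averaged in these variables is
  constant there on the box and equals \<l>^(-r) times the partial integral. Integrating its square
  over them restores \<l>^r, and the remaining factor \<l>^(-r) is at most 1 because \<l> \<ge>
  1.\<close>

lemma terminal_integral:
  assumes t: "\<tau> \<in> terminal"
  defines "\<rho> \<equiv> \<lambda>j. if \<tau> j = \<alpha> then \<alpha> else \<tau> j - \<alpha> - 1"
  shows "(LINT x|lborel. (tens m E \<tau> x)\<^sup>2) \<le> partial_sq {j. \<rho> j = \<alpha>} (tens m D \<rho>)"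
proof -
  define w where "w = {j. \<rho> j = \<alpha>}"
  have t': "\<alpha> \<le> \<tau> j" "\<tau> j \<le> 2 * \<alpha>" for j using t by (auto simp: terminal_def)
  have cases: "(\<tau> j = \<alpha> \<and> \<rho> j = \<alpha>) \<or> (\<tau> j > \<alpha> \<and> \<rho> j = \<tau> j - \<alpha> - 1 \<and> \<rho> j < \<alpha>)" for j
    unfolding \<rho>_def using t'[of j] al by (cases "\<tau> j = \<alpha>") auto
  have rho: "\<rho> j \<le> \<alpha>" for j using cases[of j] by linarith
  have w: "\<tau> j = \<alpha>" "\<rho> j = \<alpha>" if "j \<in> w" for j
    using that cases[of j] by (auto simp: w_def)
  have w': "\<tau> j > \<alpha>" "\<rho> j = \<tau> j - \<alpha> - 1" if "j \<in> - w" for j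
    using that cases[of j] by (auto simp: w_def)
  interpret T: box_L2 a b "tens m D \<rho>"
    by (rule box_L2_tens[OF ab]) (use chain rho in \<open>auto simp: sobolev_chain_def\<close>)
  interpret TE: box_L2 a b "tens m E \<tau>"
    by (rule box_L2_tens[OF ab]) (rule L2_E)
  let ?I = "\<lambda>i j. LINT s|lborel. D i j (\<rho> j) s"
  have int: "integrable lborel (D i j (\<rho> j))" if "i < m" for i j
    using chain[OF that, of j] rho[of j] by (intro L2_on_integrable[of "a $ j" "b $ j"]) (auto simp: sobolev_chain_def)
  have P: "partial_integral w (tens m D \<rho>) y = (\<Sum>i<m. (\<Prod>j\<in>w. D i j \<alpha> (y j)) * (\<Prod>j\<in>- w. ?I i j))" for y
  proof -
    have e: "tens m D \<rho> (merge_vec w y x) = (\<Sum>i<m. (\<Prod>j\<in>w. D i j \<alpha> (y j)) * (\<Prod>j\<in>- w. D i j (\<rho> j) (x j)))" for x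
      unfolding tens_def
    proof (intro sum.cong refl)
      fix i
      have "(\<Prod>j\<in>UNIV. D i j (\<rho> j) (merge_vec w y x $ j)) = (\<Prod>j\<in>w. D i j (\<rho> j) (merge_vec w y x $ j)) * (\<Prod>j\<in>- w. D i j (\<rho> j) (merge_vec w y x $ j))"
        by (subst prod.union_disjoint[symmetric]) (auto simp: Compl_partition)
      then show "(\<Prod>j\<in>UNIV. D i j (\<rho> j) (merge_vec w y x $ j)) = (\<Prod>j\<in>w. D i j \<alpha> (y j)) * (\<Prod>j\<in>- w. D i j (\<rho> j) (x j))"
        using w by simp
    qed
    show ?thesis
      unfolding partial_integral_def e
      using PL.product_integrable_prod[of "- w" "\<lambda>j. D i j (\<rho> j)" for i] PL.product_integral_prod[of "- w" "\<lambda>j. D i j (\<rho> j)" for i] int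
      by (subst Bochner_Integration.integral_sum) auto
  qed
  have Teq: "tens m E \<tau> (merge_vec w y x) = (1 / \<l>) ^ card (- w) * partial_integral w (tens m D \<rho>) y * (\<Prod>j\<in>- w. indicator {a $ j..b $ j} (x j))" for y x
  proof -
    have "(\<Prod>j\<in>UNIV. E i j (\<tau> j) (merge_vec w y x $ j)) = (1 / \<l>) ^ card (- w) * ((\<Prod>j\<in>w. D i j \<alpha> (y j)) * (\<Prod>j\<in>- w. ?I i j)) * (\<Prod>j\<in>- w. indicator {a $ j..b $ j} (x j))" for i
    proof -
      have "(\<Prod>j\<in>UNIV. E i j (\<tau> j) (merge_vec w y x $ j)) = (\<Prod>j\<in>w. E i j (\<tau> j) (merge_vec w y x $ j)) * (\<Prod>j\<in>- w. E i j (\<tau> j) (merge_vec w y x $ j))"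
        by (subst prod.union_disjoint[symmetric]) (auto simp: Compl_partition)
      also have "(\<Prod>j\<in>w. E i j (\<tau> j) (merge_vec w y x $ j)) = (\<Prod>j\<in>w. D i j \<alpha> (y j))"
        using w by (intro prod.cong) (auto simp: mean_ext_def)
      also have "(\<Prod>j\<in>- w. E i j (\<tau> j) (merge_vec w y x $ j)) = (\<Prod>j\<in>- w. indicator {a $ j..b $ j} (x j) * ((1 / \<l>) * ?I i j))"
        using w' by (intro prod.cong) (auto simp: mean_ext_def not_le[symmetric])
      also have "\<dots> = (\<Prod>j\<in>- w. indicator {a $ j..b $ j} (x j)) * ((1 / \<l>) ^ card (- w) * (\<Prod>j\<in>- w. ?I i j))"
        by (simp only: prod.distrib prod_constant)
      finally show ?thesis by (simp only: mult_ac)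
    qed
    then show ?thesis unfolding P tens_def by (simp only: sum_distrib_left sum_distrib_right)
  qed
  have le: "(\<integral>\<^sup>+x. ennreal ((tens m E \<tau> (merge_vec w y x))\<^sup>2) \<partial>PiM (- w) (\<lambda>_. lborel)) \<le> ennreal ((partial_integral w (tens m D \<rho>) y)\<^sup>2)" for y
  proof -
    have "(\<integral>\<^sup>+x. ennreal ((tens m E \<tau> (merge_vec w y x))\<^sup>2) \<partial>PiM (- w) (\<lambda>_. lborel))
      = (\<integral>\<^sup>+x. ennreal (((1 / \<l>) ^ card (- w))\<^sup>2 * (partial_integral w (tens m D \<rho>) y)\<^sup>2) * indicator (\<Pi>\<^sub>E j\<in>- w. {a $ j..b $ j}) x \<partial>PiM (- w) (\<lambda>_. lborel))"
    proof (rule nn_integral_cong)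
      fix x :: "'d \<Rightarrow> real" assume x: "x \<in> space (PiM (- w) (\<lambda>_. lborel))"
      show "ennreal ((tens m E \<tau> (merge_vec w y x))\<^sup>2) = ennreal (((1 / \<l>) ^ card (- w))\<^sup>2 * (partial_integral w (tens m D \<rho>) y)\<^sup>2) * indicator (\<Pi>\<^sub>E j\<in>- w. {a $ j..b $ j}) x"
      proof (cases "x \<in> (\<Pi>\<^sub>E j\<in>- w. {a $ j..b $ j})")
        case True
        then have "(\<Prod>j\<in>- w. indicator {a $ j..b $ j} (x j)) = (1::real)" by (intro prod.neutral) (auto simp: PiE_iff)
        then show ?thesis unfolding Teq using True by (simp add: power_mult_distrib)
      next
        case False
        then obtain j where "j \<in> - w" "x j \<notin> {a $ j..b $ j}" using x by (auto simp: space_PiM PiE_iff)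
        then have "(\<Prod>j\<in>- w. indicator {a $ j..b $ j} (x j)) = (0::real)"
          by (intro prod_zero bexI[of _ j]) auto
        then show ?thesis unfolding Teq using False by simp
      qed
    qed
    also have "\<dots> = ennreal (((1 / \<l>) ^ card (- w))\<^sup>2 * (partial_integral w (tens m D \<rho>) y)\<^sup>2) * ennreal (\<Prod>j\<in>- w. b $ j - a $ j)"
      by (subst nn_integral_cmult_indicator) (auto simp: T.box_compl_measure intro!: sets_PiM_I_finite)
    also have "\<dots> = ennreal (((1 / \<l>) ^ card (- w))\<^sup>2 * (partial_integral w (tens m D \<rho>) y)\<^sup>2 * \<l> ^ card (- w))"
      using l1 by (subst ennreal_mult'[symmetric]) (auto simp: side)
    also have "\<dots> \<le> ennreal ((partial_integral w (tens m D \<rho>) y)\<^sup>2)"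
    proof (rule ennreal_leI)
      have "((1 / \<l>) ^ card (- w))\<^sup>2 * \<l> ^ card (- w) = (1 / \<l>) ^ card (- w)"
        using l1 by (simp add: power2_eq_square power_one_over)
      also have "\<dots> \<le> 1" using l1 by (intro power_le_one) auto
      finally have "(((1 / \<l>) ^ card (- w))\<^sup>2 * \<l> ^ card (- w)) * (partial_integral w (tens m D \<rho>) y)\<^sup>2 \<le> 1 * (partial_integral w (tens m D \<rho>) y)\<^sup>2"
        by (intro mult_right_mono) auto
      then show "((1 / \<l>) ^ card (- w))\<^sup>2 * (partial_integral w (tens m D \<rho>) y)\<^sup>2 * \<l> ^ card (- w) \<le> (partial_integral w (tens m D \<rho>) y)\<^sup>2"
        by (simp add: mult_ac)
    qed
    finally show ?thesis .
  qed
  have "ennreal (LINT x|lborel. (tens m E \<tau> x)\<^sup>2) = (\<integral>\<^sup>+x. ennreal ((tens m E \<tau> x)\<^sup>2) \<partial>lborel)"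
    using TE.V_sq by (intro nn_integral_eq_integral[symmetric]) auto
  also have "\<dots> = (\<integral>\<^sup>+y. (\<integral>\<^sup>+x. ennreal ((tens m E \<tau> (merge_vec w y x))\<^sup>2) \<partial>PiM (- w) (\<lambda>_. lborel)) \<partial>PiM w (\<lambda>_. lborel))"
    by (rule TE.nn_integral_merge) measurable
  also have "\<dots> \<le> (\<integral>\<^sup>+y. ennreal ((partial_integral w (tens m D \<rho>) y)\<^sup>2) \<partial>PiM w (\<lambda>_. lborel))"
    by (intro nn_integral_mono le)
  also have "\<dots> = ennreal (partial_sq w (tens m D \<rho>))"
    unfolding partial_sq_def by (intro nn_integral_eq_integral T.partial_sq_bound(1)) auto
  finally show ?thesis
    unfolding w_def by (subst (asm) ennreal_le_iff) (auto simp: partial_sq_def)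
qed

text \<open>The constant collects 4 for each of at most \<alpha> d missing orders and the number
  (\<alpha> + 1)^d of terminal indices; a terminal weight is at most \<l>^(2 \<alpha> d). The weight
  on the left is kept because the cutoff later multiplies derivatives by comparable powers of the
  scale.\<close>

theorem poincare_tens:
  assumes S: "\<And>\<rho>. (\<And>j. \<rho> j \<le> \<alpha>) \<Longrightarrow> partial_sq {j. \<rho> j = \<alpha>} (tens m D \<rho>) \<le> S" and \<sigma>: "\<And>j. \<sigma> j \<le> \<alpha>"
  shows "\<l> ^ (2 * (\<Sum>j\<in>UNIV. \<sigma> j)) * (LINT x|lborel. (tens m D \<sigma> x)\<^sup>2) \<le>
    4 ^ (\<alpha> * CARD('d)) * real ((\<alpha> + 1) ^ CARD('d)) * \<l> ^ (2 * \<alpha> * CARD('d)) * S"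
proof -
  have S0: "S \<ge> 0"
    using S[of "\<lambda>_. \<alpha>"] unfolding partial_sq_def by (smt (verit) Bochner_Integration.integral_nonneg le_refl zero_le_power2)
  have en: "energy \<tau> \<le> \<l> ^ (2 * \<alpha> * CARD('d)) * S" if t: "\<tau> \<in> terminal" for \<tau>
  proof -
    let ?\<rho> = "\<lambda>j. if \<tau> j = \<alpha> then \<alpha> else \<tau> j - \<alpha> - 1"
    have r: "?\<rho> j \<le> \<alpha>" for j
    proof -
      have "\<tau> j \<le> 2 * \<alpha>" using t by (auto simp: terminal_def)
      then show ?thesis by (simp split: if_splits) linarith
    qed
    have wl: "wt k \<le> \<l> ^ (2 * \<alpha>)" if "k \<le> 2 * \<alpha>" for k
      using that l1 unfolding wt_def by (auto intro!: power_increasing)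
    have "(\<Prod>j\<in>UNIV. wt (\<tau> j)) \<le> (\<Prod>j\<in>(UNIV::'d set). \<l> ^ (2 * \<alpha>))"
      using t l1 by (intro prod_mono conjI wl) (auto simp: terminal_def wt_def)
    also have "\<dots> = \<l> ^ (2 * \<alpha> * CARD('d))" by (simp add: power_mult)
    finally have p: "(\<Prod>j\<in>UNIV. wt (\<tau> j)) \<le> \<l> ^ (2 * \<alpha> * CARD('d))" .
    have "(LINT x|lborel. (tens m E \<tau> x)\<^sup>2) \<le> S"
      using terminal_integral[OF t] S[of ?\<rho>, OF r] by linarith
    then show ?thesis unfolding energy_def using p l1 by (intro mult_mono) auto
  qed
  have "\<l> ^ (2 * (\<Sum>j\<in>UNIV. \<sigma> j)) * (LINT x|lborel. (tens m D \<sigma> x)\<^sup>2) = energy \<sigma>"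
    unfolding energy_def tens_def using \<sigma> by (simp add: wt_def mean_ext_def power_sum sum_distrib_left)
  also have "\<dots> \<le> 4 ^ (\<Sum>j\<in>UNIV. \<alpha> - \<sigma> j) * (\<Sum>\<tau>\<in>terminal. energy \<tau>)"
  proof (rule energy_le_terminal)
    fix j show "\<sigma> j \<le> 2 * \<alpha>" using \<sigma>[of j] by simp
  qed
  also have "\<dots> \<le> 4 ^ (\<alpha> * CARD('d)) * (\<Sum>\<tau>\<in>terminal. energy \<tau>)"
  proof (intro mult_right_mono power_increasing sum_nonneg energy_nonneg)
    have "(\<Sum>j\<in>(UNIV::'d set). \<alpha> - \<sigma> j) \<le> (\<Sum>j\<in>(UNIV::'d set). \<alpha>)" by (intro sum_mono) auto
    then show "(\<Sum>j\<in>UNIV. \<alpha> - \<sigma> j) \<le> \<alpha> * CARD('d)" by (simp add: mult.commute)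
  qed auto
  also have "\<dots> \<le> 4 ^ (\<alpha> * CARD('d)) * (real (card terminal) * (\<l> ^ (2 * \<alpha> * CARD('d)) * S))"
    by (intro mult_left_mono sum_bounded_above en) auto
  finally show ?thesis unfolding card_terminal by (simp add: mult_ac)
qed

end

section \<open>Approximation of Sobolev functions by tensors\<close>

lemma L2_on_cmult: "L2_on l r u \<Longrightarrow> L2_on l r (\<lambda>t. c * u t)"
  by (auto simp: L2_on_def power_mult_distrib)

lemma weak_pair_cmult: "weak_pair l r u u' \<Longrightarrow> weak_pair l r (\<lambda>t. c * u t) (\<lambda>t. c * u' t)"
  unfolding weak_pair_def
  by (auto intro!: L2_on_cmult abs_continuous_on_mult abs_continuous_on_const DERIV_cmult elim: AE_mp)

lemma sobolev_chain_cmult: "sobolev_chain \<alpha> l r D \<Longrightarrow> sobolev_chain \<alpha> l r (\<lambda>k t. c * D k t)"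
  by (simp add: sobolev_chain_def L2_on_cmult weak_pair_cmult)

text \<open>The summands of both tensors are concatenated. The minus sign must enter the product
  over all variables exactly once, so it is attached to the factors in one variable
  \<open>j0\<close>.\<close>

definition tens_minus ::
  "'d::finite \<Rightarrow> nat \<Rightarrow> (nat \<Rightarrow> 'd \<Rightarrow> nat \<Rightarrow> real \<Rightarrow> real) \<Rightarrow> (nat \<Rightarrow> 'd \<Rightarrow> nat \<Rightarrow> real \<Rightarrow> real) \<Rightarrow>
     nat \<Rightarrow> 'd \<Rightarrow> nat \<Rightarrow> real \<Rightarrow> real" where
  "tens_minus j0 m D D' i j = (if i < m then D i j else (\<lambda>k t. (if j = j0 then - 1 else 1) * D' (i - m) j k t))"

lemma tens_minus: "tens (m + m') (tens_minus j0 m D D') \<tau> x = tens m D \<tau> x - tens m' D' \<tau> x"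
proof -
  let ?E = "tens_minus j0 m D D'"
  have "{..<m + m'} = {..<m} \<union> (\<lambda>i. i + m) ` {..<m'}"
  proof -
    have "x \<in> (\<lambda>i. i + m) ` {..<m'}" if "x < m + m'" "\<not> x < m" for x
      by (rule image_eqI[of _ _ "x - m"]) (use that in auto)
    then show ?thesis by auto
  qed
  then have "tens (m + m') ?E \<tau> x = (\<Sum>i\<in>{..<m}. \<Prod>j\<in>UNIV. ?E i j (\<tau> j) (x $ j)) + (\<Sum>i\<in>(\<lambda>i. i + m) ` {..<m'}. \<Prod>j\<in>UNIV. ?E i j (\<tau> j) (x $ j))"
    unfolding tens_def by (simp only:, subst sum.union_disjoint) auto
  also have "(\<Sum>i\<in>{..<m}. \<Prod>j\<in>UNIV. ?E i j (\<tau> j) (x $ j)) = tens m D \<tau> x"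
    by (simp add: tens_def tens_minus_def)
  also have "(\<Sum>i\<in>(\<lambda>i. i + m) ` {..<m'}. \<Prod>j\<in>UNIV. ?E i j (\<tau> j) (x $ j)) = (\<Sum>i<m'. \<Prod>j\<in>UNIV. (if j = j0 then - 1 else 1) * D' i j (\<tau> j) (x $ j))"
    by (subst sum.reindex) (auto simp: inj_on_def tens_minus_def)
  also have "\<dots> = (\<Sum>i<m'. - 1 * (\<Prod>j\<in>UNIV. D' i j (\<tau> j) (x $ j)))"
    by (simp only: prod.distrib) (simp add: prod.delta)
  also have "\<dots> = - tens m' D' \<tau> x" by (simp add: tens_def sum_negf)
  finally show ?thesis by simp
qed

lemma tensor_chain_minus:
  assumes "tensor_chain a b \<l> \<alpha> m D" "tensor_chain a b \<l> \<alpha> m' D'"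
  shows "tensor_chain a b \<l> \<alpha> (m + m') (tens_minus j0 m D D')"
proof -
  interpret A: tensor_chain a b \<l> \<alpha> m D by fact
  interpret B: tensor_chain a b \<l> \<alpha> m' D' by fact
  show ?thesis
  proof
    show "sobolev_chain \<alpha> (a $ j) (b $ j) (tens_minus j0 m D D' i j)" if "i < m + m'" for i j
      using A.chain[of i j] sobolev_chain_cmult[OF B.chain[of "i - m" j], of "if j = j0 then -1 else 1"] that
      by (cases "i < m") (simp_all add: tens_minus_def)
  qed (use A.side A.l1 A.al in auto)
qed

lemma integral_mult_L2_tendsto:
  assumes H: "\<And>k. box_L2 a b (H k)" and W: "box_L2 a b W"
    and lim: "(\<lambda>k. LINT x|lborel. (H k x - W x)\<^sup>2) \<longlonglongrightarrow> 0"
    and \<psi>: "\<psi> \<in> borel_measurable borel" "\<And>x. \<bar>\<psi> x\<bar> \<le> B"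
  shows "(\<lambda>k. LINT x|lborel. H k x * \<psi> x) \<longlonglongrightarrow> (LINT x|lborel. W x * \<psi> x)"
proof -
  interpret H: box_L2 a b "H k" for k by (rule H)
  interpret W: box_L2 a b W by (rule W)
  interpret D: box_L2 a b "\<lambda>x. H k x - W x" for k by (rule box_L2_diff[OF H W])
  note [measurable] = \<psi>(1)
  define v where "v = measure lborel (cbox a b)"
  have v: "emeasure lborel (cbox a b) = ennreal v"
    unfolding v_def using emeasure_bounded_finite[OF bounded_cbox, of a b]
    by (intro emeasure_eq_ennreal_measure) auto
  have i: "integrable lborel (\<lambda>x. V x * \<psi> x)" if V: "box_L2 a b V" for V
  proof (rule Bochner_Integration.integrable_bound)
    interpret box_L2 a b V by (rule V)
    show "integrable lborel (\<lambda>x. B * V x)" using box_L2_integrable[OF V] by simp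
    show "AE x in lborel. norm (V x * \<psi> x) \<le> norm (B * V x)"
    proof (intro AE_I2)
      fix x
      have "\<bar>V x\<bar> * \<bar>\<psi> x\<bar> \<le> \<bar>V x\<bar> * \<bar>B\<bar>" by (intro mult_left_mono order_trans[OF \<psi>(2) abs_ge_self]) auto
      then show "norm (V x * \<psi> x) \<le> norm (B * V x)" by (simp add: abs_mult mult.commute)
    qed
    show "(\<lambda>x. V x * \<psi> x) \<in> borel_measurable lborel" by measurable
  qed
  have bd: "(LINT x|lborel. (H k x - W x) * \<psi> x)\<^sup>2 \<le> v * (B\<^sup>2 * (LINT x|lborel. (H k x - W x)\<^sup>2))" for k
  proof -
    have "ennreal ((LINT x|lborel. (H k x - W x) * \<psi> x)\<^sup>2) \<le> emeasure lborel (cbox a b) * (\<integral>\<^sup>+x. ennreal (((H k x - W x) * \<psi> x)\<^sup>2) \<partial>lborel)"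
      by (rule square_integral_le) (auto simp: H.V_supp W.V_supp)
    also have "\<dots> \<le> ennreal v * (\<integral>\<^sup>+x. ennreal (B\<^sup>2 * (H k x - W x)\<^sup>2) \<partial>lborel)"
      unfolding v
    proof (intro mult_left_mono nn_integral_mono ennreal_leI)
      fix x
      have "(\<psi> x)\<^sup>2 \<le> B\<^sup>2" using \<psi>(2)[of x] by (metis abs_ge_zero abs_le_square_iff abs_of_nonneg order_trans)
      then have "(\<psi> x)\<^sup>2 * (H k x - W x)\<^sup>2 \<le> B\<^sup>2 * (H k x - W x)\<^sup>2" by (intro mult_right_mono) auto
      then show "((H k x - W x) * \<psi> x)\<^sup>2 \<le> B\<^sup>2 * (H k x - W x)\<^sup>2" by (simp add: power_mult_distrib mult.commute)
    qed simp
    also have "(\<integral>\<^sup>+x. ennreal (B\<^sup>2 * (H k x - W x)\<^sup>2) \<partial>lborel) = ennreal (B\<^sup>2 * (LINT x|lborel. (H k x - W x)\<^sup>2))"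
      using D.V_sq[of k] by (subst nn_integral_eq_integral) auto
    finally show ?thesis
      by (subst (asm) ennreal_mult'[symmetric]) (auto simp: ennreal_le_iff v_def)
  qed
  have "(\<lambda>k. v * (B\<^sup>2 * (LINT x|lborel. (H k x - W x)\<^sup>2))) \<longlonglongrightarrow> v * (B\<^sup>2 * 0)"
    by (intro tendsto_intros lim)
  then have "(\<lambda>k. (LINT x|lborel. (H k x - W x) * \<psi> x)\<^sup>2) \<longlonglongrightarrow> 0"
    using bd by (intro Lim_null_comparison[of "\<lambda>k. (LINT x|lborel. (H k x - W x) * \<psi> x)\<^sup>2"]) (auto intro!: always_eventually)
  then have "(\<lambda>k. sqrt ((LINT x|lborel. (H k x - W x) * \<psi> x)\<^sup>2)) \<longlonglongrightarrow> sqrt 0" by (intro tendsto_intros)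
  then have "(\<lambda>k. LINT x|lborel. (H k x - W x) * \<psi> x) \<longlonglongrightarrow> 0" by (simp add: tendsto_rabs_zero_iff)
  then have "(\<lambda>k. (LINT x|lborel. H k x * \<psi> x) - (LINT x|lborel. W x * \<psi> x)) \<longlonglongrightarrow> 0"
    using i[OF H] i[OF W] by (simp add: left_diff_distrib)
  then show ?thesis by (simp add: LIM_zero_iff)
qed

text \<open>Membership in the Sobolev space is stated by pointwise limits, while completeness yields
  an L2 limit. Fatou's lemma shows that the two agree almost everywhere.\<close>

lemma L2_limit_pointwise:
  assumes H: "\<And>k. box_L2 a b (H k)" and W: "box_L2 a b W"
    and lim: "(\<lambda>k. LINT x|lborel. (H k x - W x)\<^sup>2) \<longlonglongrightarrow> 0"
    and pt: "\<And>x. (\<lambda>k. H k x) \<longlonglongrightarrow> f x"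
  shows "f \<in> borel_measurable borel" "AE x in lborel. f x = W x"
proof -
  interpret H: box_L2 a b "H k" for k by (rule H)
  interpret W: box_L2 a b W by (rule W)
  interpret D: box_L2 a b "\<lambda>x. H k x - W x" for k by (rule box_L2_diff[OF H W])
  show f: "f \<in> borel_measurable borel"
    by (rule borel_measurable_LIMSEQ_real[OF pt]) measurable
  have "(\<integral>\<^sup>+x. ennreal ((f x - W x)\<^sup>2) \<partial>lborel) = (\<integral>\<^sup>+x. liminf (\<lambda>k. ennreal ((H k x - W x)\<^sup>2)) \<partial>lborel)"
  proof (intro nn_integral_cong)
    fix x
    have "(\<lambda>k. ennreal ((H k x - W x)\<^sup>2)) \<longlonglongrightarrow> ennreal ((f x - W x)\<^sup>2)"
      by (intro tendsto_ennrealI tendsto_intros pt)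
    then show "ennreal ((f x - W x)\<^sup>2) = liminf (\<lambda>k. ennreal ((H k x - W x)\<^sup>2))"
      by (rule lim_imp_Liminf[OF trivial_limit_sequentially, symmetric])
  qed
  also have "\<dots> \<le> liminf (\<lambda>k. \<integral>\<^sup>+x. ennreal ((H k x - W x)\<^sup>2) \<partial>lborel)"
    by (rule nn_integral_liminf) measurable
  also have "(\<lambda>k. \<integral>\<^sup>+x. ennreal ((H k x - W x)\<^sup>2) \<partial>lborel) = (\<lambda>k. ennreal (LINT x|lborel. (H k x - W x)\<^sup>2))"
    using D.V_sq by (intro ext nn_integral_eq_integral) auto
  also have "liminf \<dots> = ennreal 0"
    by (intro lim_imp_Liminf[OF trivial_limit_sequentially] tendsto_ennrealI lim)
  finally have "(\<integral>\<^sup>+x. ennreal ((f x - W x)\<^sup>2) \<partial>lborel) = 0" by simp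
  then have "AE x in lborel. ennreal ((f x - W x)\<^sup>2) = 0"
    using f by (subst (asm) nn_integral_0_iff_AE) auto
  then show "AE x in lborel. f x = W x" by eventually_elim simp
qed

definition poincare_const :: "nat \<Rightarrow> nat \<Rightarrow> real" where
  "poincare_const \<alpha> d = 4 ^ (\<alpha> * d) * real ((\<alpha> + 1) ^ d)"

lemma poincare_const_pos: "poincare_const \<alpha> d > 0"
  by (simp add: poincare_const_def)

text \<open>The sides of the box enter only through a power of \<open>\<l>\<close>, so that the constant is uniform in the box.\<close>

theorem sobolev_space_approx:
  fixes f :: "real^'d::finite \<Rightarrow> real"
  assumes f: "f \<in> sobolev_space \<alpha> a b" and side: "\<And>j. b $ j - a $ j = \<l>" and l1: "\<l> \<ge> 1" and al: "\<alpha> \<ge> 1"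
  obtains m D where "\<And>k. tensor_chain a b \<l> \<alpha> (m k) (D k)"
    "\<And>x. x \<in> cbox a b \<Longrightarrow> (\<lambda>k. tens (m k) (D k) (\<lambda>_. 0) x) \<longlonglongrightarrow> f x"
    "box_L2 a b (\<lambda>x. indicator (cbox a b) x * f x)"
    "(\<lambda>k. LINT x|lborel. (tens (m k) (D k) (\<lambda>_. 0) x - indicator (cbox a b) x * f x)\<^sup>2) \<longlonglongrightarrow> 0"
    "\<And>\<epsilon>. \<epsilon> > 0 \<Longrightarrow> \<forall>\<^sub>F k in sequentially. \<forall>\<sigma>. (\<forall>j. \<sigma> j \<le> \<alpha>) \<longrightarrow>
       \<l> ^ (2 * (\<Sum>j\<in>UNIV. \<sigma> j)) * (LINT x|lborel. (tens (m k) (D k) \<sigma> x)\<^sup>2) \<le>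
       poincare_const \<alpha> CARD('d) * \<l> ^ (2 * \<alpha> * CARD('d)) * (4 * (sobolev_norm \<alpha> a b f)\<^sup>2 + \<epsilon>)"
proof -
  have ab: "a $ j \<le> b $ j" for j using side[of j] l1 by simp
  obtain g where g: "\<And>k. g k \<in> algebraic_tensors \<alpha> a b"
    and cau: "\<And>\<epsilon>. \<epsilon> > 0 \<Longrightarrow> \<exists>M. \<forall>k\<ge>M. \<forall>l\<ge>M. sobolev_norm \<alpha> a b (\<lambda>x. g k x - g l x) < \<epsilon>"
    and gf: "\<And>x. x \<in> cbox a b \<Longrightarrow> (\<lambda>k. g k x) \<longlonglongrightarrow> f x"
    using f unfolding sobolev_space_def by blast
  have "\<exists>(m::nat) D. (\<forall>i<m. \<forall>j. sobolev_chain \<alpha> (a $ j) (b $ j) (D i j)) \<and>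
     (\<forall>x\<in>cbox a b. g k x = tens m D (\<lambda>_. 0) x)" for k
  proof -
    obtain m :: nat and u where u0: "\<forall>i<m. \<forall>j. u i j \<in> sobolev_1d \<alpha> (a $ j) (b $ j)"
      and gk: "g k = (\<lambda>x. \<Sum>i<m. \<Prod>j\<in>UNIV. u i j (x $ j))"
      using g[of k] unfolding algebraic_tensors_def by blast
    have u: "u i j \<in> sobolev_1d \<alpha> (a $ j) (b $ j)" if "i < m" for i j using u0 that by simp
    have "\<exists>D. sobolev_chain \<alpha> (a $ j) (b $ j) D \<and> (\<forall>x\<in>{a $ j..b $ j}. D 0 x = u i j x)" if "i < m" for i j
      using sobolev_1d_chain[OF u[OF that, of j]] al by (metis less_le_trans zero_less_one)
    then obtain D where D: "\<And>i j. i < m \<Longrightarrow> sobolev_chain \<alpha> (a $ j) (b $ j) (D i j)"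
      "\<And>i j x. i < m \<Longrightarrow> x \<in> {a $ j..b $ j} \<Longrightarrow> D i j 0 x = u i j x" by metis
    have "g k x = tens m D (\<lambda>_. 0) x" if "x \<in> cbox a b" for x
      unfolding gk tens_def using that D(2) by (intro sum.cong prod.cong) (auto simp: mem_box_cart)
    then show ?thesis using D(1) by blast
  qed
  then obtain m D where ch: "\<And>k i j. i < m k \<Longrightarrow> sobolev_chain \<alpha> (a $ j) (b $ j) (D k i j)"
    and gD: "\<And>k x. x \<in> cbox a b \<Longrightarrow> g k x = tens (m k) (D k) (\<lambda>_. 0) x" by metis
  have TC: "tensor_chain a b \<l> \<alpha> (m k) (D k)" for k
    by standard (use side l1 al ch in auto)
  define H where "H \<sigma> k = tens (m k) (D k) \<sigma>" for \<sigma> k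
  have HL2: "box_L2 a b (H \<sigma> k)" if "\<forall>j. \<sigma> j \<le> \<alpha>" for \<sigma> k
    unfolding H_def by (rule box_L2_tens[OF ab]) (use ch that in \<open>auto simp: sobolev_chain_def\<close>)
  define C where "C = poincare_const \<alpha> CARD('d) * \<l> ^ (2 * \<alpha> * CARD('d))"
  have C: "C > 0" unfolding C_def using l1 poincare_const_pos by simp
  \<comment> \<open>A difference of approximants is again a tensor, so the Poincare inequality turns
    the Cauchy property in the Sobolev norm into one in L2 for each mixed derivative with orders up
    to \<alpha>.\<close>
  have cauchy: "\<exists>N. \<forall>k\<ge>N. \<forall>l\<ge>N. (LINT x|lborel. (H \<sigma> k x - H \<sigma> l x)\<^sup>2) < \<epsilon>"
    if \<sigma>: "\<forall>j. \<sigma> j \<le> \<alpha>" and e: "\<epsilon> > 0" for \<sigma> \<epsilon>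
  proof -
    define \<delta> where "\<delta> = sqrt (\<epsilon> / (4 * C))"
    have d: "\<delta> > 0" "C * (2 * \<delta>\<^sup>2) < \<epsilon>" using e C by (auto simp: \<delta>_def)
    obtain M where M: "\<And>k l. k \<ge> M \<Longrightarrow> l \<ge> M \<Longrightarrow> sobolev_norm \<alpha> a b (\<lambda>x. g k x - g l x) < \<delta>"
      using cau[OF d(1)] by blast
    have "(LINT x|lborel. (H \<sigma> k x - H \<sigma> l x)\<^sup>2) < \<epsilon>" if kl: "k \<ge> M" "l \<ge> M" for k l
    proof -
      define n where "n = m k + m l"
      \<comment> \<open>Any variable may carry the sign of the second tensor, hence an unspecified
        one is taken.\<close>
      define E where "E = tens_minus undefined (m k) (D k) (D l)"
      have E: "tens n E \<tau> x = H \<tau> k x - H \<tau> l x" for \<tau> x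
        unfolding n_def E_def H_def by (rule tens_minus)
      interpret E: tensor_chain a b \<l> \<alpha> n E
        unfolding n_def E_def by (rule tensor_chain_minus[OF TC TC])
      define s where "s = sobolev_norm \<alpha> a b (\<lambda>x. g k x - g l x)"
      have s: "s < \<delta>" "s \<ge> 0" using M[OF kl] by (auto simp: s_def sobolev_norm_eq intro!: sum_nonneg sobolev_term_nonneg)
      have "partial_sq {j. \<rho> j = \<alpha>} (tens n E \<rho>) \<le> 2 * s\<^sup>2" if rho: "\<And>j. \<rho> j \<le> \<alpha>" for \<rho>
        unfolding s_def
      proof (rule partial_sq_le_sobolev_norm[OF ab])
        show "has_weak_deriv \<rho> a b (\<lambda>x. g k x - g l x) (tens n E \<rho>)"
          by (rule has_weak_deriv_tens[OF ab E.chain]) (use gD E rho in \<open>auto simp: H_def\<close>)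
        show "box_L2 a b (tens n E \<rho>)"
          by (rule box_L2_tens[OF ab]) (use E.chain rho in \<open>auto simp: sobolev_chain_def\<close>)
      qed (use rho in auto)
      then have "\<l> ^ (2 * (\<Sum>j\<in>UNIV. \<sigma> j)) * (LINT x|lborel. (tens n E \<sigma> x)\<^sup>2) \<le> C * (2 * s\<^sup>2)"
        unfolding C_def poincare_const_def by (rule E.poincare_tens) (use \<sigma> in auto)
      moreover have "1 * (LINT x|lborel. (tens n E \<sigma> x)\<^sup>2) \<le> \<l> ^ (2 * (\<Sum>j\<in>UNIV. \<sigma> j)) * (LINT x|lborel. (tens n E \<sigma> x)\<^sup>2)"
        using l1 by (intro mult_right_mono one_le_power) auto
      moreover have "C * (2 * s\<^sup>2) \<le> C * (2 * \<delta>\<^sup>2)"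
        using s C by (intro mult_left_mono power_mono) auto
      ultimately show ?thesis using d(2) by (simp add: E)
    qed
    then show ?thesis by blast
  qed
  have "\<exists>W. box_L2 a b W \<and> (\<lambda>k. LINT x|lborel. (H \<sigma> k x - W x)\<^sup>2) \<longlonglongrightarrow> 0" if \<sigma>: "\<forall>j. \<sigma> j \<le> \<alpha>" for \<sigma>
    using box_L2_complete[OF HL2[OF \<sigma>] cauchy[OF \<sigma>]] by blast
  then have "\<forall>\<sigma>. \<exists>W. (\<forall>j. \<sigma> j \<le> \<alpha>) \<longrightarrow> box_L2 a b W \<and> (\<lambda>k. LINT x|lborel. (H \<sigma> k x - W x)\<^sup>2) \<longlonglongrightarrow> 0"
    by blast
  from choice[OF this] obtain W where W: "\<And>\<sigma>. (\<forall>j. \<sigma> j \<le> \<alpha>) \<Longrightarrow> box_L2 a b (W \<sigma>)"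
    "\<And>\<sigma>. (\<forall>j. \<sigma> j \<le> \<alpha>) \<Longrightarrow> (\<lambda>k. LINT x|lborel. (H \<sigma> k x - W \<sigma> x)\<^sup>2) \<longlonglongrightarrow> 0"
    by blast
  let ?z = "\<lambda>_::'d. 0::nat" and ?f = "\<lambda>x. indicator (cbox a b) x * f x"
  have z: "\<forall>j. ?z j \<le> \<alpha>" by simp
  have pt: "(\<lambda>k. H ?z k x) \<longlonglongrightarrow> ?f x" for x
  proof (cases "x \<in> cbox a b")
    case True
    then show ?thesis using gf[OF True] gD[OF True] by (simp add: H_def)
  next
    case False
    then show ?thesis using box_L2.V_supp[OF HL2[OF z] False] by simp
  qed
  have fm: "?f \<in> borel_measurable borel" and fW: "AE x in lborel. ?f x = W ?z x"
    using L2_limit_pointwise[of a b "H ?z" "W ?z" ?f, OF HL2[OF z] W(1)[OF z] W(2)[OF z] pt] by auto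
  have fL2: "box_L2 a b ?f"
  proof
    have "integrable lborel (\<lambda>x. (?f x)\<^sup>2) \<longleftrightarrow> integrable lborel (\<lambda>x. (W ?z x)\<^sup>2)"
      using fm box_L2.V_measurable[OF W(1)[OF z]] fW by (intro integrable_cong_AE) (auto elim!: AE_mp)
    then show "integrable lborel (\<lambda>x. (?f x)\<^sup>2)" using box_L2.V_sq[OF W(1)[OF z]] by simp
  qed (use ab fm in auto)
  have f_lim: "(\<lambda>k. LINT x|lborel. (H ?z k x - ?f x)\<^sup>2) \<longlonglongrightarrow> 0"
  proof -
    have "(LINT x|lborel. (H ?z k x - ?f x)\<^sup>2) = (LINT x|lborel. (H ?z k x - W ?z x)\<^sup>2)" for k
      using fm box_L2.V_measurable[OF W(1)[OF z]] box_L2.V_measurable[OF HL2[OF z]] fW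
      by (intro integral_cong_AE) (auto elim!: AE_mp)
    then show ?thesis using W(2)[OF z] by simp
  qed
  \<comment> \<open>The identity that defines weak derivatives holds for each approximant, and both
    sides converge because the test function and its derivative are bounded.\<close>
  have wd: "has_weak_deriv \<sigma> a b f (W \<sigma>)" if \<sigma>: "\<forall>j. \<sigma> j \<le> \<alpha>" for \<sigma>
    unfolding has_weak_deriv_def
  proof (intro conjI ballI)
    show "W \<sigma> \<in> borel_measurable borel" by (rule box_L2.V_measurable[OF W(1)[OF \<sigma>]])
    show "set_integrable lborel (cbox a b) (\<lambda>x. (W \<sigma> x)\<^sup>2)"
      unfolding set_integrable_def using box_L2.V_sq[OF W(1)[OF \<sigma>]] by (intro integrable_mult_indicator) auto
    fix \<phi> :: "real^'d \<Rightarrow> real" assume phi: "\<phi> \<in> test_functions (box a b)"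
    then obtain K where K: "test_on K \<phi>" "compact K" "K \<subseteq> box a b"
      by (auto simp: test_functions_test_on)
    obtain js where js: "mixed_partial \<sigma> \<phi> = foldr partial_deriv js \<phi>"
      using mixed_partial_list[of \<sigma>] by metis
    have K': "test_on K (mixed_partial \<sigma> \<phi>)" unfolding js by (rule test_on_foldr[OF K(1,2)])
    obtain B1 where B1: "\<And>x. \<bar>\<phi> x\<bar> \<le> B1" using test_on_bounded[OF K(1,2)] by metis
    obtain B2 where B2: "\<And>x. \<bar>mixed_partial \<sigma> \<phi> x\<bar> \<le> B2" using test_on_bounded[OF K' K(2)] by metis
    have m1: "\<phi> \<in> borel_measurable borel" "mixed_partial \<sigma> \<phi> \<in> borel_measurable borel"
      using test_on_continuous[OF K(1)] test_on_continuous[OF K'] by (auto intro: borel_measurable_continuous_onI)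
    have "has_weak_deriv \<sigma> a b (H ?z k) (H \<sigma> k)" for k
      unfolding H_def by (rule has_weak_deriv_tens[OF ab ch]) (use \<sigma> in auto)
    then have eq: "(LINT x:cbox a b|lborel. H ?z k x * mixed_partial \<sigma> \<phi> x) = (- 1) ^ (\<Sum>j\<in>UNIV. \<sigma> j) * (LINT x:cbox a b|lborel. H \<sigma> k x * \<phi> x)" for k
      using phi unfolding has_weak_deriv_def by blast
    have drop: "(LINT x:cbox a b|lborel. V x * \<psi> x) = (LINT x|lborel. V x * \<psi> x)" if "box_L2 a b V" for V \<psi> :: "real^'d \<Rightarrow> real"
      unfolding set_lebesgue_integral_def
      by (intro Bochner_Integration.integral_cong refl) (use box_L2.V_supp[OF that] in \<open>auto simp: indicator_def\<close>)
    have L1: "(\<lambda>k. LINT x|lborel. H ?z k x * mixed_partial \<sigma> \<phi> x) \<longlonglongrightarrow> (LINT x|lborel. ?f x * mixed_partial \<sigma> \<phi> x)"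
      by (rule integral_mult_L2_tendsto[OF HL2[OF z] fL2 f_lim m1(2) B2])
    have L2: "(\<lambda>k. (- 1) ^ (\<Sum>j\<in>UNIV. \<sigma> j) * (LINT x|lborel. H \<sigma> k x * \<phi> x)) \<longlonglongrightarrow> (- 1) ^ (\<Sum>j\<in>UNIV. \<sigma> j) * (LINT x|lborel. W \<sigma> x * \<phi> x)"
      by (intro tendsto_intros integral_mult_L2_tendsto[OF HL2[OF \<sigma>] W(1)[OF \<sigma>] W(2)[OF \<sigma>] m1(1) B1])
    have "(LINT x|lborel. H ?z k x * mixed_partial \<sigma> \<phi> x) = (- 1) ^ (\<Sum>j\<in>UNIV. \<sigma> j) * (LINT x|lborel. H \<sigma> k x * \<phi> x)" for k
      using eq[of k] drop[OF HL2[OF z]] drop[OF HL2[OF \<sigma>]] by simp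
    then have "(LINT x|lborel. ?f x * mixed_partial \<sigma> \<phi> x) = (- 1) ^ (\<Sum>j\<in>UNIV. \<sigma> j) * (LINT x|lborel. W \<sigma> x * \<phi> x)"
      by (intro LIMSEQ_unique[OF L1]) (simp only: L2)
    moreover have "(LINT x:cbox a b|lborel. f x * mixed_partial \<sigma> \<phi> x) = (LINT x|lborel. ?f x * mixed_partial \<sigma> \<phi> x)"
      by (simp add: set_lebesgue_integral_def mult.assoc)
    ultimately show "(LINT x:cbox a b|lborel. f x * mixed_partial \<sigma> \<phi> x) =
        (- 1) ^ (\<Sum>j\<in>UNIV. \<sigma> j) * (LINT x:cbox a b|lborel. W \<sigma> x * \<phi> x)"
      using drop[OF W(1)[OF \<sigma>]] by simp
  qed
  define v where "v w = (\<Prod>j\<in>- w. b $ j - a $ j)" for w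
  \<comment> \<open>The factor 4 arises from two comparisons: one 2 for passing from the approximant
    to the limit \<open>W\<close>, the other for passing from \<open>W\<close> to the chosen weak
    derivative.\<close>
  have ev: "\<forall>\<^sub>F k in sequentially. \<forall>\<sigma>\<in>{\<sigma>. \<forall>j. \<sigma> j \<le> \<alpha>}. partial_sq {j. \<sigma> j = \<alpha>} (H \<sigma> k) \<le> 4 * (sobolev_norm \<alpha> a b f)\<^sup>2 + \<epsilon>"
    if e: "\<epsilon> > 0" for \<epsilon>
  proof (rule eventually_ball_finite[OF finite_multi_index], intro ballI)
    fix \<sigma> :: "'d \<Rightarrow> nat" assume "\<sigma> \<in> {\<sigma>. \<forall>j. \<sigma> j \<le> \<alpha>}"
    then have \<sigma>: "\<forall>j. \<sigma> j \<le> \<alpha>" by simp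
    let ?w = "{j. \<sigma> j = \<alpha>}"
    have "(\<lambda>k. 2 * (v ?w * (LINT x|lborel. (H \<sigma> k x - W \<sigma> x)\<^sup>2))) \<longlonglongrightarrow> 2 * (v ?w * 0)"
      by (intro tendsto_intros W(2)[OF \<sigma>])
    then have "\<forall>\<^sub>F k in sequentially. 2 * (v ?w * (LINT x|lborel. (H \<sigma> k x - W \<sigma> x)\<^sup>2)) < \<epsilon>"
      using e by (intro order_tendstoD) auto
    then show "\<forall>\<^sub>F k in sequentially. partial_sq ?w (H \<sigma> k) \<le> 4 * (sobolev_norm \<alpha> a b f)\<^sup>2 + \<epsilon>"
    proof eventually_elim
      case (elim k)
      have "partial_sq ?w (H \<sigma> k) \<le> 2 * partial_sq ?w (W \<sigma>) + 2 * partial_sq ?w (\<lambda>x. H \<sigma> k x - W \<sigma> x)"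
        by (rule partial_sq_diff_le[OF HL2[OF \<sigma>] W(1)[OF \<sigma>]])
      moreover have "partial_sq ?w (W \<sigma>) \<le> 2 * (sobolev_norm \<alpha> a b f)\<^sup>2"
        by (rule partial_sq_le_sobolev_norm[OF ab wd[OF \<sigma>] W(1)[OF \<sigma>] \<sigma>])
      moreover have "partial_sq ?w (\<lambda>x. H \<sigma> k x - W \<sigma> x) \<le> v ?w * (LINT x|lborel. (H \<sigma> k x - W \<sigma> x)\<^sup>2)"
        unfolding v_def by (rule box_L2.partial_sq_bound(2)[OF box_L2_diff[OF HL2[OF \<sigma>] W(1)[OF \<sigma>]]])
      ultimately show ?case using elim by linarith
    qed
  qed
  have bound: "\<forall>\<^sub>F k in sequentially. \<forall>\<sigma>. (\<forall>j. \<sigma> j \<le> \<alpha>) \<longrightarrow>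
       \<l> ^ (2 * (\<Sum>j\<in>UNIV. \<sigma> j)) * (LINT x|lborel. (tens (m k) (D k) \<sigma> x)\<^sup>2) \<le>
       poincare_const \<alpha> CARD('d) * \<l> ^ (2 * \<alpha> * CARD('d)) * (4 * (sobolev_norm \<alpha> a b f)\<^sup>2 + \<epsilon>)"
    if e: "\<epsilon> > 0" for \<epsilon>
    using ev[OF e]
  proof eventually_elim
    case (elim k)
    show ?case
    proof (intro allI impI)
      fix \<sigma> :: "'d \<Rightarrow> nat" assume \<sigma>: "\<forall>j. \<sigma> j \<le> \<alpha>"
      interpret T: tensor_chain a b \<l> \<alpha> "m k" "D k" by (rule TC)
      show "\<l> ^ (2 * (\<Sum>j\<in>UNIV. \<sigma> j)) * (LINT x|lborel. (tens (m k) (D k) \<sigma> x)\<^sup>2) \<le>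
       poincare_const \<alpha> CARD('d) * \<l> ^ (2 * \<alpha> * CARD('d)) * (4 * (sobolev_norm \<alpha> a b f)\<^sup>2 + \<epsilon>)"
        unfolding poincare_const_def
        by (rule T.poincare_tens) (use elim \<sigma> in \<open>auto simp: H_def\<close>)
    qed
  qed
  show ?thesis
  proof (rule that[OF TC])
    show "(\<lambda>k. tens (m k) (D k) (\<lambda>_. 0) x) \<longlonglongrightarrow> f x" if "x \<in> cbox a b" for x
      using pt[of x] that by (simp add: H_def)
  qed (use fL2 f_lim bound in \<open>auto simp: H_def\<close>)
qed

section \<open>The cutoff function\<close>

text \<open>The lower limit -1 gives the same values as 0, as the bump vanishes on negative numbers,
  but makes 0 an interior point of the interval of integration when the derivative is taken
  there.\<close>

definition bump_int :: "real \<Rightarrow> real" where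
  "bump_int x = integral {-1..x} (bump 1 0)"

lemma bump_int_deriv: "(bump_int has_real_derivative bump 1 0 x) (at x)"
proof (cases "x < 0")
  case True
  have "bump_int y = 0" if "y < 0" for y
  proof -
    have "bump_int y = integral {-1..y} (\<lambda>_. 0)"
      unfolding bump_int_def by (rule integral_cong) (use that in \<open>simp add: bump_0\<close>)
    then show ?thesis by simp
  qed
  note z = this
  have "((\<lambda>_. 0) has_real_derivative 0) (at x)" by simp
  then have "(bump_int has_real_derivative 0) (at x)"
    by (rule has_field_derivative_transform_within_open[of "\<lambda>_. 0" 0 x "{..<0}"]) (use True z in auto)
  then show ?thesis using True by (simp add: bump_0)
next
  case False
  have "(bump_int has_real_derivative bump 1 0 x) (at x within {-1..x + 1})"
    unfolding bump_int_def[abs_def]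
    by (rule integral_has_real_derivative) (use False smooth_seq_continuous[OF smooth_seq_bump, of 1] in auto)
  then show ?thesis using False by (simp add: at_within_Icc_at)
qed

lemma bump_int_mono: "x \<le> y \<Longrightarrow> bump_int x \<le> bump_int y"
  by (rule DERIV_nonneg_imp_nondecreasing) (auto intro!: bump_int_deriv exI bump_0_bounds)

lemma bump_int_neg: "x \<le> 0 \<Longrightarrow> bump_int x = 0"
proof -
  assume x: "x \<le> 0"
  have "bump_int x = integral {-1..x} (\<lambda>_. 0)"
    unfolding bump_int_def by (rule integral_cong) (use x in \<open>simp add: bump_0\<close>)
  then show ?thesis by simp
qed

lemma bump_int_ge1:
  assumes "x \<ge> 1" shows "bump_int x = bump_int 1"
proof (cases "x = 1")
  case False
  then have "1 < x" using assms by simp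
  moreover have "continuous_on {1..x} bump_int"
    by (meson DERIV_continuous_on bump_int_deriv has_field_derivative_at_within)
  moreover have "(bump_int has_real_derivative 0) (at y)" if "1 < y" for y
    using bump_int_deriv[of y] that by (simp add: bump_0)
  ultimately show ?thesis by (intro DERIV_isconst_end) auto
qed simp

lemma bump_int_1: "bump_int 1 > 0"
proof -
  have "bump_int 0 < bump_int 1"
  proof (rule DERIV_pos_imp_increasing_open[where f = bump_int and a = 0 and b = 1])
    fix x :: real assume "0 < x" "x < 1"
    then show "\<exists>y. (bump_int has_real_derivative y) (at x) \<and> 0 < y"
      using bump_int_deriv[of x] by (intro exI[of _ "bump 1 0 x"]) (simp add: bump_0)
  next
    show "continuous_on {0..1} bump_int"
      by (meson DERIV_continuous_on bump_int_deriv has_field_derivative_at_within)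
  qed simp
  then show ?thesis by (simp add: bump_int_neg)
qed

definition smooth_step :: "nat \<Rightarrow> real \<Rightarrow> real" where
  "smooth_step k x = (case k of 0 \<Rightarrow> bump_int x | Suc n \<Rightarrow> bump 1 n x) / bump_int 1"

lemma smooth_seq_step: "smooth_seq smooth_step"
  unfolding smooth_seq_def
proof (intro allI)
  fix k x
  show "(smooth_step k has_real_derivative smooth_step (Suc k) x) (at x)"
    unfolding smooth_step_def[abs_def]
    by (cases k) (auto intro!: DERIV_cdivide bump_int_deriv smooth_seqD[OF smooth_seq_bump])
qed

lemma bump_zero: "x \<le> 0 \<or> x \<ge> 1 \<Longrightarrow> bump c k x = 0"
  by (auto simp: bump_def bump_term_def)

text \<open>A plateau with transitions on [-3/2, -1/2] and [1/2, 3/2], k being the order of the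
  derivative. At t = y / (2 a) the plateau is 1 for |y| \<le> a and 0 for |y| \<ge> 3 a, so the
  period 2 a is the only scale that occurs.\<close>

definition eta :: "nat \<Rightarrow> real \<Rightarrow> real" where
  "eta k t = smooth_step k (t + 3 / 2) - smooth_step k (t - 1 / 2)"

lemma smooth_seq_eta: "smooth_seq eta"
  unfolding smooth_seq_def
proof (intro allI)
  fix k x
  have "((\<lambda>t. smooth_step k (t + c)) has_real_derivative smooth_step (Suc k) (x + c) * 1) (at x)" for c
    by (rule DERIV_chain2[OF smooth_seqD[OF smooth_seq_step]]) (auto intro!: derivative_eq_intros)
  from DERIV_diff[OF this[of "3/2"] this[of "-1/2"]]
  show "(eta k has_real_derivative eta (Suc k) x) (at x)"
    by (simp add: eta_def[abs_def])
qed

lemma eta_one: "\<bar>t\<bar> \<le> 1 / 2 \<Longrightarrow> eta 0 t = 1"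
  using bump_int_1 by (simp add: eta_def smooth_step_def bump_int_neg bump_int_ge1[of "t + 3 / 2"] abs_le_iff)

lemma eta_zero: "\<bar>t\<bar> \<ge> 3 / 2 \<Longrightarrow> eta k t = 0"
proof -
  assume t: "\<bar>t\<bar> \<ge> 3 / 2"
  then consider "t \<ge> 3 / 2" | "t \<le> - 3 / 2" by linarith
  then show ?thesis
  proof cases
    case 1
    then show ?thesis
      using bump_int_ge1[of "t + 3 / 2"] bump_int_ge1[of "t - 1 / 2"]
      by (cases k) (auto simp: eta_def smooth_step_def bump_zero)
  next
    case 2
    then show ?thesis
      using bump_int_neg[of "t + 3 / 2"] bump_int_neg[of "t - 1 / 2"]
      by (cases k) (auto simp: eta_def smooth_step_def bump_zero)
  qed
qed

lemma eta_bounds: "0 \<le> eta 0 t" "eta 0 t \<le> 1"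
proof -
  have r: "0 \<le> smooth_step 0 x" "smooth_step 0 x \<le> 1" for x
  proof -
    have "bump_int x \<ge> 0" using bump_int_mono[of "min x 0" x] bump_int_neg[of "min x 0"] by simp
    moreover have "bump_int x \<le> bump_int 1" using bump_int_mono[of x "max x 1"] bump_int_ge1[of "max x 1"] by simp
    ultimately show "0 \<le> smooth_step 0 x" "smooth_step 0 x \<le> 1"
      using bump_int_1 by (auto simp: smooth_step_def)
  qed
  have z: "smooth_step 0 x = 0" if "x \<le> 0" for x using bump_int_neg[OF that] by (simp add: smooth_step_def)
  have o: "smooth_step 0 x = 1" if "x \<ge> 1" for x using bump_int_ge1[OF that] bump_int_1 by (simp add: smooth_step_def)
  show "0 \<le> eta 0 t"
    using r[of "t + 3/2"] r[of "t - 1/2"] z[of "t - 1/2"] o[of "t + 3/2"] unfolding eta_def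
    by (cases "t \<le> 1/2") auto
  show "eta 0 t \<le> 1" using r[of "t + 3/2"] r[of "t - 1/2"] unfolding eta_def by linarith
qed

lemma eta_bounded: "\<exists>B. \<forall>t. \<bar>eta k t\<bar> \<le> B"
proof -
  have "bounded (eta k ` {-3/2..3/2})"
    by (intro compact_imp_bounded compact_continuous_image smooth_seq_continuous smooth_seq_eta) auto
  then obtain B where B: "B > 0" "\<And>t. t \<in> {-3/2..3/2} \<Longrightarrow> \<bar>eta k t\<bar> \<le> B"
    unfolding bounded_pos by auto
  have "\<bar>eta k t\<bar> \<le> B" for t
  proof (cases "\<bar>t\<bar> \<le> 3/2")
    case True
    then have "-3/2 \<le> t" "t \<le> 3/2" by linarith+
    then show ?thesis using B(2)[of t] by simp
  qed (use B(1) eta_zero[of t k] in auto)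
  then show ?thesis by blast
qed

section \<open>Fourier series in one dimension\<close>

text \<open>The sawtooth series converges in the mean because of Parseval's identity, which for this function is
  the evaluation of \<open>\<Sum>n. 1 / n\<^sup>2\<close>.\<close>

definition saw :: "real \<Rightarrow> real" where
  "saw t = t - of_int \<lceil>t\<rceil> + 1 / 2"

definition saw_sum :: "nat \<Rightarrow> real \<Rightarrow> real" where
  "saw_sum N t = - (\<Sum>h=1..N. sin (2 * pi * real h * t) / (pi * real h))"

lemma cos_has_integral:
  fixes m :: int
  shows "((\<lambda>t. cos (2 * pi * of_int m * t)) has_integral (if m = 0 then 1 else 0)) {0..1}"
proof (cases "m = 0")
  case False
  have "((\<lambda>t. cos (2 * pi * of_int m * t)) has_integral
     (sin (2 * pi * of_int m * 1) / (2 * pi * of_int m) - sin (2 * pi * of_int m * 0) / (2 * pi * of_int m))) {0..1}"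
    by (rule fundamental_theorem_of_calculus)
       (use False in \<open>auto intro!: derivative_eq_intros simp: has_real_derivative_iff_has_vector_derivative[symmetric]\<close>)
  then show ?thesis using False sin_int_2pin[of m] by simp
qed (use has_integral_const_real[of "1::real" 0 1] in simp)

lemma sin_sin_has_integral:
  fixes h k :: nat
  assumes "h \<ge> 1" "k \<ge> 1"
  shows "((\<lambda>t. sin (2 * pi * real h * t) * sin (2 * pi * real k * t)) has_integral (if h = k then 1 / 2 else 0)) {0..1}"
proof -
  have "((\<lambda>t. (cos (2 * pi * of_int (int h - int k) * t) - cos (2 * pi * of_int (int h + int k) * t)) / 2) has_integral
     ((if int h - int k = 0 then 1 else 0) - (if int h + int k = 0 then 1 else 0)) / 2) {0..1}"
    by (intro has_integral_divide has_integral_diff cos_has_integral)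
  moreover have "(\<lambda>t. (cos (2 * pi * of_int (int h - int k) * t) - cos (2 * pi * of_int (int h + int k) * t)) / 2)
     = (\<lambda>t. sin (2 * pi * real h * t) * sin (2 * pi * real k * t))"
    by (simp add: sin_times_sin algebra_simps)
  ultimately show ?thesis using assms by (simp split: if_splits)
qed

lemma lin_sin_has_integral:
  fixes h :: nat
  assumes h: "h \<ge> 1"
  shows "((\<lambda>t. (t - 1 / 2) * sin (2 * pi * real h * t)) has_integral - (1 / (2 * pi * real h))) {0..1}"
proof -
  define \<omega> where "\<omega> = 2 * pi * real h"
  have \<omega>: "\<omega> > 0" using h by (simp add: \<omega>_def)
  have "((\<lambda>t. (t - 1 / 2) * sin (\<omega> * t)) has_integral
     ((- (1 - 1 / 2) * cos (\<omega> * 1) / \<omega> + sin (\<omega> * 1) / \<omega>\<^sup>2) - (- (0 - 1 / 2) * cos (\<omega> * 0) / \<omega> + sin (\<omega> * 0) / \<omega>\<^sup>2))) {0..1}"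
  proof (rule fundamental_theorem_of_calculus)
    fix t :: real
    have "((\<lambda>t. - (t - 1 / 2) * cos (\<omega> * t) / \<omega> + sin (\<omega> * t) / \<omega>\<^sup>2) has_real_derivative (t - 1 / 2) * sin (\<omega> * t)) (at t within {0..1})"
      using \<omega> by (auto intro!: derivative_eq_intros simp: field_simps power2_eq_square)
    then show "((\<lambda>t. - (t - 1 / 2) * cos (\<omega> * t) / \<omega> + sin (\<omega> * t) / \<omega>\<^sup>2) has_vector_derivative (t - 1 / 2) * sin (\<omega> * t)) (at t within {0..1})"
      by (simp add: has_real_derivative_iff_has_vector_derivative)
  qed simp
  moreover have "cos \<omega> = 1" "sin \<omega> = 0"
    using cos_int_2pin[of "int h"] sin_int_2pin[of "int h"] by (auto simp: \<omega>_def)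
  ultimately show ?thesis unfolding \<omega>_def[symmetric] by simp
qed

text \<open>Expansion of the square: 1/12 is the squared norm of t - 1/2, the sines are orthogonal,
  and the cross terms count each summand -2 times while the squares of the sines count it
  once.\<close>

lemma saw_error_has_integral:
  "((\<lambda>t. (t - 1 / 2 - saw_sum N t)\<^sup>2) has_integral (1 / 12 - (\<Sum>h=1..N. 1 / (2 * pi\<^sup>2 * (real h)\<^sup>2)))) {0..1}"
proof -
  have i1: "((\<lambda>t::real. (t - 1 / 2)\<^sup>2) has_integral 1 / 12) {0..1}"
  proof -
    have "((\<lambda>t::real. (t - 1 / 2)\<^sup>2) has_integral ((1 - 1 / 2) ^ 3 / 3 - (0 - 1 / 2) ^ 3 / 3)) {0..1}"
      by (rule fundamental_theorem_of_calculus)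
         (auto intro!: derivative_eq_intros simp: has_real_derivative_iff_has_vector_derivative[symmetric])
    then show ?thesis by (simp add: power_divide)
  qed
  have i2: "((\<lambda>t. \<Sum>h=1..N. 2 / (pi * real h) * ((t - 1 / 2) * sin (2 * pi * real h * t))) has_integral
     (\<Sum>h=1..N. 2 / (pi * real h) * (- (1 / (2 * pi * real h))))) {0..1}"
    by (intro has_integral_sum has_integral_mult_right lin_sin_has_integral) auto
  have i3: "((\<lambda>t. \<Sum>h=1..N. \<Sum>k=1..N. 1 / (pi * real h * (pi * real k)) * (sin (2 * pi * real h * t) * sin (2 * pi * real k * t))) has_integral
     (\<Sum>h=1..N. \<Sum>k=1..N. 1 / (pi * real h * (pi * real k)) * (if h = k then 1 / 2 else 0))) {0..1}"
    by (intro has_integral_sum has_integral_mult_right sin_sin_has_integral) auto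
  have e: "(t - 1 / 2 - saw_sum N t)\<^sup>2 = (t - 1 / 2)\<^sup>2 + (\<Sum>h=1..N. 2 / (pi * real h) * ((t - 1 / 2) * sin (2 * pi * real h * t)))
     + (\<Sum>h=1..N. \<Sum>k=1..N. 1 / (pi * real h * (pi * real k)) * (sin (2 * pi * real h * t) * sin (2 * pi * real k * t)))" for t
  proof -
    define S where "S = (\<Sum>h=1..N. sin (2 * pi * real h * t) / (pi * real h))"
    have "S\<^sup>2 = (\<Sum>h=1..N. \<Sum>k=1..N. 1 / (pi * real h * (pi * real k)) * (sin (2 * pi * real h * t) * sin (2 * pi * real k * t)))"
      unfolding S_def power2_eq_square sum_product by (intro sum.cong refl) simp
    moreover have "2 * ((t - 1 / 2) * S) = (\<Sum>h=1..N. 2 / (pi * real h) * ((t - 1 / 2) * sin (2 * pi * real h * t)))"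
      unfolding S_def sum_distrib_left by (intro sum.cong refl) simp
    moreover have "(t - 1 / 2 - saw_sum N t)\<^sup>2 = (t - 1 / 2)\<^sup>2 + 2 * ((t - 1 / 2) * S) + S\<^sup>2"
      unfolding saw_sum_def S_def[symmetric] by (simp add: power2_eq_square algebra_simps)
    ultimately show ?thesis by simp
  qed
  have v: "1 / 12 + (\<Sum>h=1..N. 2 / (pi * real h) * (- (1 / (2 * pi * real h))))
     + (\<Sum>h=1..N. \<Sum>k=1..N. 1 / (pi * real h * (pi * real k)) * (if h = k then 1 / 2 else 0))
     = 1 / 12 - (\<Sum>h=1..N. 1 / (2 * pi\<^sup>2 * (real h)\<^sup>2))"
  proof -
    have "(\<Sum>h=1..N. \<Sum>k=1..N. 1 / (pi * real h * (pi * real k)) * (if h = k then 1 / 2 else 0))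
      = (\<Sum>h=1..N. 1 / (2 * pi\<^sup>2 * (real h)\<^sup>2))"
    proof (intro sum.cong refl)
      fix h assume h: "h \<in> {1..N}"
      have "(\<Sum>k=1..N. 1 / (pi * real h * (pi * real k)) * (if h = k then 1 / 2 else 0))
        = (\<Sum>k=1..N. if k = h then 1 / (pi * real h * (pi * real h)) * (1 / 2) else 0)"
        by (intro sum.cong refl) auto
      also have "\<dots> = 1 / (2 * pi\<^sup>2 * (real h)\<^sup>2)"
        using h by (simp add: power2_eq_square mult_ac)
      finally show "(\<Sum>k=1..N. 1 / (pi * real h * (pi * real k)) * (if h = k then 1 / 2 else 0)) = 1 / (2 * pi\<^sup>2 * (real h)\<^sup>2)" .
    qed
    moreover have "(\<Sum>h=1..N. 2 / (pi * real h) * (- (1 / (2 * pi * real h)))) = - (2 * (\<Sum>h=1..N. 1 / (2 * pi\<^sup>2 * (real h)\<^sup>2)))"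
      unfolding sum_distrib_left sum_negf[symmetric] by (intro sum.cong refl) (simp add: power2_eq_square)
    ultimately show ?thesis by simp
  qed
  show ?thesis
    unfolding e v[symmetric] by (intro has_integral_add i1 i2 i3)
qed

lemma saw_error_tendsto: "(\<lambda>N. 1 / 12 - (\<Sum>h=1..N. 1 / (2 * pi\<^sup>2 * (real h)\<^sup>2))) \<longlonglongrightarrow> 0"
proof -
  have "(\<lambda>N. \<Sum>n<N. 1 / (real n + 1)\<^sup>2) \<longlonglongrightarrow> pi\<^sup>2 / 6"
    using inverse_squares_sums by (simp add: sums_def add.commute)
  then have "(\<lambda>N. 1 / 12 - (1 / (2 * pi\<^sup>2)) * (\<Sum>n<N. 1 / (real n + 1)\<^sup>2)) \<longlonglongrightarrow> 1 / 12 - (1 / (2 * pi\<^sup>2)) * (pi\<^sup>2 / 6)"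
    by (intro tendsto_intros)
  moreover have "(1 / (2 * pi\<^sup>2)) * (\<Sum>n<N. 1 / (real n + 1)\<^sup>2) = (\<Sum>h=1..N. 1 / (2 * pi\<^sup>2 * (real h)\<^sup>2))" for N
  proof -
    have "(\<Sum>h=1..N. 1 / (2 * pi\<^sup>2 * (real h)\<^sup>2)) = (\<Sum>n<N. 1 / (2 * pi\<^sup>2 * (real (Suc n))\<^sup>2))"
      by (rule sum.reindex_bij_witness[of _ Suc "\<lambda>n. n - 1"]) auto
    then show ?thesis by (simp add: sum_distrib_left add.commute)
  qed
  ultimately show ?thesis by simp
qed

lemma saw_sum_continuous: "continuous_on S (saw_sum N)"
  unfolding saw_sum_def by (intro continuous_intros) auto

lemma saw_measurable [measurable]: "saw \<in> borel_measurable borel" "saw_sum N \<in> borel_measurable borel"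
  unfolding saw_def by (measurable, intro borel_measurable_continuous_onI saw_sum_continuous)

lemma saw_error_nn:
  "(\<integral>\<^sup>+t. indicator {0..1} t * ennreal ((saw t - saw_sum N t)\<^sup>2) \<partial>lborel) =
     ennreal (1 / 12 - (\<Sum>h=1..N. 1 / (2 * pi\<^sup>2 * (real h)\<^sup>2)))"
proof -
  have c: "continuous_on {0..1} (\<lambda>t. (t - 1 / 2 - saw_sum N t)\<^sup>2)"
    by (intro continuous_intros saw_sum_continuous)
  have "AE t in lborel. t \<noteq> (0::real)" by (rule AE_lborel_singleton)
  then have "(\<integral>\<^sup>+t. indicator {0..1} t * ennreal ((saw t - saw_sum N t)\<^sup>2) \<partial>lborel) =
     (\<integral>\<^sup>+t. ennreal (indicator {0..1} t *\<^sub>R (t - 1 / 2 - saw_sum N t)\<^sup>2) \<partial>lborel)"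
  proof (intro nn_integral_cong_AE, eventually_elim)
    case (elim t)
    show ?case
    proof (cases "t \<in> {0..1}")
      case True
      then have "\<lceil>t\<rceil> = 1" using elim by (simp add: ceiling_eq_iff)
      then show ?thesis using True by (simp add: saw_def)
    qed simp
  qed
  also have "\<dots> = ennreal (LINT t:{0..1}|lborel. (t - 1 / 2 - saw_sum N t)\<^sup>2)"
    unfolding set_lebesgue_integral_def
    using borel_integrable_atLeastAtMost'[OF c] by (intro nn_integral_eq_integral) (auto simp: set_integrable_def)
  also have "(LINT t:{0..1}|lborel. (t - 1 / 2 - saw_sum N t)\<^sup>2) = integral {0..1} (\<lambda>t. (t - 1 / 2 - saw_sum N t)\<^sup>2)"
    by (rule set_borel_integral_eq_integral(2)[OF borel_integrable_atLeastAtMost'[OF c]])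
  also have "\<dots> = 1 / 12 - (\<Sum>h=1..N. 1 / (2 * pi\<^sup>2 * (real h)\<^sup>2))"
    by (rule integral_unique[OF saw_error_has_integral])
  finally show ?thesis .
qed

lemma saw_periodic: "saw (t + of_int k) = saw t"
  by (simp add: saw_def)

lemma saw_sum_periodic: "saw_sum N (t + of_int k) = saw_sum N t"
proof -
  have "sin (2 * pi * real h * (t + of_int k)) = sin (2 * pi * real h * t)" for h
    using sin_int_2pin[of "int h * k"] cos_int_2pin[of "int h * k"]
    by (simp add: distrib_left sin_add mult.assoc)
  then show ?thesis by (simp add: saw_sum_def)
qed

text \<open>For z in [-3 a, 3 a] and |x| \<le> a the argument (z - x) / (2 a) ranges over [-2, 2],
  which is covered by four periods.\<close>

lemma saw_error_wide:
  "(\<integral>\<^sup>+t. indicator {-2..2} t * ennreal ((saw t - saw_sum N t)\<^sup>2) \<partial>lborel) \<le>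
     4 * ennreal (1 / 12 - (\<Sum>h=1..N. 1 / (2 * pi\<^sup>2 * (real h)\<^sup>2)))"
proof -
  let ?G = "\<lambda>t. ennreal ((saw t - saw_sum N t)\<^sup>2)"
  have sh: "(\<integral>\<^sup>+t. indicator {of_int k..of_int k + 1} t * ?G t \<partial>lborel) = ennreal (1 / 12 - (\<Sum>h=1..N. 1 / (2 * pi\<^sup>2 * (real h)\<^sup>2)))" for k :: int
  proof -
    have "(\<integral>\<^sup>+t. indicator {of_int k..of_int k + 1} t * ?G t \<partial>lborel)
       = (\<integral>\<^sup>+t. indicator {of_int k..of_int k + 1} (of_int k + 1 * t) * ?G (of_int k + 1 * t) \<partial>lborel)"
      by (subst nn_integral_real_affine[of _ 1 "of_int k"]) auto
    also have "\<dots> = (\<integral>\<^sup>+t. indicator {0..1} t * ?G t \<partial>lborel)"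
      by (intro nn_integral_cong) (auto simp: indicator_def saw_periodic saw_sum_periodic add.commute)
    finally show ?thesis by (simp add: saw_error_nn)
  qed
  have "(\<integral>\<^sup>+t. indicator {-2..2} t * ?G t \<partial>lborel)
    \<le> (\<integral>\<^sup>+t. (\<Sum>k\<in>{-2..1::int}. indicator {of_int k..of_int k + 1} t * ?G t) \<partial>lborel)"
  proof (rule nn_integral_mono)
    fix t :: real
    show "indicator {-2..2} t * ?G t \<le> (\<Sum>k\<in>{-2..1::int}. indicator {of_int k..of_int k + 1} t * ?G t)"
    proof (cases "t \<in> {-2..2}")
      case True
      define k where "k = min \<lfloor>t\<rfloor> 1"
      have k: "k \<in> {-2..1}" using True by (auto simp: k_def le_floor_iff)
      have "of_int k \<le> t" "t \<le> of_int k + 1" using True floor_correct[of t] by (auto simp: k_def min_def)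
      then have "indicator {-2..2} t * ?G t = indicator {of_int k..of_int k + 1} t * ?G t" using True by simp
      also have "\<dots> \<le> (\<Sum>k\<in>{-2..1::int}. indicator {of_int k..of_int k + 1} t * ?G t)"
        by (rule member_le_sum[OF k]) auto
      finally show ?thesis .
    qed simp
  qed
  also have "\<dots> = (\<Sum>k\<in>{-2..1::int}. \<integral>\<^sup>+t. indicator {of_int k..of_int k + 1} t * ?G t \<partial>lborel)"
    by (rule nn_integral_sum) measurable
  also have "\<dots> = 4 * ennreal (1 / 12 - (\<Sum>h=1..N. 1 / (2 * pi\<^sup>2 * (real h)\<^sup>2)))"
    unfolding sh by simp
  finally show ?thesis .
qed

lemma L2_on_mult:
  assumes u: "L2_on l r u" and c: "continuous_on UNIV \<psi>"
  shows "L2_on l r (\<lambda>t. u t * \<psi> t)"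
proof -
  have "bounded (\<psi> ` {l..r})"
    by (intro compact_imp_bounded compact_continuous_image continuous_on_subset[OF c]) auto
  then obtain B where B: "B > 0" "\<And>t. t \<in> {l..r} \<Longrightarrow> \<bar>\<psi> t\<bar> \<le> B"
    unfolding bounded_pos by (metis imageI real_norm_def)
  have [measurable]: "u \<in> borel_measurable borel" "\<psi> \<in> borel_measurable borel"
    using u c by (auto simp: L2_on_def intro: borel_measurable_continuous_onI)
  have "integrable lborel (\<lambda>t. (u t * \<psi> t)\<^sup>2)"
  proof (rule Bochner_Integration.integrable_bound)
    show "integrable lborel (\<lambda>t. B\<^sup>2 * (u t)\<^sup>2)" using u by (auto simp: L2_on_def)
    have "(u t * \<psi> t)\<^sup>2 \<le> B\<^sup>2 * (u t)\<^sup>2" for t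
    proof (cases "t \<in> {l..r}")
      case True
      have "(\<psi> t)\<^sup>2 \<le> B\<^sup>2" using B(2)[OF True] by (metis abs_ge_zero power2_abs power_mono)
      then show ?thesis by (simp add: power_mult_distrib mult.commute[of "B\<^sup>2"] mult_left_mono)
    qed (use u in \<open>auto simp: L2_on_def\<close>)
    then show "AE t in lborel. norm ((u t * \<psi> t)\<^sup>2) \<le> norm (B\<^sup>2 * (u t)\<^sup>2)" by (intro AE_I2) simp
  qed measurable
  moreover have "u t * \<psi> t = 0" if "t \<notin> {l..r}" for t using u that by (auto simp: L2_on_def)
  ultimately show ?thesis unfolding L2_on_def by auto
qed

section \<open>Fourier expansion of a periodised function\<close>

lemma weak_pair_parts:
  assumes wp: "weak_pair l r u u'" and lr: "l \<le> r" and ends: "u l = 0" "u r = 0"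
    and psi: "\<And>t. (\<psi> has_real_derivative \<psi>' t) (at t)" and c: "continuous_on UNIV \<psi>'"
  shows "(LINT t|lborel. u' t * \<psi> t) = - (LINT t|lborel. u t * \<psi>' t)"
    and "integrable lborel (\<lambda>t. u' t * \<psi> t)" and "integrable lborel (\<lambda>t. u t * \<psi>' t)"
proof -
  have cpsi: "continuous_on UNIV \<psi>" using psi by (meson DERIV_continuous_on has_field_derivative_at_within)
  have L2: "L2_on l r u" "L2_on l r u'" using wp by (auto simp: weak_pair_def)
  show i1: "integrable lborel (\<lambda>t. u' t * \<psi> t)" by (rule L2_on_integrable[OF L2_on_mult[OF L2(2) cpsi]])
  show i2: "integrable lborel (\<lambda>t. u t * \<psi>' t)" by (rule L2_on_integrable[OF L2_on_mult[OF L2(1) c]])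
  have int: "set_integrable lborel {l..r} u'"
    unfolding set_integrable_def by (rule integrable_mult_indicator) (use L2_on_integrable[OF L2(2)] in auto)
  have "(\<psi> has_real_derivative \<psi>' t) (at t within {l..r})" for t
    using psi by (rule has_field_derivative_at_within)
  note parts = abs_continuous_on_parts[OF lr _ _ int this continuous_on_subset[OF c subset_UNIV], of u]
  have "(LINT t|lborel. u' t * \<psi> t + u t * \<psi>' t) = (LINT t:{l..r}|lborel. u' t * \<psi> t + u t * \<psi>' t)"
    unfolding set_lebesgue_integral_def
  proof (intro Bochner_Integration.integral_cong refl)
    fix t show "u' t * \<psi> t + u t * \<psi>' t = indicator {l..r} t *\<^sub>R (u' t * \<psi> t + u t * \<psi>' t)"
      using L2 by (cases "t \<in> {l..r}") (simp_all add: L2_on_def)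
  qed
  also have "\<dots> = 0" using parts(2) wp ends by (simp add: weak_pair_def)
  finally show "(LINT t|lborel. u' t * \<psi> t) = - (LINT t|lborel. u t * \<psi>' t)" using i1 i2 by simp
qed

text \<open>The value of v at a translate is the integral of v' over the points z to its left.
  Summing the three indicators counts the translates to the right of z, a step function of (z - x) /
  (2 a); adding the linear term z / (2 a) turns it into the sawtooth plus a constant. The constant
  disappears because v' has integral 0, and the linear term yields the mean of v by parts.\<close>

lemma periodization_saw:
  assumes wp: "weak_pair (-3 * a) (3 * a) v v'" and a: "a > 0" and ends: "v (-3 * a) = 0" "v (3 * a) = 0"
    and x: "\<bar>x\<bar> \<le> a"
  shows "(\<Sum>m\<in>{-1..1::int}. v (x + 2 * a * of_int m)) =
     (1 / (2 * a)) * (LINT z|lborel. v z) + (LINT z|lborel. v' z * saw ((z - x) / (2 * a)))"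
    and "integrable lborel (\<lambda>z. v' z * saw ((z - x) / (2 * a)))"
proof -
  have lr: "-3 * a \<le> 3 * a" using a by simp
  have L2: "L2_on (-3 * a) (3 * a) v'" using wp by (simp add: weak_pair_def)
  note i = L2_on_integrable[OF L2]
  have [measurable]: "v' \<in> borel_measurable borel" using L2 by (simp add: L2_on_def)
  have z: "(LINT z|lborel. v' z * z) = - (LINT z|lborel. v z)" "integrable lborel (\<lambda>z. v' z * z)"
    using weak_pair_parts[OF wp lr ends, of "\<lambda>z. z" "\<lambda>_. 1"] by auto
  have one: "(LINT z|lborel. v' z) = 0"
    using weak_pair_parts[OF wp lr ends, of "\<lambda>z. 1" "\<lambda>_. 0"] by auto
  have im: "integrable lborel (\<lambda>z. v' z * indicator {..y} z)" for y
    using integrable_mult_indicator[of "{..y}" lborel v'] i by (simp add: mult.commute)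
  have val: "v y = (LINT z|lborel. v' z * indicator {..y} z)" if "-3 * a \<le> y" "y \<le> 3 * a" for y
  proof -
    have "v y = (LINT z:{-3 * a..y}|lborel. v' z)"
      using weak_pair_ftc[OF wp order_refl that] ends by simp
    also have "\<dots> = (LINT z|lborel. v' z * indicator {..y} z)"
      unfolding set_lebesgue_integral_def
    proof (intro Bochner_Integration.integral_cong refl)
      fix z show "indicator {-3 * a..y} z *\<^sub>R v' z = v' z * indicator {..y} z"
        using L2 by (cases "z \<in> {-3*a..3*a}") (auto simp: L2_on_def indicator_def)
    qed
    finally show ?thesis .
  qed
  let ?c = "\<lambda>z. (\<Sum>m\<in>{-1..1::int}. indicator {..x + 2 * a * of_int m} z) + z / (2 * a)"
  have s: "(\<Sum>m\<in>{-1..1::int}. v (x + 2 * a * of_int m)) = (LINT z|lborel. (\<Sum>m\<in>{-1..1::int}. v' z * indicator {..x + 2 * a * of_int m} z))"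
  proof (subst Bochner_Integration.integral_sum)
    show "(\<Sum>m\<in>{-1..1::int}. v (x + 2 * a * of_int m)) = (\<Sum>m\<in>{-1..1::int}. LINT z|lborel. v' z * indicator {..x + 2 * a * of_int m} z)"
    proof (intro sum.cong refl val)
      fix m :: int assume "m \<in> {-1..1}"
      then have "-1 \<le> real_of_int m" "real_of_int m \<le> 1" by auto
      then have "- (2 * a) \<le> 2 * a * real_of_int m" "2 * a * real_of_int m \<le> 2 * a"
        using a mult_left_mono[of "-1" "real_of_int m" "2 * a"] mult_left_mono[of "real_of_int m" 1 "2 * a"] by auto
      then show "-3 * a \<le> x + 2 * a * real_of_int m" "x + 2 * a * real_of_int m \<le> 3 * a"
        using x by linarith+
    qed
  qed (rule im)
  have isum: "integrable lborel (\<lambda>z. \<Sum>m\<in>{-1..1::int}. v' z * indicator {..x + 2 * a * of_int m} z)"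
    by (intro Bochner_Integration.integrable_sum im)
  have ic: "integrable lborel (\<lambda>z. v' z * ?c z)"
  proof -
    have "integrable lborel (\<lambda>z. (\<Sum>m\<in>{-1..1::int}. v' z * indicator {..x + 2 * a * of_int m} z) + (1 / (2 * a)) * (v' z * z))"
      by (intro Bochner_Integration.integrable_add isum integrable_mult_right z(2))
    then show ?thesis by (simp add: distrib_left sum_distrib_left)
  qed
  have "(LINT z|lborel. v' z * ?c z) = (\<Sum>m\<in>{-1..1::int}. v (x + 2 * a * of_int m)) + (1 / (2 * a)) * (LINT z|lborel. v' z * z)"
  proof -
    have "(LINT z|lborel. (\<Sum>m\<in>{-1..1::int}. v' z * indicator {..x + 2 * a * of_int m} z) + (1 / (2 * a)) * (v' z * z))
      = (\<Sum>m\<in>{-1..1::int}. v (x + 2 * a * of_int m)) + (1 / (2 * a)) * (LINT z|lborel. v' z * z)"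
      unfolding s by (subst Bochner_Integration.integral_add[OF isum]) (use z(2) in auto)
    then show ?thesis by (simp add: distrib_left sum_distrib_left)
  qed
  note total = this
  \<comment> \<open>The left end point is excluded: for x = a it gives (z - x) / (2 a) = -2, where
    the formula would count a fourth translate.\<close>
  have cnt: "?c z = saw ((z - x) / (2 * a)) + (3 / 2 + x / (2 * a))" if zz: "z \<in> {-3 * a..3 * a}" "z \<noteq> -3 * a" for z
  proof -
    define t where "t = (z - x) / (2 * a)"
    have zt: "z = x + 2 * a * t" using a by (simp add: t_def)
    have "-3 * a < x + 2 * a * t" "x + 2 * a * t \<le> 3 * a" using zz unfolding zt by auto
    then have "2 * a * (-2) < 2 * a * t" "2 * a * t \<le> 2 * a * 2" using x by linarith+
    then have t: "-2 < t" "t \<le> 2"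
      using a mult_less_cancel_left_pos[of "2 * a" "-2" t] mult_le_cancel_left_pos[of "2 * a" t 2] by linarith+
    have ind: "indicator {..x + 2 * a * of_int m} z = (if \<lceil>t\<rceil> \<le> m then 1 else 0::real)" for m :: int
      using a by (simp add: zt indicator_def ceiling_le_iff)
    have count: "(\<Sum>m\<in>{-1, 0, 1::int}. if c \<le> m then 1 else 0::real) = 2 - real_of_int c"
      if "c \<in> {-1, 0, 1, 2}" for c :: int using that by auto
    have "\<lceil>t\<rceil> \<in> {-1, 0, 1, 2}" using t by (auto simp: ceiling_le_iff; linarith)
    moreover have "{-1..1::int} = {-1, 0, 1}" by auto
    ultimately have "(\<Sum>m\<in>{-1..1::int}. indicator {..x + 2 * a * of_int m} z) = 2 - real_of_int \<lceil>t\<rceil>"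
      unfolding ind by (simp only: count)
    moreover have "z / (2 * a) = t + x / (2 * a)" using a by (simp add: zt add_divide_distrib)
    ultimately show ?thesis unfolding t_def[symmetric] by (simp add: saw_def)
  qed
  have "AE z in lborel. z \<noteq> -3 * a" by (rule AE_lborel_singleton)
  then have ae: "AE z in lborel. v' z * ?c z = v' z * saw ((z - x) / (2 * a)) + v' z * (3 / 2 + x / (2 * a))"
  proof eventually_elim
    case (elim z)
    show ?case
    proof (cases "z \<in> {-3 * a..3 * a}")
      case True
      show ?thesis unfolding cnt[OF True elim] by (rule distrib_left)
    qed (use L2 in \<open>auto simp: L2_on_def\<close>)
  qed
  have ic': "integrable lborel (\<lambda>z. v' z * saw ((z - x) / (2 * a)) + v' z * (3 / 2 + x / (2 * a)))"
    using ic by (rule integrable_cong_AE_imp) (use ae in auto)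
  have i3: "integrable lborel (\<lambda>z. v' z * (3 / 2 + x / (2 * a)))" using i by simp
  show isaw: "integrable lborel (\<lambda>z. v' z * saw ((z - x) / (2 * a)))"
    using Bochner_Integration.integrable_diff[OF ic' i3] by simp
  have "(LINT z|lborel. v' z * ?c z) = (LINT z|lborel. v' z * saw ((z - x) / (2 * a)) + v' z * (3 / 2 + x / (2 * a)))"
    by (rule integral_cong_AE) (use ae in auto)
  also have "\<dots> = (LINT z|lborel. v' z * saw ((z - x) / (2 * a)))"
    using isaw i3 one by simp
  finally show "(\<Sum>m\<in>{-1..1::int}. v (x + 2 * a * of_int m)) =
     (1 / (2 * a)) * (LINT z|lborel. v z) + (LINT z|lborel. v' z * saw ((z - x) / (2 * a)))"
    using total z(1) by simp
qed

text \<open>Integration by parts turns the partial sum of the sawtooth series into the Fourier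
  partial sum. The error is the integral of v' against the remainder of the sawtooth series and
  tends to 0 by Cauchy and Schwarz, so square integrability of v' gives convergence at every point
  of the interval and not only in the mean.\<close>

lemma fourier_1d_real:
  assumes wp: "weak_pair (-3 * a) (3 * a) v v'" and a: "a > 0" and ends: "v (-3 * a) = 0" "v (3 * a) = 0"
    and x: "\<bar>x\<bar> \<le> a"
  shows "(\<lambda>N. (1 / (2 * a)) * ((LINT z|lborel. v z) + 2 * (\<Sum>h=1..N. LINT z|lborel. v z * cos (pi * real h / a * (z - x)))))
     \<longlonglongrightarrow> (\<Sum>m\<in>{-1..1::int}. v (x + 2 * a * of_int m))"
proof -
  have lr: "-3 * a \<le> 3 * a" using a by simp
  have L2: "L2_on (-3 * a) (3 * a) v'" using wp by (simp add: weak_pair_def)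
  have [measurable]: "v' \<in> borel_measurable borel" using L2 by (simp add: L2_on_def)
  have i1: "integrable lborel (\<lambda>z. v' z * saw_sum N ((z - x) / (2 * a)))" for N
    by (rule L2_on_integrable[OF L2_on_mult[OF L2]], rule continuous_on_compose2[OF saw_sum_continuous[of UNIV]])
       (use a in \<open>auto intro!: continuous_intros\<close>)
  have eq: "(LINT z|lborel. v' z * saw_sum N ((z - x) / (2 * a))) = (1 / a) * (\<Sum>h=1..N. LINT z|lborel. v z * cos (pi * real h / a * (z - x)))" for N
  proof -
    have part: "(LINT z|lborel. v' z * sin (pi * real h / a * (z - x))) = - (LINT z|lborel. v z * (pi * real h / a * cos (pi * real h / a * (z - x))))"
      "integrable lborel (\<lambda>z. v' z * sin (pi * real h / a * (z - x)))" for h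
    proof -
      have d: "((\<lambda>z. sin (\<omega> * (z - x))) has_real_derivative \<omega> * cos (\<omega> * (z - x))) (at z)" for z \<omega>
        by (auto intro!: derivative_eq_intros)
      have c: "continuous_on UNIV (\<lambda>z. \<omega> * cos (\<omega> * (z - x)))" for \<omega>
        by (intro continuous_intros)
      show "(LINT z|lborel. v' z * sin (pi * real h / a * (z - x))) = - (LINT z|lborel. v z * (pi * real h / a * cos (pi * real h / a * (z - x))))"
        "integrable lborel (\<lambda>z. v' z * sin (pi * real h / a * (z - x)))"
        by (rule weak_pair_parts[OF wp lr ends d c])+
    qed
    have "(LINT z|lborel. v' z * saw_sum N ((z - x) / (2 * a))) = (LINT z|lborel. (\<Sum>h=1..N. - (1 / (pi * real h)) * (v' z * sin (pi * real h / a * (z - x)))))"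
    proof -
      have "2 * pi * real h * ((z - x) / (2 * a)) = pi * real h / a * (z - x)" for h z by simp
      then have "v' z * saw_sum N ((z - x) / (2 * a)) = (\<Sum>h=1..N. - (1 / (pi * real h)) * (v' z * sin (pi * real h / a * (z - x))))" for z
        unfolding saw_sum_def by (simp only: sum_negf[symmetric] sum_distrib_left) (intro sum.cong refl, simp)
      then show ?thesis by simp
    qed
    also have "\<dots> = (\<Sum>h=1..N. - (1 / (pi * real h)) * (LINT z|lborel. v' z * sin (pi * real h / a * (z - x))))"
      using part(2) by (subst Bochner_Integration.integral_sum) auto
    also have "\<dots> = (\<Sum>h=1..N. (1 / a) * (LINT z|lborel. v z * cos (pi * real h / a * (z - x))))"
    proof (intro sum.cong refl)
      fix h assume h: "h \<in> {1..N}"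
      have "(LINT z|lborel. v z * (pi * real h / a * cos (pi * real h / a * (z - x)))) = (LINT z|lborel. (pi * real h / a) * (v z * cos (pi * real h / a * (z - x))))"
        by (intro Bochner_Integration.integral_cong refl) (simp add: mult_ac)
      also have "\<dots> = (pi * real h / a) * (LINT z|lborel. v z * cos (pi * real h / a * (z - x)))"
        by (rule integral_mult_right_zero)
      finally show "- (1 / (pi * real h)) * (LINT z|lborel. v' z * sin (pi * real h / a * (z - x))) = (1 / a) * (LINT z|lborel. v z * cos (pi * real h / a * (z - x)))"
        unfolding part(1)
      proof (elim ssubst)
        have "real h > 0" using h by simp
        then show "- (1 / (pi * real h)) * - (pi * real h / a * X) = 1 / a * X" for X by simp
      qed
    qed
    finally show ?thesis by (simp add: sum_distrib_left)
  qed
  define e where "e N = 1 / 12 - (\<Sum>h=1..N. 1 / (2 * pi\<^sup>2 * (real h)\<^sup>2))" for N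
  have e0: "e N \<ge> 0" for N
    unfolding e_def by (rule has_integral_nonneg[OF saw_error_has_integral]) auto
  define R where "R = (LINT z|lborel. (v' z)\<^sup>2)"
  \<comment> \<open>The factor 8 a is 2 a from the substitution z = x + 2 a t times the four periods
    of \<open>saw_error_wide\<close>.\<close>
  have bd: "(LINT z|lborel. v' z * (saw ((z - x) / (2 * a)) - saw_sum N ((z - x) / (2 * a))))\<^sup>2 \<le> R * (8 * a * e N)" (is "?I\<^sup>2 \<le> _") for N
  proof -
    let ?g = "\<lambda>z. indicator {-3 * a..3 * a} z * ennreal \<bar>saw ((z - x) / (2 * a)) - saw_sum N ((z - x) / (2 * a))\<bar>"
    have ii: "integrable lborel (\<lambda>z. v' z * (saw ((z - x) / (2 * a)) - saw_sum N ((z - x) / (2 * a))))"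
      using Bochner_Integration.integrable_diff[OF periodization_saw(2)[OF wp a ends x] i1[of N]] by (simp add: right_diff_distrib)
    have "ennreal \<bar>?I\<bar> \<le> (\<integral>\<^sup>+z. ennreal \<bar>v' z * (saw ((z - x) / (2 * a)) - saw_sum N ((z - x) / (2 * a)))\<bar> \<partial>lborel)"
      using integral_norm_bound_ennreal[OF ii] by simp
    also have "\<dots> = (\<integral>\<^sup>+z. ennreal \<bar>v' z\<bar> * ?g z \<partial>lborel)"
    proof (intro nn_integral_cong)
      fix z show "ennreal \<bar>v' z * (saw ((z - x) / (2 * a)) - saw_sum N ((z - x) / (2 * a)))\<bar> = ennreal \<bar>v' z\<bar> * ?g z"
        using L2 by (cases "z \<in> {-3*a..3*a}") (simp_all add: L2_on_def abs_mult ennreal_mult')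
    qed
    finally have "(ennreal \<bar>?I\<bar>)\<^sup>2 \<le> (\<integral>\<^sup>+z. ennreal \<bar>v' z\<bar> * ?g z \<partial>lborel)\<^sup>2" by (intro power_mono) auto
    also have "\<dots> \<le> (\<integral>\<^sup>+z. (ennreal \<bar>v' z\<bar>)\<^sup>2 \<partial>lborel) * (\<integral>\<^sup>+z. (?g z)\<^sup>2 \<partial>lborel)"
      by (rule Cauchy_Schwarz_nn_integral) measurable
    also have "(\<integral>\<^sup>+z. (ennreal \<bar>v' z\<bar>)\<^sup>2 \<partial>lborel) = ennreal R"
      unfolding R_def using L2 by (subst nn_integral_eq_integral[symmetric]) (auto simp: L2_on_def ennreal_power)
    also have "(\<integral>\<^sup>+z. (?g z)\<^sup>2 \<partial>lborel) \<le> ennreal (8 * a * e N)"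
    proof -
      let ?G = "\<lambda>t. indicator {-2..2} t * ennreal ((saw t - saw_sum N t)\<^sup>2)"
      have "(\<integral>\<^sup>+z. (?g z)\<^sup>2 \<partial>lborel) = ennreal \<bar>2 * a\<bar> * (\<integral>\<^sup>+t. (?g (x + 2 * a * t))\<^sup>2 \<partial>lborel)"
        using a by (subst nn_integral_real_affine[of _ "2 * a" x]) auto
      also have "\<dots> \<le> ennreal \<bar>2 * a\<bar> * (\<integral>\<^sup>+t. ?G t \<partial>lborel)"
      proof (intro mult_left_mono nn_integral_mono)
        fix t
        have "t \<in> {-2..2}" if "x + 2 * a * t \<in> {-3*a..3*a}"
        proof -
          have "2 * a * (-2) \<le> 2 * a * t" "2 * a * t \<le> 2 * a * 2" using that x by auto
          then show ?thesis
            using a mult_le_cancel_left_pos[of "2 * a" "-2" t] mult_le_cancel_left_pos[of "2 * a" t 2] by simp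
        qed
        then show "(?g (x + 2 * a * t))\<^sup>2 \<le> ?G t"
          using a by (auto simp: indicator_def ennreal_power)
      qed simp
      also have "\<dots> \<le> ennreal \<bar>2 * a\<bar> * (4 * ennreal (e N))"
        unfolding e_def by (intro mult_left_mono saw_error_wide) simp
      also have "\<dots> = ennreal (8 * a * e N)"
      proof -
        have "4 * ennreal (e N) = ennreal (4 * e N)" using ennreal_mult'[of 4 "e N"] by simp
        then show ?thesis using a e0 by (simp add: ennreal_mult'[symmetric])
      qed
      finally show ?thesis .
    qed
    finally have "(ennreal \<bar>?I\<bar>)\<^sup>2 \<le> ennreal (R * (8 * a * e N))"
      by (simp add: ennreal_mult' R_def mult_left_mono)
    then show ?thesis using a e0[of N] by (simp add: ennreal_power ennreal_le_iff R_def)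
  qed
  have "e \<longlonglongrightarrow> 0" unfolding e_def by (rule saw_error_tendsto)
  then have "(\<lambda>N. R * (8 * a * e N)) \<longlonglongrightarrow> R * (8 * a * 0)" by (intro tendsto_intros)
  then have "(\<lambda>N. (LINT z|lborel. v' z * (saw ((z - x) / (2 * a)) - saw_sum N ((z - x) / (2 * a))))\<^sup>2) \<longlonglongrightarrow> 0"
    by (intro Lim_null_comparison[of "\<lambda>N. (LINT z|lborel. v' z * (saw ((z - x) / (2 * a)) - saw_sum N ((z - x) / (2 * a))))\<^sup>2"])
       (use bd in \<open>auto intro!: always_eventually\<close>)
  then have "(\<lambda>N. sqrt ((LINT z|lborel. v' z * (saw ((z - x) / (2 * a)) - saw_sum N ((z - x) / (2 * a))))\<^sup>2)) \<longlonglongrightarrow> sqrt 0"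
    by (intro tendsto_intros)
  then have "(\<lambda>N. LINT z|lborel. v' z * (saw ((z - x) / (2 * a)) - saw_sum N ((z - x) / (2 * a)))) \<longlonglongrightarrow> 0"
    by (simp add: tendsto_rabs_zero_iff)
  then have "(\<lambda>N. (LINT z|lborel. v' z * saw ((z - x) / (2 * a))) - (LINT z|lborel. v' z * saw_sum N ((z - x) / (2 * a)))) \<longlonglongrightarrow> 0"
    using periodization_saw(2)[OF wp a ends x] i1 by (simp add: right_diff_distrib)
  then have "(\<lambda>N. (LINT z|lborel. v' z * saw_sum N ((z - x) / (2 * a))) - (LINT z|lborel. v' z * saw ((z - x) / (2 * a)))) \<longlonglongrightarrow> 0"
    using tendsto_minus by fastforce
  then have "(\<lambda>N. LINT z|lborel. v' z * saw_sum N ((z - x) / (2 * a))) \<longlonglongrightarrow> (LINT z|lborel. v' z * saw ((z - x) / (2 * a)))"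
    by (simp add: LIM_zero_iff)
  then have "(\<lambda>N. (1 / (2 * a)) * (LINT z|lborel. v z) + (LINT z|lborel. v' z * saw_sum N ((z - x) / (2 * a))))
     \<longlonglongrightarrow> (\<Sum>m\<in>{-1..1::int}. v (x + 2 * a * of_int m))"
    unfolding periodization_saw(1)[OF wp a ends x] by (intro tendsto_intros)
  then show ?thesis unfolding eq by (simp add: distrib_left)
qed

text \<open>For v supported in [-3 a, 3 a] this integral over the line is 2 a times the Fourier
  coefficient of the periodisation of v with period 2 a, so no integral over a single period has to
  be formed.\<close>

definition fhat :: "real \<Rightarrow> (real \<Rightarrow> real) \<Rightarrow> int \<Rightarrow> complex" where
  "fhat a v h = (LINT z|lborel. of_real (v z) * cis (- (pi * of_int h / a * z)))"

lemma integrable_cis: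
  assumes "integrable lborel v"
  shows "integrable lborel (\<lambda>z. of_real (v z) * cis (c * z))"
proof (rule Bochner_Integration.integrable_bound[OF assms])
  have [measurable]: "v \<in> borel_measurable borel" using assms by simp
  have [measurable]: "(\<lambda>z. cis (c * z)) \<in> borel_measurable borel"
    by (intro borel_measurable_continuous_onI continuous_intros)
  show "(\<lambda>z. of_real (v z) * cis (c * z)) \<in> borel_measurable lborel" by measurable
qed (simp add: norm_mult)

lemma fhat_eq:
  assumes "integrable lborel v"
  shows "fhat a v h = Complex (LINT z|lborel. v z * cos (pi * of_int h / a * z)) (- (LINT z|lborel. v z * sin (pi * of_int h / a * z)))"
proof -
  have i: "integrable lborel (\<lambda>z. of_real (v z) * cis (- (pi * of_int h / a * z)))"
    using integrable_cis[OF assms, of "- (pi * of_int h / a)"] by simp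
  have "Re (fhat a v h) = (LINT z|lborel. v z * cos (pi * of_int h / a * z))"
    unfolding fhat_def using integral_bounded_linear[OF bounded_linear_Re i] by simp
  moreover have "Im (fhat a v h) = - (LINT z|lborel. v z * sin (pi * of_int h / a * z))"
    unfolding fhat_def using integral_bounded_linear[OF bounded_linear_Im i] by simp
  ultimately show ?thesis by (simp add: complex_eq_iff)
qed

lemma fhat_deriv:
  assumes wp: "weak_pair (-3 * a) (3 * a) v v'" and a: "a > 0" and ends: "v (-3 * a) = 0" "v (3 * a) = 0"
  shows "fhat a v' h = \<i> * of_real (pi * of_int h / a) * fhat a v h"
proof -
  have lr: "-3 * a \<le> 3 * a" using a by simp
  define \<theta> where "\<theta> = pi * of_int h / a"
  have i: "integrable lborel v" "integrable lborel v'" using wp by (auto simp: weak_pair_def intro: L2_on_integrable)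
  have c: "(LINT z|lborel. v' z * cos (\<theta> * z)) = - (LINT z|lborel. v z * (- \<theta> * sin (\<theta> * z)))"
    by (rule weak_pair_parts[OF wp lr ends]) (auto intro!: derivative_eq_intros continuous_intros)
  have s: "(LINT z|lborel. v' z * sin (\<theta> * z)) = - (LINT z|lborel. v z * (\<theta> * cos (\<theta> * z)))"
    by (rule weak_pair_parts[OF wp lr ends]) (auto intro!: derivative_eq_intros continuous_intros)
  have "(\<lambda>z. v z * (- \<theta> * sin (\<theta> * z))) = (\<lambda>z. - \<theta> * (v z * sin (\<theta> * z)))"
    "(\<lambda>z. v z * (\<theta> * cos (\<theta> * z))) = (\<lambda>z. \<theta> * (v z * cos (\<theta> * z)))" by auto
  then show ?thesis
    unfolding fhat_eq[OF i(1)] fhat_eq[OF i(2)] \<theta>_def[symmetric] c s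
    by (simp add: complex_eq_iff)
qed

lemma sum_symmetric_int:
  fixes g :: "int \<Rightarrow> complex"
  shows "(\<Sum>h\<in>{- int N..int N}. g h) = g 0 + (\<Sum>h=1..N. g (int h) + g (- int h))"
proof (induction N)
  case (Suc N)
  have "{- int (Suc N)..int (Suc N)} = insert (int (Suc N)) (insert (- int (Suc N)) {- int N..int N})" by auto
  then have "(\<Sum>h\<in>{- int (Suc N)..int (Suc N)}. g h) = g (int (Suc N)) + (g (- int (Suc N)) + (\<Sum>h\<in>{- int N..int N}. g h))"
    by (subst (1) \<open>_ = insert _ _\<close>) (subst sum.insert; simp)+
  then show ?case using Suc by simp
qed simp

text \<open>Symmetric partial sums pair h with -h; as v is real, the two terms are conjugate and
  combine to the cosine form already treated.\<close>

lemma fourier_1d: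
  assumes wp: "weak_pair (-3 * a) (3 * a) v v'" and a: "a > 0" and ends: "v (-3 * a) = 0" "v (3 * a) = 0"
    and x: "\<bar>x\<bar> \<le> a"
  shows "(\<lambda>N. of_real (1 / (2 * a)) * (\<Sum>h\<in>{- int N..int N}. fhat a v h * cis (pi * of_int h / a * x)))
     \<longlonglongrightarrow> of_real (\<Sum>m\<in>{-1..1::int}. v (x + 2 * a * of_int m))"
proof -
  have i: "integrable lborel v" using wp by (auto simp: weak_pair_def intro: L2_on_integrable)
  have L2: "L2_on (-3 * a) (3 * a) v" using wp by (simp add: weak_pair_def)
  have pair: "fhat a v (int h) * cis (pi * of_int (int h) / a * x) + fhat a v (- int h) * cis (pi * of_int (- int h) / a * x)
     = of_real (2 * (LINT z|lborel. v z * cos (pi * real h / a * (z - x))))" for h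
  proof -
    define \<theta> where "\<theta> = pi * real h / a"
    have ic: "integrable lborel (\<lambda>z. v z * cos (\<theta> * z))" "integrable lborel (\<lambda>z. v z * sin (\<theta> * z))"
      by (rule L2_on_integrable[OF L2_on_mult[OF L2]]; intro continuous_intros)+
    have "(LINT z|lborel. v z * cos (\<theta> * (z - x))) = (LINT z|lborel. cos (\<theta> * x) * (v z * cos (\<theta> * z)) + sin (\<theta> * x) * (v z * sin (\<theta> * z)))"
      by (intro Bochner_Integration.integral_cong refl) (simp add: right_diff_distrib cos_diff algebra_simps)
    also have "\<dots> = cos (\<theta> * x) * (LINT z|lborel. v z * cos (\<theta> * z)) + sin (\<theta> * x) * (LINT z|lborel. v z * sin (\<theta> * z))"
      using ic by simp
    finally have R: "(LINT z|lborel. v z * cos (\<theta> * (z - x))) = \<dots>" .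
    have "fhat a v (int h) = Complex (LINT z|lborel. v z * cos (\<theta> * z)) (- (LINT z|lborel. v z * sin (\<theta> * z)))"
      "fhat a v (- int h) = Complex (LINT z|lborel. v z * cos (\<theta> * z)) (LINT z|lborel. v z * sin (\<theta> * z))"
      unfolding fhat_eq[OF i] by (simp_all add: \<theta>_def)
    then show ?thesis unfolding R[unfolded \<theta>_def] \<theta>_def[symmetric]
      by (simp add: complex_eq_iff \<theta>_def[symmetric] R)
  qed
  have "fhat a v 0 = of_real (LINT z|lborel. v z)" unfolding fhat_eq[OF i] by (simp add: complex_eq_iff)
  then have eq: "of_real (1 / (2 * a)) * (\<Sum>h\<in>{- int N..int N}. fhat a v h * cis (pi * of_int h / a * x))
     = of_real ((1 / (2 * a)) * ((LINT z|lborel. v z) + 2 * (\<Sum>h=1..N. LINT z|lborel. v z * cos (pi * real h / a * (z - x)))))" for N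
    unfolding sum_symmetric_int pair by (simp add: sum_distrib_left)
  show ?thesis unfolding eq by (intro tendsto_of_real fourier_1d_real[OF assms])
qed

section \<open>Derivatives of cut-off functions\<close>

text \<open>Pascal's rule, the combinatorial core of Leibniz's rule: it regroups the derivative of
  one binomial sum into the next binomial sum.\<close>

lemma leibniz_sum:
  fixes e d :: "nat \<Rightarrow> real"
  shows "(\<Sum>i\<le>k. real (k choose i) * (e (Suc k - i) * d i + e (k - i) * d (Suc i))) =
     (\<Sum>i\<le>Suc k. real (Suc k choose i) * (e (Suc k - i) * d i))"
proof -
  have "(\<Sum>i\<le>Suc k. real (Suc k choose i) * (e (Suc k - i) * d i)) =
     e (Suc k) * d 0 + (\<Sum>i\<le>k. real (Suc k choose Suc i) * (e (k - i) * d (Suc i)))"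
    by (subst sum.atMost_Suc_shift) simp
  also have "\<dots> = e (Suc k) * d 0 + (\<Sum>i\<le>k. real (k choose Suc i) * (e (k - i) * d (Suc i))) + (\<Sum>i\<le>k. real (k choose i) * (e (k - i) * d (Suc i)))"
    by (simp add: algebra_simps sum.distrib)
  also have "e (Suc k) * d 0 + (\<Sum>i\<le>k. real (k choose Suc i) * (e (k - i) * d (Suc i))) = (\<Sum>i\<le>Suc k. real (k choose i) * (e (Suc k - i) * d i))"
    by (subst sum.atMost_Suc_shift) simp
  also have "\<dots> = (\<Sum>i\<le>k. real (k choose i) * (e (Suc k - i) * d i))" by simp
  finally show ?thesis by (simp add: distrib_left sum.distrib)
qed

text \<open>By Leibniz's rule this is (2 a)^k times the derivative of order k of the cut-off
  function \<open>eta 0 (y / (2 * a)) * D 0 y\<close>. The normalisation cancels the scale: passing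
  to order k multiplies Fourier coefficients by (2 pi i h)^k, whose modulus for k = \<alpha> and h
  \<noteq> 0 is \<open>r_weight \<alpha> h\<close>.\<close>

definition cut :: "real \<Rightarrow> (nat \<Rightarrow> real \<Rightarrow> real) \<Rightarrow> nat \<Rightarrow> real \<Rightarrow> real" where
  "cut a D k y = (\<Sum>i\<le>k. real (k choose i) * (eta (k - i) (y / (2 * a)) * ((2 * a) ^ i * D i y)))"

lemma eta_scaled:
  assumes "a > 0"
  shows "((\<lambda>y. eta k (y / (2 * a))) has_real_derivative eta (Suc k) (y / (2 * a)) / (2 * a)) (at y within S)"
    and "continuous_on S (\<lambda>y. eta k (y / (2 * a)))"
proof -
  show "((\<lambda>y. eta k (y / (2 * a))) has_real_derivative eta (Suc k) (y / (2 * a)) / (2 * a)) (at y within S)" for k y S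
    using DERIV_chain2[OF smooth_seqD[OF smooth_seq_eta, of k "y / (2 * a)"] DERIV_cdivide[OF DERIV_ident, of "2 * a" y S]] by simp
  then show "continuous_on S (\<lambda>y. eta k (y / (2 * a)))" by (rule DERIV_continuous_on)
qed

lemma cut_L2:
  assumes "sobolev_chain \<alpha> l r D" "a > 0" "k \<le> \<alpha>"
  shows "L2_on l r (cut a D k)"
proof -
  have "L2_on l r (\<lambda>y. \<Sum>i<Suc k. (real (k choose i) * (2 * a) ^ i) * (D i y * eta (k - i) (y / (2 * a))))"
    using assms by (intro L2_on_sum L2_on_mult eta_scaled) (auto simp: sobolev_chain_def)
  then show ?thesis by (simp add: cut_def[abs_def] lessThan_Suc_atMost mult_ac)
qed

lemma cut_weak_pair:
  assumes D: "sobolev_chain \<alpha> l r D" and a: "a > 0" and k: "k < \<alpha>"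
  shows "weak_pair l r (cut a D k) (\<lambda>y. cut a D (Suc k) y / (2 * a))"
  unfolding weak_pair_def
proof (intro conjI)
  show "L2_on l r (cut a D k)" using cut_L2[OF D a] k by simp
  have "L2_on l r (\<lambda>y. (1 / (2 * a)) * cut a D (Suc k) y)" using k by (intro L2_on_cmult cut_L2[OF D a]) auto
  then show "L2_on l r (\<lambda>y. cut a D (Suc k) y / (2 * a))" by simp
  show "abs_continuous_on l r (cut a D k)"
    unfolding cut_def[abs_def]
  proof (intro abs_continuous_on_sum abs_continuous_on_mult abs_continuous_on_const)
    fix i assume "i \<in> {..k}"
    then show "abs_continuous_on l r (D i)" using D k by (auto simp: sobolev_chain_def weak_pair_def)
    show "abs_continuous_on l r (\<lambda>y. eta (k - i) (y / (2 * a)))"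
      by (rule abs_continuous_on_C1[OF eta_scaled(1)[OF a]])
         (intro continuous_on_divide eta_scaled(2)[OF a] continuous_on_const, use a in auto)
  qed
  have "AE x in lborel. \<forall>i\<in>{..k}. x \<in> {l..r} \<longrightarrow> (D i has_real_derivative D (Suc i) x) (at x within {l..r})"
    using D k by (subst AE_ball_countable) (auto simp: sobolev_chain_def weak_pair_def)
  then show "AE x\<in>{l..r} in lborel. (cut a D k has_real_derivative cut a D (Suc k) x / (2 * a)) (at x within {l..r})"
  proof (eventually_elim, intro impI)
    fix x assume d: "\<forall>i\<in>{..k}. x \<in> {l..r} \<longrightarrow> (D i has_real_derivative D (Suc i) x) (at x within {l..r})" and x: "x \<in> {l..r}"
    let ?e = "\<lambda>j. eta j (x / (2 * a))"
    have "((\<lambda>y. eta (k - i) (y / (2 * a)) * ((2 * a) ^ i * D i y)) has_real_derivative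
        (?e (Suc k - i) * ((2 * a) ^ i * D i x) + ?e (k - i) * ((2 * a) ^ Suc i * D (Suc i) x)) / (2 * a)) (at x within {l..r})"
      if i: "i \<le> k" for i
    proof -
      have "(D i has_real_derivative D (Suc i) x) (at x within {l..r})" using d x i by simp
      from DERIV_mult[OF eta_scaled(1)[OF a, of "k - i" x] DERIV_cmult[OF this, of "(2 * a) ^ i"]]
      show ?thesis by (rule DERIV_cong) (use i a in \<open>simp add: Suc_diff_le add_divide_distrib\<close>)
    qed
    then have "(cut a D k has_real_derivative (\<Sum>i\<le>k. real (k choose i) *
        ((?e (Suc k - i) * ((2 * a) ^ i * D i x) + ?e (k - i) * ((2 * a) ^ Suc i * D (Suc i) x)) / (2 * a)))) (at x within {l..r})"
      unfolding cut_def[abs_def] by (intro DERIV_sum DERIV_cmult) auto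
    then show "(cut a D k has_real_derivative cut a D (Suc k) x / (2 * a)) (at x within {l..r})"
      using leibniz_sum[of k ?e "\<lambda>i. (2 * a) ^ i * D i x"]
      by (simp only: cut_def sum_divide_distrib[symmetric] times_divide_eq_right)
  qed
qed

lemma cut_ends: "a > 0 \<Longrightarrow> cut a D k (-3 * a) = 0" "a > 0 \<Longrightarrow> cut a D k (3 * a) = 0"
  unfolding cut_def by (auto intro!: sum.neutral simp: eta_zero)

lemma fhat_cut:
  assumes D: "sobolev_chain \<alpha> (-3 * a) (3 * a) D" and a: "a > 0"
  shows "k \<le> \<alpha> \<Longrightarrow> fhat a (cut a D k) h = (2 * of_real pi * \<i> * of_int h) ^ k * fhat a (cut a D 0) h"
proof (induction k)
  case (Suc k)
  have "fhat a (\<lambda>y. cut a D (Suc k) y / (2 * a)) h = \<i> * of_real (pi * of_int h / a) * fhat a (cut a D k) h"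
    using Suc.prems by (intro fhat_deriv[OF cut_weak_pair[OF D a] a] cut_ends a) auto
  moreover have "fhat a (\<lambda>y. cut a D (Suc k) y / (2 * a)) h = fhat a (cut a D (Suc k)) h / of_real (2 * a)"
    unfolding fhat_def by (simp flip: integral_divide_zero)
  ultimately have "fhat a (cut a D (Suc k)) h / of_real (2 * a) = \<i> * of_real (pi * of_int h / a) * fhat a (cut a D k) h"
    by simp
  then have "fhat a (cut a D (Suc k)) h = of_real (2 * a) * (\<i> * of_real (pi * of_int h / a) * fhat a (cut a D k) h)"
    using a by (metis divide_eq_eq mult.commute mult_eq_0_iff of_real_eq_0_iff less_irrefl zero_neq_numeral)
  also have "\<dots> = (2 * of_real pi * \<i> * of_int h) * fhat a (cut a D k) h" using a by simp
  finally show ?case using Suc by (simp add: mult_ac)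
qed simp

section \<open>Lattice sums\<close>

definition cube :: "nat \<Rightarrow> (int^'d::finite) set" where
  "cube N = {h. \<forall>j. h $ j \<in> {- int N..int N}}"

lemma prod_sum_vec:
  fixes f :: "'d::finite \<Rightarrow> 'k \<Rightarrow> 'c::comm_semiring_1"
  assumes "finite A"
  shows "(\<Prod>j\<in>UNIV. \<Sum>k\<in>A. f j k) = (\<Sum>h | \<forall>j. h $ j \<in> A. \<Prod>j\<in>UNIV. f j (h $ j))"
proof -
  have "(\<Prod>j\<in>UNIV. \<Sum>k\<in>A. f j k) = (\<Sum>g\<in>PiE UNIV (\<lambda>_. A). \<Prod>j\<in>UNIV. f j (g j))"
    using assms by (intro prod_sum_PiE) auto
  also have "\<dots> = (\<Sum>h | \<forall>j. h $ j \<in> A. \<Prod>j\<in>UNIV. f j (h $ j))"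
    by (rule sum.reindex_bij_witness[of _ "\<lambda>h. vec_nth h" "\<lambda>g. vec_lambda g"]) (auto simp: PiE_iff)
  finally show ?thesis .
qed

lemma finite_vec_set: "finite A \<Longrightarrow> finite {h :: 'k^'d::finite. \<forall>j. h $ j \<in> A}"
proof -
  assume "finite A"
  moreover have "{h :: 'k^'d. \<forall>j. h $ j \<in> A} = vec_lambda ` (PiE UNIV (\<lambda>_. A))"
    by (auto simp: PiE_iff image_iff intro!: exI[of _ "vec_nth _"] bexI[of _ "vec_nth _"])
  ultimately show ?thesis by (simp add: finite_PiE)
qed

lemma finite_cube: "finite (cube N)"
  unfolding cube_def by (intro finite_vec_set) simp

lemma r_weight_pos: "r_weight \<alpha> h > 0"
  by (simp add: r_weight_def)

lemma r_weight_prod_pos: "r_weight_prod \<alpha> h > 0"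
  unfolding r_weight_prod_def by (intro prod_pos ballI r_weight_pos)

lemma sum_r_weight_le:
  assumes "\<alpha> \<ge> 1"
  shows "(\<Sum>h\<in>{- int N..int N}. 1 / (r_weight \<alpha> h)\<^sup>2) \<le> 1 + pi\<^sup>2 / 3"
proof -
  have le: "1 / (r_weight \<alpha> k)\<^sup>2 \<le> 1 / (real_of_int k)\<^sup>2" if "k \<noteq> 0" for k
  proof -
    have k1: "1 \<le> \<bar>real_of_int k\<bar>" using that by linarith
    have "\<bar>real_of_int k\<bar> \<le> \<bar>2 * pi * real_of_int k\<bar>"
      using pi_ge_two by (simp add: abs_mult mult_le_cancel_right1)
    moreover have "\<bar>2 * pi * real_of_int k\<bar> ^ 1 \<le> \<bar>2 * pi * real_of_int k\<bar> ^ \<alpha>"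
      using assms k1 calculation by (intro power_increasing) auto
    ultimately have "\<bar>real_of_int k\<bar> \<le> r_weight \<alpha> k" using that by (simp add: r_weight_def)
    then have "\<bar>real_of_int k\<bar>\<^sup>2 \<le> (r_weight \<alpha> k)\<^sup>2" by (intro power_mono) auto
    then show ?thesis using that by (intro divide_left_mono) (auto intro!: mult_pos_pos r_weight_pos simp: power2_eq_square mult_less_0_iff zero_less_mult_iff)
  qed
  have "(\<Sum>h\<in>{- int N..int N}. 1 / (r_weight \<alpha> h)\<^sup>2) = 1 + 2 * (\<Sum>h=1..N. 1 / (r_weight \<alpha> (int h))\<^sup>2)"
  proof (induction N)
    case (Suc N)
    have e: "{- int (Suc N)..int (Suc N)} = insert (int (Suc N)) (insert (- int (Suc N)) {- int N..int N})" by auto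
    have "r_weight \<alpha> (- k) = r_weight \<alpha> k" for k by (simp add: r_weight_def)
    then have "r_weight \<alpha> (- int (Suc N)) = r_weight \<alpha> (int (Suc N))" .
    then show ?case unfolding e using Suc by (subst sum.insert; simp)+
  qed (simp add: r_weight_def)
  also have "(\<Sum>h=1..N. 1 / (r_weight \<alpha> (int h))\<^sup>2) \<le> (\<Sum>h=1..N. 1 / (real h)\<^sup>2)"
    by (intro sum_mono order_trans[OF le]) auto
  also have "(\<Sum>h=1..N. 1 / (real h)\<^sup>2) = (\<Sum>n<N. 1 / (real n + 1)\<^sup>2)"
    by (rule sum.reindex_bij_witness[of _ Suc "\<lambda>n. n - 1"]) (auto simp: add.commute)
  also have "\<dots> \<le> (\<Sum>n. 1 / (real n + 1)\<^sup>2)"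
    using inverse_squares_sums by (intro sum_le_suminf) (auto simp: sums_iff add.commute)
  also have "\<dots> = pi\<^sup>2 / 6" using inverse_squares_sums by (simp add: sums_iff add.commute)
  finally show ?thesis by simp
qed

text \<open>Finite sums lie in a cube of frequencies and are bounded there by a product of
  one-dimensional sums. Summability is what makes the infinite sum in
  \<open>good_lattice_rule\<close> an upper bound for its finite subsums.\<close>

lemma r_weight_prod_summable:
  assumes "\<alpha> \<ge> 1"
  shows "(\<lambda>h::int^'d::finite. 1 / (r_weight_prod \<alpha> h)\<^sup>2) summable_on S"
proof (rule nonneg_bdd_above_summable_on)
  show "bdd_above (sum (\<lambda>h::int^'d. 1 / (r_weight_prod \<alpha> h)\<^sup>2) ` {F. F \<subseteq> S \<and> finite F})"
  proof (rule bdd_aboveI2)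
    fix F :: "(int^'d) set" assume F: "F \<in> {F. F \<subseteq> S \<and> finite F}"
    define N where "N = nat (\<Sum>h\<in>F. \<Sum>j\<in>UNIV. \<bar>h $ j\<bar>)"
    have "F \<subseteq> cube N"
    proof
      fix h assume h: "h \<in> F"
      have "\<bar>h $ j\<bar> \<le> (\<Sum>h\<in>F. \<Sum>j\<in>UNIV. \<bar>h $ j\<bar>)" for j
      proof -
        have "\<bar>h $ j\<bar> \<le> (\<Sum>j\<in>UNIV. \<bar>h $ j\<bar>)" by (rule member_le_sum) auto
        also have "\<dots> \<le> (\<Sum>h\<in>F. \<Sum>j\<in>UNIV. \<bar>h $ j\<bar>)"
          using h F by (intro member_le_sum[of h F "\<lambda>h. \<Sum>j\<in>UNIV. \<bar>h $ j\<bar>"]) (auto intro: sum_nonneg)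
        finally show ?thesis .
      qed
      then have "\<bar>h $ j\<bar> \<le> int N" for j unfolding N_def by (metis nat_0_le abs_ge_zero order_trans)
      then show "h \<in> cube N" by (auto simp: cube_def abs_le_iff minus_le_iff)
    qed
    note sub = this
    have "(\<Sum>h\<in>F. 1 / (r_weight_prod \<alpha> h)\<^sup>2) \<le> (\<Sum>h\<in>(cube N :: (int^'d) set). 1 / (r_weight_prod \<alpha> h)\<^sup>2)"
    proof (rule sum_mono2)
      show "finite (cube N :: (int^'d) set)" by (rule finite_cube)
      show "F \<subseteq> cube N" by (rule sub)
    qed simp
    also have "\<dots> = (\<Prod>j\<in>(UNIV::'d set). \<Sum>k\<in>{- int N..int N}. 1 / (r_weight \<alpha> k)\<^sup>2)"
      by (subst prod_sum_vec) (auto simp: cube_def r_weight_prod_def prod_power_distrib prod_dividef)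
    also have "\<dots> \<le> (\<Prod>j\<in>(UNIV::'d set). 1 + pi\<^sup>2 / 3)"
      by (intro prod_mono conjI sum_r_weight_le assms sum_nonneg) auto
    finally show "(\<Sum>h\<in>F. 1 / (r_weight_prod \<alpha> h)\<^sup>2) \<le> (1 + pi\<^sup>2 / 3) ^ CARD('d)" by simp
  qed
qed simp

lemma good_lattice_rule_finite:
  fixes z :: "int^'d::finite"
  assumes good: "good_lattice_rule \<alpha> c z n" and al: "\<alpha> \<ge> 1" and F: "F \<subseteq> dual_lattice z n - {0}" "finite F"
  shows "(\<Sum>h\<in>F. 1 / (r_weight_prod \<alpha> h)\<^sup>2) \<le> (c * ln (real n) ^ (\<alpha> * CARD('d)) / real n ^ \<alpha>)\<^sup>2"
proof -
  let ?S = "\<Sum>\<^sub>\<infinity>h\<in>dual_lattice z n - {0}. 1 / (r_weight_prod \<alpha> h)\<^sup>2"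
  have "(\<Sum>h\<in>F. 1 / (r_weight_prod \<alpha> h)\<^sup>2) \<le> ?S"
    by (intro finite_sum_le_infsum r_weight_prod_summable al F) auto
  also have "?S = (sqrt ?S)\<^sup>2" by (subst real_sqrt_pow2) (auto intro: infsum_nonneg)
  also have "\<dots> \<le> (c * ln (real n) ^ (\<alpha> * CARD('d)) / real n ^ \<alpha>)\<^sup>2"
    using good unfolding good_lattice_rule_def by (intro power_mono) (auto intro: infsum_nonneg)
  finally show ?thesis .
qed

lemma cis_2pi_int: "cis (2 * pi * of_int k) = 1"
  by (simp add: complex_eq_iff cos_int_2pin sin_int_2pin)

text \<open>A root of unity different from 1 has vanishing power sum over a full cycle. At the
  lattice nodes this is the filter that retains exactly the frequencies of the dual lattice.\<close>

lemma character_sum: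
  fixes k :: int
  assumes n: "n > 0"
  shows "(\<Sum>i=1..n. cis (2 * pi * real i * of_int k / real n)) = (if int n dvd k then of_nat n else 0)"
proof (cases "int n dvd k")
  case True
  then obtain m where k: "k = int n * m" by auto
  have "cis (2 * pi * real i * of_int k / real n) = 1" for i
    using cis_2pi_int[of "int i * m"] n by (simp add: k mult_ac)
  then show ?thesis using True by simp
next
  case False
  define \<zeta> where "\<zeta> = cis (2 * pi * of_int k / real n)"
  have pw: "cis (2 * pi * real i * of_int k / real n) = \<zeta> ^ i" for i
  proof -
    have "2 * pi * real i * of_int k / real n = real i * (2 * pi * of_int k / real n)" by simp
    then show ?thesis by (simp only: \<zeta>_def Complex.DeMoivre)
  qed
  have zn: "\<zeta> ^ n = 1"
  proof -
    have "2 * pi * real n * of_int k / real n = 2 * pi * of_int k" using n by simp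
    then show ?thesis using pw[of n] cis_2pi_int[of k] by (simp only:)
  qed
  have z1: "\<zeta> \<noteq> 1"
  proof
    assume "\<zeta> = 1"
    then have "cos (2 * pi * of_int k / real n) = 1" by (simp add: \<zeta>_def complex_eq_iff)
    then obtain m :: int where "2 * pi * of_int k / real n = of_int m * 2 * pi"
      by (auto simp: cos_one_2pi_int)
    then have "pi * of_int k = pi * (real n * of_int m)" using n by (simp add: field_simps)
    then have "real_of_int k = real_of_int (int n * m)" by simp
    then have "k = int n * m" using of_int_eq_iff by blast
    then show False using False by simp
  qed
  have "(\<Sum>i=1..n. cis (2 * pi * real i * of_int k / real n)) = (\<Sum>i<n. \<zeta> ^ Suc i)"
    unfolding pw by (rule sum.reindex_bij_witness[of _ Suc "\<lambda>n. n - 1"]) auto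
  also have "\<dots> = \<zeta> * (\<Sum>i<n. \<zeta> ^ i)" by (simp add: sum_distrib_left)
  also have "\<dots> = 0" using z1 zn by (simp add: geometric_sum)
  finally show ?thesis using False by simp
qed

section \<open>Bessel's inequality\<close>

lemma integrable_indicator_Icc: "integrable lborel (indicator {l..r::real} :: real \<Rightarrow> real)"
  by (rule integrable_real_indicator) (auto intro: emeasure_bounded_finite simp flip: infinity_ennreal_def)

text \<open>The interval consists of three full periods 2 a, so the characters remain orthogonal on
  the enlarged interval that supports the cut-off functions.\<close>

lemma cis_interval_integral:
  fixes m :: int
  assumes a: "a > 0"
  shows "(LINT t|lborel. of_real (indicator {-3 * a..3 * a} t) * cis (pi * of_int m / a * t)) = (if m = 0 then of_real (6 * a) else 0)"
proof -
  have i: "integrable lborel (indicator {-3 * a..3 * a} :: real \<Rightarrow> real)" by (rule integrable_indicator_Icc)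
  have f: "(LINT t|lborel. of_real (indicator {-3 * a..3 * a} t) * cis (pi * of_int m / a * t)) = fhat a (indicator {-3 * a..3 * a}) (- m)"
    by (simp add: fhat_def)
  show ?thesis
  proof (cases "m = 0")
    case True
    then show ?thesis unfolding f fhat_eq[OF i] using a by (simp add: complex_eq_iff)
  next
    case False
    define \<theta> where "\<theta> = pi * of_int m / a"
    have t: "\<theta> \<noteq> 0" using False a by (simp add: \<theta>_def)
    have s: "sin (3 * (a * \<theta>)) = 0"
    proof -
      have "3 * (a * \<theta>) = of_int (3 * m) * pi" using a by (simp add: \<theta>_def)
      then show ?thesis using sin_zero_iff_int2 by blast
    qed
    have 1: "(LINT t|lborel. cos (\<theta> * t) * indicator {-3 * a..3 * a} t) = sin (\<theta> * (3 * a)) / \<theta> - sin (\<theta> * (-3 * a)) / \<theta>"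
      by (rule integral_FTC_Icc_real) (use a t in \<open>auto intro!: derivative_eq_intros\<close>)
    have 2: "(LINT t|lborel. sin (\<theta> * t) * indicator {-3 * a..3 * a} t) = - cos (\<theta> * (3 * a)) / \<theta> - - cos (\<theta> * (-3 * a)) / \<theta>"
      by (rule integral_FTC_Icc_real) (use a t in \<open>auto intro!: derivative_eq_intros\<close>)
    have "(LINT t|lborel. indicator {-3 * a..3 * a} t * cos (\<theta> * t)) = 0" using 1 s by (simp add: mult_ac)
    moreover have "(LINT t|lborel. indicator {-3 * a..3 * a} t * sin (\<theta> * t)) = 0" using 2 by (simp add: mult_ac)
    ultimately show ?thesis unfolding f fhat_eq[OF i] using False by (simp add: \<theta>_def complex_eq_iff)
  qed
qed

definition char_vec :: "real \<Rightarrow> int^'d::finite \<Rightarrow> real^'d \<Rightarrow> complex" where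
  "char_vec a h x = (\<Prod>j\<in>UNIV. cis (pi * of_int (h $ j) / a * x $ j))"

lemma cnj_char_vec: "cnj (char_vec a h x) = char_vec a (- h) x"
  by (simp add: char_vec_def cis_cnj)

lemma norm_char_vec: "norm (char_vec a h x) = 1"
  by (simp add: char_vec_def prod_norm[symmetric])

lemma char_vec_mult: "char_vec a h x * char_vec a k x = char_vec a (h + k) x"
  by (simp add: char_vec_def prod.distrib[symmetric] cis_mult algebra_simps add_divide_distrib)

lemma char_vec_measurable [measurable]: "char_vec a h \<in> borel_measurable borel"
  unfolding char_vec_def[abs_def] by (intro borel_measurable_continuous_onI continuous_intros)

abbreviation "lo a \<equiv> (\<chi> j. -3 * a)"
abbreviation "hi a \<equiv> (\<chi> j. 3 * a)"

lemma indicator_cbox_prod: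
  fixes a b x :: "real^'d::finite"
  shows
  "indicator (cbox a b) x = (\<Prod>j\<in>UNIV. indicator {a $ j..b $ j} (x $ j) :: real)"
proof (cases "x \<in> cbox a b")
  case True
  then have "x $ j \<in> {a $ j..b $ j}" for j by (simp add: mem_box_cart)
  then show ?thesis using True by simp
next
  case False
  then have "\<exists>j. x $ j \<notin> {a $ j..b $ j}" by (simp add: mem_box_cart)
  then have "(\<Prod>j\<in>UNIV. indicator {a $ j..b $ j} (x $ j) :: real) = 0"
    by (intro prod_zero) (auto simp: indicator_def)
  then show ?thesis using False by simp
qed

lemma char_vec_orthogonal:
  fixes h k :: "int^'d::finite"
  assumes a: "a > 0"
  shows "(LINT x|lborel. of_real (indicator (cbox (lo a) (hi a)) x) * (char_vec a h x * cnj (char_vec a k x))) =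
     (if h = k then of_real ((6 * a) ^ CARD('d)) else 0)"
proof -
  have i: "integrable lborel (\<lambda>t. of_real (indicator {-3 * a..3 * a} t) * cis (pi * of_int m / a * t))" for m :: int
    by (rule integrable_cis[OF integrable_indicator_Icc])
  have "(LINT x|lborel. of_real (indicator (cbox (lo a) (hi a)) x) * (char_vec a h x * cnj (char_vec a k x)))
    = (LINT x|lborel. (\<Prod>j\<in>UNIV. of_real (indicator {-3 * a..3 * a} (x $ j)) * cis (pi * of_int ((h - k) $ j) / a * x $ j)))"
    by (simp add: indicator_cbox_prod prod.distrib cnj_char_vec char_vec_mult) (simp add: char_vec_def)
  also have "\<dots> = (\<Prod>j\<in>UNIV. if (h - k) $ j = 0 then of_real (6 * a) else 0)"
    by (subst integral_prod_vec[OF i]) (simp only: cis_interval_integral[OF a])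
  also have "\<dots> = (if h = k then of_real ((6 * a) ^ CARD('d)) else 0)"
  proof (cases "h = k")
    case False
    then obtain j where "(h - k) $ j \<noteq> 0" by (auto simp: vec_eq_iff)
    then show ?thesis using False by (intro trans[OF prod_zero]) auto
  qed simp
  finally show ?thesis .
qed

text \<open>Expansion of the squared distance of V from its projection T on the given characters. V
  lives on the cube of side 6 a and not on one period; there the characters have squared norm (6
  a)^d, which is the origin of the volume factor.\<close>

lemma bessel:
  fixes V :: "real^'d::finite \<Rightarrow> real"
  assumes V: "box_L2 (lo a) (hi a) V" and a: "a > 0" and H: "finite H"
  shows "(\<Sum>h\<in>H. (cmod (LINT x|lborel. of_real (V x) * cnj (char_vec a h x)))\<^sup>2) \<le> (6 * a) ^ CARD('d) * (LINT x|lborel. (V x)\<^sup>2)"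
proof -
  interpret box_L2 "lo a" "hi a" V by (rule V)
  define F where "F h = (LINT x|lborel. of_real (V x) * cnj (char_vec a h x))" for h
  define v where "v = (6 * a) ^ CARD('d)"
  have v: "v > 0" using a by (simp add: v_def)
  define I where "I x = (indicator (cbox (lo a) (hi a)) x :: real)" for x :: "real^'d"
  have Im [measurable]: "I \<in> borel_measurable borel" unfolding I_def by measurable
  have Ii: "integrable lborel I" unfolding I_def[abs_def]
    by (intro integrable_real_indicator) (auto intro!: emeasure_bounded_finite simp flip: infinity_ennreal_def)
  define T where "T x = (\<Sum>h\<in>H. F h / of_real v * char_vec a h x)" for x
  have iV: "integrable lborel V" by (rule box_L2_integrable[OF V])
  have i1: "integrable lborel (\<lambda>x. of_real (V x) * char_vec a h x)" for h
    by (rule Bochner_Integration.integrable_bound[OF iV]) (auto simp: norm_mult norm_char_vec)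
  have i1': "integrable lborel (\<lambda>x. of_real (V x) * cnj (char_vec a h x))" for h
    unfolding cnj_char_vec by (rule i1)
  have i2: "integrable lborel (\<lambda>x. of_real (I x) * (char_vec a h x * cnj (char_vec a k x)))" for h k
    unfolding cnj_char_vec by (rule Bochner_Integration.integrable_bound[OF Ii]) (auto simp: norm_mult norm_char_vec)
  have F': "(LINT x|lborel. of_real (V x) * char_vec a h x) = cnj (F h)" for h
    unfolding F_def Bochner_Integration.integral_cnj[symmetric] by simp
  define S where "S = (\<Sum>h\<in>H. (cmod (F h))\<^sup>2)"
  have orth: "(LINT x|lborel. of_real (I x) * (char_vec a h x * cnj (char_vec a k x))) = (if h = k then of_real v else 0)" for h k
    using char_vec_orthogonal[OF a, of h k] unfolding I_def v_def .
  have csq: "F h * cnj (F h) = (of_real (cmod (F h)))\<^sup>2" for h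
    using complex_norm_square[of "F h"] by simp
  have e1: "(LINT x|lborel. of_real (V x) * T x) = of_real (S / v)" "integrable lborel (\<lambda>x. of_real (V x) * T x)"
  proof -
    have e: "of_real (V x) * T x = (\<Sum>h\<in>H. F h / of_real v * (of_real (V x) * char_vec a h x))" for x
      by (simp add: T_def sum_distrib_left mult_ac)
    show "integrable lborel (\<lambda>x. of_real (V x) * T x)" unfolding e using i1 by simp
    have "(LINT x|lborel. of_real (V x) * T x) = (\<Sum>h\<in>H. F h / of_real v * cnj (F h))"
      unfolding e using i1 by (subst Bochner_Integration.integral_sum) (auto simp: F')
    also have "\<dots> = of_real (S / v)"
      by (simp add: S_def sum_divide_distrib csq)
    finally show "(LINT x|lborel. of_real (V x) * T x) = of_real (S / v)" .
  qed
  have e2: "(LINT x|lborel. of_real (I x) * (T x * cnj (T x))) = of_real (S / v)" "integrable lborel (\<lambda>x. of_real (I x) * (T x * cnj (T x)))"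
  proof -
    have e: "of_real (I x) * (T x * cnj (T x)) = (\<Sum>h\<in>H. \<Sum>k\<in>H. F h / of_real v * cnj (F k) / of_real v * (of_real (I x) * (char_vec a h x * cnj (char_vec a k x))))" for x
    proof -
      have "T x * cnj (T x) = (\<Sum>h\<in>H. \<Sum>k\<in>H. (F h / of_real v * char_vec a h x) * cnj (F k / of_real v * char_vec a k x))"
        unfolding T_def cnj_sum by (rule sum_product)
      then show ?thesis by (simp only: sum_distrib_left) (intro sum.cong refl, simp add: mult_ac)
    qed
    show "integrable lborel (\<lambda>x. of_real (I x) * (T x * cnj (T x)))" unfolding e using i2 by simp
    have "(LINT x|lborel. of_real (I x) * (T x * cnj (T x))) = (\<Sum>h\<in>H. \<Sum>k\<in>H. F h / of_real v * cnj (F k) / of_real v * (if h = k then of_real v else 0))"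
      unfolding e using i2 by (subst Bochner_Integration.integral_sum, simp) (subst Bochner_Integration.integral_sum, auto simp: orth)
    also have "\<dots> = (\<Sum>h\<in>H. F h / of_real v * cnj (F h))"
    proof (intro sum.cong refl)
      fix h assume "h \<in> H"
      have "(\<Sum>k\<in>H. F h / of_real v * cnj (F k) / of_real v * (if h = k then of_real v else 0)) = (\<Sum>k\<in>H. if h = k then F h / of_real v * cnj (F h) else 0)"
        using v by (intro sum.cong refl) auto
      then show "(\<Sum>k\<in>H. F h / of_real v * cnj (F k) / of_real v * (if h = k then of_real v else 0)) = F h / of_real v * cnj (F h)"
        using H \<open>h \<in> H\<close> by simp
    qed
    also have "\<dots> = of_real (S / v)" by (simp add: S_def sum_divide_distrib csq)
    finally show "(LINT x|lborel. of_real (I x) * (T x * cnj (T x))) = of_real (S / v)" .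
  qed
  have e3: "(LINT x|lborel. of_real (V x) * cnj (T x)) = of_real (S / v)" "integrable lborel (\<lambda>x. of_real (V x) * cnj (T x))"
  proof -
    have e: "of_real (V x) * cnj (T x) = cnj (of_real (V x) * T x)" for x by simp
    show "(LINT x|lborel. of_real (V x) * cnj (T x)) = of_real (S / v)" unfolding e Bochner_Integration.integral_cnj e1(1) by simp
    show "integrable lborel (\<lambda>x. of_real (V x) * cnj (T x))" unfolding e using e1(2) by (simp only: integrable_cnj)
  qed
  have i4: "integrable lborel (\<lambda>x. of_real ((V x)\<^sup>2) :: complex)"
    by (rule integrable_bounded_linear[OF bounded_linear_of_real V_sq])
  have eq: "of_real (I x) * ((of_real (V x) - T x) * cnj (of_real (V x) - T x)) =
     of_real ((V x)\<^sup>2) - of_real (V x) * cnj (T x) - of_real (V x) * T x + of_real (I x) * (T x * cnj (T x))" for x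
    using V_supp[of x] by (cases "x \<in> cbox (lo a) (hi a)") (simp_all add: I_def algebra_simps power2_eq_square)
  have "(LINT x|lborel. of_real (I x) * ((of_real (V x) - T x) * cnj (of_real (V x) - T x))) = of_real ((LINT x|lborel. (V x)\<^sup>2) - S / v)"
  proof -
    have "(LINT x|lborel. (complex_of_real (V x))\<^sup>2) = of_real (LINT x|lborel. (V x)\<^sup>2)"
      unfolding of_real_power[symmetric] by (rule integral_complex_of_real)
    then show ?thesis unfolding eq using i4 e1 e2 e3 by simp
  qed
  moreover have "(LINT x|lborel. of_real (I x) * ((of_real (V x) - T x) * cnj (of_real (V x) - T x))) =
     of_real (LINT x|lborel. I x * (cmod (of_real (V x) - T x))\<^sup>2)"
    unfolding complex_norm_square[symmetric] of_real_mult[symmetric] by (rule integral_complex_of_real)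
  ultimately have "(LINT x|lborel. (V x)\<^sup>2) - S / v = (LINT x|lborel. I x * (cmod (of_real (V x) - T x))\<^sup>2)"
    by (simp only: of_real_eq_iff)
  also have "\<dots> \<ge> 0" by (intro Bochner_Integration.integral_nonneg) (auto simp: I_def)
  finally have "S / v \<le> (LINT x|lborel. (V x)\<^sup>2)" by simp
  then show ?thesis using v unfolding S_def F_def v_def by (simp add: field_simps)
qed

section \<open>Cubature of cut-off tensors\<close>

lemma prod_cis: "(\<Prod>j\<in>A. cis (f j)) = cis (\<Sum>j\<in>A. f j)"
  by (induction A rule: infinite_finite_induct) (auto simp: cis_mult)


text \<open>Three translates per variable suffice when |x_j| \<le> a: any further one has absolute
  value at least 3 a in some coordinate, where the cutoff vanishes.\<close>

definition period_sum :: "real \<Rightarrow> (real^'d::finite \<Rightarrow> real) \<Rightarrow> real^'d \<Rightarrow> real" where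
  "period_sum a G x = (\<Sum>k | \<forall>j. k $ j \<in> {-1..1::int}. G (\<chi> j. x $ j + 2 * a * of_int (k $ j)))"

text \<open>The character h at the corner (-a, ..., -a) of the cube, where the scaled lattice
  starts. Its modulus is 1, so it does not affect the error bounds.\<close>

definition char_sign :: "int^'d::finite \<Rightarrow> complex" where
  "char_sign h = (\<Prod>j\<in>UNIV. cis (- (pi * of_int (h $ j))))"

lemma norm_char_sign: "cmod (char_sign h) = 1"
  by (simp add: char_sign_def prod_norm[symmetric])

locale cut_tensor = tensor_chain "lo a" "hi a" "6 * a" \<alpha> m D
  for a :: real and \<alpha> m :: nat and D :: "nat \<Rightarrow> 'd::finite \<Rightarrow> nat \<Rightarrow> real \<Rightarrow> real"
begin

lemma a0: "a > 0" using l1 by simp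

lemma chain': "i < m \<Longrightarrow> sobolev_chain \<alpha> (-3 * a) (3 * a) (D i j)"
  using chain[of i j] unfolding vec_lambda_beta .

abbreviation "C \<equiv> (\<lambda>i j. cut a (D i j))"

definition Vhat :: "('d \<Rightarrow> nat) \<Rightarrow> int^'d \<Rightarrow> complex" where
  "Vhat \<tau> h = (\<Sum>i<m. \<Prod>j\<in>UNIV. fhat a (C i j (\<tau> j)) (h $ j))"

lemma box_L2_C:
  assumes "\<And>j. \<tau> j \<le> \<alpha>"
  shows "box_L2 (lo a) (hi a) (tens m C \<tau>)"
proof (rule box_L2_tens)
  show "(lo a :: real^'d) $ j \<le> hi a $ j" for j using a0 by simp
  show "L2_on ((lo a :: real^'d) $ j) (hi a $ j) (C i j (\<tau> j))" if "i < m" for i j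
    unfolding vec_lambda_beta by (rule cut_L2[OF chain'[OF that] a0 assms])
qed

lemma Vhat_integral:
  assumes "\<And>j. \<tau> j \<le> \<alpha>"
  shows "Vhat \<tau> h = (LINT x|lborel. of_real (tens m C \<tau> x) * cnj (char_vec a h x))"
proof -
  let ?f = "\<lambda>i j t. of_real (C i j (\<tau> j) t) * cis (- (pi * of_int (h $ j) / a * t))"
  have i: "integrable lborel (?f i j)" if "i < m" for i j
    using integrable_cis[OF L2_on_integrable[OF cut_L2[OF chain'[OF that] a0 assms]], where c = "- (pi * of_int (h $ j) / a)"] by simp
  have e: "of_real (tens m C \<tau> x) * cnj (char_vec a h x) = (\<Sum>i<m. \<Prod>j\<in>UNIV. ?f i j (x $ j))" for x
    by (simp add: tens_def char_vec_def sum_distrib_right prod.distrib cis_cnj)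
  have "(LINT x|lborel. of_real (tens m C \<tau> x) * cnj (char_vec a h x)) = (\<Sum>i<m. LINT x|lborel. (\<Prod>j\<in>UNIV. ?f i j (x $ j)))"
    unfolding e by (rule Bochner_Integration.integral_sum) (rule integrable_prod_vec, use i in auto)
  also have "\<dots> = Vhat \<tau> h"
    unfolding Vhat_def fhat_def
  proof (rule sum.cong[OF refl])
    fix i assume "i \<in> {..<m}"
    then show "(LINT x|lborel. (\<Prod>j\<in>UNIV. ?f i j (x $ j))) = (\<Prod>j\<in>UNIV. LINT t|lborel. ?f i j t)"
      by (intro integral_prod_vec i) auto
  qed
  finally show ?thesis ..
qed

text \<open>Differentiating \<alpha> times exactly in the variables with nonzero frequency
  reproduces the weight, because the convention r_\<alpha>(0) = 1 corresponds to no derivative at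
  all.\<close>

lemma Vhat_support:
  "cmod (Vhat (\<lambda>j. if h $ j \<noteq> 0 then \<alpha> else 0) h) = r_weight_prod \<alpha> h * cmod (Vhat (\<lambda>_. 0) h)"
proof -
  define \<rho> where "\<rho> j = (if h $ j \<noteq> 0 then (2 * of_real pi * \<i> * of_int (h $ j)) ^ \<alpha> else 1)" for j
  have "fhat a (C i j (if h $ j \<noteq> 0 then \<alpha> else 0)) (h $ j) = \<rho> j * fhat a (C i j 0) (h $ j)" if "i < m" for i j
    using fhat_cut[OF chain'[OF that, of j] a0, of \<alpha> "h $ j"] by (simp add: \<rho>_def)
  then have "Vhat (\<lambda>j. if h $ j \<noteq> 0 then \<alpha> else 0) h = (\<Prod>j\<in>UNIV. \<rho> j) * Vhat (\<lambda>_. 0) h"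
    unfolding Vhat_def by (simp add: prod.distrib sum_distrib_left)
  moreover have "cmod (\<rho> j) = r_weight \<alpha> (h $ j)" for j
    by (simp add: \<rho>_def r_weight_def norm_power norm_mult abs_mult)
  ultimately show ?thesis by (simp add: norm_mult prod_norm[symmetric] r_weight_prod_def)
qed

text \<open>The order that reproduces the weight depends on h only through the set of its nonzero
  coordinates. Adding Bessel's inequality over all 2^d sets covers every frequency.\<close>

lemma weighted_coefficients:
  assumes B: "\<And>\<tau>. (\<And>j. \<tau> j \<le> \<alpha>) \<Longrightarrow> (LINT x|lborel. (tens m C \<tau> x)\<^sup>2) \<le> B"
  shows "(\<Sum>h\<in>cube N. (r_weight_prod \<alpha> h)\<^sup>2 * (cmod (Vhat (\<lambda>_. 0) h))\<^sup>2) \<le> 2 ^ CARD('d) * ((6 * a) ^ CARD('d) * B)"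
proof -
  define T where "T w j = (if j \<in> w then \<alpha> else 0)" for w :: "'d set" and j
  have T: "T w j \<le> \<alpha>" for w j by (simp add: T_def)
  have "(\<Sum>h\<in>cube N. (r_weight_prod \<alpha> h)\<^sup>2 * (cmod (Vhat (\<lambda>_. 0) h))\<^sup>2) \<le> (\<Sum>h\<in>cube N. \<Sum>w\<in>UNIV. (cmod (Vhat (T w) h))\<^sup>2)"
  proof (rule sum_mono)
    fix h :: "int^'d"
    have "(\<lambda>j. if h $ j \<noteq> 0 then \<alpha> else 0) = T {j. h $ j \<noteq> 0}" by (auto simp: T_def)
    then have "(r_weight_prod \<alpha> h)\<^sup>2 * (cmod (Vhat (\<lambda>_. 0) h))\<^sup>2 = (cmod (Vhat (T {j. h $ j \<noteq> 0}) h))\<^sup>2"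
      using Vhat_support[of h] by (simp add: power_mult_distrib)
    also have "\<dots> \<le> (\<Sum>w\<in>UNIV. (cmod (Vhat (T w) h))\<^sup>2)"
      by (rule member_le_sum[of "{j. h $ j \<noteq> 0}" UNIV "\<lambda>w. (cmod (Vhat (T w) h))\<^sup>2"]) auto
    finally show "(r_weight_prod \<alpha> h)\<^sup>2 * (cmod (Vhat (\<lambda>_. 0) h))\<^sup>2 \<le> (\<Sum>w\<in>UNIV. (cmod (Vhat (T w) h))\<^sup>2)" .
  qed
  also have "\<dots> = (\<Sum>w\<in>UNIV. \<Sum>h\<in>cube N. (cmod (Vhat (T w) h))\<^sup>2)" by (rule sum.swap)
  also have "\<dots> \<le> (\<Sum>w\<in>(UNIV :: 'd set set). (6 * a) ^ CARD('d) * B)"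
  proof (rule sum_mono)
    fix w
    have "(\<Sum>h\<in>cube N. (cmod (Vhat (T w) h))\<^sup>2) \<le> (6 * a) ^ CARD('d) * (LINT x|lborel. (tens m C (T w) x)\<^sup>2)"
      unfolding Vhat_integral[of "T w", OF T] by (rule bessel[OF box_L2_C a0 finite_cube]) (rule T)
    also have "\<dots> \<le> (6 * a) ^ CARD('d) * B"
      using a0 by (intro mult_left_mono B T) auto
    finally show "(\<Sum>h\<in>cube N. (cmod (Vhat (T w) h))\<^sup>2) \<le> (6 * a) ^ CARD('d) * B" .
  qed
  also have "\<dots> = 2 ^ CARD('d) * ((6 * a) ^ CARD('d) * B)"
    by (simp add: card_Pow[of "UNIV :: 'd set", unfolded Pow_UNIV])
  finally show ?thesis .
qed

text \<open>Leibniz's rule writes the cut derivative as a sum of at most (\<alpha> + 1)^d uncut ones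
  with factors (2 a)^|\<kappa>|, which the weights kept in the Poincare inequality absorb. The count
  appears squared: once from Cauchy and Schwarz for the sum, once from adding up the terms.\<close>

lemma tens_cut_bound:
  assumes M: "\<And>k i t. k \<le> \<alpha> \<Longrightarrow> i \<le> k \<Longrightarrow> \<bar>real (k choose i) * eta (k - i) t\<bar> \<le> M"
    and X: "\<And>\<kappa>. (\<And>j. \<kappa> j \<le> \<alpha>) \<Longrightarrow> (6 * a) ^ (2 * (\<Sum>j\<in>UNIV. \<kappa> j)) * (LINT x|lborel. (tens m D \<kappa> x)\<^sup>2) \<le> X"
    and \<tau>: "\<And>j. \<tau> j \<le> \<alpha>"
  shows "(LINT x|lborel. (tens m C \<tau> x)\<^sup>2) \<le> (real ((\<alpha> + 1) ^ CARD('d)))\<^sup>2 * (M ^ (2 * CARD('d)) * X)"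
proof -
  define K where "K = PiE UNIV (\<lambda>j. {..\<tau> j})"
  have K: "finite K" by (simp add: K_def finite_PiE)
  have "card K = (\<Prod>j\<in>UNIV. Suc (\<tau> j))" by (simp add: K_def card_PiE)
  also have "\<dots> \<le> (\<Prod>j\<in>(UNIV :: 'd set). \<alpha> + 1)" using \<tau> by (intro prod_mono) auto
  finally have cK: "card K \<le> (\<alpha> + 1) ^ CARD('d)" by simp
  define c where "c \<kappa> x = (\<Prod>j\<in>UNIV. real (\<tau> j choose \<kappa> j) * eta (\<tau> j - \<kappa> j) (x $ j / (2 * a)) * (2 * a) ^ \<kappa> j)" for \<kappa> and x :: "real^'d"
  have M0: "M \<ge> 0" using M[of 0 0 0] by simp
  have c: "(c \<kappa> x)\<^sup>2 \<le> M ^ (2 * CARD('d)) * (6 * a) ^ (2 * (\<Sum>j\<in>UNIV. \<kappa> j))" if k: "\<kappa> \<in> K" for \<kappa> x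
  proof -
    have "\<bar>c \<kappa> x\<bar> = (\<Prod>j\<in>UNIV. \<bar>real (\<tau> j choose \<kappa> j) * eta (\<tau> j - \<kappa> j) (x $ j / (2 * a))\<bar> * (2 * a) ^ \<kappa> j)"
      unfolding c_def using a0 by (simp add: abs_prod abs_mult)
    also have "\<dots> \<le> (\<Prod>j\<in>UNIV. M * (6 * a) ^ \<kappa> j)"
      using k \<tau> a0 M0 by (intro prod_mono conjI mult_mono M power_mono) (auto simp: K_def PiE_iff)
    also have "\<dots> = M ^ CARD('d) * (6 * a) ^ (\<Sum>j\<in>UNIV. \<kappa> j)" by (simp add: prod.distrib power_sum)
    finally have "\<bar>c \<kappa> x\<bar>\<^sup>2 \<le> (M ^ CARD('d) * (6 * a) ^ (\<Sum>j\<in>UNIV. \<kappa> j))\<^sup>2" by (intro power_mono) auto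
    then show ?thesis by (simp add: power_mult_distrib power_mult[symmetric] mult.commute)
  qed
  have e: "tens m C \<tau> x = (\<Sum>\<kappa>\<in>K. c \<kappa> x * tens m D \<kappa> x)" for x
  proof -
    have "tens m C \<tau> x = (\<Sum>i<m. \<Prod>j\<in>UNIV. \<Sum>k\<in>{..\<tau> j}. (real (\<tau> j choose k) * eta (\<tau> j - k) (x $ j / (2 * a)) * (2 * a) ^ k) * D i j k (x $ j))"
      by (simp add: tens_def cut_def mult.assoc)
    also have "\<dots> = (\<Sum>i<m. \<Sum>\<kappa>\<in>K. c \<kappa> x * (\<Prod>j\<in>UNIV. D i j (\<kappa> j) (x $ j)))"
      unfolding K_def c_def by (subst prod_sum_PiE) (auto simp: prod.distrib)
    also have "\<dots> = (\<Sum>\<kappa>\<in>K. \<Sum>i<m. c \<kappa> x * (\<Prod>j\<in>UNIV. D i j (\<kappa> j) (x $ j)))" by (rule sum.swap)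
    finally show ?thesis by (simp add: tens_def sum_distrib_left)
  qed
  have D2: "integrable lborel (\<lambda>x. (tens m D \<kappa> x)\<^sup>2)" if "\<kappa> \<in> K" for \<kappa>
  proof -
    have "\<kappa> j \<le> \<alpha>" for j using that \<tau>[of j] by (auto simp: K_def PiE_iff intro: order_trans)
    then have "box_L2 (lo a) (hi a) (tens m D \<kappa>)"
      by (intro box_L2_tens ab) (use chain in \<open>auto simp: sobolev_chain_def\<close>)
    then show ?thesis by (rule box_L2.V_sq)
  qed
  have "(LINT x|lborel. (tens m C \<tau> x)\<^sup>2) \<le> (LINT x|lborel. (\<Sum>\<kappa>\<in>K. real (card K) * (M ^ (2 * CARD('d)) * (6 * a) ^ (2 * (\<Sum>j\<in>UNIV. \<kappa> j))) * (tens m D \<kappa> x)\<^sup>2))"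
  proof (rule integral_mono)
    show "integrable lborel (\<lambda>x. (tens m C \<tau> x)\<^sup>2)" using box_L2.V_sq[OF box_L2_C] \<tau> by blast
    show "integrable lborel (\<lambda>x. \<Sum>\<kappa>\<in>K. real (card K) * (M ^ (2 * CARD('d)) * (6 * a) ^ (2 * (\<Sum>j\<in>UNIV. \<kappa> j))) * (tens m D \<kappa> x)\<^sup>2)"
      using D2 by auto
    fix x
    have "(tens m C \<tau> x)\<^sup>2 \<le> (\<Sum>\<kappa>\<in>K. (c \<kappa> x * tens m D \<kappa> x)\<^sup>2) * card K"
      unfolding e by (rule sum_squared_le_sum_of_squares)
    also have "\<dots> \<le> (\<Sum>\<kappa>\<in>K. (M ^ (2 * CARD('d)) * (6 * a) ^ (2 * (\<Sum>j\<in>UNIV. \<kappa> j))) * (tens m D \<kappa> x)\<^sup>2) * card K"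
    proof (intro mult_right_mono sum_mono)
      fix \<kappa> assume "\<kappa> \<in> K"
      then show "(c \<kappa> x * tens m D \<kappa> x)\<^sup>2 \<le> (M ^ (2 * CARD('d)) * (6 * a) ^ (2 * (\<Sum>j\<in>UNIV. \<kappa> j))) * (tens m D \<kappa> x)\<^sup>2"
        unfolding power_mult_distrib[of "c \<kappa> x"] by (intro mult_right_mono c) auto
    qed simp
    finally show "(tens m C \<tau> x)\<^sup>2 \<le> (\<Sum>\<kappa>\<in>K. real (card K) * (M ^ (2 * CARD('d)) * (6 * a) ^ (2 * (\<Sum>j\<in>UNIV. \<kappa> j))) * (tens m D \<kappa> x)\<^sup>2)"
      by (simp only: sum_distrib_left mult_ac)
  qed
  also have "\<dots> = (\<Sum>\<kappa>\<in>K. (real (card K) * M ^ (2 * CARD('d))) * ((6 * a) ^ (2 * (\<Sum>j\<in>UNIV. \<kappa> j)) * (LINT x|lborel. (tens m D \<kappa> x)\<^sup>2)))"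
    using D2 by (subst Bochner_Integration.integral_sum) (auto simp: mult.assoc)
  also have "\<dots> \<le> (\<Sum>\<kappa>\<in>K. (real (card K) * M ^ (2 * CARD('d))) * X)"
  proof (intro sum_mono mult_left_mono X)
    fix \<kappa> j assume "\<kappa> \<in> K"
    then show "\<kappa> j \<le> \<alpha>" using \<tau>[of j] by (auto simp: K_def PiE_iff intro: order_trans)
  qed (use M0 in auto)
  also have "\<dots> = (real (card K))\<^sup>2 * (M ^ (2 * CARD('d)) * X)" by (simp add: power2_eq_square)
  also have "\<dots> \<le> (real ((\<alpha> + 1) ^ CARD('d)))\<^sup>2 * (M ^ (2 * CARD('d)) * X)"
  proof (intro mult_right_mono power_mono)
    show "real (card K) \<le> real ((\<alpha> + 1) ^ CARD('d))" using cK by (simp only: of_nat_le_iff)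
    have "0 \<le> (6 * a) ^ (2 * (\<Sum>j\<in>UNIV. (\<lambda>_::'d. 0::nat) j)) * (LINT x|lborel. (tens m D (\<lambda>_. 0) x)\<^sup>2)" by simp
    also have "\<dots> \<le> X" by (rule X) simp
    finally show "0 \<le> M ^ (2 * CARD('d)) * X" using M0 by simp
  qed simp
  finally show ?thesis .
qed

text \<open>A product of symmetric one-dimensional partial sums is a sum over a cube of frequencies,
  so convergence along cubes reduces to one dimension.\<close>

lemma fourier_series:
  assumes x: "\<And>j. \<bar>x $ j\<bar> \<le> a"
  shows "(\<lambda>N. of_real ((1 / (2 * a)) ^ CARD('d)) * (\<Sum>h\<in>cube N. Vhat (\<lambda>_. 0) h * char_vec a h x))
    \<longlonglongrightarrow> of_real (period_sum a (tens m C (\<lambda>_. 0)) x)"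
proof -
  have lim: "(\<lambda>N. \<Sum>i<m. \<Prod>j\<in>UNIV. of_real (1 / (2 * a)) * (\<Sum>h\<in>{- int N..int N}. fhat a (C i j 0) h * cis (pi * of_int h / a * x $ j)))
    \<longlonglongrightarrow> (\<Sum>i<m. \<Prod>j\<in>UNIV. of_real (\<Sum>k\<in>{-1..1::int}. C i j 0 (x $ j + 2 * a * of_int k)))"
  proof (intro tendsto_sum tendsto_prod)
    fix i j assume "i \<in> {..<m}"
    then show "(\<lambda>N. of_real (1 / (2 * a)) * (\<Sum>h\<in>{- int N..int N}. fhat a (C i j 0) h * cis (pi * of_int h / a * x $ j)))
      \<longlonglongrightarrow> of_real (\<Sum>k\<in>{-1..1::int}. C i j 0 (x $ j + 2 * a * of_int k))"
      using al by (intro fourier_1d[OF cut_weak_pair[OF chain' a0] a0] cut_ends a0 x) auto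
  qed
  have l: "(\<Sum>i<m. \<Prod>j\<in>UNIV. of_real (1 / (2 * a)) * (\<Sum>h\<in>{- int N..int N}. fhat a (C i j 0) h * cis (pi * of_int h / a * x $ j)))
     = of_real ((1 / (2 * a)) ^ CARD('d)) * (\<Sum>h\<in>cube N. Vhat (\<lambda>_. 0) h * char_vec a h x)" for N
  proof -
    have "(\<Prod>j\<in>UNIV. \<Sum>h\<in>{- int N..int N}. fhat a (C i j 0) h * cis (pi * of_int h / a * x $ j))
      = (\<Sum>h\<in>cube N. (\<Prod>j\<in>UNIV. fhat a (C i j 0) (h $ j)) * char_vec a h x)" for i
      by (subst prod_sum_vec) (auto simp: cube_def char_vec_def prod.distrib)
    then have "(\<Sum>i<m. \<Prod>j\<in>UNIV. of_real (1 / (2 * a)) * (\<Sum>h\<in>{- int N..int N}. fhat a (C i j 0) h * cis (pi * of_int h / a * x $ j)))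
      = of_real ((1 / (2 * a)) ^ CARD('d)) * (\<Sum>i<m. \<Sum>h\<in>cube N. (\<Prod>j\<in>UNIV. fhat a (C i j 0) (h $ j)) * char_vec a h x)"
      by (simp only: prod.distrib prod_constant sum_distrib_left[symmetric] of_real_power)
    also have "(\<Sum>i<m. \<Sum>h\<in>cube N. (\<Prod>j\<in>UNIV. fhat a (C i j 0) (h $ j)) * char_vec a h x) = (\<Sum>h\<in>cube N. Vhat (\<lambda>_. 0) h * char_vec a h x)"
      unfolding Vhat_def sum_distrib_right by (rule sum.swap)
    finally show ?thesis .
  qed
  have "(\<Sum>i<m. \<Prod>j\<in>UNIV. (\<Sum>k\<in>{-1..1::int}. C i j 0 (x $ j + 2 * a * of_int k))) = period_sum a (tens m C (\<lambda>_. 0)) x"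
    unfolding period_sum_def tens_def by (subst prod_sum_vec) (auto intro: sum.swap)
  then have r: "(\<Sum>i<m. \<Prod>j\<in>UNIV. complex_of_real (\<Sum>k\<in>{-1..1::int}. C i j 0 (x $ j + 2 * a * of_int k))) = of_real (period_sum a (tens m C (\<lambda>_. 0)) x)"
    by (simp only: of_real_prod[symmetric] of_real_sum[symmetric])
  show ?thesis using lim unfolding l r .
qed

text \<open>The character has period 2 a, so the integer part removed by \<open>frac\<close> changes
  its argument by a multiple of 2 pi; the shift of the nodes by -a gives the sign.\<close>

lemma char_vec_node:
  fixes z :: "int^'d"
  assumes n: "n > 0"
  shows "char_vec a h (scaled_node z n (\<chi> j. - a) (\<chi> j. a) i) =
    char_sign h * cis (2 * pi * real i * of_int (\<Sum>j\<in>UNIV. h $ j * z $ j) / real n)"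
proof -
  have "cis (pi * of_int (h $ j) / a * (scaled_node z n (\<chi> j. - a) (\<chi> j. a) i $ j)) =
     cis (- (pi * of_int (h $ j))) * cis (2 * pi * real i / real n * of_int (h $ j * z $ j))" for j
  proof -
    define t where "t = real i * of_int (z $ j) / real n"
    have "pi * of_int (h $ j) / a * (scaled_node z n (\<chi> j. - a) (\<chi> j. a) i $ j) = pi * of_int (h $ j) * (2 * frac t - 1)"
      using a0 by (simp add: scaled_node_def t_def field_simps)
    also have "\<dots> = - (pi * of_int (h $ j)) + (2 * pi * of_int (h $ j) * t + 2 * pi * of_int (- (h $ j * \<lfloor>t\<rfloor>)))"
      by (simp add: frac_def algebra_simps)
    finally have "cis (pi * of_int (h $ j) / a * (scaled_node z n (\<chi> j. - a) (\<chi> j. a) i $ j)) =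
      cis (- (pi * of_int (h $ j))) * (cis (2 * pi * of_int (h $ j) * t) * cis (2 * pi * of_int (- (h $ j * \<lfloor>t\<rfloor>))))"
      by (simp only: cis_mult)
    also have "2 * pi * of_int (h $ j) * t = 2 * pi * real i / real n * of_int (h $ j * z $ j)"
      by (simp add: t_def)
    finally show ?thesis by (simp only: cis_2pi_int mult_1_right)
  qed
  then have "char_vec a h (scaled_node z n (\<chi> j. - a) (\<chi> j. a) i) =
    char_sign h * (\<Prod>j\<in>UNIV. cis (2 * pi * real i / real n * of_int (h $ j * z $ j)))"
    by (simp only: char_vec_def char_sign_def prod.distrib)
  also have "(\<Prod>j\<in>UNIV. cis (2 * pi * real i / real n * of_int (h $ j * z $ j))) = cis (\<Sum>j\<in>UNIV. 2 * pi * real i / real n * of_int (h $ j * z $ j))"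
    by (rule prod_cis)
  also have "(\<Sum>j\<in>UNIV. 2 * pi * real i / real n * of_int (h $ j * z $ j)) = 2 * pi * real i * of_int (\<Sum>j\<in>UNIV. h $ j * z $ j) / real n"
    by (simp add: sum_distrib_left sum_divide_distrib)
  finally show ?thesis .
qed

lemma node_bounds: "\<bar>scaled_node z n (\<chi> j. - a) (\<chi> j. a) i $ j\<bar> \<le> a"
proof -
  have "0 \<le> 2 * a * frac (real i * of_int (z $ j) / real n)" "2 * a * frac (real i * of_int (z $ j) / real n) \<le> 2 * a * 1"
    using a0 frac_ge_0 frac_lt_1 less_imp_le by (auto intro!: mult_nonneg_nonneg mult_left_mono)
  then show ?thesis by (simp add: scaled_node_def abs_le_iff)
qed

text \<open>The Fourier series is known to converge along cubes only. The estimate for the nonzero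
  frequencies is therefore proved for each finite cube with a bound independent of N and then passed
  to the limit.\<close>

theorem cubature_tensor:
  fixes z :: "int^'d"
  assumes n: "n > 0" and good: "good_lattice_rule \<alpha> c z n"
    and M: "\<And>k i t. k \<le> \<alpha> \<Longrightarrow> i \<le> k \<Longrightarrow> \<bar>real (k choose i) * eta (k - i) t\<bar> \<le> M"
    and X: "\<And>\<kappa>. (\<And>j. \<kappa> j \<le> \<alpha>) \<Longrightarrow> (6 * a) ^ (2 * (\<Sum>j\<in>UNIV. \<kappa> j)) * (LINT x|lborel. (tens m D \<kappa> x)\<^sup>2) \<le> X"
  shows "((2 * a) ^ CARD('d) / real n * (\<Sum>i=1..n. period_sum a (tens m C (\<lambda>_. 0)) (scaled_node z n (\<chi> j. - a) (\<chi> j. a) i))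
      - (LINT x|lborel. tens m C (\<lambda>_. 0) x))\<^sup>2
    \<le> (c * ln (real n) ^ (\<alpha> * CARD('d)) / real n ^ \<alpha>)\<^sup>2 *
       (2 ^ CARD('d) * ((6 * a) ^ CARD('d) * ((real ((\<alpha> + 1) ^ CARD('d)))\<^sup>2 * (M ^ (2 * CARD('d)) * X))))"
    (is "(?Q - ?I)\<^sup>2 \<le> ?K * ?W")
proof -
  let ?V = "Vhat (\<lambda>_. 0)" and ?x = "scaled_node z n (\<chi> j. - a) (\<chi> j. a)"
  \<comment> \<open>What is left of the partial sum after averaging over the nodes: the dual
    frequencies in the cube, each with the sign of the corner.\<close>
  define S where "S N = (\<Sum>h\<in>cube N \<inter> dual_lattice z n. ?V h * char_sign h)" for N
  have SQ: "S \<longlonglongrightarrow> of_real ?Q"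
  proof -
    have "(\<lambda>N. of_real ((2 * a) ^ CARD('d) / real n) * (\<Sum>i=1..n. of_real ((1 / (2 * a)) ^ CARD('d)) * (\<Sum>h\<in>cube N. ?V h * char_vec a h (?x i))))
      \<longlonglongrightarrow> of_real ((2 * a) ^ CARD('d) / real n) * (\<Sum>i=1..n. of_real (period_sum a (tens m C (\<lambda>_. 0)) (?x i)))"
      by (intro tendsto_mult tendsto_sum tendsto_const fourier_series node_bounds)
    moreover have "of_real ((2 * a) ^ CARD('d) / real n) * (\<Sum>i=1..n. of_real ((1 / (2 * a)) ^ CARD('d)) * (\<Sum>h\<in>cube N. ?V h * char_vec a h (?x i))) = S N" for N
    proof -
      have ev: "(\<Sum>i=1..n. char_vec a h (?x i)) = (if h \<in> dual_lattice z n then of_nat n * char_sign h else 0)" for h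
        unfolding char_vec_node[OF n] sum_distrib_left[symmetric] character_sum[OF n] by (simp add: dual_lattice_def)
      have "(\<Sum>i=1..n. of_real ((1 / (2 * a)) ^ CARD('d)) * (\<Sum>h\<in>cube N. ?V h * char_vec a h (?x i)))
        = of_real ((1 / (2 * a)) ^ CARD('d)) * (\<Sum>h\<in>cube N. ?V h * (\<Sum>i=1..n. char_vec a h (?x i)))"
        unfolding sum_distrib_left by (rule sum.swap)
      also have "(\<Sum>h\<in>cube N. ?V h * (\<Sum>i=1..n. char_vec a h (?x i))) = of_nat n * S N"
        unfolding ev S_def sum.inter_restrict[OF finite_cube] sum_distrib_left by (intro sum.cong refl) auto
      finally have "of_real ((2 * a) ^ CARD('d) / real n) * (\<Sum>i=1..n. of_real ((1 / (2 * a)) ^ CARD('d)) * (\<Sum>h\<in>cube N. ?V h * char_vec a h (?x i)))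
        = of_real ((2 * a) ^ CARD('d) / real n * (1 / (2 * a)) ^ CARD('d) * real n) * S N" by simp
      also have "(2 * a) ^ CARD('d) / real n * (1 / (2 * a)) ^ CARD('d) * real n = 1"
        using n a0 by (simp add: power_one_over)
      finally show ?thesis by simp
    qed
    ultimately show ?thesis by simp
  qed
  have zero: "?V 0 * char_sign 0 = of_real ?I"
    by (simp add: Vhat_integral char_vec_def char_sign_def)
  have bd: "(cmod (S N - of_real ?I))\<^sup>2 \<le> ?K * ?W" for N
  proof -
    define H where "H = cube N \<inter> dual_lattice z n - {0}"
    have fH: "finite H" by (simp add: H_def finite_cube)
    have "0 \<in> cube N \<inter> dual_lattice z n" by (simp add: cube_def dual_lattice_def)
    then have "S N - of_real ?I = (\<Sum>h\<in>H. ?V h * char_sign h)"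
      unfolding S_def H_def using zero by (subst sum.remove[of _ 0]) (auto simp: finite_cube)
    then have "cmod (S N - of_real ?I) \<le> (\<Sum>h\<in>H. 1 / r_weight_prod \<alpha> h * (r_weight_prod \<alpha> h * cmod (?V h)))"
    proof -
      have "r_weight_prod \<alpha> h \<noteq> 0" for h :: "int^'d" using r_weight_prod_pos[of \<alpha> h] by simp
      then show ?thesis using \<open>S N - of_real ?I = _\<close> by (auto intro!: sum_norm_le simp: norm_mult norm_char_sign)
    qed
    then have "(cmod (S N - of_real ?I))\<^sup>2 \<le> (\<Sum>h\<in>H. 1 / r_weight_prod \<alpha> h * (r_weight_prod \<alpha> h * cmod (?V h)))\<^sup>2"
      by (intro power_mono) auto
    also have "\<dots> \<le> (\<Sum>h\<in>H. (1 / r_weight_prod \<alpha> h)\<^sup>2) * (\<Sum>h\<in>H. (r_weight_prod \<alpha> h * cmod (?V h))\<^sup>2)"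
      by (rule Cauchy_Schwarz_ineq_sum)
    also have "\<dots> \<le> ?K * ?W"
    proof (rule mult_mono)
      show "(\<Sum>h\<in>H. (1 / r_weight_prod \<alpha> h)\<^sup>2) \<le> ?K"
        using good_lattice_rule_finite[OF good al _ fH] by (auto simp: H_def power_divide)
      have "(\<Sum>h\<in>H. (r_weight_prod \<alpha> h * cmod (?V h))\<^sup>2) \<le> (\<Sum>h\<in>cube N. (r_weight_prod \<alpha> h)\<^sup>2 * (cmod (?V h))\<^sup>2)"
        unfolding power_mult_distrib by (rule sum_mono2[OF finite_cube]) (auto simp: H_def)
      also have "\<dots> \<le> ?W"
        by (rule weighted_coefficients, rule tens_cut_bound[OF M X])
      finally show "(\<Sum>h\<in>H. (r_weight_prod \<alpha> h * cmod (?V h))\<^sup>2) \<le> ?W" .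
    qed (auto intro: sum_nonneg)
    finally show ?thesis .
  qed
  have "(\<lambda>N. (cmod (S N - of_real ?I))\<^sup>2) \<longlonglongrightarrow> (cmod (of_real ?Q - of_real ?I))\<^sup>2"
    by (intro tendsto_intros SQ)
  then have "(cmod (of_real ?Q - of_real ?I))\<^sup>2 \<le> ?K * ?W"
    by (rule LIMSEQ_le_const2) (use bd in auto)
  then show ?thesis by (simp only: of_real_diff[symmetric] norm_of_real power2_abs)
qed

end

section \<open>Cubature of Sobolev functions\<close>

lemma eta_binomial_bounded:
  obtains M where "\<And>k i t. k \<le> \<alpha> \<Longrightarrow> i \<le> k \<Longrightarrow> \<bar>real (k choose i) * eta (k - i) t\<bar> \<le> M"
proof -
  have "\<forall>k. \<exists>B. \<forall>t. \<bar>eta k t\<bar> \<le> B" using eta_bounded by blast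
  from choice[OF this] obtain B where B: "\<And>k t. \<bar>eta k t\<bar> \<le> B k" by blast
  have B0: "0 \<le> B k" for k using B[of k 0] by linarith
  define M where "M = (\<Sum>k\<le>\<alpha>. \<Sum>i\<le>k. real (k choose i) * B (k - i))"
  have "\<bar>real (k choose i) * eta (k - i) t\<bar> \<le> M" if "k \<le> \<alpha>" "i \<le> k" for k i t
  proof -
    have "\<bar>real (k choose i) * eta (k - i) t\<bar> \<le> real (k choose i) * B (k - i)"
      using B by (simp add: abs_mult mult_left_mono)
    also have "\<dots> \<le> (\<Sum>i\<le>k. real (k choose i) * B (k - i))"
      using that(2) B0 by (intro member_le_sum[of i "{..k}" "\<lambda>i. real (k choose i) * B (k - i)"]) auto
    also have "\<dots> \<le> M"
      unfolding M_def using that(1) B0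
      by (intro member_le_sum[of k "{..\<alpha>}" "\<lambda>k. \<Sum>i\<le>k. real (k choose i) * B (k - i)"]) (auto intro!: sum_nonneg)
    finally show ?thesis .
  qed
  then show ?thesis by (rule that)
qed

definition cutoff :: "real \<Rightarrow> real^'d::finite \<Rightarrow> real" where
  "cutoff a x = (\<Prod>j\<in>UNIV. eta 0 (x $ j / (2 * a)))"

lemma cutoff_bounds: "0 \<le> cutoff a x" "cutoff a x \<le> 1"
  unfolding cutoff_def by (auto intro!: prod_nonneg prod_le_1 eta_bounds)

lemma cutoff_one: "a > 0 \<Longrightarrow> (\<And>j. \<bar>x $ j\<bar> \<le> a) \<Longrightarrow> cutoff a x = 1"
  unfolding cutoff_def by (intro prod.neutral ballI eta_one) (simp add: abs_divide divide_simps mult.commute)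

lemma cutoff_zero: "a > 0 \<Longrightarrow> x \<notin> cbox (lo a) (hi a) \<Longrightarrow> cutoff a x = 0"
proof -
  assume a: "a > 0" and x: "x \<notin> cbox (lo a) (hi a)"
  have "\<exists>j. \<not> (-3 * a \<le> x $ j \<and> x $ j \<le> 3 * a)"
    using x unfolding mem_box_cart by simp
  then obtain j where "x $ j < -3 * a \<or> 3 * a < x $ j" by (auto simp: not_le)
  then have "\<bar>x $ j\<bar> \<ge> 3 * a" by linarith
  then have "\<bar>x $ j / (2 * a)\<bar> \<ge> 3 / 2" using a by (simp add: abs_divide divide_simps)
  then have "eta 0 (x $ j / (2 * a)) = 0" by (rule eta_zero)
  then show ?thesis unfolding cutoff_def by (intro prod_zero) auto
qed

lemma cutoff_measurable [measurable]: "cutoff a \<in> borel_measurable borel"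
proof -
  have [measurable]: "eta 0 \<in> borel_measurable borel"
    by (intro borel_measurable_continuous_onI smooth_seq_continuous smooth_seq_eta)
  show ?thesis unfolding cutoff_def[abs_def] by measurable
qed

lemma le_of_le_plus_eps:
  fixes x y A :: real
  assumes "\<And>\<epsilon>. \<epsilon> > 0 \<Longrightarrow> x \<le> A * (y + \<epsilon>)" "A \<ge> 0"
  shows "x \<le> A * y"
proof (rule field_le_epsilon)
  fix e :: real assume e: "e > 0"
  have "x \<le> A * (y + e / (A + 1))" using assms e by simp
  also have "\<dots> = A * y + e * (A / (A + 1))" by (simp add: distrib_left)
  also have "\<dots> \<le> A * y + e * 1" using assms(2) e by (intro add_left_mono mult_left_mono) auto
  finally show "x \<le> A * y + e" by simp
qed

text \<open>Each quantity has its own mode of convergence: the lattice sum involves finitely many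
  points and converges pointwise, the integral converges by the L2 limit on the enlarged cube, and
  the bound on the right holds eventually up to \<epsilon>. The constant is fixed before f, a, z, n
  and c.\<close>

lemma cubature_sobolev:
  obtains C where "C \<ge> 0" "\<And>f a z n c. f \<in> sobolev_space \<alpha> (lo a) (hi a :: real^'d::finite) \<Longrightarrow> 6 * a \<ge> 1 \<Longrightarrow> \<alpha> \<ge> 1 \<Longrightarrow>
     n > 0 \<Longrightarrow> good_lattice_rule \<alpha> c z n \<Longrightarrow>
     ((2 * a) ^ CARD('d) / real n * (\<Sum>i=1..n. period_sum a (\<lambda>x. f x * cutoff a x) (scaled_node z n (\<chi> j. - a) (\<chi> j. a) i))
       - (LINT x|lborel. f x * cutoff a x))\<^sup>2
     \<le> (c * ln (real n) ^ (\<alpha> * CARD('d)) / real n ^ \<alpha>)\<^sup>2 * (C * (6 * a) ^ ((2 * \<alpha> + 1) * CARD('d)) * (sobolev_norm \<alpha> (lo a) (hi a) f)\<^sup>2)"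
proof -
  obtain M where M: "\<And>k i t. k \<le> \<alpha> \<Longrightarrow> i \<le> k \<Longrightarrow> \<bar>real (k choose i) * eta (k - i) t\<bar> \<le> M"
    using eta_binomial_bounded by blast
  have M0: "M \<ge> 0" using M[of 0 0 0] by simp
  define C0 where "C0 = 2 ^ CARD('d) * ((real ((\<alpha> + 1) ^ CARD('d)))\<^sup>2 * (M ^ (2 * CARD('d)) * poincare_const \<alpha> CARD('d)))"
  have C0: "C0 \<ge> 0" using M0 poincare_const_pos[of \<alpha> "CARD('d)"] by (simp add: C0_def)
  show ?thesis
  proof (rule that[of "C0 * 4"])
    show "C0 * 4 \<ge> 0" using C0 by simp
    fix f :: "real^'d \<Rightarrow> real" and a c :: real and z :: "int^'d" and n :: nat
    assume f: "f \<in> sobolev_space \<alpha> (lo a) (hi a)" and a6: "6 * a \<ge> 1" and al: "\<alpha> \<ge> 1" and n: "n > 0"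
      and good: "good_lattice_rule \<alpha> c z n"
    have a: "a > 0" using a6 by simp
    define s where "s = sobolev_norm \<alpha> (lo a) (hi a) f"
    define K where "K = (c * ln (real n) ^ (\<alpha> * CARD('d)) / real n ^ \<alpha>)\<^sup>2"
    let ?x = "scaled_node z n (\<chi> j. - a) (\<chi> j. a)"
    obtain m D where TC: "\<And>k. tensor_chain (lo a) (hi a) (6 * a) \<alpha> (m k) (D k)"
      and pt: "\<And>x. x \<in> cbox (lo a) (hi a) \<Longrightarrow> (\<lambda>k. tens (m k) (D k) (\<lambda>_. 0) x) \<longlonglongrightarrow> f x"
      and fL2: "box_L2 (lo a) (hi a) (\<lambda>x. indicator (cbox (lo a) (hi a)) x * f x)"
      and L2: "(\<lambda>k. LINT x|lborel. (tens (m k) (D k) (\<lambda>_. 0) x - indicator (cbox (lo a) (hi a)) x * f x)\<^sup>2) \<longlonglongrightarrow> 0"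
      and bd: "\<And>\<epsilon>. \<epsilon> > 0 \<Longrightarrow> \<forall>\<^sub>F k in sequentially. \<forall>\<sigma>. (\<forall>j. \<sigma> j \<le> \<alpha>) \<longrightarrow>
       (6 * a) ^ (2 * (\<Sum>j\<in>UNIV. \<sigma> j)) * (LINT x|lborel. (tens (m k) (D k) \<sigma> x)\<^sup>2) \<le>
       poincare_const \<alpha> CARD('d) * (6 * a) ^ (2 * \<alpha> * CARD('d)) * (4 * s\<^sup>2 + \<epsilon>)"
      using sobolev_space_approx[OF f _ a6 al] unfolding s_def[symmetric] by (auto simp: mult.commute)
    let ?C = "\<lambda>k i j. cut a (D k i j)"
    have cut0: "tens (m k) (?C k) (\<lambda>_. 0) x = tens (m k) (D k) (\<lambda>_. 0) x * cutoff a x" for k x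
      by (simp add: tens_def cut_def cutoff_def prod.distrib sum_distrib_left mult.commute)
    define Q where "Q k = (2 * a) ^ CARD('d) / real n * (\<Sum>i=1..n. period_sum a (tens (m k) (?C k) (\<lambda>_. 0)) (?x i))" for k
    define Qf where "Qf = (2 * a) ^ CARD('d) / real n * (\<Sum>i=1..n. period_sum a (\<lambda>x. f x * cutoff a x) (?x i))"
    have CT: "cut_tensor a \<alpha> (m k) (D k)" for k unfolding cut_tensor_def by (rule TC)
    have Qlim: "Q \<longlonglongrightarrow> Qf"
      unfolding Q_def Qf_def period_sum_def cut0
    proof (intro tendsto_mult tendsto_const tendsto_sum pt)
      fix i and k :: "int^'d" assume k: "k \<in> {k. \<forall>j. k $ j \<in> {-1..1}}"
      show "(\<chi> j. ?x i $ j + 2 * a * real_of_int (k $ j)) \<in> cbox (lo a) (hi a)"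
        unfolding mem_box_cart vec_lambda_beta
      proof
        fix j
        have "\<bar>?x i $ j\<bar> \<le> a" by (rule cut_tensor.node_bounds[OF CT])
        moreover have "\<bar>2 * a * real_of_int (k $ j)\<bar> \<le> 2 * a * 1"
        proof -
          have "k $ j \<in> {-1..1}" using k by blast
          then have "\<bar>k $ j\<bar> \<le> 1" by auto
          then have "\<bar>real_of_int (k $ j)\<bar> \<le> 1" by (simp add: of_int_abs[symmetric] del: of_int_abs)
          then show ?thesis using a unfolding abs_mult by (intro mult_mono) auto
        qed
        ultimately show "-3 * a \<le> ?x i $ j + 2 * a * real_of_int (k $ j) \<and> ?x i $ j + 2 * a * real_of_int (k $ j) \<le> 3 * a"
          by (simp add: abs_le_iff)
      qed
    qed
    have TL2: "box_L2 (lo a) (hi a) (tens (m k) (D k) (\<lambda>_. 0))" for k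
    proof -
      interpret tensor_chain "lo a" "hi a" "6 * a" \<alpha> "m k" "D k" by (rule TC)
      show ?thesis by (rule box_L2_tens[OF ab]) (use chain in \<open>auto simp: sobolev_chain_def\<close>)
    qed
    have "(\<lambda>k. LINT x|lborel. tens (m k) (D k) (\<lambda>_. 0) x * cutoff a x) \<longlonglongrightarrow> (LINT x|lborel. (indicator (cbox (lo a) (hi a)) x * f x) * cutoff a x)"
      by (rule integral_mult_L2_tendsto[OF TL2 fL2 L2, where B = 1]) (auto simp: abs_of_nonneg cutoff_bounds)
    also have "(\<lambda>x. (indicator (cbox (lo a) (hi a)) x * f x) * cutoff a x) = (\<lambda>x. f x * cutoff a x)"
    proof
      fix x show "(indicator (cbox (lo a) (hi a)) x * f x) * cutoff a x = f x * cutoff a x"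
        using cutoff_zero[OF a, of x] by (cases "x \<in> cbox (lo a) (hi a)") simp_all
    qed
    finally have Ilim: "(\<lambda>k. LINT x|lborel. tens (m k) (?C k) (\<lambda>_. 0) x) \<longlonglongrightarrow> (LINT x|lborel. f x * cutoff a x)"
      unfolding cut0 .
    have lim: "(\<lambda>k. (Q k - (LINT x|lborel. tens (m k) (?C k) (\<lambda>_. 0) x))\<^sup>2) \<longlonglongrightarrow> (Qf - (LINT x|lborel. f x * cutoff a x))\<^sup>2"
      by (intro tendsto_intros Qlim Ilim)
    define A where "A = K * (C0 * (6 * a) ^ ((2 * \<alpha> + 1) * CARD('d)))"
    have "(Qf - (LINT x|lborel. f x * cutoff a x))\<^sup>2 \<le> A * (4 * s\<^sup>2 + \<epsilon>)" if e: "\<epsilon> > 0" for \<epsilon>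
    proof (rule tendsto_upperbound[OF lim])
      show "\<forall>\<^sub>F k in sequentially. (Q k - (LINT x|lborel. tens (m k) (?C k) (\<lambda>_. 0) x))\<^sup>2 \<le> A * (4 * s\<^sup>2 + \<epsilon>)"
        using bd[OF e]
      proof eventually_elim
        case (elim k)
        have "(Q k - (LINT x|lborel. tens (m k) (?C k) (\<lambda>_. 0) x))\<^sup>2 \<le> K * (2 ^ CARD('d) * ((6 * a) ^ CARD('d) * ((real ((\<alpha> + 1) ^ CARD('d)))\<^sup>2 *
            (M ^ (2 * CARD('d)) * (poincare_const \<alpha> CARD('d) * (6 * a) ^ (2 * \<alpha> * CARD('d)) * (4 * s\<^sup>2 + \<epsilon>))))))"
          unfolding Q_def K_def by (rule cut_tensor.cubature_tensor[OF CT n good M]) (use elim in auto)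
        also have "\<dots> = K * (C0 * ((6 * a) ^ CARD('d) * (6 * a) ^ (2 * \<alpha> * CARD('d)))) * (4 * s\<^sup>2 + \<epsilon>)"
          unfolding C0_def by (simp only: mult_ac)
        \<comment> \<open>The volume factor of Bessel's inequality meets the scale factor of the
          Poincare inequality.\<close>
        also have "(6 * a) ^ CARD('d) * (6 * a) ^ (2 * \<alpha> * CARD('d)) = (6 * a) ^ ((2 * \<alpha> + 1) * CARD('d))"
          unfolding distrib_right power_add mult_1_left by (rule mult.commute)
        finally show ?case unfolding A_def .
      qed
    qed simp
    then have "(Qf - (LINT x|lborel. f x * cutoff a x))\<^sup>2 \<le> A * (4 * s\<^sup>2)"
    proof (rule le_of_le_plus_eps)
      have "K \<ge> 0" "(6 * a) ^ ((2 * \<alpha> + 1) * CARD('d)) \<ge> 0" using a by (simp_all add: K_def)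
      then show "A \<ge> 0" unfolding A_def using C0 by (intro mult_nonneg_nonneg)
    qed
    show "((2 * a) ^ CARD('d) / real n * (\<Sum>i=1..n. period_sum a (\<lambda>x. f x * cutoff a x) (?x i)) - (LINT x|lborel. f x * cutoff a x))\<^sup>2
     \<le> (c * ln (real n) ^ (\<alpha> * CARD('d)) / real n ^ \<alpha>)\<^sup>2 * (C0 * 4 * (6 * a) ^ ((2 * \<alpha> + 1) * CARD('d)) * (sobolev_norm \<alpha> (lo a) (hi a) f)\<^sup>2)"
      using \<open>(Qf - (LINT x|lborel. f x * cutoff a x))\<^sup>2 \<le> A * (4 * s\<^sup>2)\<close>
      unfolding Qf_def A_def K_def s_def by (simp add: mult_ac)
  qed
qed

section \<open>The total error\<close>

text \<open>Each restriction to a cube is measurable as a limit of tensors, and f is the pointwise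
  limit of its restrictions to growing cubes.\<close>

lemma sobolev_space_measurable:
  fixes f :: "real^'d::finite \<Rightarrow> real"
  assumes f: "\<And>a. a \<ge> 1 \<Longrightarrow> f \<in> sobolev_space \<alpha> (lo a) (hi a)" and al: "\<alpha> \<ge> 1"
  shows "f \<in> borel_measurable borel" "a \<ge> 1 \<Longrightarrow> box_L2 (lo a) (hi a) (\<lambda>x. indicator (cbox (lo a) (hi a)) x * f x)"
proof -
  have B: "box_L2 (lo a) (hi a) (\<lambda>x. indicator (cbox (lo a) (hi a)) x * f x)" if a: "a \<ge> 1" for a :: real
  proof -
    have "6 * a \<ge> 1" using a by simp
    from sobolev_space_approx[OF f[OF a] _ this al] show ?thesis by (auto simp: mult.commute)
  qed
  show "a \<ge> 1 \<Longrightarrow> box_L2 (lo a) (hi a) (\<lambda>x. indicator (cbox (lo a) (hi a)) x * f x)" by (rule B)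
  show "f \<in> borel_measurable borel"
  proof (rule borel_measurable_LIMSEQ_real)
    show "(\<lambda>x. indicator (cbox (lo (real (Suc N))) (hi (real (Suc N)))) x * f x) \<in> borel_measurable borel" for N
      by (rule box_L2.V_measurable[OF B]) simp
    fix x :: "real^'d"
    show "(\<lambda>N. indicator (cbox (lo (real (Suc N))) (hi (real (Suc N)))) x * f x) \<longlonglongrightarrow> f x"
    proof (rule tendsto_eventually, unfold eventually_sequentially, intro exI allI impI)
      fix N assume N: "N \<ge> nat \<lceil>norm x\<rceil>"
      have "\<bar>x $ j\<bar> \<le> real N" for j
        using component_le_norm_cart[of x j] N by (meson le_nat_iff nat_ceiling_le_eq order_trans)
      then have "x \<in> cbox (lo (real (Suc N))) (hi (real (Suc N)))"
        unfolding mem_box_cart vec_lambda_beta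
      proof (intro allI)
        fix j show "-3 * real (Suc N) \<le> x $ j \<and> x $ j \<le> 3 * real (Suc N)"
          using \<open>\<And>j. \<bar>x $ j\<bar> \<le> real N\<close>[of j] by (simp add: abs_le_iff)
      qed
      then show "indicator (cbox (lo (real (Suc N))) (hi (real (Suc N)))) x * f x = f x" by simp
    qed
  qed
qed

text \<open>Periodising the cut-off function changes its values at the nodes only by values of \<open>f\<close> outside
  the cube, and its integral over a period is that of the cut-off function over the whole space.\<close>

lemma error_split:
  fixes f :: "real^'d::finite \<Rightarrow> real" and z :: "int^'d"
  assumes f: "\<And>a. a \<ge> 1 \<Longrightarrow> f \<in> sobolev_space \<alpha> (lo a) (hi a)" and al: "\<alpha> \<ge> 1" and a: "a \<ge> 1" and n: "n > 0"
    and B: "\<And>x j. \<bar>x $ j\<bar> \<ge> a \<Longrightarrow> \<bar>f x\<bar> \<le> B"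
    and \<omega>: "integrable lborel \<omega>" and T: "\<And>x j. \<bar>x $ j\<bar> \<ge> a \<Longrightarrow> \<bar>f x\<bar> \<le> T * (\<Prod>j\<in>UNIV. \<omega> (x $ j))"
    and T0: "\<And>x :: real^'d. 0 \<le> T * (\<Prod>j\<in>UNIV. \<omega> (x $ j))" and B0: "B \<ge> 0"
  defines "Q \<equiv> (2 * a) ^ CARD('d) / real n * (\<Sum>i=1..n. period_sum a (\<lambda>x. f x * cutoff a x) (scaled_node z n (\<chi> j. - a) (\<chi> j. a) i))"
  shows "\<bar>(LINT x|lborel. f x) - scaled_lattice_rule z n (\<chi> j. - a) (\<chi> j. a) f\<bar>
     \<le> \<bar>Q - (LINT x|lborel. f x * cutoff a x)\<bar> + (2 * a) ^ CARD('d) * (3 ^ CARD('d) * B) + T * (LINT t|lborel. \<omega> t) ^ CARD('d)"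
proof -
  let ?x = "scaled_node z n (\<chi> j. - a) (\<chi> j. a)"
  have a0: "a > 0" using a by simp
  have fm [measurable]: "f \<in> borel_measurable borel" by (rule sobolev_space_measurable[OF f al])
  have fL2: "box_L2 (lo a) (hi a) (\<lambda>x. indicator (cbox (lo a) (hi a)) x * f x)"
    by (rule sobolev_space_measurable(2)[OF f al a])
  have ic: "integrable lborel (\<lambda>x. f x * cutoff a x)"
  proof (rule Bochner_Integration.integrable_bound[OF box_L2_integrable[OF fL2]])
    show "AE x in lborel. norm (f x * cutoff a x) \<le> norm (indicator (cbox (lo a) (hi a)) x * f x)"
    proof (intro AE_I2)
      fix x show "norm (f x * cutoff a x) \<le> norm (indicator (cbox (lo a) (hi a)) x * f x)"
        using cutoff_zero[OF a0, of x] cutoff_bounds[of a x]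
        by (cases "x \<in> cbox (lo a) (hi a)") (auto simp: abs_mult intro!: mult_left_le)
    qed
  qed measurable
  have ip: "integrable lborel (\<lambda>x::real^'d. T * (\<Prod>j\<in>UNIV. \<omega> (x $ j)))"
    by (intro integrable_mult_right integrable_prod_vec \<omega>)
  \<comment> \<open>If all coordinates are smaller than a in absolute value, the cutoff is 1 and the
    left side vanishes; otherwise the majorant applies.\<close>
  have le: "\<bar>f x * (1 - cutoff a x)\<bar> \<le> T * (\<Prod>j\<in>UNIV. \<omega> (x $ j))" for x
  proof (cases "\<exists>j. \<bar>x $ j\<bar> \<ge> a")
    case True
    then obtain j where j: "\<bar>x $ j\<bar> \<ge> a" ..
    have "\<bar>f x * (1 - cutoff a x)\<bar> \<le> \<bar>f x\<bar>"
      using cutoff_bounds[of a x] by (auto simp: abs_mult intro!: mult_left_le)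
    then show ?thesis using T[OF j] by linarith
  next
    case False
    then have "cutoff a x = 1" by (intro cutoff_one a0) (meson less_imp_le not_le)
    then show ?thesis using T0 by simp
  qed
  have id: "integrable lborel (\<lambda>x. f x * (1 - cutoff a x))"
    by (rule Bochner_Integration.integrable_bound[OF ip]) (use le T0 in \<open>auto intro!: AE_I2\<close>)
  have "(LINT x|lborel. f x) = (LINT x|lborel. f x * cutoff a x + f x * (1 - cutoff a x))"
    by (simp add: algebra_simps)
  also have "\<dots> = (LINT x|lborel. f x * cutoff a x) + (LINT x|lborel. f x * (1 - cutoff a x))"
    by (rule Bochner_Integration.integral_add[OF ic id])
  finally have e1: "(LINT x|lborel. f x) = (LINT x|lborel. f x * cutoff a x) + (LINT x|lborel. f x * (1 - cutoff a x))" .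
  have "\<bar>LINT x|lborel. f x * (1 - cutoff a x)\<bar> \<le> (LINT x|lborel. \<bar>f x * (1 - cutoff a x)\<bar>)" by (rule integral_abs_bound)
  also have "\<dots> \<le> (LINT x|lborel. T * (\<Prod>j\<in>UNIV. \<omega> ((x :: real^'d) $ j)))"
    by (rule integral_mono) (use id ip le in auto)
  also have "\<dots> = T * (LINT t|lborel. \<omega> t) ^ CARD('d)"
    using integral_prod_vec[of "\<lambda>_::'d. \<omega>", OF \<omega>] by simp
  finally have trunc: "\<bar>LINT x|lborel. f x * (1 - cutoff a x)\<bar> \<le> T * (LINT t|lborel. \<omega> t) ^ CARD('d)" .
  have nb: "\<bar>?x i $ j\<bar> \<le> a" for i j
  proof -
    have "0 \<le> 2 * a * frac (real i * of_int (z $ j) / real n)" "2 * a * frac (real i * of_int (z $ j) / real n) \<le> 2 * a * 1"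
      using a0 frac_ge_0 frac_lt_1 less_imp_le by (auto intro!: mult_nonneg_nonneg mult_left_mono)
    then show ?thesis by (simp add: scaled_node_def abs_le_iff)
  qed
  \<comment> \<open>Translate 0 reproduces the value of f at the node. Every other one moves some
    coordinate by 2 a from [-a, a], hence to absolute value at least a, where f is bounded by
    B.\<close>
  have node: "\<bar>period_sum a (\<lambda>x. f x * cutoff a x) (?x i) - f (?x i)\<bar> \<le> 3 ^ CARD('d) * B" for i
  proof -
    let ?S = "{k :: int^'d. \<forall>j. k $ j \<in> {-1..1}}"
    let ?g = "\<lambda>k :: int^'d. f (\<chi> j. ?x i $ j + 2 * a * of_int (k $ j)) * cutoff a (\<chi> j. ?x i $ j + 2 * a * of_int (k $ j))"
    have fin: "finite ?S" by (intro finite_vec_set) simp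
    have "0 \<in> ?S" by simp
    then have "period_sum a (\<lambda>x. f x * cutoff a x) (?x i) = ?g 0 + (\<Sum>k\<in>?S - {0}. ?g k)"
      unfolding period_sum_def by (rule sum.remove[OF fin])
    moreover have "?g 0 = f (?x i)"
      using cutoff_one[OF a0, of "?x i", OF nb] by simp
    ultimately have "period_sum a (\<lambda>x. f x * cutoff a x) (?x i) - f (?x i) = (\<Sum>k\<in>?S - {0}. ?g k)"
      by linarith
    then have "\<bar>period_sum a (\<lambda>x. f x * cutoff a x) (?x i) - f (?x i)\<bar> \<le> (\<Sum>k\<in>?S - {0}. \<bar>?g k\<bar>)"
      by (simp only: sum_abs)
    also have "\<dots> \<le> (\<Sum>k\<in>?S - {0}. B)"
    proof (rule sum_mono)
      fix k assume k: "k \<in> ?S - {0}"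
      then obtain j where j: "k $ j \<noteq> 0" by (auto simp: vec_eq_iff)
      have "k $ j \<in> {-1..1}" using k by blast
      with j have "k $ j = 1 \<or> k $ j = -1" by auto
      then have "\<bar>(\<chi> j. ?x i $ j + 2 * a * of_int (k $ j)) $ j\<bar> \<ge> a"
        using nb[of i j] by (auto simp: abs_if split: if_splits)
      then have "\<bar>f (\<chi> j. ?x i $ j + 2 * a * of_int (k $ j))\<bar> \<le> B" by (rule B)
      moreover have "\<bar>?g k\<bar> \<le> \<bar>f (\<chi> j. ?x i $ j + 2 * a * of_int (k $ j))\<bar>"
        using cutoff_bounds[of a "\<chi> j. ?x i $ j + 2 * a * of_int (k $ j)"] by (auto simp: abs_mult intro!: mult_left_le)
      ultimately show "\<bar>?g k\<bar> \<le> B" by linarith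
    qed
    also have "\<dots> \<le> (\<Sum>k\<in>?S. B)" using fin B0 by (intro sum_mono2) auto
    also have "\<dots> = 3 ^ CARD('d) * B"
      using prod_sum_vec[of "{-1..1::int}" "\<lambda>_::'d. \<lambda>_. 1::real"] by simp
    finally show ?thesis .
  qed
  define A where "A = (2 * a) ^ CARD('d) / real n"
  have A0: "A \<ge> 0" using a0 by (simp add: A_def)
  have rule: "scaled_lattice_rule z n (\<chi> j. - a) (\<chi> j. a) f = A * (\<Sum>i=1..n. f (?x i))"
    by (simp add: scaled_lattice_rule_def A_def)
  have "\<bar>Q - scaled_lattice_rule z n (\<chi> j. - a) (\<chi> j. a) f\<bar> = A * \<bar>\<Sum>i=1..n. period_sum a (\<lambda>x. f x * cutoff a x) (?x i) - f (?x i)\<bar>"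
    unfolding rule Q_def A_def[symmetric] right_diff_distrib[symmetric] sum_subtractf[symmetric] abs_mult using A0 by simp
  also have "\<dots> \<le> A * (\<Sum>i=1..n. 3 ^ CARD('d) * B)"
    using A0 node by (intro mult_left_mono order_trans[OF sum_abs] sum_mono) auto
  also have "\<dots> = (2 * a) ^ CARD('d) * (3 ^ CARD('d) * B)" using n by (simp add: A_def)
  finally have "\<bar>Q - scaled_lattice_rule z n (\<chi> j. - a) (\<chi> j. a) f\<bar> \<le> (2 * a) ^ CARD('d) * (3 ^ CARD('d) * B)" .
  then show ?thesis using e1 trunc by linarith
qed

text \<open>Decay enters through two quantities only: a bound B outside the cube, used for the
  translates, and an integrable majorant of product form, whose integral is a power of a
  one-dimensional one, used for the truncation. Both decay conditions are instances.\<close>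

lemma total_error:
  obtains C where "C \<ge> 0" "\<And>(f :: real^'d::finite \<Rightarrow> real) a z n B T \<omega>.
     (\<forall>(a, b)\<in>boxes. f \<in> sobolev_space \<alpha> a b) \<Longrightarrow> sobolev_norm_star \<alpha> f < \<infinity> \<Longrightarrow> \<alpha> \<ge> 1 \<Longrightarrow> a \<ge> 1 \<Longrightarrow>
     n > 0 \<Longrightarrow> good_lattice_rule \<alpha> c z n \<Longrightarrow> B \<ge> 0 \<Longrightarrow> (\<And>x j. \<bar>x $ j\<bar> \<ge> a \<Longrightarrow> \<bar>f x\<bar> \<le> B) \<Longrightarrow>
     integrable lborel \<omega> \<Longrightarrow> (\<And>x. 0 \<le> T * (\<Prod>j\<in>UNIV. \<omega> ((x :: real^'d) $ j))) \<Longrightarrow>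
     (\<And>x j. \<bar>x $ j\<bar> \<ge> a \<Longrightarrow> \<bar>f x\<bar> \<le> T * (\<Prod>j\<in>UNIV. \<omega> (x $ j))) \<Longrightarrow>
     \<bar>(LINT x|lborel. f x) - scaled_lattice_rule z n (\<chi> j. - a) (\<chi> j. a) f\<bar>
     \<le> C * \<bar>ln (real n)\<bar> ^ (\<alpha> * CARD('d)) / real n ^ \<alpha> * a powr ((real \<alpha> + 1 / 2) * real CARD('d))
           * enn2real (sobolev_norm_star \<alpha> f)
       + (6 * a) ^ CARD('d) * B + T * (LINT t|lborel. \<omega> t) ^ CARD('d)"
proof -
  let ?d = "CARD('d)" and ?u = "(real \<alpha> + 1 / 2) * real CARD('d)"
  obtain C where C: "C \<ge> 0" and cub: "\<And>(f :: real^'d \<Rightarrow> real) a z n c. f \<in> sobolev_space \<alpha> (lo a) (hi a) \<Longrightarrow> 6 * a \<ge> 1 \<Longrightarrow> \<alpha> \<ge> 1 \<Longrightarrow>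
     n > 0 \<Longrightarrow> good_lattice_rule \<alpha> c z n \<Longrightarrow>
     ((2 * a) ^ CARD('d) / real n * (\<Sum>i=1..n. period_sum a (\<lambda>x. f x * cutoff a x) (scaled_node z n (\<chi> j. - a) (\<chi> j. a) i))
       - (LINT x|lborel. f x * cutoff a x))\<^sup>2
     \<le> (c * ln (real n) ^ (\<alpha> * CARD('d)) / real n ^ \<alpha>)\<^sup>2 * (C * (6 * a) ^ ((2 * \<alpha> + 1) * CARD('d)) * (sobolev_norm \<alpha> (lo a) (hi a) f)\<^sup>2)"
    using cubature_sobolev[where 'd = 'd and \<alpha> = \<alpha>] by blast
  show thesis
  proof (rule that[of "\<bar>c\<bar> * sqrt C * 6 powr ?u"])
    show "\<bar>c\<bar> * sqrt C * 6 powr ?u \<ge> 0" using C by simp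
    fix f :: "real^'d \<Rightarrow> real" and a :: real and z :: "int^'d" and n :: nat and B T :: real and \<omega> :: "real \<Rightarrow> real"
    assume fs: "\<forall>(a, b)\<in>boxes. f \<in> sobolev_space \<alpha> a b" and fin: "sobolev_norm_star \<alpha> f < \<infinity>" and al: "\<alpha> \<ge> 1" and a: "a \<ge> 1"
      and n: "n > 0" and good: "good_lattice_rule \<alpha> c z n" and B0: "B \<ge> 0" and B: "\<And>x j. \<bar>x $ j\<bar> \<ge> a \<Longrightarrow> \<bar>f x\<bar> \<le> B"
      and \<omega>: "integrable lborel \<omega>" and T0: "\<And>x. 0 \<le> T * (\<Prod>j\<in>UNIV. \<omega> ((x :: real^'d) $ j))"
      and T: "\<And>x j. \<bar>x $ j\<bar> \<ge> a \<Longrightarrow> \<bar>f x\<bar> \<le> T * (\<Prod>j\<in>UNIV. \<omega> (x $ j))"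
    have box: "(lo b, hi b :: real^'d) \<in> boxes" if "b \<ge> 1" for b using that by (simp add: boxes_def)
    have f: "f \<in> sobolev_space \<alpha> (lo b) (hi b)" if "b \<ge> 1" for b using fs box[OF that] by blast
    let ?X = "(2 * a) ^ CARD('d) / real n * (\<Sum>i=1..n. period_sum a (\<lambda>x. f x * cutoff a x) (scaled_node z n (\<chi> j. - a) (\<chi> j. a) i))
       - (LINT x|lborel. f x * cutoff a x)"
    define K where "K = ln (real n) ^ (\<alpha> * ?d) / real n ^ \<alpha>"
    define s where "s = sobolev_norm \<alpha> (lo a) (hi a) f"
    have s0: "s \<ge> 0" unfolding s_def sobolev_norm_def by (auto simp: Let_def set_lebesgue_integral_def intro!: real_sqrt_ge_zero sum_nonneg integral_nonneg)
    have "ennreal s \<le> sobolev_norm_star \<alpha> f"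
      unfolding sobolev_norm_star_def s_def by (rule SUP_upper2[OF box[OF a]]) simp
    then have sS: "s \<le> enn2real (sobolev_norm_star \<alpha> f)"
      using enn2real_mono[of "ennreal s"] fin s0 by fastforce
    \<comment> \<open>The square root halves the exponent (2 \<alpha> + 1) d, which may leave a
      half-integer, hence \<open>powr\<close>.\<close>
    have sq: "((6 * a) powr ?u)\<^sup>2 = (6 * a) ^ ((2 * \<alpha> + 1) * ?d)"
    proof -
      have "((6 * a) powr ?u)\<^sup>2 = (6 * a) powr real ((2 * \<alpha> + 1) * ?d)"
        by (simp add: power2_eq_square powr_add[symmetric] algebra_simps)
      then show ?thesis using a by (simp only: powr_realpow)
    qed
    have "?X\<^sup>2 \<le> (c * K)\<^sup>2 * (C * ((6 * a) powr ?u)\<^sup>2 * s\<^sup>2)"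
      using cub[OF f[OF a] _ al n good] a unfolding sq K_def s_def by simp
    also have "\<dots> = (\<bar>c\<bar> * \<bar>K\<bar> * sqrt C * (6 * a) powr ?u * s)\<^sup>2"
      using C by (simp add: power_mult_distrib)
    finally have "\<bar>?X\<bar> \<le> \<bar>\<bar>c\<bar> * \<bar>K\<bar> * sqrt C * (6 * a) powr ?u * s\<bar>"
      by (simp only: abs_le_square_iff)
    also have "\<dots> = \<bar>c\<bar> * \<bar>K\<bar> * sqrt C * (6 * a) powr ?u * s" using C s0 by simp
    also have "\<dots> \<le> \<bar>c\<bar> * \<bar>K\<bar> * sqrt C * (6 * a) powr ?u * enn2real (sobolev_norm_star \<alpha> f)"
      using C by (intro mult_left_mono sS) simp
    also have "\<dots> = \<bar>c\<bar> * sqrt C * 6 powr ?u * \<bar>ln (real n)\<bar> ^ (\<alpha> * ?d) / real n ^ \<alpha> * a powr ?u * enn2real (sobolev_norm_star \<alpha> f)"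
    proof -
      have "\<bar>K\<bar> = \<bar>ln (real n)\<bar> ^ (\<alpha> * ?d) / real n ^ \<alpha>" by (simp add: K_def power_abs)
      moreover have "(6 * a) powr ?u = 6 powr ?u * a powr ?u" by (rule powr_mult)
      ultimately show ?thesis by (simp only: mult_ac times_divide_eq_left times_divide_eq_right)
    qed
    finally have X: "\<bar>?X\<bar> \<le> \<dots>" .
    have "2 * a * 3 = 6 * a" by simp
    then have "(6 * a) ^ ?d = (2 * a) ^ ?d * 3 ^ ?d" by (metis power_mult_distrib)
    then have "(2 * a) ^ ?d * (3 ^ ?d * B) = (6 * a) ^ ?d * B" by (simp only: mult.assoc)
    moreover have "\<bar>(LINT x|lborel. f x) - scaled_lattice_rule z n (\<chi> j. - a) (\<chi> j. a) f\<bar>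
      \<le> \<bar>?X\<bar> + (2 * a) ^ ?d * (3 ^ ?d * B) + T * (LINT t|lborel. \<omega> t) ^ ?d"
      by (rule error_split[OF _ al a n _ \<omega> _ T0 B0]) (use f B T in \<open>blast+\<close>)
    ultimately show "\<bar>(LINT x|lborel. f x) - scaled_lattice_rule z n (\<chi> j. - a) (\<chi> j. a) f\<bar>
     \<le> \<bar>c\<bar> * sqrt C * 6 powr ?u * \<bar>ln (real n)\<bar> ^ (\<alpha> * ?d) / real n ^ \<alpha> * a powr ?u * enn2real (sobolev_norm_star \<alpha> f)
       + (6 * a) ^ ?d * B + T * (LINT t|lborel. \<omega> t) ^ ?d"
      using X by linarith
  qed
qed

section \<open>Decay\<close>

text \<open>All later decay estimates compare the norm with single coordinates by this inequality,
  whose constant is 1 for every p; this keeps the final constants independent of p.\<close>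

lemma component_le_lp_norm:
  assumes "p \<ge> 1"
  shows "\<bar>x $ j\<bar> \<le> lp_norm p x"
proof (cases "p = \<infinity>")
  case True
  then show ?thesis by (simp add: lp_norm_def component_le_infnorm_cart)
next
  case False
  with assms obtain r where r: "p = ereal r" "r \<ge> 1" by (cases p) auto
  have "\<bar>x $ j\<bar> = (\<bar>x $ j\<bar> powr r) powr (1 / r)" using r by (simp add: powr_powr)
  also have "\<dots> \<le> (\<Sum>j\<in>UNIV. \<bar>x $ j\<bar> powr r) powr (1 / r)"
    using r by (intro powr_mono2 member_le_sum) auto
  finally show ?thesis using r by (simp add: lp_norm_def)
qed

lemma exp_decay_bound:
  assumes "exp_decay_norm \<alpha> \<beta> p q f < \<infinity>" "1 \<le> \<alpha>"
  shows "\<bar>f x\<bar> \<le> enn2real (exp_decay_norm \<alpha> \<beta> p q f) * exp (- \<beta> * lp_norm p x powr q)"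
proof -
  have "ennreal \<bar>exp (\<beta> * lp_norm p x powr q) * mixed_partial (\<lambda>_. 0) f x\<bar> \<le> exp_decay_norm \<alpha> \<beta> p q f"
    unfolding exp_decay_norm_def by (rule SUP_upper2[of x], simp, rule SUP_upper2[of "\<lambda>_. 0"]) (use assms(2) in auto)
  then have "\<bar>exp (\<beta> * lp_norm p x powr q) * f x\<bar> \<le> enn2real (exp_decay_norm \<alpha> \<beta> p q f)"
    using enn2real_mono[of "ennreal \<bar>exp (\<beta> * lp_norm p x powr q) * f x\<bar>"] assms(1) by fastforce
  then show ?thesis by (simp add: abs_mult exp_minus divide_simps mult.commute)
qed

text \<open>Positivity excludes the origin, where \<open>0 powr - \<beta>\<close> is 0 and the decay
  condition says nothing about f.\<close>

lemma poly_decay_bound: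
  assumes "poly_decay_norm \<alpha> \<beta> p f < \<infinity>" "1 \<le> \<alpha>" and pos: "lp_norm p x > 0"
  shows "\<bar>f x\<bar> \<le> enn2real (poly_decay_norm \<alpha> \<beta> p f) * lp_norm p x powr - \<beta>"
proof -
  have "ennreal \<bar>lp_norm p x powr \<beta> * mixed_partial (\<lambda>_. 0) f x\<bar> \<le> poly_decay_norm \<alpha> \<beta> p f"
    unfolding poly_decay_norm_def by (rule SUP_upper2[of x], simp, rule SUP_upper2[of "\<lambda>_. 0"]) (use assms(2) in auto)
  then have "\<bar>lp_norm p x powr \<beta> * f x\<bar> \<le> enn2real (poly_decay_norm \<alpha> \<beta> p f)"
    using enn2real_mono[of "ennreal \<bar>lp_norm p x powr \<beta> * f x\<bar>"] assms(1) by fastforce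
  then show ?thesis using pos by (simp add: abs_mult powr_minus divide_simps mult.commute)
qed

text \<open>Outside the cube only one coordinate has to exceed a, so a majorant of product form must
  be bounded in the others; \<open>max \<bar>t\<bar> a\<close> achieves this. The constant middle
  part contributes 2 a g(a) and each of the two tails L - G(a).\<close>

lemma integral_max_abs:
  fixes g G :: "real \<Rightarrow> real"
  assumes a: "a \<ge> 0" and [measurable]: "g \<in> borel_measurable borel"
    and G: "\<And>s. s \<ge> a \<Longrightarrow> (G has_real_derivative g s) (at s)" and g0: "\<And>s. s \<ge> a \<Longrightarrow> 0 \<le> g s"
    and lim: "(G \<longlongrightarrow> L) at_top"
  shows "integrable lborel (\<lambda>t. g (max \<bar>t\<bar> a))" "(LINT t|lborel. g (max \<bar>t\<bar> a)) \<le> 2 * (a * g a + (L - G a))"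
proof -
  let ?h = "\<lambda>t. g t * indicator {a..} t" and ?k = "\<lambda>t. g a * indicator {-a..a} t"
  have LG: "G a \<le> L"
  proof (rule tendsto_lowerbound[OF lim])
    show "\<forall>\<^sub>F x in at_top. G a \<le> G x"
      using eventually_ge_at_top[of a]
    proof eventually_elim
      case (elim x)
      then show ?case by (intro DERIV_nonneg_imp_nondecreasing[of a x G]) (use G g0 in \<open>blast+\<close>)
    qed
  qed simp
  have nn: "(\<integral>\<^sup>+t. ennreal (?h t) \<partial>lborel) = ennreal (L - G a)"
  proof -
    have "(\<integral>\<^sup>+t. ennreal (?h t) \<partial>lborel) = (\<integral>\<^sup>+t. ennreal (g t) * indicator {a..} t \<partial>lborel)"
      by (intro nn_integral_cong) (simp split: split_indicator)
    also have "\<dots> = ennreal (L - G a)" by (rule nn_integral_FTC_atLeast) (use G g0 lim in auto)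
    finally show ?thesis .
  qed
  have hb: "has_bochner_integral lborel ?h (L - G a)"
    by (rule has_bochner_integral_nn_integral[OF _ _ _ nn]) (use LG g0 in \<open>auto split: split_indicator\<close>)
  have hb': "has_bochner_integral lborel (\<lambda>t. ?h (0 + (-1) * t)) (L - G a)"
    using lborel_has_bochner_integral_real_affine_iff[of "-1" ?h "L - G a" 0] hb by simp
  have kb: "has_bochner_integral lborel ?k (g a * (2 * a))"
  proof -
    have "has_bochner_integral lborel (indicator {-a..a} :: real \<Rightarrow> real) (2 * a)"
      using has_bochner_integral_real_indicator[of "{-a..a}" lborel] a by simp
    then show ?thesis by (rule has_bochner_integral_mult_right)
  qed
  have sb: "has_bochner_integral lborel (\<lambda>t. ?k t + (?h t + ?h (0 + (-1) * t))) (g a * (2 * a) + ((L - G a) + (L - G a)))"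
    by (intro has_bochner_integral_add kb hb hb')
  have le: "\<bar>g (max \<bar>t\<bar> a)\<bar> \<le> ?k t + (?h t + ?h (0 + (-1) * t))" for t
    using a g0[of a] g0[of t] g0[of "-t"] by (cases "t \<ge> 0"; cases "\<bar>t\<bar> \<ge> a") (auto simp: max_def abs_if split: split_indicator)
  show i: "integrable lborel (\<lambda>t. g (max \<bar>t\<bar> a))"
    by (rule Bochner_Integration.integrable_bound[OF integrable.intros[OF sb]])
       (use le in \<open>auto intro!: AE_I2 intro: order_trans[OF _ abs_ge_self]\<close>)
  have "(LINT t|lborel. g (max \<bar>t\<bar> a)) \<le> (LINT t|lborel. ?k t + (?h t + ?h (0 + (-1) * t)))"
    by (rule integral_mono[OF i integrable.intros[OF sb]]) (use le in \<open>blast intro: order_trans[OF abs_ge_self]\<close>)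
  also have "\<dots> = g a * (2 * a) + ((L - G a) + (L - G a))" by (rule has_bochner_integral_integral_eq[OF sb])
  finally show "(LINT t|lborel. g (max \<bar>t\<bar> a)) \<le> 2 * (a * g a + (L - G a))" by (simp add: algebra_simps)
qed

text \<open>Linearises the exponent: for q \<ge> 1 the gain in the q-th power is at least the gain
  in the norm itself, which can be distributed over the coordinates.\<close>

lemma powr_diff_ge:
  fixes a b q :: real
  assumes "1 \<le> a" "a \<le> b" "1 \<le> q"
  shows "b - a \<le> b powr q - a powr q"
proof -
  have "b - a \<le> (b - a) * a powr (q - 1)" using assms ge_one_powr_ge_zero[of a "q - 1"] by (intro mult_right_le_one_le[THEN order_trans] mult_le_cancel_left1[THEN iffD2]) auto
  also have "\<dots> \<le> b * b powr (q - 1) - a * a powr (q - 1)"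
    using assms powr_mono2[of "q - 1" a b] by (simp add: left_diff_distrib mult_left_mono)
  also have "\<dots> = b powr q - a powr q"
    using assms by (simp add: powr_mult_base)
  finally show ?thesis .
qed

text \<open>The excess of each coordinate over a is at most that of the norm, so the excess of the
  norm dominates the average over all d coordinates. After linearisation of the power the
  exponential becomes a product with rate \<beta> / d in each variable.\<close>

lemma exp_decay_tail:
  fixes f :: "real^'d::finite \<Rightarrow> real"
  assumes fin: "exp_decay_norm \<alpha> \<beta> p q f < \<infinity>" and al: "1 \<le> \<alpha>" and p: "p \<ge> 1" and q: "q \<ge> 1" and \<beta>: "\<beta> > 0" and a: "a \<ge> 1"
    and x: "\<bar>x $ j\<bar> \<ge> a"
  defines "M \<equiv> enn2real (exp_decay_norm \<alpha> \<beta> p q f)"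
  shows "\<bar>f x\<bar> \<le> M * exp (- \<beta> * a powr q) * (\<Prod>j\<in>UNIV. exp (- (\<beta> / real CARD('d)) * (max \<bar>x $ j\<bar> a - a)))"
    "\<bar>f x\<bar> \<le> M * exp (- \<beta> * a powr q)"
proof -
  define r where "r = lp_norm p x"
  have r: "\<bar>x $ i\<bar> \<le> r" for i unfolding r_def by (rule component_le_lp_norm[OF p])
  have ra: "r \<ge> a" using r[of j] x by linarith
  have "(\<Sum>i\<in>UNIV. max \<bar>x $ i\<bar> a - a) \<le> (\<Sum>i\<in>(UNIV::'d set). r - a)" by (intro sum_mono) (use r ra in auto)
  also have "\<dots> = real CARD('d) * (r - a)" by simp
  also have "\<dots> \<le> real CARD('d) * (r powr q - a powr q)" by (intro mult_left_mono powr_diff_ge a ra q) simp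
  finally have s: "(\<Sum>i\<in>UNIV. max \<bar>x $ i\<bar> a - a) \<le> real CARD('d) * (r powr q - a powr q)" .
  have s0: "0 \<le> (\<Sum>i\<in>UNIV. max \<bar>x $ i\<bar> a - a)" by (intro sum_nonneg) simp
  have "\<beta> / real CARD('d) * (\<Sum>i\<in>UNIV. max \<bar>x $ i\<bar> a - a) \<le> \<beta> / real CARD('d) * (real CARD('d) * (r powr q - a powr q))"
    using \<beta> by (intro mult_left_mono s) simp
  then have s': "- \<beta> * r powr q \<le> - \<beta> * a powr q - \<beta> / real CARD('d) * (\<Sum>i\<in>UNIV. max \<bar>x $ i\<bar> a - a)"
    by (simp add: algebra_simps)
  have "\<bar>f x\<bar> \<le> M * exp (- \<beta> * r powr q)" unfolding M_def r_def by (rule exp_decay_bound[OF fin al])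
  also have "\<dots> \<le> M * exp (- \<beta> * a powr q - \<beta> / real CARD('d) * (\<Sum>i\<in>UNIV. max \<bar>x $ i\<bar> a - a))"
    using s' by (intro mult_left_mono) (auto simp: M_def)
  finally have 1: "\<bar>f x\<bar> \<le> \<dots>" .
  also have "\<dots> \<le> M * exp (- \<beta> * a powr q)"
    using s0 \<beta> by (intro mult_left_mono) (auto simp: M_def)
  finally show "\<bar>f x\<bar> \<le> M * exp (- \<beta> * a powr q)" .
  have "(\<Prod>j\<in>UNIV. exp (- (\<beta> / real CARD('d)) * (max \<bar>x $ j\<bar> a - a))) = exp (- (\<beta> / real CARD('d) * (\<Sum>i\<in>UNIV. max \<bar>x $ i\<bar> a - a)))"
    by (simp only: exp_sum[symmetric, OF finite] sum_distrib_left sum_negf mult_minus_left)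
  then show "\<bar>f x\<bar> \<le> M * exp (- \<beta> * a powr q) * (\<Prod>j\<in>UNIV. exp (- (\<beta> / real CARD('d)) * (max \<bar>x $ j\<bar> a - a)))"
    using 1 by (simp add: exp_diff exp_minus divide_inverse mult.assoc)
qed

text \<open>The flat middle part has length 2 a, while each tail contributes only 1 / \<gamma>,
  which a \<ge> 1 allows to be written as a multiple of a.\<close>

lemma exp_decay_integral:
  fixes a \<gamma> :: real
  assumes a: "a \<ge> 1" and \<gamma>: "\<gamma> > 0"
  shows "integrable lborel (\<lambda>t. exp (- \<gamma> * (max \<bar>t\<bar> a - a)))" "(LINT t|lborel. exp (- \<gamma> * (max \<bar>t\<bar> a - a))) \<le> 2 * (1 + 1 / \<gamma>) * a"
proof -
  have D: "((\<lambda>s. - exp (- \<gamma> * (s - a)) / \<gamma>) has_real_derivative exp (- \<gamma> * (s - a))) (at s)" for s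
    using \<gamma> by (auto intro!: derivative_eq_intros)
  have "filterlim (\<lambda>s. \<gamma> * (- a + s)) at_top at_top"
    by (rule filterlim_tendsto_pos_mult_at_top[OF tendsto_const \<gamma> filterlim_tendsto_add_at_top[OF tendsto_const filterlim_ident]])
  then have "filterlim (\<lambda>s. - \<gamma> * (s - a)) at_bot at_top"
    by (simp add: filterlim_uminus_at_bot algebra_simps)
  from filterlim_compose[OF exp_at_bot this]
  have L: "((\<lambda>s. - exp (- \<gamma> * (s - a)) / \<gamma>) \<longlongrightarrow> 0) at_top"
    using tendsto_divide[OF tendsto_minus tendsto_const[of \<gamma>]] \<gamma> by fastforce
  note I = integral_max_abs[where g = "\<lambda>s. exp (- \<gamma> * (s - a))" and G = "\<lambda>s. - exp (- \<gamma> * (s - a)) / \<gamma>" and a = a and L = 0, OF _ _ D _ L]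
  show "integrable lborel (\<lambda>t. exp (- \<gamma> * (max \<bar>t\<bar> a - a)))" by (rule I(1)) (use a in auto)
  have "(LINT t|lborel. exp (- \<gamma> * (max \<bar>t\<bar> a - a))) \<le> 2 * (a * exp (- \<gamma> * (a - a)) + (0 - (- exp (- \<gamma> * (a - a)) / \<gamma>)))"
    by (rule I(2)) (use a in auto)
  also have "\<dots> = 2 * (a + 1 / \<gamma> * 1)" by simp
  also have "\<dots> \<le> 2 * (a + 1 / \<gamma> * a)" using a \<gamma> by (intro mult_left_mono add_left_mono) auto
  finally show "(LINT t|lborel. exp (- \<gamma> * (max \<bar>t\<bar> a - a))) \<le> 2 * (1 + 1 / \<gamma>) * a" by (simp add: algebra_simps)
qed

text \<open>The power of the norm r is shared equally among the variables: r^(-\<beta>) consists of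
  d factors r^(-\<beta> / d), and r dominates both a and every |x_j|. The factors are integrable as
  soon as \<beta> > d.\<close>

lemma poly_decay_tail:
  fixes f :: "real^'d::finite \<Rightarrow> real"
  assumes fin: "poly_decay_norm \<alpha> \<beta> p f < \<infinity>" and al: "1 \<le> \<alpha>" and p: "p \<ge> 1" and \<beta>: "\<beta> > 0" and a: "a \<ge> 1"
    and x: "\<bar>x $ j\<bar> \<ge> a"
  defines "M \<equiv> enn2real (poly_decay_norm \<alpha> \<beta> p f)"
  shows "\<bar>f x\<bar> \<le> M * (\<Prod>j\<in>UNIV. max \<bar>x $ j\<bar> a powr - (\<beta> / real CARD('d)))"
    "\<bar>f x\<bar> \<le> M * a powr - \<beta>"
proof -
  define r where "r = lp_norm p x"
  have r: "\<bar>x $ i\<bar> \<le> r" for i unfolding r_def by (rule component_le_lp_norm[OF p])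
  have ra: "r \<ge> a" using r[of j] x by linarith
  have 1: "\<bar>f x\<bar> \<le> M * r powr - \<beta>"
    unfolding M_def r_def by (rule poly_decay_bound[OF fin al]) (use ra a r_def in auto)
  also have "\<dots> \<le> M * a powr - \<beta>" using a ra \<beta> by (intro mult_left_mono powr_mono2') (auto simp: M_def)
  finally show "\<bar>f x\<bar> \<le> M * a powr - \<beta>" .
  have "r powr - \<beta> = (\<Prod>i\<in>(UNIV::'d set). r powr - (\<beta> / real CARD('d)))"
    using ra a by (simp add: powr_power)
  also have "\<dots> \<le> (\<Prod>j\<in>UNIV. max \<bar>x $ j\<bar> a powr - (\<beta> / real CARD('d)))"
    using a ra r \<beta> by (intro prod_mono) (auto intro!: powr_mono2')
  finally have "M * r powr - \<beta> \<le> M * (\<Prod>j\<in>UNIV. max \<bar>x $ j\<bar> a powr - (\<beta> / real CARD('d)))"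
    by (rule mult_left_mono) (simp add: M_def)
  with 1 show "\<bar>f x\<bar> \<le> M * (\<Prod>j\<in>UNIV. max \<bar>x $ j\<bar> a powr - (\<beta> / real CARD('d)))" by (rule order_trans)
qed

lemma poly_decay_integral:
  fixes a \<gamma> :: real
  assumes a: "a \<ge> 1" and \<gamma>: "\<gamma> > 1"
  shows "integrable lborel (\<lambda>t. max \<bar>t\<bar> a powr - \<gamma>)" "(LINT t|lborel. max \<bar>t\<bar> a powr - \<gamma>) \<le> 2 * (1 + 1 / (\<gamma> - 1)) * a powr (1 - \<gamma>)"
proof -
  have D: "((\<lambda>s. s powr (1 - \<gamma>) / (1 - \<gamma>)) has_real_derivative s powr - \<gamma>) (at s)" if "s \<ge> a" for s
    using DERIV_cdivide[OF has_real_derivative_powr[of s "1 - \<gamma>"], of "1 - \<gamma>"] \<gamma> a that by simp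
  have L: "((\<lambda>s. s powr (1 - \<gamma>) / (1 - \<gamma>)) \<longlongrightarrow> 0) at_top"
    using tendsto_divide[OF tendsto_neg_powr[of "1 - \<gamma>" "\<lambda>s. s" at_top] tendsto_const[of "1 - \<gamma>"]] \<gamma> by (simp add: filterlim_ident)
  note I = integral_max_abs[where g = "\<lambda>s. s powr - \<gamma>" and G = "\<lambda>s. s powr (1 - \<gamma>) / (1 - \<gamma>)" and a = a and L = 0, OF _ _ D _ L]
  show "integrable lborel (\<lambda>t. max \<bar>t\<bar> a powr - \<gamma>)" by (rule I(1)) (use a in auto)
  have "(LINT t|lborel. max \<bar>t\<bar> a powr - \<gamma>) \<le> 2 * (a * a powr - \<gamma> + (0 - a powr (1 - \<gamma>) / (1 - \<gamma>)))"
    by (rule I(2)) (use a in auto)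
  also have "a * a powr - \<gamma> = a powr (1 - \<gamma>)" using a by (simp add: powr_mult_base)
  also have "2 * (a powr (1 - \<gamma>) + (0 - a powr (1 - \<gamma>) / (1 - \<gamma>))) = 2 * (1 + 1 / (\<gamma> - 1)) * a powr (1 - \<gamma>)"
    using \<gamma> by (simp add: divide_simps) (simp add: algebra_simps)
  finally show "(LINT t|lborel. max \<bar>t\<bar> a powr - \<gamma>) \<le> 2 * (1 + 1 / (\<gamma> - 1)) * a powr (1 - \<gamma>)" .
qed

section \<open>Balancing the box size\<close>

text \<open>The choice of a makes exp (- \<beta> a^q) equal to n^(-\<alpha>), so the contributions
  from outside the cube are of order a^d / n^\<alpha> and lie below the cubature error, whose power
  of a is larger. The conclusion also exports n \<ge> 2, since good rules are supplied only from
  there on.\<close>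

lemma exp_decay_error:
  fixes \<alpha> :: nat and c \<beta> q :: real
  assumes al: "1 \<le> \<alpha>" and \<beta>: "\<beta> > 0" and q: "q \<ge> 1"
  obtains C N where "\<And>p n z (f :: real^'d::finite \<Rightarrow> real). p \<ge> 1 \<Longrightarrow> n \<ge> N \<Longrightarrow> n \<ge> 2 \<and> (good_lattice_rule \<alpha> c z n \<longrightarrow>
     (\<forall>(a, b)\<in>boxes. f \<in> sobolev_space \<alpha> a b) \<longrightarrow> sobolev_norm_star \<alpha> f < \<infinity> \<longrightarrow> exp_decay_norm \<alpha> \<beta> p q f < \<infinity> \<longrightarrow>
     (let a = ln (real n powr (real \<alpha> / \<beta>)) powr (1 / q) in
        \<bar>(LINT x|lborel. f x) - scaled_lattice_rule z n (\<chi> j. - a) (\<chi> j. a) f\<bar>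
          \<le> C * (enn2real (sobolev_norm_star \<alpha> f) + enn2real (exp_decay_norm \<alpha> \<beta> p q f))
            * ln (real n) powr (real \<alpha> * real CARD('d) + (real \<alpha> + 1 / 2) * real CARD('d) / q) / real n ^ \<alpha>))"
proof -
  let ?d = "CARD('d)" and ?u = "(real \<alpha> + 1 / 2) * real CARD('d)"
  obtain C where C: "C \<ge> 0" and err: "\<And>(f :: real^'d \<Rightarrow> real) a z n B T \<omega>.
     (\<forall>(a, b)\<in>boxes. f \<in> sobolev_space \<alpha> a b) \<Longrightarrow> sobolev_norm_star \<alpha> f < \<infinity> \<Longrightarrow> \<alpha> \<ge> 1 \<Longrightarrow> a \<ge> 1 \<Longrightarrow>
     n > 0 \<Longrightarrow> good_lattice_rule \<alpha> c z n \<Longrightarrow> B \<ge> 0 \<Longrightarrow> (\<And>x j. \<bar>x $ j\<bar> \<ge> a \<Longrightarrow> \<bar>f x\<bar> \<le> B) \<Longrightarrow>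
     integrable lborel \<omega> \<Longrightarrow> (\<And>x. 0 \<le> T * (\<Prod>j\<in>UNIV. \<omega> ((x :: real^'d) $ j))) \<Longrightarrow>
     (\<And>x j. \<bar>x $ j\<bar> \<ge> a \<Longrightarrow> \<bar>f x\<bar> \<le> T * (\<Prod>j\<in>UNIV. \<omega> (x $ j))) \<Longrightarrow>
     \<bar>(LINT x|lborel. f x) - scaled_lattice_rule z n (\<chi> j. - a) (\<chi> j. a) f\<bar>
     \<le> C * \<bar>ln (real n)\<bar> ^ (\<alpha> * ?d) / real n ^ \<alpha> * a powr ?u * enn2real (sobolev_norm_star \<alpha> f)
       + (6 * a) ^ ?d * B + T * (LINT t|lborel. \<omega> t) ^ ?d"
    using total_error[where 'd = 'd and \<alpha> = \<alpha> and c = c] by blast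
  \<comment> \<open>The constant part of a^((\<alpha> + 1/2) d), the rest being a power of ln
    n.\<close>
  define \<kappa> where "\<kappa> = (real \<alpha> / \<beta>) powr (?u / q)"
  define \<gamma> where "\<gamma> = \<beta> / real ?d"
  define E where "E = (2 * (1 + 1 / \<gamma>)) ^ ?d"
  have \<kappa>0: "\<kappa> \<ge> 0" by (simp add: \<kappa>_def)
  have \<gamma>0: "\<gamma> > 0" using \<beta> by (simp add: \<gamma>_def)
  have E0: "E \<ge> 0" using \<gamma>0 by (simp add: E_def)
  \<comment> \<open>From N on both ln n \<ge> 1 and ln n \<ge> \<beta> / \<alpha>, and the latter
    gives a \<ge> 1.\<close>
  define N where "N = nat \<lceil>exp (max 1 (\<beta> / real \<alpha>))\<rceil> + 2"
  show thesis
  proof (rule that[of N "\<kappa> * (C + 6 ^ ?d + E)"], intro conjI impI)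
    fix p :: ereal and n :: nat and z :: "int^'d" and f :: "real^'d \<Rightarrow> real"
    assume p: "p \<ge> 1" and n: "n \<ge> N"
    show n2: "n \<ge> 2" using n by (simp add: N_def)
    assume good: "good_lattice_rule \<alpha> c z n" and fs: "\<forall>(a, b)\<in>boxes. f \<in> sobolev_space \<alpha> a b"
      and fin: "sobolev_norm_star \<alpha> f < \<infinity>" and fin': "exp_decay_norm \<alpha> \<beta> p q f < \<infinity>"
    define l where "l = ln (real n)"
    define a where "a = ln (real n powr (real \<alpha> / \<beta>)) powr (1 / q)"
    define S where "S = enn2real (sobolev_norm_star \<alpha> f)"
    define M where "M = enn2real (exp_decay_norm \<alpha> \<beta> p q f)"
    have SM: "S \<ge> 0" "M \<ge> 0" by (simp_all add: S_def M_def)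
    have "exp (max 1 (\<beta> / real \<alpha>)) \<le> real n" using n unfolding N_def by linarith
    moreover have "0 < real n" using n2 by simp
    ultimately have "max 1 (\<beta> / real \<alpha>) \<le> l" unfolding l_def by (simp only: ln_ge_iff)
    then have l: "l \<ge> 1" "real \<alpha> / \<beta> * l \<ge> 1" using al \<beta> by (simp_all add: divide_simps mult.commute)
    have a_eq: "a = (real \<alpha> / \<beta> * l) powr (1 / q)" using n2 by (simp add: a_def l_def ln_powr)
    have a: "a \<ge> 1" unfolding a_eq using l q by (intro ge_one_powr_ge_zero) auto
    have "a powr q = real \<alpha> / \<beta> * l" using l q \<beta> by (simp add: a_eq powr_powr)
    then have ex: "exp (- \<beta> * a powr q) = 1 / real n ^ \<alpha>"
      using \<beta> n2 by (simp add: l_def exp_minus exp_of_nat_mult[symmetric] inverse_eq_divide exp_of_nat_mult)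
    have au: "a powr ?u = \<kappa> * l powr (?u / q)"
    proof -
      have "1 / q * ?u = ?u / q" by simp
      then show ?thesis by (simp only: a_eq powr_powr powr_mult \<kappa>_def)
    qed
    have ad: "a ^ ?d \<le> a powr ?u"
    proof -
      have "a ^ ?d = a powr real ?d" using a by (simp add: powr_realpow)
      also have "\<dots> \<le> a powr ?u" using a al by (intro powr_mono) auto
      finally show ?thesis .
    qed
    have lp: "l ^ (\<alpha> * ?d) \<ge> 1" using l by simp
    have "\<bar>(LINT x|lborel. f x) - scaled_lattice_rule z n (\<chi> j. - a) (\<chi> j. a) f\<bar>
      \<le> C * \<bar>ln (real n)\<bar> ^ (\<alpha> * ?d) / real n ^ \<alpha> * a powr ?u * enn2real (sobolev_norm_star \<alpha> f)
       + (6 * a) ^ ?d * (M * exp (- \<beta> * a powr q)) + M * exp (- \<beta> * a powr q) * (LINT t|lborel. exp (- \<gamma> * (max \<bar>t\<bar> a - a))) ^ ?d"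
      by (rule err[OF fs fin al a _ good])
         (use n2 SM exp_decay_tail[OF fin' al p q \<beta> a] exp_decay_integral(1)[OF a \<gamma>0] in \<open>auto simp: M_def[symmetric] \<gamma>_def[symmetric] intro!: mult_nonneg_nonneg prod_nonneg\<close>)
    also have "\<bar>ln (real n)\<bar> = l" using l by (simp add: l_def)
    also have "C * l ^ (\<alpha> * ?d) / real n ^ \<alpha> * a powr ?u * enn2real (sobolev_norm_star \<alpha> f)
       + (6 * a) ^ ?d * (M * exp (- \<beta> * a powr q)) + M * exp (- \<beta> * a powr q) * (LINT t|lborel. exp (- \<gamma> * (max \<bar>t\<bar> a - a))) ^ ?d
      = (C * S * (l ^ (\<alpha> * ?d) * a powr ?u) + 6 ^ ?d * M * (1 * a ^ ?d) + M * (LINT t|lborel. exp (- \<gamma> * (max \<bar>t\<bar> a - a))) ^ ?d) / real n ^ \<alpha>"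
      unfolding ex S_def by (simp add: add_divide_distrib power_mult_distrib mult_ac)
    also have "\<dots> \<le> (C * S * (l ^ (\<alpha> * ?d) * a powr ?u) + 6 ^ ?d * M * (l ^ (\<alpha> * ?d) * a powr ?u) + M * (E * (l ^ (\<alpha> * ?d) * a powr ?u))) / real n ^ \<alpha>"
    proof (intro divide_right_mono add_mono order_refl mult_left_mono mult_mono lp ad)
      have "(LINT t|lborel. exp (- \<gamma> * (max \<bar>t\<bar> a - a))) ^ ?d \<le> (2 * (1 + 1 / \<gamma>) * a) ^ ?d"
        by (intro power_mono exp_decay_integral(2)[OF a \<gamma>0] integral_nonneg) simp
      also have "\<dots> = E * (1 * a ^ ?d)" by (simp add: E_def power_mult_distrib)
      also have "\<dots> \<le> E * (l ^ (\<alpha> * ?d) * a powr ?u)"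
        using l a by (intro mult_left_mono[OF mult_mono[OF lp ad]] E0) auto
      finally show "(LINT t|lborel. exp (- \<gamma> * (max \<bar>t\<bar> a - a))) ^ ?d \<le> E * (l ^ (\<alpha> * ?d) * a powr ?u)" .
    qed (use SM a l in auto)
    also have "\<dots> = (C * S + 6 ^ ?d * M + E * M) * (l ^ (\<alpha> * ?d) * a powr ?u) / real n ^ \<alpha>" by (simp add: algebra_simps)
    also have "\<dots> \<le> (C + 6 ^ ?d + E) * (S + M) * (l ^ (\<alpha> * ?d) * a powr ?u) / real n ^ \<alpha>"
    proof -
      have "C * S + 6 ^ ?d * M + E * M \<le> C * (S + M) + 6 ^ ?d * (S + M) + E * (S + M)"
        using C E0 SM by (intro add_mono mult_left_mono) auto
      also have "\<dots> = (C + 6 ^ ?d + E) * (S + M)" by (simp add: algebra_simps)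
      finally show ?thesis using l by (intro divide_right_mono mult_right_mono) auto
    qed
    also have "l ^ (\<alpha> * ?d) * a powr ?u = \<kappa> * l powr (real \<alpha> * real ?d + ?u / q)"
      using l unfolding au powr_add by (simp add: powr_realpow[symmetric] mult_ac)
    also have "(C + 6 ^ ?d + E) * (S + M) * (\<kappa> * l powr (real \<alpha> * real ?d + ?u / q)) / real n ^ \<alpha>
      = \<kappa> * (C + 6 ^ ?d + E) * (S + M) * l powr (real \<alpha> * real ?d + ?u / q) / real n ^ \<alpha>" by (simp only: mult_ac)
    finally show "let a = ln (real n powr (real \<alpha> / \<beta>)) powr (1 / q) in
        \<bar>(LINT x|lborel. f x) - scaled_lattice_rule z n (\<chi> j. - a) (\<chi> j. a) f\<bar>
          \<le> \<kappa> * (C + 6 ^ ?d + E) * (enn2real (sobolev_norm_star \<alpha> f) + enn2real (exp_decay_norm \<alpha> \<beta> p q f))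
            * ln (real n) powr (real \<alpha> * real ?d + ?u / q) / real n ^ \<alpha>"
      unfolding Let_def a_def[symmetric] S_def[symmetric] M_def[symmetric] l_def[symmetric] .
  qed
qed

text \<open>Write u = (\<alpha> + 1/2) d and e = \<beta> + t d / 2, so that a^e = n^\<alpha>. The
  cubature error is of order a^(u - e) up to logarithms and the contributions from outside the cube
  of order a^(d - \<beta>). The second condition on t says exactly that d - \<beta> \<le> u - e, so
  the first term dominates.\<close>

lemma poly_decay_error:
  fixes \<alpha> :: nat and c \<beta> t :: real
  assumes al: "1 \<le> \<alpha>" and \<beta>: "\<beta> > real CARD('d::finite)" and t: "t \<ge> 1" "t + 2 \<le> 2 * real \<alpha> + 1"
  obtains C where "\<And>p n z (f :: real^'d \<Rightarrow> real). p \<ge> 1 \<Longrightarrow> n \<ge> 3 \<Longrightarrow> good_lattice_rule \<alpha> c z n \<Longrightarrow>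
     (\<forall>(a, b)\<in>boxes. f \<in> sobolev_space \<alpha> a b) \<Longrightarrow> sobolev_norm_star \<alpha> f < \<infinity> \<Longrightarrow> poly_decay_norm \<alpha> \<beta> p f < \<infinity> \<Longrightarrow>
     (let a = real n powr (real \<alpha> / (\<beta> + t * real CARD('d) / 2)) in
        \<bar>(LINT x|lborel. f x) - scaled_lattice_rule z n (\<chi> j. - a) (\<chi> j. a) f\<bar>
          \<le> C * (enn2real (sobolev_norm_star \<alpha> f) + enn2real (poly_decay_norm \<alpha> \<beta> p f))
            * real n powr (- real \<alpha> + real \<alpha> * (1 + 2 * real \<alpha>) / (t + 2 * \<beta> / real CARD('d)))
            * ln (real n) ^ (\<alpha> * CARD('d)))"
proof -
  let ?d = "CARD('d)" and ?u = "(real \<alpha> + 1 / 2) * real CARD('d)"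
  obtain C where C: "C \<ge> 0" and err: "\<And>(f :: real^'d \<Rightarrow> real) a z n B T \<omega>.
     (\<forall>(a, b)\<in>boxes. f \<in> sobolev_space \<alpha> a b) \<Longrightarrow> sobolev_norm_star \<alpha> f < \<infinity> \<Longrightarrow> \<alpha> \<ge> 1 \<Longrightarrow> a \<ge> 1 \<Longrightarrow>
     n > 0 \<Longrightarrow> good_lattice_rule \<alpha> c z n \<Longrightarrow> B \<ge> 0 \<Longrightarrow> (\<And>x j. \<bar>x $ j\<bar> \<ge> a \<Longrightarrow> \<bar>f x\<bar> \<le> B) \<Longrightarrow>
     integrable lborel \<omega> \<Longrightarrow> (\<And>x. 0 \<le> T * (\<Prod>j\<in>UNIV. \<omega> ((x :: real^'d) $ j))) \<Longrightarrow>
     (\<And>x j. \<bar>x $ j\<bar> \<ge> a \<Longrightarrow> \<bar>f x\<bar> \<le> T * (\<Prod>j\<in>UNIV. \<omega> (x $ j))) \<Longrightarrow>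
     \<bar>(LINT x|lborel. f x) - scaled_lattice_rule z n (\<chi> j. - a) (\<chi> j. a) f\<bar>
     \<le> C * \<bar>ln (real n)\<bar> ^ (\<alpha> * ?d) / real n ^ \<alpha> * a powr ?u * enn2real (sobolev_norm_star \<alpha> f)
       + (6 * a) ^ ?d * B + T * (LINT t|lborel. \<omega> t) ^ ?d"
    using total_error[where 'd = 'd and \<alpha> = \<alpha> and c = c] by blast
  define \<gamma> where "\<gamma> = \<beta> / real ?d"
  define E where "E = (2 * (1 + 1 / (\<gamma> - 1))) ^ ?d"
  define e where "e = \<beta> + t * real ?d / 2"
  have d0: "real ?d \<ge> 1" by (simp add: Suc_leI)
  have \<beta>0: "\<beta> > 0" using \<beta> d0 by linarith
  have \<gamma>1: "\<gamma> > 1" using \<beta> by (simp add: \<gamma>_def divide_simps)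
  have E0: "E \<ge> 0" using \<gamma>1 by (simp add: E_def)
  have e0: "e > 0" using \<beta>0 t d0 by (simp add: e_def add_pos_nonneg)
  show thesis
  proof (rule that[of "C + 6 ^ ?d + E"])
    fix p :: ereal and n :: nat and z :: "int^'d" and f :: "real^'d \<Rightarrow> real"
    assume p: "p \<ge> 1" and n: "n \<ge> 3" and good: "good_lattice_rule \<alpha> c z n" and fs: "\<forall>(a, b)\<in>boxes. f \<in> sobolev_space \<alpha> a b"
      and fin: "sobolev_norm_star \<alpha> f < \<infinity>" and fin': "poly_decay_norm \<alpha> \<beta> p f < \<infinity>"
    define l where "l = ln (real n)"
    define a where "a = real n powr (real \<alpha> / e)"
    define S where "S = enn2real (sobolev_norm_star \<alpha> f)"
    define M where "M = enn2real (poly_decay_norm \<alpha> \<beta> p f)"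
    have SM: "S \<ge> 0" "M \<ge> 0" by (simp_all add: S_def M_def)
    \<comment> \<open>The threshold 3 on n exceeds e, so that ln n \<ge> 1 and its powers may be
      inserted into the smaller terms.\<close>
    have "exp 1 \<le> real n" using n exp_le by linarith
    then have l: "l \<ge> 1" using n by (simp add: l_def ln_ge_iff)
    have a: "a \<ge> 1" unfolding a_def using n e0 by (intro ge_one_powr_ge_zero) auto
    have lp: "l ^ (\<alpha> * ?d) \<ge> 1" using l by simp
    have na: "1 / real n ^ \<alpha> = a powr - e"
      using n e0 by (simp add: a_def powr_powr powr_minus_divide powr_realpow)
    have "real ?d * (t + 2) \<le> real ?d * (2 * real \<alpha> + 1)" by (intro mult_left_mono t) simp
    then have ue: "real ?d - \<beta> \<le> ?u - e" by (simp add: e_def algebra_simps)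
    have ad: "a powr (real ?d - \<beta>) \<le> l ^ (\<alpha> * ?d) * a powr (?u - e)"
    proof -
      have "1 * a powr (real ?d - \<beta>) \<le> l ^ (\<alpha> * ?d) * a powr (?u - e)" using a l by (intro mult_mono lp powr_mono ue) auto
      then show ?thesis by simp
    qed
    have "\<bar>(LINT x|lborel. f x) - scaled_lattice_rule z n (\<chi> j. - a) (\<chi> j. a) f\<bar>
      \<le> C * \<bar>ln (real n)\<bar> ^ (\<alpha> * ?d) / real n ^ \<alpha> * a powr ?u * enn2real (sobolev_norm_star \<alpha> f)
       + (6 * a) ^ ?d * (M * a powr - \<beta>) + M * (LINT t|lborel. max \<bar>t\<bar> a powr - \<gamma>) ^ ?d"
      by (rule err[OF fs fin al a _ good])
         (use n SM poly_decay_tail[OF fin' al p \<beta>0 a] poly_decay_integral(1)[OF a \<gamma>1] in \<open>auto simp: M_def[symmetric] \<gamma>_def[symmetric] intro!: mult_nonneg_nonneg prod_nonneg\<close>)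
    also have "\<bar>ln (real n)\<bar> = l" using l by (simp add: l_def)
    also have "C * l ^ (\<alpha> * ?d) / real n ^ \<alpha> * a powr ?u * enn2real (sobolev_norm_star \<alpha> f) = C * S * (l ^ (\<alpha> * ?d) * (a powr ?u * (1 / real n ^ \<alpha>)))"
      by (simp add: S_def mult_ac)
    also have "a powr ?u * (1 / real n ^ \<alpha>) = a powr (?u - e)"
      unfolding na by (simp only: powr_add[symmetric] diff_conv_add_uminus)
    also have "(6 * a) ^ ?d * (M * a powr - \<beta>) = 6 ^ ?d * M * a powr (real ?d - \<beta>)"
      using a by (simp add: power_mult_distrib powr_realpow[symmetric] powr_diff powr_minus_divide)
    also have "C * S * (l ^ (\<alpha> * ?d) * a powr (?u - e)) + 6 ^ ?d * M * a powr (real ?d - \<beta>) + M * (LINT t|lborel. max \<bar>t\<bar> a powr - \<gamma>) ^ ?d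
       \<le> C * S * (l ^ (\<alpha> * ?d) * a powr (?u - e)) + 6 ^ ?d * M * (l ^ (\<alpha> * ?d) * a powr (?u - e)) + M * (E * (l ^ (\<alpha> * ?d) * a powr (?u - e)))"
    proof (intro add_mono order_refl mult_left_mono ad)
      have "(LINT t|lborel. max \<bar>t\<bar> a powr - \<gamma>) ^ ?d \<le> (2 * (1 + 1 / (\<gamma> - 1)) * a powr (1 - \<gamma>)) ^ ?d"
        by (intro power_mono poly_decay_integral(2)[OF a \<gamma>1] integral_nonneg) simp
      also have "\<dots> = E * a powr (real ?d - \<beta>)"
      proof -
        have "(1 - \<gamma>) * real ?d = real ?d - \<beta>" by (simp add: \<gamma>_def left_diff_distrib)
        then have "(a powr (1 - \<gamma>)) ^ ?d = a powr (real ?d - \<beta>)" using a by (simp add: powr_power mult.commute)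
        then show ?thesis by (simp only: E_def power_mult_distrib)
      qed
      also have "\<dots> \<le> E * (l ^ (\<alpha> * ?d) * a powr (?u - e))" by (intro mult_left_mono ad E0)
      finally show "(LINT t|lborel. max \<bar>t\<bar> a powr - \<gamma>) ^ ?d \<le> E * (l ^ (\<alpha> * ?d) * a powr (?u - e))" .
    qed (use SM in auto)
    also have "\<dots> = (C * S + 6 ^ ?d * M + E * M) * (l ^ (\<alpha> * ?d) * a powr (?u - e))" by (simp add: algebra_simps)
    also have "\<dots> \<le> (C + 6 ^ ?d + E) * (S + M) * (l ^ (\<alpha> * ?d) * a powr (?u - e))"
    proof -
      have "C * S + 6 ^ ?d * M + E * M \<le> C * (S + M) + 6 ^ ?d * (S + M) + E * (S + M)"
        using C E0 SM by (intro add_mono mult_left_mono) auto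
      also have "\<dots> = (C + 6 ^ ?d + E) * (S + M)" by (simp add: algebra_simps)
      finally show ?thesis using l by (intro mult_right_mono) auto
    qed
    also have "a powr (?u - e) = real n powr (- real \<alpha> + real \<alpha> * (1 + 2 * real \<alpha>) / (t + 2 * \<beta> / real ?d))"
    proof -
      \<comment> \<open>The exponent of n is \<alpha> (u - e) / e = - \<alpha> + \<alpha> u / e, and
        with u = (1 + 2 \<alpha>) d / 2 the quotient u / e is (1 + 2 \<alpha>) / (t + 2 \<beta> /
        d).\<close>
      have "t + 2 * \<beta> / real ?d = 2 * e / real ?d" by (simp add: e_def field_simps)
      then have "real \<alpha> / e * (?u - e) = - real \<alpha> + real \<alpha> * (1 + 2 * real \<alpha>) / (t + 2 * \<beta> / real ?d)"
        using e0 by (simp add: field_simps)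
      then show ?thesis by (simp add: a_def powr_powr)
    qed
    also have "(C + 6 ^ ?d + E) * (S + M) * (l ^ (\<alpha> * ?d) * real n powr (- real \<alpha> + real \<alpha> * (1 + 2 * real \<alpha>) / (t + 2 * \<beta> / real ?d)))
      = (C + 6 ^ ?d + E) * (S + M) * real n powr (- real \<alpha> + real \<alpha> * (1 + 2 * real \<alpha>) / (t + 2 * \<beta> / real ?d)) * l ^ (\<alpha> * ?d)"
      by (simp only: mult_ac)
    finally show "let a = real n powr (real \<alpha> / (\<beta> + t * real ?d / 2)) in
        \<bar>(LINT x|lborel. f x) - scaled_lattice_rule z n (\<chi> j. - a) (\<chi> j. a) f\<bar>
          \<le> (C + 6 ^ ?d + E) * (enn2real (sobolev_norm_star \<alpha> f) + enn2real (poly_decay_norm \<alpha> \<beta> p f))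
            * real n powr (- real \<alpha> + real \<alpha> * (1 + 2 * real \<alpha>) / (t + 2 * \<beta> / real ?d)) * ln (real n) ^ (\<alpha> * ?d)"
      unfolding Let_def e_def[symmetric] a_def[symmetric] S_def[symmetric] M_def[symmetric] l_def[symmetric] .
  qed
qed

text \<open>\<open>C\<close> and \<open>N\<close> are chosen before p, the generating vectors and f.
  The threshold can be uniform because it only has to ensure a \<ge> 1 and ln n \<ge> 1, neither of
  which involves f.\<close>

theorem theorem1:
  fixes \<alpha> :: nat and c :: real
  assumes "1 \<le> \<alpha>"
  shows
    "(\<forall>\<beta>>0. \<forall>q\<ge>1. \<exists>C N. \<forall>p\<ge>1. \<forall>(z :: nat \<Rightarrow> int^'d::finite) (f :: real^'d \<Rightarrow> real).
        (\<forall>n\<ge>2. z n \<in> generating_vectors n \<and> good_lattice_rule \<alpha> c (z n) n) \<longrightarrow>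
        (\<forall>(a, b)\<in>boxes. f \<in> sobolev_space \<alpha> a b) \<longrightarrow>
        sobolev_norm_star \<alpha> f < \<infinity> \<longrightarrow>
        exp_decay_norm \<alpha> \<beta> p q f < \<infinity> \<longrightarrow>
        (\<forall>n\<ge>N. let a = ln (real n powr (real \<alpha> / \<beta>)) powr (1 / q) in
           \<bar>(LINT x|lborel. f x) - scaled_lattice_rule (z n) n (\<chi> j. - a) (\<chi> j. a) f\<bar>
             \<le> C * (enn2real (sobolev_norm_star \<alpha> f) + enn2real (exp_decay_norm \<alpha> \<beta> p q f))
               * ln (real n) powr (real \<alpha> * real CARD('d)
                                    + (real \<alpha> + 1 / 2) * real CARD('d) / q)
               / real n ^ \<alpha>))
     \<and>
     (\<forall>\<beta>>real CARD('d) * max (real \<alpha> - 1) 1.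
        \<exists>C N. \<forall>p\<ge>1. \<forall>(z :: nat \<Rightarrow> int^'d) (f :: real^'d \<Rightarrow> real).
        (\<forall>n\<ge>2. z n \<in> generating_vectors n \<and> good_lattice_rule \<alpha> c (z n) n) \<longrightarrow>
        (\<forall>(a, b)\<in>boxes. f \<in> sobolev_space \<alpha> a b) \<longrightarrow>
        sobolev_norm_star \<alpha> f < \<infinity> \<longrightarrow>
        poly_decay_norm \<alpha> \<beta> p f < \<infinity> \<longrightarrow>
        (\<forall>n\<ge>N. let t = (if \<alpha> \<ge> 2 then 3 else 1);
                    a = real n powr (real \<alpha> / (\<beta> + t * real CARD('d) / 2)) in
           \<bar>(LINT x|lborel. f x) - scaled_lattice_rule (z n) n (\<chi> j. - a) (\<chi> j. a) f\<bar>
             \<le> C * (enn2real (sobolev_norm_star \<alpha> f) + enn2real (poly_decay_norm \<alpha> \<beta> p f))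
               * real n powr (- real \<alpha> + real \<alpha> * (1 + 2 * real \<alpha>)
                                / (t + 2 * \<beta> / real CARD('d)))
               * ln (real n) ^ (\<alpha> * CARD('d))))"
proof (intro conjI allI impI)
  fix \<beta> q :: real assume \<beta>: "\<beta> > 0" and q: "q \<ge> 1"
  show "\<exists>C N. \<forall>p\<ge>1. \<forall>(z :: nat \<Rightarrow> int^'d) (f :: real^'d \<Rightarrow> real).
        (\<forall>n\<ge>2. z n \<in> generating_vectors n \<and> good_lattice_rule \<alpha> c (z n) n) \<longrightarrow>
        (\<forall>(a, b)\<in>boxes. f \<in> sobolev_space \<alpha> a b) \<longrightarrow>
        sobolev_norm_star \<alpha> f < \<infinity> \<longrightarrow>
        exp_decay_norm \<alpha> \<beta> p q f < \<infinity> \<longrightarrow>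
        (\<forall>n\<ge>N. let a = ln (real n powr (real \<alpha> / \<beta>)) powr (1 / q) in
           \<bar>(LINT x|lborel. f x) - scaled_lattice_rule (z n) n (\<chi> j. - a) (\<chi> j. a) f\<bar>
             \<le> C * (enn2real (sobolev_norm_star \<alpha> f) + enn2real (exp_decay_norm \<alpha> \<beta> p q f))
               * ln (real n) powr (real \<alpha> * real CARD('d)
                                    + (real \<alpha> + 1 / 2) * real CARD('d) / q)
               / real n ^ \<alpha>)"
  proof (rule exp_decay_error[OF assms \<beta> q, where 'd = 'd and c = c])
    fix C :: real and N :: nat
    assume CN: "\<And>p n z (f :: real^'d \<Rightarrow> real). p \<ge> 1 \<Longrightarrow> n \<ge> N \<Longrightarrow> n \<ge> 2 \<and> (good_lattice_rule \<alpha> c z n \<longrightarrow>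
     (\<forall>(a, b)\<in>boxes. f \<in> sobolev_space \<alpha> a b) \<longrightarrow> sobolev_norm_star \<alpha> f < \<infinity> \<longrightarrow> exp_decay_norm \<alpha> \<beta> p q f < \<infinity> \<longrightarrow>
     (let a = ln (real n powr (real \<alpha> / \<beta>)) powr (1 / q) in
        \<bar>(LINT x|lborel. f x) - scaled_lattice_rule z n (\<chi> j. - a) (\<chi> j. a) f\<bar>
          \<le> C * (enn2real (sobolev_norm_star \<alpha> f) + enn2real (exp_decay_norm \<alpha> \<beta> p q f))
            * ln (real n) powr (real \<alpha> * real CARD('d) + (real \<alpha> + 1 / 2) * real CARD('d) / q) / real n ^ \<alpha>))"
    show ?thesis
    proof (intro exI[of _ C] exI[of _ N] allI impI)
      fix p :: ereal and n :: nat and z :: "nat \<Rightarrow> int^'d" and f :: "real^'d \<Rightarrow> real"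
      assume p: "p \<ge> 1" and z: "\<forall>n\<ge>2. z n \<in> generating_vectors n \<and> good_lattice_rule \<alpha> c (z n) n" and n: "n \<ge> N"
        and f: "\<forall>(a, b)\<in>boxes. f \<in> sobolev_space \<alpha> a b" "sobolev_norm_star \<alpha> f < \<infinity>" "exp_decay_norm \<alpha> \<beta> p q f < \<infinity>"
      have "good_lattice_rule \<alpha> c (z n) n" using CN[OF p n] z by blast
      then show "let a = ln (real n powr (real \<alpha> / \<beta>)) powr (1 / q) in
             \<bar>(LINT x|lborel. f x) - scaled_lattice_rule (z n) n (\<chi> j. - a) (\<chi> j. a) f\<bar>
               \<le> C * (enn2real (sobolev_norm_star \<alpha> f) + enn2real (exp_decay_norm \<alpha> \<beta> p q f))
                 * ln (real n) powr (real \<alpha> * real CARD('d) + (real \<alpha> + 1 / 2) * real CARD('d) / q) / real n ^ \<alpha>"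
        using CN[OF p n, of "z n" f] f by blast
    qed
  qed
next
  fix \<beta> :: real assume "real CARD('d) * max (real \<alpha> - 1) 1 < \<beta>"
  \<comment> \<open>The maximum is at least 1, so \<beta> exceeds d and the one-dimensional tail
    exponent \<beta> / d exceeds 1.\<close>
  moreover have "real CARD('d) * 1 \<le> real CARD('d) * max (real \<alpha> - 1) 1" by (intro mult_left_mono) auto
  ultimately have \<beta>: "real CARD('d) < \<beta>" by linarith
  define t :: real where "t = (if \<alpha> \<ge> 2 then 3 else 1)"
  \<comment> \<open>The bound t + 2 \<le> 2 \<alpha> + 1 is sharp for t = 1 at \<alpha> = 1 and for
    t = 3 at \<alpha> = 2; this is why the value of t depends on \<alpha>.\<close>
  have t: "t \<ge> 1" "t + 2 \<le> 2 * real \<alpha> + 1" using assms by (auto simp: t_def)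
  show "\<exists>C N. \<forall>p\<ge>1. \<forall>(z :: nat \<Rightarrow> int^'d) (f :: real^'d \<Rightarrow> real).
        (\<forall>n\<ge>2. z n \<in> generating_vectors n \<and> good_lattice_rule \<alpha> c (z n) n) \<longrightarrow>
        (\<forall>(a, b)\<in>boxes. f \<in> sobolev_space \<alpha> a b) \<longrightarrow>
        sobolev_norm_star \<alpha> f < \<infinity> \<longrightarrow>
        poly_decay_norm \<alpha> \<beta> p f < \<infinity> \<longrightarrow>
        (\<forall>n\<ge>N. let t = (if \<alpha> \<ge> 2 then 3 else 1);
                    a = real n powr (real \<alpha> / (\<beta> + t * real CARD('d) / 2)) in
           \<bar>(LINT x|lborel. f x) - scaled_lattice_rule (z n) n (\<chi> j. - a) (\<chi> j. a) f\<bar>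
             \<le> C * (enn2real (sobolev_norm_star \<alpha> f) + enn2real (poly_decay_norm \<alpha> \<beta> p f))
               * real n powr (- real \<alpha> + real \<alpha> * (1 + 2 * real \<alpha>)
                                / (t + 2 * \<beta> / real CARD('d)))
               * ln (real n) ^ (\<alpha> * CARD('d)))"
  proof (rule poly_decay_error[OF assms \<beta> t, where c = c])
    fix C :: real
    assume C: "\<And>p n z (f :: real^'d \<Rightarrow> real). p \<ge> 1 \<Longrightarrow> n \<ge> 3 \<Longrightarrow> good_lattice_rule \<alpha> c z n \<Longrightarrow>
     (\<forall>(a, b)\<in>boxes. f \<in> sobolev_space \<alpha> a b) \<Longrightarrow> sobolev_norm_star \<alpha> f < \<infinity> \<Longrightarrow> poly_decay_norm \<alpha> \<beta> p f < \<infinity> \<Longrightarrow>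
     (let a = real n powr (real \<alpha> / (\<beta> + t * real CARD('d) / 2)) in
        \<bar>(LINT x|lborel. f x) - scaled_lattice_rule z n (\<chi> j. - a) (\<chi> j. a) f\<bar>
          \<le> C * (enn2real (sobolev_norm_star \<alpha> f) + enn2real (poly_decay_norm \<alpha> \<beta> p f))
            * real n powr (- real \<alpha> + real \<alpha> * (1 + 2 * real \<alpha>) / (t + 2 * \<beta> / real CARD('d)))
            * ln (real n) ^ (\<alpha> * CARD('d)))"
    show ?thesis
      unfolding t_def[symmetric] Let_def[of t]
      by (intro exI[of _ C] exI[of _ "3::nat"] allI impI C) auto
  qed
qed

end
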